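(* Let $m\geqslant2$, let $g\in C^\infty(\mathbb S^{m-1})$, and for sufficiently small $|\varepsilon|$ let $K_\varepsilon\subset\mathbb R^m$ be the convex body with support function $h_\varepsilon=1+\varepsilon g$ on $\mathbb S^{m-1}$. Let $\alpha\in\mathbb R$, and let $T_\alpha(\varepsilon)=T_\alpha(K_\varepsilon)$ be the isotropy tensor associated with the probability measure on $\partial K_\varepsilon$ whose density with respect to surface area is proportional to $h_\varepsilon^\alpha$. Then $$\left.\frac{\mathrm d}{\mathrm d\varepsilon}\right|_{\varepsilon=0}T_\alpha(\varepsilon)=m(\alpha-1)\int_{\mathbb S^{m-1}}g(u)\left(u\otimes u-\frac1mI_m\right)\mathrm d\omega(u),$$ where $\omega$ is the rotationally invariant probability measure on $\mathbb S^{m-1}$. Hence only the degree-$2$ spherical harmonic component $P_2g$ of $g$ contributes (the right-hand side is unchanged if $g$ is replaced by $P_2g$). If $P_2g(u)=u^\top Su$ with $S$ a real symmetric $m\times m$ matrix with $\operatorname{tr}(S)=0$, then this derivative equals $$\frac{2(\alpha-1)}{m+2}S.$$ In particular, $\alpha=1$ is the unique real exponent such that $T_\alpha(K)=I_m$ for every smooth strictly convex body $K\subset\mathbb R^m$ that is centrally symmetric about the origin.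
   Context: Let $K\subset\mathbb R^m$ be a smooth strictly convex body with the origin in its interior, $h_K(u)=\max_{x\in K}\langle x,u\rangle_2$ its support function and $n_K(x)\in\mathbb S^{m-1}$ the Euclidean outer unit normal at $x\in\partial K$. For $\alpha\in\mathbb R$ let $\nu_K^\alpha$ be the probability measure on $\partial K$ with $$\mathrm d\nu_K^\alpha(x)=\frac{h_K(n_K(x))^\alpha}{\int_{\partial K}h_K(n_K(y))^\alpha\,\mathrm d\mathcal H^{m-1}(y)}\,\mathrm d\mathcal H^{m-1}(x).$$ The norming functional at $x\in\partial K$ is $x^\sharp(z)=\langle z,n_K(x)\rangle_2/h_K(n_K(x))$. The isotropy tensor is $$T_\alpha(K)=m\int_{\partial K}x\otimes x^\sharp\,\mathrm d\nu_K^\alpha(x)\in\operatorname{End}(\mathbb R^m),$$ where $(x\otimes f)(z)=f(z)x$. In terms of the unit normal $u$, when the support function $h$ of $K$ is $C^2$ and $L_h=\nabla_S^2h+hI$ is positive definite on each tangent space of the sphere, one has $x_h(u)=h(u)u+\nabla_Sh(u)$ and $$T_\alpha=\frac{m}{Z_\alpha}\int_{\mathbb S^{m-1}}x_h(u)\otimes u\;h(u)^{\alpha-1}\det L_h(u)\,\mathrm d\omega(u),\quad Z_\alpha=\int_{\mathbb S^{m-1}}h^\alpha\det L_h\,\mathrm d\omega,$$ with $u$ identified with the functional $z\mapsto\langle z,u\rangle_2$; here $\nabla_S,\nabla_S^2$ are the gradient and Hessian on $\mathbb S^{m-1}$. The cases $\alpha=0,1$ are normalised hypersurface measure and cone measure.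 $P_2$ denotes the $L^2(\omega)$-orthogonal projection onto the space of spherical harmonics of degree $2$. *)

theory Defs
  imports "HOL-Probability.Probability"
begin

section \<open>Smooth functions\<close>

text \<open>
  On an open subset of a Euclidean space, \<open>C_k_on k S f\<close> says that all iterated directional
  derivatives of \<open>f\<close> of order at most \<open>k\<close> exist and are continuous on \<open>S\<close>. It is only used
  for open \<open>S\<close>.
\<close>

fun C_k_on :: "nat \<Rightarrow> 'a::real_normed_vector set \<Rightarrow> ('a \<Rightarrow> 'b::real_normed_vector) \<Rightarrow> bool" where
  "C_k_on 0 S f \<longleftrightarrow> continuous_on S f"
| "C_k_on (Suc k) S f \<longleftrightarrow>
     (\<forall>x\<in>S. f differentiable (at x)) \<and> (\<forall>v. C_k_on k S (\<lambda>x. frechet_derivative f (at x) v))"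

definition smooth_on :: "'a::real_normed_vector set \<Rightarrow> ('a \<Rightarrow> 'b::real_normed_vector) \<Rightarrow> bool" where
  "smooth_on S f \<longleftrightarrow> (\<forall>k. C_k_on k S f)"

text \<open>Only the values of \<open>g\<close> on the unit sphere matter.\<close>

definition smooth_on_sphere :: "('a::euclidean_space \<Rightarrow> real) \<Rightarrow> bool" where
  "smooth_on_sphere g \<longleftrightarrow>
     (\<exists>U F. open U \<and> sphere 0 1 \<subseteq> U \<and> smooth_on U F \<and> (\<forall>u\<in>sphere 0 1. F u = g u))"


section \<open>Hausdorff measure\<close>

text \<open>
  The factor \<open>unit_ball_vol k / 2 ^ k\<close> is the usual normalisation, for which the \<open>k\<close>-dimensional
  Hausdorff measure on a \<open>k\<close>-dimensional Euclidean space is Lebesgue measure. Covering sets are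
  required to be bounded because \<open>diameter\<close> is meaningless otherwise; the case distinction on
  empty sets matters only for \<open>k = 0\<close>, where \<open>0 ^ 0 = 1\<close>.
\<close>

definition hausdorff_premeasure :: "nat \<Rightarrow> real \<Rightarrow> 'a::metric_space set \<Rightarrow> ennreal" where
  "hausdorff_premeasure k \<delta> A =
     (INF U \<in> {U :: nat \<Rightarrow> 'a set. A \<subseteq> (\<Union>i. U i) \<and> (\<forall>i. bounded (U i) \<and> diameter (U i) \<le> \<delta>)}.
        \<Sum>i. if U i = {} then 0
             else ennreal (unit_ball_vol (real k) / 2 ^ k * diameter (U i) ^ k))"

definition hausdorff_outer :: "nat \<Rightarrow> 'a::metric_space set \<Rightarrow> ennreal" where
  "hausdorff_outer k A = (SUP \<delta>\<in>{0<..}. hausdorff_premeasure k \<delta> A)"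

text \<open>
  Being a metric outer measure, \<open>hausdorff_outer k\<close> is countably additive on the Borel sets, so
  it is indeed the value of the following measure on them.
\<close>

definition hausdorff_measure :: "nat \<Rightarrow> 'a::metric_space measure" where
  "hausdorff_measure k = measure_of UNIV (sets borel) (hausdorff_outer k)"


section \<open>Convex bodies\<close>

definition convex_body :: "'a::euclidean_space set \<Rightarrow> bool" where
  "convex_body K \<longleftrightarrow> compact K \<and> convex K \<and> interior K \<noteq> {}"

definition support_function :: "'a::euclidean_space set \<Rightarrow> 'a \<Rightarrow> real" where
  "support_function K u = (SUP x\<in>K. x \<bullet> u)"

definition outer_normal :: "'a::euclidean_space set \<Rightarrow> 'a \<Rightarrow> 'a" where
  "outer_normal K x = (THE n. norm n = 1 \<and> (\<forall>y\<in>K. (y - x) \<bullet> n \<le> 0))"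

text \<open>The boundary is locally a regular level set of a smooth function.\<close>

definition smooth_boundary :: "'a::euclidean_space set \<Rightarrow> bool" where
  "smooth_boundary K \<longleftrightarrow>
     (\<forall>x\<in>frontier K. \<exists>U (F :: 'a \<Rightarrow> real). open U \<and> x \<in> U \<and> smooth_on U F \<and>
        (\<forall>y\<in>U. frechet_derivative F (at y) \<noteq> (\<lambda>v. 0)) \<and>
        frontier K \<inter> U = {y\<in>U. F y = 0})"

definition smooth_strictly_convex_body :: "'a::euclidean_space set \<Rightarrow> bool" where
  "smooth_strictly_convex_body K \<longleftrightarrow>
     convex_body K \<and> 0 \<in> interior K \<and> smooth_boundary K \<and>
     (\<forall>x\<in>K. \<forall>y\<in>K. x \<noteq> y \<longrightarrow> open_segment x y \<subseteq> interior K)"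

definition has_support_function :: "'a::euclidean_space set \<Rightarrow> ('a \<Rightarrow> real) \<Rightarrow> bool" where
  "has_support_function K h \<longleftrightarrow> convex_body K \<and> (\<forall>u\<in>sphere 0 1. support_function K u = h u)"

definition body_with_support_function :: "('a::euclidean_space \<Rightarrow> real) \<Rightarrow> 'a set" where
  "body_with_support_function h = (THE K. has_support_function K h)"


section \<open>The isotropy tensor\<close>

definition surface_measure :: "(real^'n) set \<Rightarrow> (real^'n) measure" where
  "surface_measure K = restrict_space (hausdorff_measure (CARD('n) - 1)) (frontier K)"

definition boundary_measure :: "real \<Rightarrow> (real^'n) set \<Rightarrow> (real^'n) measure" where
  "boundary_measure \<alpha> K =
     density (surface_measure K)
       (\<lambda>x. ennreal (support_function K (outer_normal K x) powr \<alpha> /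
          (\<integral>y. support_function K (outer_normal K y) powr \<alpha> \<partial>surface_measure K)))"

definition norming_functional :: "(real^'n) set \<Rightarrow> real^'n \<Rightarrow> real^'n \<Rightarrow> real" where
  "norming_functional K x z = (z \<bullet> outer_normal K x) / support_function K (outer_normal K x)"

text \<open>Endomorphisms are represented by their matrices in the standard basis.\<close>

definition tensor :: "real^'n \<Rightarrow> (real^'n \<Rightarrow> real) \<Rightarrow> real^'n^'n" where
  "tensor x f = matrix (\<lambda>z. f z *\<^sub>R x)"

definition isotropy_tensor :: "real \<Rightarrow> (real^'n) set \<Rightarrow> real^'n^'n" where
  "isotropy_tensor \<alpha> K =
     real CARD('n) *\<^sub>R (\<integral>x. tensor x (norming_functional K x) \<partial>boundary_measure \<alpha> K)"


section \<open>Rotation-invariant measure and spherical harmonics\<close>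

definition rotation_invariant_prob :: "(real^'n) measure \<Rightarrow> bool" where
  "rotation_invariant_prob \<omega> \<longleftrightarrow>
     prob_space \<omega> \<and> sets \<omega> = sets (restrict_space borel (sphere 0 1)) \<and>
     (\<forall>Q. rotation_matrix Q \<longrightarrow> distr \<omega> \<omega> ((*v) Q) = \<omega>)"

definition laplacian :: "('a::euclidean_space \<Rightarrow> real) \<Rightarrow> 'a \<Rightarrow> real" where
  "laplacian p x =
     (\<Sum>b\<in>Basis. frechet_derivative (\<lambda>y. frechet_derivative p (at y) b) (at x) b)"

text \<open>
  Functions on the sphere are made extensional (undefined elsewhere), so that the projection
  below is unique as a function on the ambient space.
\<close>

definition spherical_harmonics :: "nat \<Rightarrow> ('a::euclidean_space \<Rightarrow> real) set" where
  "spherical_harmonics k =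
     {restrict p (sphere 0 1) | p. real_polynomial_function p \<and>
        (\<forall>t x. p (t *\<^sub>R x) = t ^ k * p x) \<and> (\<forall>x. laplacian p x = 0)}"

definition harmonic_projection ::
    "(real^'n) measure \<Rightarrow> nat \<Rightarrow> (real^'n \<Rightarrow> real) \<Rightarrow> real^'n \<Rightarrow> real" where
  "harmonic_projection \<omega> k g =
     (THE q. q \<in> spherical_harmonics k \<and>
        (\<forall>v\<in>spherical_harmonics k. (\<integral>u. (g u - q u) * v u \<partial>\<omega>) = 0))"

end

theory Submission
  imports Defs
begin

text \<open>
  Both the rotation-invariant probability on the sphere and the normalised Hausdorff measure on
  the sphere are the projection of Lebesgue measure on the ball, since any two uniformly distributed
  probability measures agree. For a body \<open>K\<close> with gauge function \<open>N\<close>, the map \<open>x \<mapsto> x / N x\<close> carries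
  Lebesgue measure on \<open>K\<close>, weighted by \<open>1 / h\<close> at the normal, to a constant multiple of surface measure:
  near a boundary point a linear map of determinant \<open>1 / h\<close> turns the boundary into an almost
  isometric copy of a piece of a sphere. Differentiating integrals of a function of \<open>N\<close> under
  shears \<open>x + t (a \<bullet> x) w\<close> gives \<open>T\<^sub>1 = I\<close>, so that \<open>T\<^sub>\<alpha> - I\<close> becomes an integral over \<open>K\<close> with the factor
  \<open>h powr (\<alpha> - 1) - 1\<close>. For \<open>h = 1 + \<epsilon> g\<close> this factor is of order \<open>\<epsilon>\<close>, and the derivative follows by dominated
  convergence without any derivative of the other ingredients. Fourth moments on the sphere identify
  the degree-two projection, and \<open>g u = u\<^sub>a\<^sup>2 - u\<^sub>b\<^sup>2\<close> separates the exponents \<open>\<alpha> \<noteq> 1\<close>.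
\<close>

section \<open>Hausdorff measure\<close>

text \<open>Hausdorff measure is given only as an infimum over covers, so at the start nothing is
  known about it on a surface, not even finiteness on the sphere. Change of variables on surfaces is
  replaced by squeezing: a bijection that is (1 + \<eta>)-Lipschitz in both directions changes
  Hausdorff measure by at most a power of 1 + \<eta>, so surface measure and projected weighted
  volume agree locally up to (1 + \<eta>)^(2 m), and \<eta> is arbitrary. The determinant 1 / h is
  forced: the linear map fixes tangent vectors and sends the boundary point, whose component along
  the normal is h, to the unit normal. All of this takes place at first order, with outer normals
  that are unique and therefore continuous. That suits the limit \<epsilon> \<rightarrow> 0, where
  bodies and normals merely converge and the whole first-order dependence sits in one scalar factor.
  The smoothness of g is spent on showing that 1 + \<epsilon> g is the support function of a smooth
  strictly convex body, with constants that do not depend on \<epsilon>.\<close>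

abbreviation hcost :: "nat \<Rightarrow> 'a::metric_space set \<Rightarrow> ennreal" where
  "hcost k V \<equiv> (if V = {} then 0 else ennreal (unit_ball_vol (real k) / 2 ^ k * diameter V ^ k))"

lemma hausdorff_premeasure_le:
  assumes "A \<subseteq> (\<Union>i. U i)" "\<And>i. bounded (U i)" "\<And>i. diameter (U i) \<le> \<delta>"
  shows "hausdorff_premeasure k \<delta> A \<le> (\<Sum>i. hcost k (U i))"
  unfolding hausdorff_premeasure_def using assms by (intro INF_lower) auto

lemma hausdorff_premeasure_mono:
  "A \<subseteq> B \<Longrightarrow> hausdorff_premeasure k \<delta> A \<le> hausdorff_premeasure k \<delta> B"
  unfolding hausdorff_premeasure_def by (rule INF_superset_mono) auto

lemma hausdorff_premeasure_antimono:
  "\<delta> \<le> \<delta>' \<Longrightarrow> hausdorff_premeasure k \<delta>' A \<le> hausdorff_premeasure k \<delta> A"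
  unfolding hausdorff_premeasure_def by (rule INF_superset_mono) (auto intro: order_trans)

lemma hausdorff_premeasure_le_outer:
  "0 < \<delta> \<Longrightarrow> hausdorff_premeasure k \<delta> A \<le> hausdorff_outer k A"
  unfolding hausdorff_outer_def by (rule SUP_upper) auto

lemma hausdorff_outer_mono: "A \<subseteq> B \<Longrightarrow> hausdorff_outer k A \<le> hausdorff_outer k B"
  unfolding hausdorff_outer_def by (intro SUP_mono') (auto intro: hausdorff_premeasure_mono)

lemma hausdorff_outer_empty [simp]: "hausdorff_outer k {} = 0"
proof -
  have "hausdorff_premeasure k \<delta> ({}::'a set) \<le> 0" if "\<delta> > 0" for \<delta>
    using hausdorff_premeasure_le[of "{}" "\<lambda>_. {}" \<delta> k] that by simp
  then show ?thesis
    unfolding hausdorff_outer_def by (auto intro!: antisym SUP_least)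
qed

lemma hausdorff_premeasure_approx:
  assumes "hausdorff_premeasure k \<delta> A < c"
  shows "\<exists>U. A \<subseteq> (\<Union>i. U i) \<and> (\<forall>i. bounded (U i)) \<and> (\<forall>i. diameter (U i) \<le> \<delta>) \<and>
    (\<Sum>i. hcost k (U i)) < c"
  using assms unfolding hausdorff_premeasure_def INF_less_iff by auto

text \<open>Covers of the \<open>A i\<close> that are optimal up to e / 2^(i+1) combine into one
  countable cover, enumerated through \<open>prod_decode\<close>; the errors add up to e.\<close>

lemma hausdorff_premeasure_UN:
  "hausdorff_premeasure k \<delta> (\<Union>i. A i) \<le> (\<Sum>i. hausdorff_premeasure k \<delta> (A i))" (is "?L \<le> ?R")
proof (cases "?R = \<infinity>")
  case False
  show ?thesis
  proof (rule ennreal_le_epsilon)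
    fix e :: real assume e: "0 < e"
    have fin: "hausdorff_premeasure k \<delta> (A i) < \<infinity>" for i
      using False ennreal_suminf_lessD[of "\<lambda>i. hausdorff_premeasure k \<delta> (A i)" \<infinity> i]
      by (auto simp: less_top)
    define P where "P i U \<longleftrightarrow> A i \<subseteq> (\<Union>j. U j) \<and> (\<forall>j. bounded (U j)) \<and> (\<forall>j. diameter (U j) \<le> \<delta>) \<and>
       (\<Sum>j. hcost k (U j)) \<le> hausdorff_premeasure k \<delta> (A i) + ennreal (e * (1/2)^Suc i)" for i U
    have "\<exists>U. P i U" for i
    proof -
      have "hausdorff_premeasure k \<delta> (A i) < hausdorff_premeasure k \<delta> (A i) + ennreal (e * (1/2)^Suc i)"
        using ennreal_add_left_cancel_less[of "hausdorff_premeasure k \<delta> (A i)" 0 "ennreal (e * (1/2)^Suc i)"]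
          fin[of i] e by auto
      from hausdorff_premeasure_approx[OF this] obtain U where
        "A i \<subseteq> (\<Union>j. U j) \<and> (\<forall>j. bounded (U j)) \<and> (\<forall>j. diameter (U j) \<le> \<delta>) \<and>
        (\<Sum>j. hcost k (U j)) < hausdorff_premeasure k \<delta> (A i) + ennreal (e * (1/2)^Suc i)" ..
      then have "P i U" unfolding P_def by (elim conjE) (intro conjI; (assumption | erule less_imp_le))
      then show ?thesis by blast
    qed
    then obtain U where "\<And>i. P i (U i)" by metis
    then have U: "\<And>i. A i \<subseteq> (\<Union>j. U i j)" "\<And>i j. bounded (U i j)" "\<And>i j. diameter (U i j) \<le> \<delta>"
      "\<And>i. (\<Sum>j. hcost k (U i j)) \<le> hausdorff_premeasure k \<delta> (A i) + ennreal (e * (1/2)^Suc i)"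
      unfolding P_def by blast+
    define V where "V n = U (fst (prod_decode n)) (snd (prod_decode n))" for n
    have "(\<Union>i. A i) \<subseteq> (\<Union>n. V n)"
    proof
      fix x assume "x \<in> (\<Union>i. A i)"
      then obtain i j where "x \<in> U i j" using U(1) by blast
      then have "x \<in> V (prod_encode (i, j))" by (simp add: V_def)
      then show "x \<in> (\<Union>n. V n)" by blast
    qed
    then have "?L \<le> (\<Sum>n. hcost k (V n))"
      by (intro hausdorff_premeasure_le) (auto simp: V_def U)
    also have "\<dots> = (\<Sum>n. case_prod (\<lambda>i j. hcost k (U i j)) (prod_decode n))"
      by (simp only: V_def case_prod_beta)
    also have "\<dots> = (\<Sum>i. \<Sum>j. hcost k (U i j))"
      by (rule suminf_ennreal_2dimen) simp
    also have "\<dots> \<le> (\<Sum>i. hausdorff_premeasure k \<delta> (A i) + ennreal (e * (1/2)^Suc i))"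
      by (intro suminf_le U(4)) auto
    also have "\<dots> = ?R + (\<Sum>i. ennreal (e * (1/2)^Suc i))"
      by (intro suminf_add[symmetric]) auto
    also have "(\<Sum>i. ennreal (e * (1/2)^Suc i)) = ennreal e"
    proof -
      have "(\<lambda>i. e * (1/2)^Suc i) sums e"
        using sums_mult[OF power_half_series, of e] by simp
      then show ?thesis using e
        by (intro suminf_ennreal_eq) auto
    qed
    finally show "?L \<le> ?R + ennreal e" .
  qed
qed simp

lemma hausdorff_outer_UN:
  "hausdorff_outer k (\<Union>i. A i) \<le> (\<Sum>i. hausdorff_outer k (A i))"
  unfolding hausdorff_outer_def[of k "\<Union>i. A i"]
proof (rule SUP_least)
  fix \<delta> :: real assume "\<delta> \<in> {0<..}"
  then show "hausdorff_premeasure k \<delta> (\<Union>i. A i) \<le> (\<Sum>i. hausdorff_outer k (A i))"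
    by (intro order_trans[OF hausdorff_premeasure_UN] suminf_le hausdorff_premeasure_le_outer) auto
qed

lemma hausdorff_outer_Un: "hausdorff_outer k (A \<union> B) \<le> hausdorff_outer k A + hausdorff_outer k B"
proof -
  have "hausdorff_outer k (\<Union>i. binaryset A B i) \<le> (\<Sum>i. hausdorff_outer k (binaryset A B i))"
    by (rule hausdorff_outer_UN)
  also have "\<dots> = hausdorff_outer k A + hausdorff_outer k B"
    by (rule suminf_binaryset_eq) simp
  finally show ?thesis by (simp add: UN_binaryset_eq)
qed

text \<open>A set of diameter below d cannot meet both A and B, so at scales \<delta> < d every
  cover of the union splits into two covers that share no set and hence no cost.\<close>

lemma hausdorff_outer_separated:
  assumes d: "0 < d" "\<And>a b. a \<in> A \<Longrightarrow> b \<in> B \<Longrightarrow> d \<le> dist a b"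
  shows "hausdorff_outer k A + hausdorff_outer k B \<le> hausdorff_outer k (A \<union> B)"
proof -
  have pre: "hausdorff_premeasure k \<delta> A + hausdorff_premeasure k \<delta> B \<le> hausdorff_premeasure k \<delta> (A \<union> B)"
    if "\<delta> < d" for \<delta>
    unfolding hausdorff_premeasure_def[of k \<delta> "A \<union> B"]
  proof (rule INF_greatest)
    fix U :: "nat \<Rightarrow> 'a set"
    assume "U \<in> {U. A \<union> B \<subseteq> (\<Union>i. U i) \<and> (\<forall>i. bounded (U i) \<and> diameter (U i) \<le> \<delta>)}"
    then have U: "A \<union> B \<subseteq> (\<Union>i. U i)" "\<And>i. bounded (U i)" "\<And>i. diameter (U i) \<le> \<delta>" by auto
    have \<delta>0: "0 \<le> \<delta>" using U(2,3)[of 0] diameter_ge_0[of "U 0"] by linarith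
    define V where "V C i = (if U i \<inter> C = {} then {} else U i)" for C i
    have *: "hausdorff_premeasure k \<delta> C \<le> (\<Sum>i. hcost k (V C i))" if "C \<subseteq> A \<union> B" for C
    proof (rule hausdorff_premeasure_le)
      show "C \<subseteq> (\<Union>i. V C i)"
      proof
        fix x assume "x \<in> C"
        then obtain i where "x \<in> U i" using U(1) \<open>C \<subseteq> A \<union> B\<close> by blast
        then have "x \<in> V C i" using \<open>x \<in> C\<close> by (auto simp: V_def)
        then show "x \<in> (\<Union>i. V C i)" by blast
      qed
    qed (use U(2,3) \<delta>0 in \<open>auto simp: V_def\<close>)
    have disj: "U i \<inter> A = {} \<or> U i \<inter> B = {}" for i
    proof (rule ccontr)
      assume "\<not> ?thesis"
      then obtain a b where "a \<in> U i" "a \<in> A" "b \<in> U i" "b \<in> B" by blast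
      then show False
        using diameter_bounded_bound[OF U(2)[of i], of a b] U(3)[of i] d(2)[of a b] that by linarith
    qed
    have "hausdorff_premeasure k \<delta> A + hausdorff_premeasure k \<delta> B
        \<le> (\<Sum>i. hcost k (V A i)) + (\<Sum>i. hcost k (V B i))"
      by (intro add_mono *) auto
    also have "\<dots> = (\<Sum>i. hcost k (V A i) + hcost k (V B i))"
      by (intro suminf_add) auto
    also have "\<dots> \<le> (\<Sum>i. hcost k (U i))"
    proof (intro suminf_le)
      show "hcost k (V A i) + hcost k (V B i) \<le> hcost k (U i)" for i
        using disj[of i] by (auto simp: V_def)
    qed auto
    finally show "hausdorff_premeasure k \<delta> A + hausdorff_premeasure k \<delta> B
      \<le> (\<Sum>i. if U i = {} then 0 else ennreal (unit_ball_vol (real k) / 2 ^ k * diameter (U i) ^ k))" .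
  qed
  \<comment> \<open>Each outer measure is a supremum over its own scale; passing to a common scale
    below d only increases the premeasures.\<close>
  have mixed: "hausdorff_premeasure k s A + hausdorff_premeasure k t B \<le> hausdorff_outer k (A \<union> B)"
    if "0 < s" "0 < t" for s t
  proof -
    define \<delta> where "\<delta> = min (d/2) (min s t)"
    have \<delta>: "0 < \<delta>" "\<delta> < d" "\<delta> \<le> s" "\<delta> \<le> t" using d(1) that by (auto simp: \<delta>_def)
    have "hausdorff_premeasure k s A + hausdorff_premeasure k t B
        \<le> hausdorff_premeasure k \<delta> A + hausdorff_premeasure k \<delta> B"
      using \<delta> by (intro add_mono hausdorff_premeasure_antimono) auto
    also have "\<dots> \<le> hausdorff_outer k (A \<union> B)"
      using pre[OF \<delta>(2)] hausdorff_premeasure_le_outer[OF \<delta>(1)] by (rule order_trans)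
    finally show ?thesis .
  qed
  have "hausdorff_outer k A + hausdorff_outer k B
      = (SUP s\<in>{0<..}. SUP t\<in>{0<..}. hausdorff_premeasure k s A + hausdorff_premeasure k t B)"
    unfolding hausdorff_outer_def
    by (subst ennreal_SUP_add_left[symmetric]) (auto simp: ennreal_SUP_add_right intro!: SUP_cong)
  also have "\<dots> \<le> hausdorff_outer k (A \<union> B)"
    by (intro SUP_least mixed) auto
  finally show ?thesis .
qed

text \<open>Induction on partial sums: each new set needs a positive distance to the earlier ones
  only, and these distances may tend to 0.\<close>

lemma hausdorff_outer_separated_family:
  assumes "\<And>n::nat. \<exists>d>0. \<forall>x\<in>(\<Union>i<n. R i). \<forall>y\<in>R n. d \<le> dist x y" "\<And>n. R n \<subseteq> A"
  shows "(\<Sum>n. hausdorff_outer k (R n)) \<le> hausdorff_outer k A"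
proof (rule suminf_le_const)
  fix n
  have "(\<Sum>i<n. hausdorff_outer k (R i)) \<le> hausdorff_outer k (\<Union>i<n. R i)"
  proof (induction n)
    case (Suc n)
    obtain d where "d > 0" "\<forall>x\<in>(\<Union>i<n. R i). \<forall>y\<in>R n. d \<le> dist x y"
      using assms(1) by blast
    then have "hausdorff_outer k (\<Union>i<n. R i) + hausdorff_outer k (R n) \<le> hausdorff_outer k ((\<Union>i<n. R i) \<union> R n)"
      by (intro hausdorff_outer_separated[of d]) blast+
    also have "(\<Union>i<n. R i) \<union> R n = (\<Union>i<Suc n. R i)"
      by (auto simp: lessThan_Suc)
    finally show ?case
      using order_trans[OF add_right_mono[OF Suc]] by simp
  qed simp
  also have "\<dots> \<le> hausdorff_outer k A"
    using assms(2) by (intro hausdorff_outer_mono) auto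
  finally show "(\<Sum>i<n. hausdorff_outer k (R i)) \<le> hausdorff_outer k A" .
qed auto

text \<open>Caratheodory's criterion: additivity on separated sets makes closed sets measurable.
  \<open>B n\<close> collects the points of A at distance at least 1 / (n+1) from C; what it misses
  of A - C lies in the shells \<open>R i\<close> with i \<ge> n, and their total measure is the tail
  of a convergent series.\<close>

lemma hausdorff_outer_closed_split:
  fixes C :: "'a::metric_space set"
  assumes C: "closed C"
  shows "hausdorff_outer k (C \<inter> A) + hausdorff_outer k (A - C) \<le> hausdorff_outer k A"
proof (cases "hausdorff_outer k A = \<infinity> \<or> C = {}")
  case False
  then have fin: "hausdorff_outer k A < \<infinity>" and ne: "C \<noteq> {}"
    by (simp_all add: less_top[symmetric])
  define B where "B n = {x\<in>A. 1 / real (Suc n) \<le> infdist x C}" for n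
  define R where "R n = B (Suc n) - B n" for n
  have RA: "R n \<subseteq> A" for n by (auto simp: R_def B_def)
  have B_mono: "B m \<subseteq> B n" if "m \<le> n" for m n
  proof -
    have "1 / real (Suc n) \<le> 1 / real (Suc m)" using that by (simp add: field_simps)
    then show ?thesis by (auto simp: B_def)
  qed
  have sep: "1 / real (Suc m) - 1 / real (Suc n) \<le> dist x y" if "x \<in> B m" "y \<notin> B n" "y \<in> A" for x y m n
    using that infdist_triangle[of x C y] by (auto simp: B_def dist_commute)
  have gap: "0 < 1 / real (Suc m) - 1 / real (Suc n)" if "m < n" for m n
    using that by (simp add: frac_less2)
  \<comment> \<open>Neighbouring shells may touch, but shells of equal parity have a level between
    them: the earlier ones lie in \<open>B (2 * n + s - 1)\<close>, while the next one avoids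
    \<open>B (2 * n + s)\<close>.\<close>
  have every_other: "(\<Sum>n. hausdorff_outer k (R (2 * n + s))) \<le> hausdorff_outer k A" for s
  proof (rule hausdorff_outer_separated_family)
    fix n
    show "\<exists>d>0. \<forall>x\<in>(\<Union>i<n. R (2 * i + s)). \<forall>y\<in>R (2 * n + s). d \<le> dist x y"
    proof (cases n)
      case (Suc n')
      show ?thesis
      proof (intro exI[of _ "1 / real (Suc (2 * n + s - 1)) - 1 / real (Suc (2 * n + s))"] conjI ballI)
        fix x y assume "x \<in> (\<Union>i<n. R (2 * i + s))" and y: "y \<in> R (2 * n + s)"
        then obtain i where "i < n" "x \<in> B (Suc (2 * i + s))" by (auto simp: R_def)
        then have "x \<in> B (2 * n + s - 1)"
          using B_mono[of "Suc (2 * i + s)" "2 * n + s - 1"] by (auto simp: less_iff_Suc_add)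
        then show "1 / real (Suc (2 * n + s - 1)) - 1 / real (Suc (2 * n + s)) \<le> dist x y"
          using y RA by (intro sep) (auto simp: R_def)
      qed (use Suc gap[of "2 * n + s - 1" "2 * n + s"] in simp)
    qed (auto intro: exI[of _ 1])
  qed (use RA in auto)
  define r where "r n = enn2real (hausdorff_outer k (R n))" for n
  have r: "hausdorff_outer k (R n) = ennreal (r n)" for n
  proof -
    have "hausdorff_outer k (R n) < \<infinity>"
      using hausdorff_outer_mono[OF RA] fin by (rule le_less_trans)
    then show ?thesis by (simp add: r_def)
  qed
  have r0: "0 \<le> r n" for n by (simp add: r_def)
  have summ: "summable (\<lambda>n. r (2 * n + s))" for s
    using every_other[of s] fin r0 unfolding r
    by (intro summable_suminf_not_top) (use le_less_trans in \<open>force+\<close>)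
  have "summable r"
  proof -
    let ?S = "(\<Sum>n. r (2*n)) + (\<Sum>n. r (2*n+1))"
    have "(\<Sum>i<n. r i) \<le> ?S" for n
    proof -
      have "(\<Sum>i<n. r i) \<le> (\<Sum>i<2*n. r i)"
        using r0 by (intro sum_mono2) auto
      also have "\<dots> = (\<Sum>i<n. r (2*i)) + (\<Sum>i<n. r (2*i+1))"
        by (induction n) (auto simp: algebra_simps)
      also have "\<dots> \<le> ?S"
        using summ[of 0] summ[of 1] r0 by (intro add_mono sum_le_suminf) auto
      finally show ?thesis .
    qed
    then show ?thesis
      using r0 by (intro summableI_nonneg_bounded[where x = ?S]) auto
  qed
  have cover: "A - C = B n \<union> (\<Union>i. R (i + n))" for n
  proof (intro equalityI subsetI)
    fix x assume x: "x \<in> A - C"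
    then have "0 < infdist x C"
      using C ne infdist_pos_not_in_closed[of C x] by auto
    then obtain j where "1 / real (Suc j) < infdist x C"
      using nat_approx_posE by blast
    then have xj: "x \<in> B j" using x by (auto simp: B_def)
    show "x \<in> B n \<union> (\<Union>i. R (i + n))"
    proof (cases "x \<in> B n")
      case False
      have xjn: "x \<in> B (j + n)" using xj B_mono[of j "j + n"] by auto
      define m where "m = (LEAST m. x \<in> B (m + n))"
      have m: "x \<in> B (m + n)" unfolding m_def using xjn by (rule LeastI)
      have "m \<noteq> 0"
      proof
        assume "m = 0"
        with m False show False by simp
      qed
      then obtain m' where m': "m = Suc m'" by (cases m) auto
      have "x \<notin> B (m' + n)" using not_less_Least[of m' "\<lambda>m. x \<in> B (m + n)"] m' m_def by auto
      then have "x \<in> R (m' + n)" using m m' by (auto simp: R_def)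
      then show ?thesis by blast
    qed blast
  next
    fix x assume "x \<in> B n \<union> (\<Union>i. R (i + n))"
    then obtain j where "x \<in> B j" by (auto simp: R_def)
    moreover have "infdist x C = 0" if "x \<in> C" using that by simp
    ultimately show "x \<in> A - C" by (auto simp: B_def)
  qed
  have tail: "hausdorff_outer k (C \<inter> A) + hausdorff_outer k (A - C) \<le> hausdorff_outer k A + ennreal (\<Sum>i. r (i + n))" for n
  proof -
    have "hausdorff_outer k (A - C) \<le> hausdorff_outer k (B n) + hausdorff_outer k (\<Union>i. R (i + n))"
      unfolding cover[of n] by (rule hausdorff_outer_Un)
    also have "hausdorff_outer k (\<Union>i. R (i + n)) \<le> (\<Sum>i. ennreal (r (i + n)))"
      unfolding r[symmetric] by (rule hausdorff_outer_UN)
    also have "\<dots> = ennreal (\<Sum>i. r (i + n))"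
      using \<open>summable r\<close> r0 by (intro suminf_ennreal2) auto
    finally have "hausdorff_outer k (C \<inter> A) + hausdorff_outer k (A - C)
      \<le> (hausdorff_outer k (C \<inter> A) + hausdorff_outer k (B n)) + ennreal (\<Sum>i. r (i + n))"
      by (simp add: add.assoc add_left_mono)
    also have "hausdorff_outer k (C \<inter> A) + hausdorff_outer k (B n) \<le> hausdorff_outer k ((C \<inter> A) \<union> B n)"
    proof (rule hausdorff_outer_separated[of "1 / real (Suc n)"])
      fix a b assume "a \<in> C \<inter> A" "b \<in> B n"
      then show "1 / real (Suc n) \<le> dist a b"
        using infdist_le[of a C b] by (auto simp: B_def dist_commute)
    qed simp
    also have "\<dots> \<le> hausdorff_outer k A"
      by (intro hausdorff_outer_mono) (auto simp: B_def)
    finally show ?thesis by simp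
  qed
  have "(\<lambda>n. hausdorff_outer k A + ennreal (\<Sum>i. r (i + n))) \<longlonglongrightarrow> hausdorff_outer k A + ennreal 0"
    by (intro tendsto_intros suminf_exist_split2 \<open>summable r\<close> tendsto_ennrealI)
  from LIMSEQ_le_const[OF this, of "hausdorff_outer k (C \<inter> A) + hausdorff_outer k (A - C)"]
  show ?thesis using tail by simp
next
  case True
  then show ?thesis by (elim disjE) simp_all
qed

text \<open>\<open>measure_of\<close> yields the null measure unless its set function is a measure
  on the given sets, so this is what gives \<open>hausdorff_measure\<close> its values. Closed sets
  belong to the Caratheodory system of the outer measure, and they generate the Borel sets.\<close>

lemma measure_space_hausdorff:
  "measure_space UNIV (sets borel) (hausdorff_outer k :: 'a::metric_space set \<Rightarrow> ennreal)"
proof -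
  interpret sigma_algebra "UNIV :: 'a set" "Pow UNIV" by (rule sigma_algebra_Pow)
  define L where "L = lambda_system UNIV (Pow UNIV) (hausdorff_outer k :: 'a set \<Rightarrow> ennreal)"
  have "outer_measure_space (Pow UNIV) (hausdorff_outer k :: 'a set \<Rightarrow> ennreal)"
    unfolding outer_measure_space_def positive_def increasing_def countably_subadditive_def
    by (auto intro: hausdorff_outer_mono hausdorff_outer_UN)
  then have L: "measure_space UNIV L (hausdorff_outer k)"
    unfolding L_def by (rule caratheodory_lemma)
  have "C \<in> L" if "closed C" for C
  proof -
    have "hausdorff_outer k (C \<inter> x) + hausdorff_outer k ((UNIV - C) \<inter> x) = hausdorff_outer k x" for x
    proof (rule antisym)
      show "hausdorff_outer k (C \<inter> x) + hausdorff_outer k ((UNIV - C) \<inter> x) \<le> hausdorff_outer k x"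
        using hausdorff_outer_closed_split[OF that, of k x]
        by (simp add: Diff_eq Int_commute)
      show "hausdorff_outer k x \<le> hausdorff_outer k (C \<inter> x) + hausdorff_outer k ((UNIV - C) \<inter> x)"
        using hausdorff_outer_Un[of k "C \<inter> x" "(UNIV - C) \<inter> x"]
        by (simp add: Int_Un_distrib2[symmetric])
    qed
    then show ?thesis by (simp add: L_def lambda_system_def)
  qed
  then have "sigma_sets UNIV (Collect closed) \<subseteq> L"
    using L unfolding measure_space_def
    by (intro sigma_algebra.sigma_sets_subset) auto
  then have "sets borel \<subseteq> L"
    unfolding borel_eq_closed by simp
  with L show ?thesis
    using sets.sigma_algebra_axioms[of "borel :: 'a measure"]
    unfolding measure_space_def positive_def countably_additive_def by (simp add: subset_iff)
qed

lemma sets_hausdorff_measure [simp, measurable_cong]: "sets (hausdorff_measure k) = sets borel"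
  unfolding hausdorff_measure_def using sets.sigma_sets_eq[of borel] by simp

lemma space_hausdorff_measure [simp]: "space (hausdorff_measure k) = UNIV"
  unfolding hausdorff_measure_def by (simp add: space_measure_of_conv)

lemma emeasure_hausdorff_measure:
  "A \<in> sets borel \<Longrightarrow> emeasure (hausdorff_measure k) A = hausdorff_outer k A"
  using measure_space_hausdorff[of k] unfolding hausdorff_measure_def measure_space_def
  by (intro emeasure_measure_of_sigma) auto

lemma less_divide_ennreal_iff:
  assumes "0 < b"
  shows "x < a / ennreal b \<longleftrightarrow> x * ennreal b < a"
proof -
  have "a / ennreal b \<le> x \<longleftrightarrow> a \<le> x * ennreal b"
  proof
    assume "a / ennreal b \<le> x"
    then have "a / ennreal b * ennreal b \<le> x * ennreal b" by (rule mult_right_mono) simp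
    moreover have "a / ennreal b * ennreal b = a"
      using assms by (simp add: ennreal_divide_times ennreal_mult_divide_eq)
    ultimately show "a \<le> x * ennreal b" by simp
  next
    assume "a \<le> x * ennreal b"
    then show "a / ennreal b \<le> x"
      using assms by (intro divide_le_posI_ennreal) (auto simp: mult.commute)
  qed
  then show ?thesis by (meson not_le)
qed

text \<open>The bound holds on A only, so covering sets are first cut down to A; their images then
  have at most L times the diameter and form a cover at scale L * \<delta>.\<close>

lemma hausdorff_outer_lipschitz:
  fixes f :: "'a::metric_space \<Rightarrow> 'b::metric_space"
  assumes L: "0 < L" "\<And>x y. x \<in> A \<Longrightarrow> y \<in> A \<Longrightarrow> dist (f x) (f y) \<le> L * dist x y"
  shows "hausdorff_outer k (f ` A) \<le> ennreal (L ^ k) * hausdorff_outer k A"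
proof -
  have step: "hausdorff_premeasure k (L * \<delta>) (f ` A) \<le> ennreal (L ^ k) * hausdorff_premeasure k \<delta> A"
    for \<delta>
  proof (rule ccontr)
    assume "\<not> ?thesis"
    then have "hausdorff_premeasure k \<delta> A < hausdorff_premeasure k (L * \<delta>) (f ` A) / ennreal (L ^ k)"
      using L(1) by (simp add: less_divide_ennreal_iff not_le mult.commute)
    from hausdorff_premeasure_approx[OF this]
    obtain U where U: "A \<subseteq> (\<Union>i. U i)" "\<And>i. bounded (U i)" "\<And>i. diameter (U i) \<le> \<delta>"
      "(\<Sum>i. hcost k (U i)) < hausdorff_premeasure k (L * \<delta>) (f ` A) / ennreal (L ^ k)"
      by auto
    define V where "V i = f ` (U i \<inter> A)" for i
    have dist: "dist x y \<le> L * diameter (U i)" if "x \<in> V i" "y \<in> V i" for x y i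
    proof -
      obtain a b where ab: "a \<in> U i \<inter> A" "b \<in> U i \<inter> A" "x = f a" "y = f b"
        using \<open>x \<in> V i\<close> \<open>y \<in> V i\<close> by (auto simp: V_def)
      have "dist x y \<le> L * dist a b" using L(2) ab by auto
      also have "\<dots> \<le> L * diameter (U i)"
        using L(1) ab diameter_bounded_bound[OF U(2)[of i], of a b] by (intro mult_left_mono) auto
      finally show ?thesis .
    qed
    have diam: "diameter (V i) \<le> L * diameter (U i)" for i
    proof (cases "V i = {}")
      case True
      then show ?thesis using L(1) diameter_ge_0[OF U(2)[of i]] by simp
    next
      case False
      then have "diameter (V i) = (SUP (x, y) \<in> V i \<times> V i. dist x y)" by (simp add: diameter_def)
      also have "\<dots> \<le> L * diameter (U i)"
        using False dist by (intro cSUP_least) auto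
      finally show ?thesis .
    qed
    have bdd: "bounded (V i)" for i
      unfolding bounded_two_points using dist[of _ i] by blast
    have "hausdorff_premeasure k (L * \<delta>) (f ` A) \<le> (\<Sum>i. hcost k (V i))"
    proof (rule hausdorff_premeasure_le)
      show "f ` A \<subseteq> (\<Union>i. V i)" using U(1) unfolding V_def by blast
      show "diameter (V i) \<le> L * \<delta>" for i
        using diam[of i] U(3)[of i] L(1) by (smt (verit) mult_left_mono)
    qed (rule bdd)
    also have "\<dots> \<le> (\<Sum>i. ennreal (L ^ k) * hcost k (U i))"
    proof (intro suminf_le)
      fix i
      show "hcost k (V i) \<le> ennreal (L ^ k) * hcost k (U i)"
      proof (cases "V i = {}")
        case False
        then have "U i \<noteq> {}" by (auto simp: V_def)
        moreover have "diameter (V i) ^ k \<le> L ^ k * diameter (U i) ^ k"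
          using power_mono[OF diam[of i] diameter_ge_0[OF bdd], of k] by (simp add: power_mult_distrib)
        then have "unit_ball_vol (real k) / 2 ^ k * diameter (V i) ^ k
            \<le> unit_ball_vol (real k) / 2 ^ k * (L ^ k * diameter (U i) ^ k)"
          by (intro mult_left_mono) auto
        ultimately show ?thesis
          using False L(1) diameter_ge_0[OF U(2)[of i]]
          by (auto simp: ennreal_mult'[symmetric] algebra_simps intro!: ennreal_leI)
      qed simp
    qed auto
    also have "\<dots> = ennreal (L ^ k) * (\<Sum>i. hcost k (U i))" by simp
    also have "\<dots> < hausdorff_premeasure k (L * \<delta>) (f ` A)"
      using U(4) L(1) unfolding less_divide_ennreal_iff[OF zero_less_power[OF L(1)]]
      by (simp only: mult.commute)
    finally show False by simp
  qed
  show ?thesis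
    unfolding hausdorff_outer_def[of k "f ` A"]
  proof (rule SUP_least)
    fix \<delta> :: real assume "\<delta> \<in> {0<..}"
    then have "hausdorff_premeasure k (L * (\<delta> / L)) (f ` A) \<le> ennreal (L ^ k) * hausdorff_outer k A"
      using L(1) by (intro order_trans[OF step] mult_left_mono hausdorff_premeasure_le_outer) auto
    then show "hausdorff_premeasure k \<delta> (f ` A) \<le> ennreal (L ^ k) * hausdorff_outer k A"
      using L(1) by simp
  qed
qed

section \<open>Uniqueness of uniformly distributed measures\<close>

lemma nn_integral_emeasure_ball_swap:
  fixes \<mu> \<nu> :: "'a::{metric_space,second_countable_topology} measure"
  assumes "finite_measure \<mu>" "finite_measure \<nu>" "sets \<mu> = sets borel" "sets \<nu> = sets borel"
    and "U \<in> sets borel" "V \<in> sets borel"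
  shows "(\<integral>\<^sup>+x\<in>U. emeasure \<nu> (V \<inter> ball x r) \<partial>\<mu>) = (\<integral>\<^sup>+y\<in>V. emeasure \<mu> (U \<inter> ball y r) \<partial>\<nu>)"
proof -
  interpret \<mu>: finite_measure \<mu> by fact
  interpret \<nu>: finite_measure \<nu> by fact
  interpret pair_sigma_finite \<mu> \<nu> ..
  note [measurable_cong] = assms(3,4) and [measurable] = assms(5,6)
  let ?f = "\<lambda>x y. indicator U x * indicator V y * (if dist x y < r then 1 else 0 :: ennreal)"
  have "(\<integral>\<^sup>+x\<in>U. emeasure \<nu> (V \<inter> ball x r) \<partial>\<mu>) = (\<integral>\<^sup>+x. (\<integral>\<^sup>+y. ?f x y \<partial>\<nu>) \<partial>\<mu>)"
  proof (intro nn_integral_cong)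
    fix x
    have "emeasure \<nu> (V \<inter> ball x r) * indicator U x = (\<integral>\<^sup>+y. indicator U x * indicator (V \<inter> ball x r) y \<partial>\<nu>)"
      by (subst nn_integral_cmult) (auto simp: mult.commute assms intro!: borel_measurable_indicator)
    also have "\<dots> = (\<integral>\<^sup>+y. ?f x y \<partial>\<nu>)"
      by (intro nn_integral_cong) (auto simp: indicator_def)
    finally show "emeasure \<nu> (V \<inter> ball x r) * indicator U x = (\<integral>\<^sup>+y. ?f x y \<partial>\<nu>)" .
  qed
  also have "\<dots> = (\<integral>\<^sup>+y. (\<integral>\<^sup>+x. ?f x y \<partial>\<mu>) \<partial>\<nu>)"
    by (rule Fubini'[symmetric]) measurable
  also have "\<dots> = (\<integral>\<^sup>+y\<in>V. emeasure \<mu> (U \<inter> ball y r) \<partial>\<nu>)"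
  proof (intro nn_integral_cong)
    fix y
    have "emeasure \<mu> (U \<inter> ball y r) * indicator V y = (\<integral>\<^sup>+x. indicator V y * indicator (U \<inter> ball y r) x \<partial>\<mu>)"
      by (subst nn_integral_cmult) (auto simp: mult.commute assms intro!: borel_measurable_indicator)
    also have "\<dots> = (\<integral>\<^sup>+x. ?f x y \<partial>\<mu>)"
      by (intro nn_integral_cong) (auto simp: indicator_def dist_commute)
    finally show "(\<integral>\<^sup>+x. ?f x y \<partial>\<mu>) = emeasure \<mu> (U \<inter> ball y r) * indicator V y" ..
  qed
  finally show ?thesis .
qed

lemma emeasure_ball_measurable:
  fixes \<nu> :: "'a::{metric_space,second_countable_topology} measure"
  assumes "finite_measure \<nu>" "sets \<nu> = sets borel" "V \<in> sets borel"
  shows "(\<lambda>x. emeasure \<nu> (V \<inter> ball x r)) \<in> borel_measurable borel"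
proof -
  interpret \<nu>: finite_measure \<nu> by fact
  note [measurable_cong] = assms(2) and [measurable] = assms(3)
  have meas: "(\<lambda>x. \<integral>\<^sup>+y. indicator V y * (if dist x y < r then 1 else 0 :: ennreal) \<partial>\<nu>) \<in> borel_measurable borel"
    by measurable
  have eq: "(\<lambda>x. \<integral>\<^sup>+y. indicator V y * (if dist x y < r then 1 else 0 :: ennreal) \<partial>\<nu>)
      = (\<lambda>x. emeasure \<nu> (V \<inter> ball x r))"
  proof
    fix x
    have "(\<integral>\<^sup>+y. indicator V y * (if dist x y < r then 1 else 0 :: ennreal) \<partial>\<nu>) = (\<integral>\<^sup>+y. indicator (V \<inter> ball x r) y \<partial>\<nu>)"
      by (intro nn_integral_cong) (auto simp: indicator_def)
    also have "\<dots> = emeasure \<nu> (V \<inter> ball x r)" using assms by simp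
    finally show "(\<integral>\<^sup>+y. indicator V y * (if dist x y < r then 1 else 0 :: ennreal) \<partial>\<nu>) = emeasure \<nu> (V \<inter> ball x r)" .
  qed
  show ?thesis using meas unfolding eq .
qed

text \<open>Two probability measures on a compact set X for which the mass of a ball centred in X
  depends on the radius alone. That such uniformly distributed measures coincide is a classical
  metric argument; it takes the place of Haar measure on the rotation group.\<close>

locale uniform_pair =
  fixes \<mu> \<nu> :: "'a::{metric_space,second_countable_topology} measure" and X :: "'a set"
  assumes prob: "prob_space \<mu>" "prob_space \<nu>"
    and sets: "sets \<mu> = sets borel" "sets \<nu> = sets borel"
    and X: "compact X" "emeasure \<mu> (- X) = 0" "emeasure \<nu> (- X) = 0"
    and unif: "\<And>x y r. x \<in> X \<Longrightarrow> y \<in> X \<Longrightarrow> emeasure \<mu> (ball x r) = emeasure \<mu> (ball y r)"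
      "\<And>x y r. x \<in> X \<Longrightarrow> y \<in> X \<Longrightarrow> emeasure \<nu> (ball x r) = emeasure \<nu> (ball y r)"
begin

lemma swap: "uniform_pair \<nu> \<mu> X"
  by (rule uniform_pair.intro) (fact prob sets X unif)+

lemma fin: "finite_measure \<mu>" "finite_measure \<nu>"
  using prob by (auto intro: prob_space.finite_measure)

lemma emeasure_UNIV: "emeasure \<mu> UNIV = 1" "emeasure \<nu> UNIV = 1"
  using prob_space.emeasure_space_1[OF prob(1)] prob_space.emeasure_space_1[OF prob(2)]
    sets_eq_imp_space_eq[OF sets(1)] sets_eq_imp_space_eq[OF sets(2)] by auto

lemma AE_X: "AE x in \<mu>. x \<in> X" "AE x in \<nu>. x \<in> X"
  using X compact_imp_closed[OF X(1)] sets sets_eq_imp_space_eq[OF sets(1)] sets_eq_imp_space_eq[OF sets(2)]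
  by (auto intro!: AE_I[where N = "- X"])

text \<open>If one ball of radius r were null, all of them would be, and finitely many cover
  X.\<close>

lemma ball_pos:
  assumes "x \<in> X" "0 < r"
  shows "0 < emeasure \<mu> (ball x r)"
proof (rule ccontr)
  assume "\<not> ?thesis"
  then have 0: "emeasure \<mu> (ball y r) = 0" if "y \<in> X" for y
    using unif(1)[OF assms(1) that, of r] by simp
  obtain C where C: "C \<subseteq> X" "finite C" "X \<subseteq> (\<Union>c\<in>C. ball c r)"
    using compactE_image[OF X(1), of X "\<lambda>c. ball c r"] assms(2) by (metis UN_I centre_in_ball open_ball subsetI)
  have "emeasure \<mu> UNIV \<le> emeasure \<mu> (- X \<union> (\<Union>c\<in>C. ball c r))"
    using C(3) compact_imp_closed[OF X(1)] C(2)
    by (intro emeasure_mono) (auto simp: sets intro!: sets.Un sets.finite_UN borel_open open_Compl)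
  also have "\<dots> \<le> emeasure \<mu> (- X) + emeasure \<mu> (\<Union>c\<in>C. ball c r)"
    using compact_imp_closed[OF X(1)] C(2) 
    by (intro emeasure_subadditive) (auto simp: sets intro!: sets.finite_UN borel_open open_Compl)
  also have "emeasure \<mu> (\<Union>c\<in>C. ball c r) \<le> (\<Sum>c\<in>C. emeasure \<mu> (ball c r))"
    using C by (intro emeasure_subadditive_finite) (auto simp: sets)
  also have "\<dots> = 0" using C(1) 0 by (intro sum.neutral) auto
  finally show False using X(2) emeasure_UNIV by simp
qed

text \<open>The average over \<mu> of the \<nu>-mass of balls is the \<nu>-mass of a single ball;
  swapping the integrals turns the same average into the \<mu>-mass.\<close>

lemma ball_eq:
  assumes x: "x \<in> X"
  shows "emeasure \<mu> (ball x r) = emeasure \<nu> (ball x r)"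
proof -
  have "emeasure \<nu> (ball x r) = (\<integral>\<^sup>+y\<in>UNIV. emeasure \<nu> (UNIV \<inter> ball y r) \<partial>\<mu>)"
    using AE_X(1) unif(2)[OF x] emeasure_UNIV(1) sets_eq_imp_space_eq[OF sets(1)]
    by (subst nn_integral_cong_AE[where v = "\<lambda>_. emeasure \<nu> (ball x r)"]) auto
  also have "\<dots> = (\<integral>\<^sup>+y\<in>UNIV. emeasure \<mu> (UNIV \<inter> ball y r) \<partial>\<nu>)"
    by (intro nn_integral_emeasure_ball_swap fin sets) auto
  also have "\<dots> = emeasure \<mu> (ball x r)"
    using AE_X(2) unif(1)[OF x] emeasure_UNIV(2) sets_eq_imp_space_eq[OF sets(2)]
    by (subst nn_integral_cong_AE[where v = "\<lambda>_. emeasure \<mu> (ball x r)"]) auto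
  finally show ?thesis ..
qed

text \<open>\<open>f n x\<close> is the share of U in the ball of radius 1 / (n+1) around x. It
  tends to 1 on U, so by Fatou's lemma \<mu>(U) is at most the lower limit of its integrals; the
  swap identity and the common ball mass \<open>b n\<close> bound each integral by \<nu>(U).\<close>

lemma open_le:
  assumes U: "open U"
  shows "emeasure \<mu> U \<le> emeasure \<nu> U"
proof -
  have "X \<noteq> {}" using X(2) emeasure_UNIV by auto
  then obtain x0 where x0: "x0 \<in> X" by auto
  define b where "b n = emeasure \<nu> (ball x0 (1 / real (Suc n)))" for n
  have b: "b n \<noteq> 0" "b n \<noteq> top" for n
    using ball_pos[OF x0, of "1 / real (Suc n)"] ball_eq[OF x0]
      finite_measure.emeasure_finite[OF fin(2)] by (auto simp: b_def)
  define f where "f n x = emeasure \<nu> (U \<inter> ball x (1 / real (Suc n))) * indicator U x / b n" for n x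
  have f_meas [measurable]: "f n \<in> borel_measurable \<mu>" for n
    unfolding f_def measurable_cong_sets[OF sets(1) refl] using U
    by (intro borel_measurable_divide_ennreal borel_measurable_times_ennreal emeasure_ball_measurable fin sets
        borel_measurable_indicator borel_measurable_const) auto
  have f_lim: "indicator U x \<le> liminf (\<lambda>n. f n x)" if "x \<in> X" for x
  proof (cases "x \<in> U")
    case True
    then obtain e where e: "e > 0" "ball x e \<subseteq> U" using U openE by blast
    have "eventually (\<lambda>n. 1 / real (Suc n) < e) sequentially"
      using e(1) by real_asymp
    then have "eventually (\<lambda>n. f n x = 1) sequentially"
    proof eventually_elim
      case (elim n)
      then have "U \<inter> ball x (1 / real (Suc n)) = ball x (1 / real (Suc n))" using e(2) by auto
      then have "f n x = b n / b n" using True unif(2)[OF that x0] by (simp add: f_def b_def)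
      then show ?case using b[of n] by (simp add: less_top[symmetric] zero_less_iff_neq_zero)
    qed
    then have "eventually (\<lambda>n. 1 \<le> f n x) sequentially" by eventually_elim simp
    then show ?thesis using True by (auto intro!: Liminf_bounded)
  qed simp
  have "emeasure \<mu> U = (\<integral>\<^sup>+x. indicator U x \<partial>\<mu>)" using U sets by auto
  also have "\<dots> \<le> (\<integral>\<^sup>+x. liminf (\<lambda>n. f n x) \<partial>\<mu>)"
    using AE_X(1) f_lim by (intro nn_integral_mono_AE) auto
  also have "\<dots> \<le> liminf (\<lambda>n. integral\<^sup>N \<mu> (f n))"
    by (intro nn_integral_liminf) measurable
  also have "\<dots> \<le> emeasure \<nu> U"
  proof (rule Liminf_le)
    have "integral\<^sup>N \<mu> (f n) \<le> emeasure \<nu> U" for n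
    proof -
      let ?r = "1 / real (Suc n)"
      have "integral\<^sup>N \<mu> (f n) = (\<integral>\<^sup>+x\<in>U. emeasure \<nu> (U \<inter> ball x ?r) \<partial>\<mu>) / b n"
        unfolding f_def using U
        by (intro nn_integral_divide)
          (auto simp: measurable_cong_sets[OF sets(1) refl] intro!: emeasure_ball_measurable fin sets borel_measurable_times_ennreal)
      also have "(\<integral>\<^sup>+x\<in>U. emeasure \<nu> (U \<inter> ball x ?r) \<partial>\<mu>) = (\<integral>\<^sup>+y\<in>U. emeasure \<mu> (U \<inter> ball y ?r) \<partial>\<nu>)"
        using U by (intro nn_integral_emeasure_ball_swap fin sets) auto
      also have "\<dots> \<le> (\<integral>\<^sup>+y. b n * indicator U y \<partial>\<nu>)"
      proof (intro nn_integral_mono_AE)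
        show "AE y in \<nu>. emeasure \<mu> (U \<inter> ball y ?r) * indicator U y \<le> b n * indicator U y"
          using AE_X(2)
        proof eventually_elim
          case (elim y)
          have "emeasure \<mu> (U \<inter> ball y ?r) \<le> emeasure \<mu> (ball y ?r)"
            using sets by (intro emeasure_mono) auto
          also have "\<dots> = b n" using unif(1)[OF elim x0] ball_eq[OF x0] by (simp add: b_def)
          finally show ?case by (intro mult_right_mono) auto
        qed
      qed
      also have "\<dots> = b n * emeasure \<nu> U" using U sets
        by (subst nn_integral_cmult) (auto intro!: borel_measurable_indicator)
      finally have "integral\<^sup>N \<mu> (f n) \<le> b n * emeasure \<nu> U / b n" by (simp add: divide_right_mono_ennreal)
      also have "\<dots> = emeasure \<nu> U"
        using b[of n] ennreal_mult_divide_eq[of "b n" "emeasure \<nu> U"] by (simp add: mult.commute)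
      finally show ?thesis .
    qed
    then show "\<forall>\<^sub>F n in sequentially. integral\<^sup>N \<mu> (f n) \<le> emeasure \<nu> U" by simp
  qed simp
  finally show ?thesis .
qed

lemma unique: "\<mu> = \<nu>"
proof -
  interpret s: uniform_pair \<nu> \<mu> X by (rule swap)
  have eq: "emeasure \<mu> U = emeasure \<nu> U" if "open U" for U
    using open_le[OF that] s.open_le[OF that] by (rule antisym)
  show ?thesis
  proof (rule measure_eqI_generator_eq[where E = "Collect open" and \<Omega> = UNIV and A = "\<lambda>_. UNIV"])
    show "Int_stable (Collect open)" by (auto simp: Int_stable_def)
    show "\<And>i. emeasure \<mu> UNIV \<noteq> \<infinity>" by (simp add: emeasure_UNIV)
  qed (auto simp: eq sets borel_def)
qed

end

section \<open>Linear maps and volume\<close>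

text \<open>The uniqueness argument for Haar measure: the indicator of A at x + y times that of the
  unit ball at y is integrated in both orders, using the translation invariance of one measure each
  time.\<close>

lemma translation_invariant_proportional:
  fixes M :: "'a::euclidean_space measure"
  assumes M: "sigma_finite_measure M" and sets: "sets M = sets borel"
    and inv: "\<And>a A. A \<in> sets borel \<Longrightarrow> emeasure M ((+) a -` A) = emeasure M A"
    and A: "A \<in> sets borel"
  shows "emeasure M A * emeasure lborel (ball 0 1 :: 'a set) = emeasure lborel A * emeasure M (ball 0 1)"
proof -
  interpret M: sigma_finite_measure M by fact
  interpret pair_sigma_finite M "lborel :: 'a measure" ..
  note [measurable_cong] = sets and [measurable] = A
  have space: "space M = UNIV" using sets_eq_imp_space_eq[OF sets] by simp
  let ?C = "ball (0::'a) 1"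
  have [measurable]: "?C \<in> sets borel" by simp
  have plus: "(+) a \<in> borel \<rightarrow>\<^sub>M borel" for a :: 'a by measurable
  have lb: "(\<integral>\<^sup>+y. f (a + y) \<partial>lborel) = (\<integral>\<^sup>+y. f y \<partial>lborel)" if "f \<in> borel_measurable borel"
    for f :: "'a \<Rightarrow> ennreal" and a
    using that by (subst (2) lborel_distr_plus[of a, symmetric]) (simp add: nn_integral_distr)
  have "emeasure M A * emeasure lborel ?C = (\<integral>\<^sup>+y. emeasure M A * indicator ?C y \<partial>lborel)"
    by (subst nn_integral_cmult) (auto intro!: borel_measurable_indicator)
  also have "\<dots> = (\<integral>\<^sup>+y. (\<integral>\<^sup>+x. indicator A (x + y) * indicator ?C y \<partial>M) \<partial>lborel)"
  proof (intro nn_integral_cong)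
    fix y :: 'a
    have "(\<integral>\<^sup>+x. indicator A (x + y) * indicator ?C y \<partial>M) = (\<integral>\<^sup>+x. indicator ((+) y -` A) x * indicator ?C y \<partial>M)"
      by (intro nn_integral_cong) (simp add: indicator_def add.commute)
    also have "\<dots> = emeasure M ((+) y -` A) * indicator ?C y"
      using measurable_sets_borel[OF plus A, of y] by (simp add: nn_integral_multc sets)
    finally show "emeasure M A * indicator ?C y = (\<integral>\<^sup>+x. indicator A (x + y) * indicator ?C y \<partial>M)"
      by (simp add: inv[OF A])
  qed
  also have "\<dots> = (\<integral>\<^sup>+x. (\<integral>\<^sup>+y. indicator A (x + y) * indicator ?C y \<partial>lborel) \<partial>M)"
    by (rule Fubini') measurable
  also have "\<dots> = (\<integral>\<^sup>+x. (\<integral>\<^sup>+y. indicator A y * indicator ?C (y - x) \<partial>lborel) \<partial>M)"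
  proof (rule nn_integral_cong)
    fix x
    have "(\<lambda>y. indicator A y * indicator ?C (y - x) :: ennreal) \<in> borel_measurable borel" by measurable
    from lb[OF this, of x]
    show "(\<integral>\<^sup>+y. indicator A (x + y) * indicator ?C y \<partial>lborel) = (\<integral>\<^sup>+y. indicator A y * indicator ?C (y - x) \<partial>lborel)"
      by simp
  qed
  also have "\<dots> = (\<integral>\<^sup>+y. (\<integral>\<^sup>+x. indicator A y * indicator ?C (y - x) \<partial>M) \<partial>lborel)"
    by (rule Fubini'[symmetric]) measurable
  also have "\<dots> = (\<integral>\<^sup>+y. emeasure M ?C * indicator A y \<partial>lborel)"
  proof (intro nn_integral_cong)
    fix y :: 'a
    have "(\<integral>\<^sup>+x. indicator A y * indicator ?C (y - x) \<partial>M) = (\<integral>\<^sup>+x. indicator A y * indicator ((+) (-y) -` ?C) x \<partial>M)"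
      by (intro nn_integral_cong) (auto simp: indicator_def dist_norm norm_minus_commute)
    also have "\<dots> = indicator A y * emeasure M ((+) (-y) -` ?C)"
      using measurable_sets_borel[OF plus, of ?C "- y"] by (subst nn_integral_cmult) (auto simp: sets)
    finally show "(\<integral>\<^sup>+x. indicator A y * indicator ?C (y - x) \<partial>M) = emeasure M ?C * indicator A y"
      by (subst (asm) inv) (auto simp: mult.commute)
  qed
  also have "\<dots> = emeasure lborel A * emeasure M ?C"
    by (subst nn_integral_cmult) (auto simp: mult.commute)
  finally show ?thesis .
qed

lemma unit_ball_vol_nonzero [simp]: "unit_ball_vol (real n) \<noteq> 0"
  using unit_ball_vol_pos[of "real n"] by (simp del: unit_ball_vol_pos)

lemma emeasure_unit_ball: "emeasure lborel (ball (0 :: 'a::euclidean_space) 1) = ennreal (unit_ball_vol DIM('a))"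
  by (simp add: emeasure_ball)

text \<open>The factor by which the preimage under \<open>f\<close> changes volumes, that is, \<open>1 / \<bar>det f\<bar>\<close>.\<close>

definition vimage_scale :: "('a::euclidean_space \<Rightarrow> 'a) \<Rightarrow> real" where
  "vimage_scale f = measure lborel (f -` ball 0 1) / unit_ball_vol DIM('a)"

lemma linear_borel_measurable: "linear (f :: 'a::euclidean_space \<Rightarrow> 'a) \<Longrightarrow> f \<in> borel \<rightarrow>\<^sub>M borel"
  by (intro borel_measurable_continuous_onI linear_continuous_on) (simp add: linear_conv_bounded_linear)

lemma bounded_linear_vimage:
  fixes f :: "'a::euclidean_space \<Rightarrow> 'a"
  assumes "linear f" "bij f" "bounded A"
  shows "bounded (f -` A)"
proof -
  obtain g where g: "linear g" "\<And>x. g (f x) = x"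
    using linear_injective_left_inverse[OF assms(1) bij_is_inj[OF assms(2)]] by (auto simp: fun_eq_iff)
  have "bounded (g ` A)"
    using assms(3) g(1) bounded_linear_image linear_conv_bounded_linear by blast
  moreover have "f -` A \<subseteq> g ` A"
  proof
    fix x assume "x \<in> f -` A"
    then show "x \<in> g ` A" using g(2)[of x] by (intro image_eqI[of _ _ "f x"]) auto
  qed
  ultimately show ?thesis by (rule bounded_subset)
qed

text \<open>The image of volume under f is translation invariant because f is onto, hence a multiple
  of volume, and the unit ball gives the factor. It is positive because the preimage of the ball
  contains a ball.\<close>

lemma emeasure_linear_vimage_aux:
  fixes f :: "'a::euclidean_space \<Rightarrow> 'a"
  assumes f: "linear f" "bij f" and A: "A \<in> sets borel"
  shows "emeasure lborel (f -` A) = ennreal (vimage_scale f) * emeasure lborel A"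
    and "0 < vimage_scale f"
proof -
  note [measurable] = linear_borel_measurable[OF f(1)]
  have bd: "emeasure lborel (f -` S) < \<infinity>" if "bounded S" for S
    using bounded_linear_vimage[OF f that] by (rule emeasure_bounded_finite)
  let ?M = "distr lborel borel f"
  have M: "emeasure ?M B = emeasure lborel (f -` B)" if "B \<in> sets borel" for B
    using that by (subst emeasure_distr) auto
  have "emeasure ?M A * emeasure lborel (ball 0 1 :: 'a set) = emeasure lborel A * emeasure ?M (ball 0 1)"
  proof (rule translation_invariant_proportional)
    show "sigma_finite_measure ?M"
    proof
      show "\<exists>B. countable B \<and> B \<subseteq> sets ?M \<and> \<Union> B = space ?M \<and> (\<forall>a\<in>B. emeasure ?M a \<noteq> \<infinity>)"
      proof (intro exI[of _ "range (\<lambda>n. ball 0 (real n))"] conjI)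
        show "\<Union> (range (\<lambda>n. ball (0::'a) (real n))) = space ?M"
          using reals_Archimedean2 by (auto simp: dist_norm)
        show "\<forall>a\<in>range (\<lambda>n. ball 0 (real n)). emeasure ?M a \<noteq> \<infinity>"
          using bd[OF bounded_ball] by (auto simp: M less_top[symmetric] simp del: emeasure_distr)
      qed auto
    qed
    fix a B assume B: "B \<in> sets (borel :: 'a measure)"
    obtain b where b: "f b = a" using bij_is_surj[OF f(2)] by (metis surjD)
    have "(+) a \<in> borel \<rightarrow>\<^sub>M borel" by measurable
    then have aB: "(+) a -` B \<in> sets borel" using B by (rule measurable_sets_borel)
    have "f -` ((+) a -` B) = (+) b -` (f -` B)"
      using b linear_add[OF f(1)] by auto
    moreover have "emeasure lborel ((+) b -` (f -` B)) = emeasure lborel (f -` B)"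
      using emeasure_distr[of "(+) b" lborel borel "f -` B"] lborel_distr_plus[of b]
        measurable_sets_borel[OF linear_borel_measurable[OF f(1)] B] by simp
    ultimately show "emeasure ?M ((+) a -` B) = emeasure ?M B"
      using B aB by (simp add: M)
  qed (use A in auto)
  then have eq: "emeasure lborel (f -` A) * ennreal (unit_ball_vol DIM('a)) = emeasure lborel A * emeasure lborel (f -` ball 0 1)"
    using A by (simp add: M emeasure_unit_ball)
  have fin: "emeasure lborel (f -` ball 0 1) = ennreal (measure lborel (f -` ball 0 1))"
    using bd[OF bounded_ball[of 0 1]] by (simp add: emeasure_eq_ennreal_measure less_top[symmetric])
  let ?v = "unit_ball_vol DIM('a)"
  have v: "0 < ?v" by simp
  have "emeasure lborel (f -` A) = emeasure lborel (f -` A) * (ennreal ?v * ennreal (1 / ?v))"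
    using v by (simp flip: ennreal_mult')
  also have "\<dots> = emeasure lborel A * (ennreal (measure lborel (f -` ball 0 1)) * ennreal (1 / ?v))"
    by (simp add: eq fin mult.assoc[symmetric])
  also have "\<dots> = ennreal (vimage_scale f) * emeasure lborel A"
    using v by (simp add: vimage_scale_def mult.commute flip: ennreal_mult')
  finally show "emeasure lborel (f -` A) = ennreal (vimage_scale f) * emeasure lborel A" .
  have "open (f -` ball 0 1)"
    using f(1) by (intro continuous_open_vimage) (auto simp: linear_conv_bounded_linear intro: linear_continuous_at)
  moreover have "0 \<in> f -` ball 0 1" using linear_0[OF f(1)] by simp
  ultimately obtain e where e: "0 < e" "ball 0 e \<subseteq> f -` ball 0 1" by (metis openE)
  have "emeasure lborel (ball (0::'a) e) \<le> emeasure lborel (f -` ball 0 1)"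
    using e(2) measurable_sets_borel[OF linear_borel_measurable[OF f(1)], of "ball 0 1"]
    by (intro emeasure_mono) auto
  moreover have "0 < emeasure lborel (ball (0::'a) e)"
    using e(1) unit_ball_vol_pos[of "DIM('a)"] by (simp add: emeasure_ball)
  ultimately have "emeasure lborel (f -` ball 0 1) \<noteq> 0" by auto
  then show "0 < vimage_scale f"
    using fin v by (auto simp: vimage_scale_def less_le measure_nonneg)
qed

lemmas emeasure_linear_vimage = emeasure_linear_vimage_aux(1)

lemma vimage_scale_pos: "linear f \<Longrightarrow> bij f \<Longrightarrow> 0 < vimage_scale (f :: 'a::euclidean_space \<Rightarrow> 'a)"
  by (rule emeasure_linear_vimage_aux(2)[where A = "{}"]) auto

lemma vimage_scale_compose:
  assumes "linear f" "bij f" "linear g" "bij g"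
  shows "vimage_scale (f \<circ> g) = vimage_scale f * vimage_scale (g :: 'a::euclidean_space \<Rightarrow> 'a)"
proof -
  have *: "linear (f \<circ> g)" "bij (f \<circ> g)"
    using assms by (auto intro: linear_compose bij_comp)
  have "f -` ball 0 1 \<in> sets borel"
    using measurable_sets_borel[OF linear_borel_measurable[OF assms(1)], of "ball 0 1"] by simp
  then have "emeasure lborel ((f \<circ> g) -` ball 0 1)
      = ennreal (vimage_scale g) * (ennreal (vimage_scale f) * emeasure lborel (ball (0::'a) 1))"
    unfolding vimage_comp[symmetric] using assms by (simp add: emeasure_linear_vimage)
  also have "emeasure lborel ((f \<circ> g) -` ball 0 1) = ennreal (vimage_scale (f \<circ> g)) * emeasure lborel (ball (0::'a) 1)"
    using * by (intro emeasure_linear_vimage) auto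
  finally show ?thesis
    using vimage_scale_pos[OF assms(1,2)] vimage_scale_pos[OF assms(3,4)] vimage_scale_pos[OF *]
      unit_ball_vol_pos[of "DIM('a)"]
    by (simp add: emeasure_unit_ball ennreal_mult'[symmetric] mult.commute less_imp_le)
qed

lemma vimage_scale_orthogonal:
  assumes "orthogonal_transformation (f :: 'a::euclidean_space \<Rightarrow> 'a)"
  shows "vimage_scale f = 1"
proof -
  have "f -` ball 0 1 = ball 0 1"
    using assms by (auto simp: orthogonal_transformation)
  then show ?thesis
    using unit_ball_vol_pos[of "DIM('a)"] by (simp add: vimage_scale_def measure_def emeasure_unit_ball)
qed

lemma bij_add_rank_one:
  fixes n w :: "'a::euclidean_space"
  assumes "1 + n \<bullet> w \<noteq> 0"
  shows "bij (\<lambda>x. x + (n \<bullet> x) *\<^sub>R w)" "linear (\<lambda>x. x + (n \<bullet> x) *\<^sub>R w)"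
proof -
  show lin: "linear (\<lambda>x. x + (n \<bullet> x) *\<^sub>R w)"
    by (intro linearI) (auto simp: inner_simps algebra_simps)
  have "x = 0" if "x + (n \<bullet> x) *\<^sub>R w = 0" for x
  proof -
    have "n \<bullet> (x + (n \<bullet> x) *\<^sub>R w) = (1 + n \<bullet> w) * (n \<bullet> x)" by (simp add: inner_simps algebra_simps)
    then have "(1 + n \<bullet> w) * (n \<bullet> x) = 0" unfolding that by simp
    with assms have nx: "n \<bullet> x = 0" by (metis mult_eq_0_iff)
    show "x = 0" using that unfolding nx by simp
  qed
  then have "inj (\<lambda>x. x + (n \<bullet> x) *\<^sub>R w)"
    unfolding linear_injective_0[OF lin] by blast
  then show "bij (\<lambda>x. x + (n \<bullet> x) *\<^sub>R w)"
    using linear_injective_imp_surjective[OF lin] by (simp add: bij_def)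
qed

lemma vimage_scale_conj:
  fixes f D g :: "'a::euclidean_space \<Rightarrow> 'a"
  assumes "linear f" "bij f" "linear D" "bij D" "linear g" "bij g" "\<And>x. f (D x) = D (g x)"
  shows "vimage_scale f = vimage_scale g"
proof -
  have "f \<circ> D = D \<circ> g" using assms(7) by auto
  then show ?thesis
    using vimage_scale_compose[OF assms(1,2,3,4)] vimage_scale_compose[OF assms(3,4,5,6)] vimage_scale_pos[OF assms(3,4)]
    by (simp add: mult.commute)
qed

text \<open>A shear is conjugate to its own square through the map \<open>?D\<close>, which doubles
  the component along n; so its positive factor equals its square.\<close>

lemma vimage_scale_shear:
  fixes n w :: "'a::euclidean_space"
  assumes "n \<bullet> w = 0" "n \<noteq> 0"
  shows "vimage_scale (\<lambda>x. x + (n \<bullet> x) *\<^sub>R w) = 1"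
proof -
  let ?g = "\<lambda>c x. x + (n \<bullet> x) *\<^sub>R (c *\<^sub>R w)"
  let ?D = "\<lambda>x. x + (n \<bullet> x) *\<^sub>R ((1 / (n \<bullet> n)) *\<^sub>R n)"
  have nn: "n \<bullet> n \<noteq> 0" using assms(2) by simp
  have g: "linear (?g c)" "bij (?g c)" for c
    using bij_add_rank_one[of n "c *\<^sub>R w"] assms(1) by (auto simp del: scaleR_scaleR)
  have D: "linear ?D" "bij ?D"
    using bij_add_rank_one[of n "(1 / (n \<bullet> n)) *\<^sub>R n"] nn by (auto simp del: scaleR_scaleR)
  have "vimage_scale (?g 1) = vimage_scale (?g 2)"
  proof (rule vimage_scale_conj[OF g D g])
    fix x
    show "?g 1 (?D x) = ?D (?g 2 x)"
      using nn assms(1) by (simp add: inner_simps algebra_simps inner_commute[of w n])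
  qed
  also have "\<dots> = vimage_scale (?g 1 \<circ> ?g 1)"
    by (rule arg_cong[where f = vimage_scale]) (auto simp: fun_eq_iff inner_simps assms(1) algebra_simps scaleR_2)
  also have "\<dots> = vimage_scale (?g 1) * vimage_scale (?g 1)"
    by (rule vimage_scale_compose[OF g g])
  finally show ?thesis using vimage_scale_pos[OF g, of 1] by simp
qed

lemma vimage_scale_axis:
  fixes e :: "'a::euclidean_space"
  assumes e: "e \<in> Basis" and s: "s \<noteq> 0"
  shows "vimage_scale (\<lambda>x. x + (e \<bullet> x) *\<^sub>R ((s - 1) *\<^sub>R e)) = 1 / \<bar>s\<bar>"
proof -
  let ?f = "\<lambda>x. x + (e \<bullet> x) *\<^sub>R ((s - 1) *\<^sub>R e)"
  define c where "c j = (if j = e then s else 1)" for j :: 'a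
  have T: "(\<Sum>j\<in>Basis. (c j * (x \<bullet> j)) *\<^sub>R j) = ?f x" for x
  proof -
    have "(\<Sum>j\<in>Basis. (c j * (x \<bullet> j)) *\<^sub>R j) = (\<Sum>j\<in>Basis. (x \<bullet> j) *\<^sub>R j + (if j = e then ((s - 1) * (x \<bullet> e)) *\<^sub>R e else 0))"
      by (intro sum.cong) (auto simp: c_def algebra_simps)
    also have "\<dots> = ?f x"
      using e by (simp add: sum.distrib euclidean_representation inner_commute[of e] mult.commute)
    finally show ?thesis .
  qed
  have f: "linear ?f" "bij ?f"
    using bij_add_rank_one[of e "(s - 1) *\<^sub>R e"] e s by (auto simp: inner_Basis simp del: scaleR_scaleR)
  note [measurable] = linear_borel_measurable[OF f(1)]
  have "(\<Prod>j\<in>(Basis::'a set). \<bar>c j\<bar>) = \<bar>s\<bar>"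
    using e by (simp add: c_def if_distrib[of abs] prod.delta cong: if_cong)
  moreover have "c j \<noteq> 0" for j using s by (simp add: c_def)
  ultimately have "lborel = density (distr lborel borel ?f) (\<lambda>_. ennreal \<bar>s\<bar>)"
    using lborel_affine_euclidean[of c 0] by (simp only: T add_0_left simp_thms)
  then have "emeasure lborel (ball (0::'a) 1) = emeasure (density (distr lborel borel ?f) (\<lambda>_. ennreal \<bar>s\<bar>)) (ball 0 1)"
    by simp
  also have "\<dots> = ennreal \<bar>s\<bar> * emeasure (distr lborel borel ?f) (ball 0 1)"
    by (subst emeasure_density) (auto simp: nn_integral_cmult simp del: scaleR_scaleR intro!: nn_integral_cmult_indicator)
  also have "emeasure (distr lborel borel ?f) (ball 0 1) = emeasure lborel (?f -` ball 0 1)"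
    by (subst emeasure_distr) auto
  also have "\<dots> = ennreal (vimage_scale ?f) * emeasure lborel (ball (0::'a) 1)"
    by (rule emeasure_linear_vimage[OF f]) simp
  finally have "unit_ball_vol DIM('a) = \<bar>s\<bar> * (vimage_scale ?f * unit_ball_vol DIM('a))"
    using vimage_scale_pos[OF f] by (simp add: emeasure_unit_ball flip: ennreal_mult')
  then show ?thesis using s by (simp add: field_simps)
qed

text \<open>This is det (I + w n^T) = 1 + n . w. For a unit vector n the map is a dilation by that
  number along n followed by a shear, and an orthogonal map moves n to a coordinate axis.\<close>

lemma vimage_scale_add_rank_one:
  fixes n w :: "real^'n"
  assumes s: "1 + n \<bullet> w \<noteq> 0"
  shows "vimage_scale (\<lambda>x. x + (n \<bullet> x) *\<^sub>R w) = 1 / \<bar>1 + n \<bullet> w\<bar>"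
proof -
  have unit: "vimage_scale (\<lambda>x. x + (n \<bullet> x) *\<^sub>R w) = 1 / \<bar>1 + n \<bullet> w\<bar>"
    if n: "norm n = 1" and s: "1 + n \<bullet> w \<noteq> 0" for n w :: "real^'n"
  proof -
    have nn: "n \<bullet> n = 1" using n by (simp add: norm_eq_1)
    define s where "s = 1 + n \<bullet> w"
    \<comment> \<open>The dilation comes first and multiplies n . x by s, so the vector of the shear
      has to be divided by s.\<close>
    define v where "v = (1 / s) *\<^sub>R (w - (n \<bullet> w) *\<^sub>R n)"
    have s0: "s \<noteq> 0" using s s_def by simp
    have nv: "n \<bullet> v = 0" by (simp add: v_def inner_simps nn)
    let ?g = "\<lambda>x. x + (n \<bullet> x) *\<^sub>R v" and ?h = "\<lambda>x. x + (n \<bullet> x) *\<^sub>R ((s - 1) *\<^sub>R n)"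
    have g: "linear ?g" "bij ?g" using bij_add_rank_one[of n v] nv by auto
    have h: "linear ?h" "bij ?h" using bij_add_rank_one[of n "(s - 1) *\<^sub>R n"] s0 nn by (auto simp del: scaleR_scaleR)
    have w: "w = (s - 1) *\<^sub>R n + s *\<^sub>R v" 
    proof -
      have "s *\<^sub>R v = w - (n \<bullet> w) *\<^sub>R n" using s0 by (simp add: v_def)
      then show ?thesis by (simp add: s_def)
    qed
    have "(\<lambda>x. x + (n \<bullet> x) *\<^sub>R w) = ?g \<circ> ?h"
    proof
      fix x
      have "n \<bullet> (x + (n \<bullet> x) *\<^sub>R ((s - 1) *\<^sub>R n)) = s * (n \<bullet> x)"
        by (simp add: inner_simps nn algebra_simps)
      then show "x + (n \<bullet> x) *\<^sub>R w = (?g \<circ> ?h) x"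
        by (subst w) (simp add: algebra_simps)
    qed
    moreover have "n \<noteq> 0" using n by auto
    ultimately have 1: "vimage_scale (\<lambda>x. x + (n \<bullet> x) *\<^sub>R w) = vimage_scale ?h"
      using vimage_scale_compose[OF g h] vimage_scale_shear[OF nv] by auto
    obtain e :: "real^'n" where e: "e \<in> Basis" using nonempty_Basis by blast
    obtain f :: "real^'n \<Rightarrow> real^'n" where f: "orthogonal_transformation f" "f e = n"
      using orthogonal_transformation_exists[of e n] n e by (auto)
    have fl: "linear f" "bij f" using f(1) orthogonal_transformation_bij orthogonal_transformation_linear by auto
    let ?k = "\<lambda>x. x + (e \<bullet> x) *\<^sub>R ((s - 1) *\<^sub>R e)"
    have k: "linear ?k" "bij ?k" using bij_add_rank_one[of e "(s - 1) *\<^sub>R e"] s0 e by (auto simp: inner_Basis simp del: scaleR_scaleR)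
    have "vimage_scale ?h = vimage_scale ?k"
    proof (rule vimage_scale_conj[OF h fl k])
      fix x
      have "n \<bullet> f x = e \<bullet> x" using f by (metis orthogonal_transformation_def)
      then show "?h (f x) = f (?k x)"
        by (simp add: linear_add[OF fl(1)] linear_scale[OF fl(1)] f(2))
    qed
    with 1 show ?thesis using vimage_scale_axis[OF e s0] s_def by simp
  qed
  show ?thesis
  proof (cases "n = 0")
    case True
    then show ?thesis using vimage_scale_orthogonal[OF orthogonal_transformation_id] by (simp add: id_def)
  next
    case False
    then show ?thesis
      using unit[of "n /\<^sub>R norm n" "norm n *\<^sub>R w"] s by (simp add: field_simps)
  qed
qed

section \<open>The invariant probability on the sphere\<close>

lemma emeasure_lborel_orthogonal_vimage:
  fixes f :: "real^'n \<Rightarrow> real^'n"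
  assumes "orthogonal_transformation f" "B \<in> sets borel"
  shows "emeasure lborel (f -` B) = emeasure lborel B"
  using emeasure_linear_vimage[OF orthogonal_transformation_linear[OF assms(1)] orthogonal_transformation_bij[OF assms(1)] assms(2)]
  by (simp add: vimage_scale_orthogonal[OF assms(1)])

text \<open>A measure on the Borel sets of the whole space, carried by the sphere, so that it can be
  compared with Hausdorff measure there. As \<open>inverse 0 = 0\<close>, the origin is sent to
  itself.\<close>

definition sphere_prob :: "(real^'n) measure" where
  "sphere_prob = distr (uniform_measure lborel (ball 0 1)) borel (\<lambda>x. x /\<^sub>R norm x)"

lemma sets_sphere_prob [simp, measurable_cong]: "sets sphere_prob = sets borel"
  by (simp add: sphere_prob_def)

lemma space_sphere_prob [simp]: "space sphere_prob = UNIV"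
  by (simp add: sphere_prob_def)

lemma prob_space_sphere_prob: "prob_space (sphere_prob :: (real^'n) measure)"
  unfolding sphere_prob_def
  by (intro prob_space.prob_space_distr prob_space_uniform_measure) (auto simp: emeasure_unit_ball)

lemma emeasure_sphere_prob:
  fixes A :: "(real^'n) set"
  assumes [measurable]: "A \<in> sets borel"
  shows "emeasure sphere_prob A =
    emeasure lborel {x \<in> ball 0 1. x /\<^sub>R norm x \<in> A} / emeasure lborel (ball (0 :: real^'n) 1)"
proof -
  have "(\<lambda>x. x /\<^sub>R norm x) \<in> uniform_measure lborel (ball 0 1) \<rightarrow>\<^sub>M (borel :: (real^'n) measure)"
    by measurable
  then have "emeasure sphere_prob A = emeasure (uniform_measure lborel (ball 0 1)) ((\<lambda>x. x /\<^sub>R norm x) -` A)"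
    unfolding sphere_prob_def by (subst emeasure_distr) auto
  also have "\<dots> = emeasure lborel (ball 0 1 \<inter> (\<lambda>x. x /\<^sub>R norm x) -` A) / emeasure lborel (ball (0 :: real^'n) 1)"
  proof (rule emeasure_uniform_measure)
    have "(\<lambda>x :: real^'n. x /\<^sub>R norm x) \<in> borel_measurable borel" by measurable
    from measurable_sets_borel[OF this assms]
    show "(\<lambda>x. x /\<^sub>R norm x) -` A \<in> sets lborel" by simp
  qed simp
  also have "ball 0 1 \<inter> (\<lambda>x. x /\<^sub>R norm x) -` A = {x \<in> ball 0 1. x /\<^sub>R norm x \<in> A}" by auto
  finally show ?thesis .
qed

lemma sphere_prob_null: "emeasure sphere_prob (- sphere (0 :: real^'n) 1) = 0"
proof -
  have "emeasure lborel {x \<in> ball 0 1. x /\<^sub>R norm x \<in> - sphere (0 :: real^'n) 1} \<le> emeasure lborel {0 :: real^'n}"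
    by (intro emeasure_mono) (auto simp: field_simps)
  then show ?thesis
    by (subst emeasure_sphere_prob) (auto simp: borel_open open_Compl)
qed

lemma AE_sphere_prob: "AE u in sphere_prob. u \<in> sphere (0 :: real^'n) 1"
  using sphere_prob_null by (auto intro!: AE_I[where N = "- sphere 0 1"] borel_open open_Compl)

lemma sphere_prob_orthogonal:
  fixes A :: "(real^'n) set" and f :: "real^'n \<Rightarrow> real^'n"
  assumes f: "orthogonal_transformation f" and A: "A \<in> sets borel"
  shows "emeasure sphere_prob (f -` A) = emeasure sphere_prob A"
proof -
  have lin: "linear f" and nf: "\<And>x. norm (f x) = norm x"
    using f by (auto simp: orthogonal_transformation)
  have fA: "f -` A \<in> sets borel"
    using measurable_sets_borel[OF _ A, of f] lin
    by (auto intro!: borel_measurable_continuous_onI linear_continuous_on simp: linear_conv_bounded_linear)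
  have "{x \<in> ball 0 1. x /\<^sub>R norm x \<in> f -` A} = f -` {x \<in> ball 0 1. x /\<^sub>R norm x \<in> A}"
    by (auto simp: nf linear_scale[OF lin])
  moreover have "{x \<in> ball 0 1. x /\<^sub>R norm x \<in> A} \<in> sets borel"
  proof -
    note [measurable] = A
    show ?thesis by measurable
  qed
  ultimately show ?thesis
    by (simp only: emeasure_sphere_prob[OF A] emeasure_sphere_prob[OF fA] emeasure_lborel_orthogonal_vimage[OF f])
qed

lemma orthogonal_vimage_ball:
  assumes f: "orthogonal_transformation f"
  shows "f -` ball (f x) r = ball x r"
  using f by (auto simp: dist_norm orthogonal_transformation linear_diff[symmetric])

text \<open>In dimension at least two a map of determinant one, and not merely an orthogonal one,
  carries x to y; it takes balls to balls.\<close>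

lemma orthogonal_vimage_ball_emeasure:
  fixes \<mu> :: "(real^'n) measure"
  assumes "CARD('n) \<ge> 2" "norm x = norm y"
    and "\<And>Q A. rotation_matrix Q \<Longrightarrow> A \<in> sets borel \<Longrightarrow> emeasure \<mu> ((*v) Q -` A) = emeasure \<mu> A"
  shows "emeasure \<mu> (ball x r) = emeasure \<mu> (ball y r)"
proof -
  obtain f :: "real^'n \<Rightarrow> real^'n" where f: "orthogonal_transformation f" "det (matrix f) = 1" "f x = y"
    using rotation_exists[OF assms(1,2)] .
  have Q: "rotation_matrix (matrix f)"
    using f by (simp add: rotation_matrix_def orthogonal_transformation_matrix)
  have "(*v) (matrix f) = f"
    using f(1) by (auto simp: orthogonal_transformation matrix_works)
  then have "emeasure \<mu> (ball y r) = emeasure \<mu> (f -` ball (f x) r)"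
    using assms(3)[OF Q, of "ball y r"] f(3) by simp
  then show ?thesis using orthogonal_vimage_ball[OF f(1)] by simp
qed

lemma rotation_matrix_orthogonal: "rotation_matrix (Q :: real^'n^'n) \<Longrightarrow> orthogonal_transformation ((*v) Q)"
  by (simp add: rotation_matrix_def orthogonal_transformation_matrix)

lemma rotation_invariant_eq_sphere_prob:
  fixes \<mu> :: "(real^'n) measure"
  assumes card: "CARD('n) \<ge> 2" and \<mu>: "prob_space \<mu>" "sets \<mu> = sets borel" "emeasure \<mu> (- sphere 0 1) = 0"
    and inv: "\<And>Q A. rotation_matrix Q \<Longrightarrow> A \<in> sets borel \<Longrightarrow> emeasure \<mu> ((*v) Q -` A) = emeasure \<mu> A"
  shows "\<mu> = sphere_prob"
proof -
  have "uniform_pair \<mu> sphere_prob (sphere 0 1)"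
  proof (rule uniform_pair.intro)
    show "emeasure \<mu> (ball x r) = emeasure \<mu> (ball y r)" if "x \<in> sphere 0 1" "y \<in> sphere 0 1" for x y r
      using that by (intro orthogonal_vimage_ball_emeasure[OF card _ inv]) simp_all
    show "emeasure sphere_prob (ball x r) = emeasure sphere_prob (ball y r)"
      if "x \<in> sphere 0 1" "y \<in> sphere 0 1" for x y :: "real^'n" and r
      by (rule orthogonal_vimage_ball_emeasure[OF card])
        (use that in \<open>simp_all add: sphere_prob_orthogonal rotation_matrix_orthogonal\<close>)
  qed (fact \<mu> prob_space_sphere_prob sphere_prob_null sets_sphere_prob compact_sphere)+
  then show ?thesis by (rule uniform_pair.unique)
qed

text \<open>The space of \<omega> is the sphere; the identity map transports \<omega> to the Borel
  sets of the whole space, where \<open>sphere_prob\<close> lives.\<close>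

lemma rotation_invariant_prob_eq:
  fixes \<omega> :: "(real^'n) measure"
  assumes card: "CARD('n) \<ge> 2" and \<omega>: "rotation_invariant_prob \<omega>"
  shows "distr \<omega> borel (\<lambda>x. x) = sphere_prob"
proof (rule rotation_invariant_eq_sphere_prob[OF card])
  have sets: "sets \<omega> = sets (restrict_space borel (sphere 0 1))" and prob: "prob_space \<omega>"
    and inv: "\<And>Q. rotation_matrix Q \<Longrightarrow> distr \<omega> \<omega> ((*v) Q) = \<omega>"
    using \<omega> by (auto simp: rotation_invariant_prob_def)
  have space: "space \<omega> = sphere 0 1"
    using sets_eq_imp_space_eq[OF sets] by (simp add: space_restrict_space)
  have id: "(\<lambda>x. x) \<in> \<omega> \<rightarrow>\<^sub>M borel"
    by (simp add: measurable_cong_sets[OF sets refl] measurable_restrict_space1)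
  have emb: "emeasure (distr \<omega> borel (\<lambda>x. x)) A = emeasure \<omega> (A \<inter> sphere 0 1)" if "A \<in> sets borel" for A
    using that by (simp add: emeasure_distr[OF id] space vimage_def Int_def)
  show "prob_space (distr \<omega> borel (\<lambda>x. x))"
    by (rule prob_space.prob_space_distr[OF prob id])
  show "emeasure (distr \<omega> borel (\<lambda>x. x)) (- sphere 0 1) = 0"
    by (subst emb) (auto simp: borel_open open_Compl)
  fix Q :: "real^'n^'n" and A :: "(real^'n) set"
  assume Q: "rotation_matrix Q" and A: "A \<in> sets borel"
  have nQ: "norm (Q *v x) = norm x" for x
    using rotation_matrix_orthogonal[OF Q] by (auto simp: orthogonal_transformation)
  have Qm: "(*v) Q \<in> borel \<rightarrow>\<^sub>M borel"
    by (intro borel_measurable_continuous_onI matrix_vector_mult_linear_continuous_on)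
  have A': "A \<inter> sphere 0 1 \<in> sets \<omega>"
    using A by (simp add: sets sets_restrict_space_iff Int_commute)
  have "(*v) Q \<in> \<omega> \<rightarrow>\<^sub>M \<omega>"
    unfolding measurable_cong_sets[OF sets sets]
    using Qm by (intro measurable_restrict_space3) (auto simp: nQ)
  then have "emeasure \<omega> (A \<inter> sphere 0 1) = emeasure \<omega> ((*v) Q -` (A \<inter> sphere 0 1) \<inter> space \<omega>)"
    using emeasure_distr[of "(*v) Q" \<omega> \<omega> "A \<inter> sphere 0 1"] A' inv[OF Q] by simp
  also have "(*v) Q -` (A \<inter> sphere 0 1) \<inter> space \<omega> = (*v) Q -` A \<inter> sphere 0 1"
    by (auto simp: space nQ)
  finally show "emeasure (distr \<omega> borel (\<lambda>x. x)) ((*v) Q -` A) = emeasure (distr \<omega> borel (\<lambda>x. x)) A"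
    using A measurable_sets_borel[OF Qm A] by (simp add: emb)
qed (simp_all)

section \<open>Hausdorff measure of the unit sphere\<close>

lemma emeasure_hausdorff_isometry:
  fixes f :: "'a::metric_space \<Rightarrow> 'b::metric_space"
  assumes "\<And>x y. x \<in> A \<Longrightarrow> y \<in> A \<Longrightarrow> dist (f x) (f y) = dist x y"
  shows "hausdorff_outer k (f ` A) = hausdorff_outer k A"
proof (rule antisym)
  show "hausdorff_outer k (f ` A) \<le> hausdorff_outer k A"
    using hausdorff_outer_lipschitz[of 1 A f k] assms by simp
  have inj: "inj_on f A" using assms by (intro inj_onI) (metis dist_eq_0_iff)
  have "dist (inv_into A f x) (inv_into A f y) \<le> 1 * dist x y" if "x \<in> f ` A" "y \<in> f ` A" for x y
    using that assms inj by (auto simp: inv_into_f_f)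
  then have "hausdorff_outer k (inv_into A f ` (f ` A)) \<le> ennreal (1 ^ k) * hausdorff_outer k (f ` A)"
    by (intro hausdorff_outer_lipschitz) auto
  then show "hausdorff_outer k A \<le> hausdorff_outer k (f ` A)"
    using inv_into_image_cancel[OF inj order.refl] by simp
qed

text \<open>A point y over the cap is within d of \<open>norm y *\<^sub>R x\<close>, and the points
  j / N on the segment from 0 to x have spacing 1 / N \<le> d; hence the radius 2 * d.\<close>

lemma sphere_cap_cover:
  fixes x :: "real^'n"
  assumes x: "norm x = 1" and d: "0 < d"
  defines "N \<equiv> nat \<lceil>1 / d\<rceil>"
  shows "{y \<in> ball 0 1. y /\<^sub>R norm y \<in> cball x d} \<subseteq> (\<Union>j\<le>N. cball ((real j / real N) *\<^sub>R x) (2 * d))"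
proof
  have N: "1 / d \<le> real N" unfolding N_def by (rule real_nat_ceiling_ge)
  have N0: "0 < real N" using N d by (smt (verit) divide_pos_pos)
  have Nd: "1 / real N \<le> d" using N N0 d by (simp add: field_simps)
  fix y assume y: "y \<in> {y \<in> ball 0 1. y /\<^sub>R norm y \<in> cball x d}"
  define j where "j = nat \<lfloor>norm y * real N\<rfloor>"
  have j: "real j \<le> norm y * real N" "norm y * real N < real j + 1"
    using N0 by (auto simp: j_def)
  have "norm y * real N \<le> 1 * real N" using y by (intro mult_right_mono) auto
  then have "j \<le> N" using j(1) by linarith
  have "norm y = (norm y * real N) / real N" using N0 by simp
  then have *: "\<bar>norm y - real j / real N\<bar> \<le> 1 / real N"
    using j N0 by (smt (verit) diff_divide_distrib divide_right_mono divide_nonneg_pos)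
  have "dist ((real j / real N) *\<^sub>R x) y \<le> 2 * d"
  proof (cases "y = 0")
    case True
    then show ?thesis using d by (simp add: j_def)
  next
    case False
    have "y = norm y *\<^sub>R (y /\<^sub>R norm y)" using False by simp
    then have "y - (real j / real N) *\<^sub>R x = norm y *\<^sub>R (y /\<^sub>R norm y - x) + (norm y - real j / real N) *\<^sub>R x"
      by (simp add: algebra_simps)
    then have "norm (y - (real j / real N) *\<^sub>R x) \<le> norm y * norm (y /\<^sub>R norm y - x) + \<bar>norm y - real j / real N\<bar>"
      using norm_triangle_ineq[of "norm y *\<^sub>R (y /\<^sub>R norm y - x)" "(norm y - real j / real N) *\<^sub>R x"] x by simp
    also have "norm y * norm (y /\<^sub>R norm y - x) \<le> 1 * d"
      using y by (intro mult_mono) (auto simp: dist_norm norm_minus_commute)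
    finally show ?thesis using * Nd by (simp add: dist_norm norm_minus_commute)
  qed
  then show "y \<in> (\<Union>j\<le>N. cball ((real j / real N) *\<^sub>R x) (2 * d))"
    using \<open>j \<le> N\<close> by auto
qed

text \<open>At most 3 / d balls of volume proportional to (2 d)^m cover the cone over the cap, which
  leaves the power m - 1 of d.\<close>

lemma sphere_cap_le_pos:
  fixes x :: "real^'n"
  assumes x: "norm x = 1" and d: "0 < d" "d \<le> 1"
  shows "emeasure sphere_prob (cball x d) \<le> ennreal (3 * 2 ^ CARD('n) * d ^ (CARD('n) - 1))"
proof -
  let ?m = "CARD('n)" and ?V = "unit_ball_vol (real CARD('n))"
  define N where "N = nat \<lceil>1 / d\<rceil>"
  have m: "?m = Suc (?m - 1)" using zero_less_card_finite[where 'a = 'n] by simp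
  have N1: "real N < 1 / d + 1"
    unfolding N_def using d(1) by (simp add: of_nat_nat) linarith
  have "emeasure lborel {y \<in> ball 0 1. y /\<^sub>R norm y \<in> cball x d}
      \<le> emeasure lborel (\<Union>j\<le>N. cball ((real j / real N) *\<^sub>R x) (2 * d))"
    using sphere_cap_cover[OF x d(1)] unfolding N_def by (intro emeasure_mono) auto
  also have "\<dots> \<le> (\<Sum>j\<le>N. emeasure lborel (cball ((real j / real N) *\<^sub>R x) (2 * d)))"
    by (intro emeasure_subadditive_finite) auto
  also have "\<dots> = (\<Sum>j\<le>N. ennreal (?V * (2 * d) ^ ?m))"
    using d by (intro sum.cong refl) (simp add: emeasure_cball)
  also have "\<dots> = ennreal ((real N + 1) * (?V * (2 * d) ^ ?m))"
    using d by (simp add: ennreal_of_nat_eq_real_of_nat flip: ennreal_mult' ennreal_plus)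
  finally have "emeasure sphere_prob (cball x d) \<le> ennreal ((real N + 1) * (?V * (2 * d) ^ ?m)) / ennreal ?V"
    by (simp add: emeasure_sphere_prob emeasure_unit_ball divide_right_mono_ennreal)
  also have "\<dots> = ennreal ((real N + 1) * (2 * d) ^ ?m)"
    using d by (subst divide_ennreal) (auto simp: unit_ball_vol_pos)
  also have "(real N + 1) * (2 * d) ^ ?m \<le> (3 / d) * (2 * d) ^ ?m"
  proof (rule mult_right_mono)
    have "1 \<le> 1 / d" using d by simp
    then show "real N + 1 \<le> 3 / d" using N1 by (simp add: field_simps) 
  qed (use d in simp)
  also have "(3 / d) * (2 * d) ^ ?m = 3 * 2 ^ ?m * d ^ (?m - 1)"
    using d by (simp add: power_mult_distrib power_eq_if[of d "?m"])
  finally show ?thesis by (simp add: ennreal_leI)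
qed

lemma sphere_cap_le:
  fixes x :: "real^'n"
  assumes card: "CARD('n) \<ge> 2" and x: "norm x = 1" and d: "0 \<le> d" "d \<le> 1"
  shows "emeasure sphere_prob (cball x d) \<le> ennreal (3 * 2 ^ CARD('n) * d ^ (CARD('n) - 1))"
proof (cases "d = 0")
  case True
  let ?f = "\<lambda>n. ennreal (3 * 2 ^ CARD('n) * (1 / real (Suc n)) ^ (CARD('n) - 1))"
  have "(\<lambda>n. 1 / real (Suc n)) \<longlonglongrightarrow> 0" by real_asymp
  then have "?f \<longlonglongrightarrow> ennreal (3 * 2 ^ CARD('n) * 0 ^ (CARD('n) - 1))"
    by (intro tendsto_ennrealI tendsto_intros)
  moreover have "emeasure sphere_prob (cball x d) \<le> ?f n" for n
  proof -
    have "emeasure sphere_prob (cball x d) \<le> emeasure sphere_prob (cball x (1 / real (Suc n)))"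
      using True by (intro emeasure_mono) auto
    also have "\<dots> \<le> ?f n" using x by (intro sphere_cap_le_pos) auto
    finally show ?thesis .
  qed
  ultimately have "emeasure sphere_prob (cball x d) \<le> ennreal (3 * 2 ^ CARD('n) * 0 ^ (CARD('n) - 1))"
    by (intro LIMSEQ_le_const) blast+
  then show ?thesis using True by simp
qed (use sphere_cap_le_pos[OF x] d in auto)

text \<open>The mass distribution principle: the part of the sphere in a set of diameter d has
  \<open>sphere_prob\<close> at most a constant times d^(m-1), so the cost of every cover of the
  sphere is bounded below.\<close>

lemma hausdorff_sphere_pos:
  assumes card: "CARD('n) \<ge> 2"
  shows "0 < hausdorff_outer (CARD('n) - 1) (sphere (0 :: real^'n) 1)"
proof -
  let ?k = "CARD('n) - 1" and ?S = "sphere (0 :: real^'n) 1"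
  let ?C = "3 * 2 ^ CARD('n) :: real" and ?c = "unit_ball_vol (real (CARD('n) - 1)) / 2 ^ (CARD('n) - 1)"
  have c: "0 < ?c" using unit_ball_vol_pos[of "real ?k"] by simp
  have cancel: "C * t = (C / c) * (c * t)" "(c / C) * (C / c) = (if C = 0 then 0 else 1)" if "0 < c" for C c t :: real
    using that by simp_all
  have "ennreal (?c / ?C) \<le> hausdorff_premeasure ?k 1 ?S"
    unfolding hausdorff_premeasure_def
  proof (rule INF_greatest)
    fix U :: "nat \<Rightarrow> (real^'n) set"
    assume "U \<in> {U. ?S \<subseteq> (\<Union>i. U i) \<and> (\<forall>i. bounded (U i) \<and> diameter (U i) \<le> 1)}"
    then have U: "?S \<subseteq> (\<Union>i. U i)" "\<And>i. bounded (U i)" "\<And>i. diameter (U i) \<le> 1" by auto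
    \<comment> \<open>The cap bound concerns balls centred on the sphere, so a covering set that
      meets the sphere is enlarged to such a ball, with its diameter as radius. Closed balls also
      serve the case of diameter 0.\<close>
    define W where "W i = (if U i \<inter> ?S = {} then {} else cball (SOME x. x \<in> U i \<inter> ?S) (diameter (U i)))" for i
    have x: "(SOME x. x \<in> U i \<inter> ?S) \<in> U i \<inter> ?S" if "U i \<inter> ?S \<noteq> {}" for i
      using that someI_ex[of "\<lambda>x. x \<in> U i \<inter> ?S"] by blast
    have cov: "?S \<subseteq> (\<Union>i. W i)"
    proof
      fix y assume y: "y \<in> ?S"
      then obtain i where i: "y \<in> U i" using U(1) by blast
      then have "U i \<inter> ?S \<noteq> {}" using y by blast
      then have "y \<in> W i"
        using diameter_bounded_bound[OF U(2)[of i] _ i, of "SOME x. x \<in> U i \<inter> ?S"] x[of i] by (simp add: W_def)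
      then show "y \<in> (\<Union>i. W i)" by blast
    qed
    have "1 = emeasure sphere_prob (UNIV :: (real^'n) set)"
      using prob_space.emeasure_space_1[OF prob_space_sphere_prob] by simp
    also have "\<dots> \<le> emeasure sphere_prob (- ?S \<union> ?S)" by (intro emeasure_mono) auto
    also have "\<dots> \<le> emeasure sphere_prob (- ?S) + emeasure sphere_prob ?S"
      by (intro emeasure_subadditive) (auto intro: borel_open)
    also have "\<dots> = emeasure sphere_prob ?S" using sphere_prob_null[where 'n = 'n] by simp
    also have "\<dots> \<le> emeasure sphere_prob (\<Union>i. W i)"
      using cov by (intro emeasure_mono) (auto simp: W_def)
    also have "\<dots> \<le> (\<Sum>i. emeasure sphere_prob (W i))"
      by (intro emeasure_subadditive_countably) (auto simp: W_def)
    also have "\<dots> \<le> (\<Sum>i. ennreal (?C / ?c) * hcost ?k (U i))"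
    proof (intro suminf_le)
      fix i
      show "emeasure sphere_prob (W i) \<le> ennreal (?C / ?c) * hcost ?k (U i)"
      proof (cases "U i \<inter> ?S = {}")
        case False
        then have "emeasure sphere_prob (W i) \<le> ennreal (?C * diameter (U i) ^ ?k)"
          using sphere_cap_le[OF card _ diameter_ge_0[OF U(2)[of i]] U(3)[of i], of "SOME x. x \<in> U i \<inter> ?S"] x[OF False]
          by (simp add: W_def)
        also have "?C * diameter (U i) ^ ?k = (?C / ?c) * (?c * diameter (U i) ^ ?k)"
          by (rule cancel(1)[OF c])
        finally show ?thesis
          using False c by (auto simp: ennreal_mult'[symmetric])
      qed (simp add: W_def)
    qed auto
    also have "\<dots> = ennreal (?C / ?c) * (\<Sum>i. hcost ?k (U i))" by simp
    finally have "ennreal (?c / ?C) * 1 \<le> ennreal (?c / ?C) * (ennreal (?C / ?c) * (\<Sum>i. hcost ?k (U i)))"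
      by (rule mult_left_mono) simp
    also have "\<dots> = ennreal ((?c / ?C) * (?C / ?c)) * (\<Sum>i. hcost ?k (U i))"
      using c by (subst ennreal_mult') (auto simp: mult.assoc)
    also have "(?c / ?C) * (?C / ?c) = 1" by (subst cancel(2)[OF c]) simp
    finally show "ennreal (?c / ?C) \<le> (\<Sum>i. if U i = {} then 0
             else ennreal (unit_ball_vol (real (CARD('n) - 1)) / 2 ^ (CARD('n) - 1) * diameter (U i) ^ (CARD('n) - 1)))"
      by simp
  qed
  also have "\<dots> \<le> hausdorff_outer ?k ?S" by (rule hausdorff_premeasure_le_outer) simp
  finally show ?thesis using c by (simp add: less_le_trans[rotated])
qed

lemma hausdorff_premeasure_finite_cover:
  assumes F: "finite F" and "A \<subseteq> (\<Union>x\<in>F. W x)" "\<And>x. x \<in> F \<Longrightarrow> bounded (W x)"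
    "\<And>x. x \<in> F \<Longrightarrow> diameter (W x) \<le> \<delta>" "0 \<le> \<delta>"
  shows "hausdorff_premeasure k \<delta> A \<le> (\<Sum>x\<in>F. hcost k (W x))"
proof -
  obtain h where h: "bij_betw h {0..<card F} F" using ex_bij_betw_nat_finite[OF F] by blast
  define U where "U i = (if i < card F then W (h i) else {})" for i
  have hF: "h i \<in> F" if "i < card F" for i using h that by (auto simp: bij_betw_def)
  have "hausdorff_premeasure k \<delta> A \<le> (\<Sum>i. hcost k (U i))"
  proof (rule hausdorff_premeasure_le)
    show "A \<subseteq> (\<Union>i. U i)"
    proof
      fix y assume "y \<in> A"
      then obtain x where "x \<in> F" "y \<in> W x" using assms(2) by blast
      then obtain i where "i < card F" "h i = x"
        using bij_betw_imp_surj_on[OF h] by (metis atLeastLessThan_iff imageE)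
      then show "y \<in> (\<Union>i. U i)" using \<open>y \<in> W x\<close> by (auto simp: U_def)
    qed
  qed (use assms hF in \<open>auto simp: U_def\<close>)
  also have "(\<Sum>i. hcost k (U i)) = (\<Sum>i\<in>{0..<card F}. hcost k (U i))"
    by (rule suminf_finite) (auto simp: U_def)
  also have "\<dots> = (\<Sum>i\<in>{0..<card F}. hcost k (W (h i)))"
    by (rule sum.cong) (auto simp: U_def)
  also have "\<dots> = (\<Sum>x\<in>F. hcost k (W x))" by (rule sum.reindex_bij_betw[OF h])
  finally show ?thesis .
qed

text \<open>The balls of radius \<delta> / 2 around the points are disjoint and lie in a shell of
  thickness \<delta>, whose volume is at most linear in \<delta> by Bernoulli's inequality.\<close>

lemma separated_sphere_card:
  fixes F :: "(real^'n) set"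
  assumes F: "finite F" "F \<subseteq> sphere 0 1" and \<delta>: "0 < \<delta>" "\<delta> \<le> 1"
    and sep: "\<And>x y. x \<in> F \<Longrightarrow> y \<in> F \<Longrightarrow> x \<noteq> y \<Longrightarrow> \<delta> \<le> dist x y"
  shows "real (card F) * (\<delta> / 2) ^ CARD('n) \<le> 2 ^ CARD('n) * real CARD('n) * \<delta>"
proof -
  let ?m = "CARD('n)" and ?V = "unit_ball_vol (real CARD('n))" and ?s = "\<delta> / 2"
  have V: "0 < ?V" by simp
  have "ennreal (real (card F) * (?V * ?s ^ ?m)) = (\<Sum>x\<in>F. emeasure lborel (ball x ?s))"
    using \<delta> by (simp add: emeasure_ball ennreal_of_nat_eq_real_of_nat ennreal_mult')
  also have "\<dots> = emeasure lborel (\<Union>x\<in>F. ball x ?s)"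
  proof (rule sum_emeasure)
    show "disjoint_family_on (\<lambda>x. ball x ?s) F"
      unfolding disjoint_family_on_def
    proof (intro ballI impI)
      fix x y assume "x \<in> F" "y \<in> F" "x \<noteq> y"
      then have "\<delta> \<le> dist x y" by (rule sep)
      then show "ball x ?s \<inter> ball y ?s = {}"
        using dist_triangle_half_l[of x _ \<delta> y] by (force simp: dist_commute)
    qed
  qed (use F in auto)
  also have "\<dots> \<le> emeasure lborel (ball 0 (1 + ?s) - ball (0 :: real^'n) (1 - ?s))"
  proof (intro emeasure_mono subsetI)
    fix y assume "y \<in> (\<Union>x\<in>F. ball x ?s)"
    then obtain x where x: "x \<in> F" "dist x y < ?s" by auto
    then have "norm x = 1" using F by auto
    then show "y \<in> ball 0 (1 + ?s) - ball 0 (1 - ?s)"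
      using x(2) norm_triangle_ineq3[of x y] by (auto simp: dist_norm)
  qed auto
  also have "\<dots> = emeasure lborel (ball (0 :: real^'n) (1 + ?s)) - emeasure lborel (ball (0 :: real^'n) (1 - ?s))"
    using \<delta> by (intro emeasure_Diff) (auto simp: emeasure_ball)
  also have "\<dots> = ennreal (?V * (1 + ?s) ^ ?m - ?V * (1 - ?s) ^ ?m)"
    using \<delta> by (simp add: emeasure_ball ennreal_minus)
  finally have "real (card F) * (?V * ?s ^ ?m) \<le> ?V * (1 + ?s) ^ ?m - ?V * (1 - ?s) ^ ?m \<or> real (card F) * (?V * ?s ^ ?m) \<le> 0"
    by (smt (verit) ennreal_le_iff2)
  moreover have "(1 - ?s) ^ ?m \<le> (1 + ?s) ^ ?m" using \<delta> by (intro power_mono) auto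
  then have "0 \<le> ?V * (1 + ?s) ^ ?m - ?V * (1 - ?s) ^ ?m" by (simp add: mult_left_mono)
  ultimately have "real (card F) * (?V * ?s ^ ?m) \<le> ?V * (1 + ?s) ^ ?m - ?V * (1 - ?s) ^ ?m"
    by linarith
  then have "?V * (real (card F) * ?s ^ ?m) \<le> ?V * ((1 + ?s) ^ ?m - (1 - ?s) ^ ?m)"
    by (simp only: right_diff_distrib mult.left_commute)
  then have "real (card F) * ?s ^ ?m \<le> (1 + ?s) ^ ?m - (1 - ?s) ^ ?m"
    using V by (simp only: mult_le_cancel_left_pos)
  also have "\<dots> \<le> (1 + ?s) ^ ?m * (real ?m * \<delta>)"
  proof -
    have "1 + real ?m * (- (\<delta> / (1 + ?s))) \<le> (1 + (- (\<delta> / (1 + ?s)))) ^ ?m"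
      using \<delta> by (intro Bernoulli_inequality) (simp add: field_simps)
    also have "1 + (- (\<delta> / (1 + ?s))) = (1 - ?s) / (1 + ?s)" using \<delta> by (simp add: field_simps)
    finally have "1 - real ?m * (\<delta> / (1 + ?s)) \<le> (1 - ?s) ^ ?m / (1 + ?s) ^ ?m" by (simp add: power_divide)
    moreover have "real ?m * (\<delta> / (1 + ?s)) \<le> real ?m * \<delta>"
      using \<delta> by (intro mult_left_mono) (auto simp: field_simps)
    ultimately have "1 - real ?m * \<delta> \<le> (1 - ?s) ^ ?m / (1 + ?s) ^ ?m" by linarith
    then have "(1 - real ?m * \<delta>) * (1 + ?s) ^ ?m \<le> (1 - ?s) ^ ?m"
      using \<delta> by (simp add: pos_le_divide_eq)
    then show ?thesis by (simp add: algebra_simps)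
  qed
  also have "\<dots> \<le> 2 ^ ?m * (real ?m * \<delta>)"
    using \<delta> by (intro mult_right_mono power_mono) auto
  finally show ?thesis by (simp add: mult.assoc)
qed

text \<open>A \<delta>-separated subset of greatest cardinality is a \<delta>-net. It has at most a
  constant times \<delta>^(1-m) points, so the balls around them are covers of bounded cost.\<close>

lemma hausdorff_sphere_finite:
  assumes card: "CARD('n) \<ge> 2"
  shows "hausdorff_outer (CARD('n) - 1) (sphere (0 :: real^'n) 1) < \<infinity>"
proof -
  let ?k = "CARD('n) - 1" and ?S = "sphere (0 :: real^'n) 1" and ?m = "CARD('n)"
  let ?c = "unit_ball_vol (real (CARD('n) - 1)) / 2 ^ (CARD('n) - 1)"
  define C where "C = ?c * (2 ^ ?k * (4 ^ ?m * real ?m))"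
  have m: "?m = Suc ?k" using card by simp
  have "hausdorff_premeasure ?k (2 * \<delta>) ?S \<le> ennreal C" if \<delta>: "0 < \<delta>" "\<delta> \<le> 1" for \<delta>
  proof -
    let ?P = "\<lambda>F. finite F \<and> F \<subseteq> ?S \<and> (\<forall>x\<in>F. \<forall>y\<in>F. x \<noteq> y \<longrightarrow> \<delta> \<le> dist x y)"
    have bound: "real (card F) * \<delta> ^ ?k \<le> 4 ^ ?m * real ?m" if "?P F" for F
    proof -
      have "real (card F) * (\<delta> / 2) ^ ?m \<le> 2 ^ ?m * real ?m * \<delta>"
        using that \<delta> by (intro separated_sphere_card) auto
      then have "real (card F) * \<delta> ^ ?m \<le> 4 ^ ?m * real ?m * \<delta>"
        by (simp add: power_divide field_simps flip: power_mult_distrib)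
      moreover have "\<delta> ^ ?m = \<delta> * \<delta> ^ ?k" by (simp add: power_eq_if[of \<delta> ?m])
      ultimately have "\<delta> * (real (card F) * \<delta> ^ ?k) \<le> \<delta> * (4 ^ ?m * real ?m)" by (simp add: algebra_simps)
      then show ?thesis using \<delta> by (simp only: mult_le_cancel_left_pos)
    qed
    have "\<exists>F. ?P F \<and> (\<forall>G. ?P G \<longrightarrow> card G \<le> card F)"
    proof (rule ex_has_greatest_nat[where k = "{}" and b = "nat \<lceil>4 ^ ?m * real ?m / \<delta> ^ ?k\<rceil> + 1"])
      show "\<forall>F. ?P F \<longrightarrow> card F < nat \<lceil>4 ^ ?m * real ?m / \<delta> ^ ?k\<rceil> + 1"
      proof (intro allI impI)
        fix F assume "?P F"
        then have "real (card F) \<le> 4 ^ ?m * real ?m / \<delta> ^ ?k" using bound[of F] \<delta> by (simp add: field_simps)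
        also have "\<dots> \<le> real (nat \<lceil>4 ^ ?m * real ?m / \<delta> ^ ?k\<rceil>)" by (rule real_nat_ceiling_ge)
        finally show "card F < nat \<lceil>4 ^ ?m * real ?m / \<delta> ^ ?k\<rceil> + 1" by linarith
      qed
    qed simp
    then obtain F where F: "?P F" "\<And>G. ?P G \<Longrightarrow> card G \<le> card F" by blast
    have cov: "?S \<subseteq> (\<Union>x\<in>F. cball x \<delta>)"
    proof (rule ccontr)
      assume "\<not> ?thesis"
      then obtain y where "y \<in> ?S" "y \<notin> (\<Union>x\<in>F. cball x \<delta>)" by blast
      then have y: "y \<in> ?S" "\<And>x. x \<in> F \<Longrightarrow> \<delta> < dist x y \<and> \<delta> < dist y x"
        by (auto simp: dist_commute not_le)
      have "?P (insert y F)" using F(1) y by (auto intro: less_imp_le)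
      then have "card (insert y F) \<le> card F" by (rule F(2))
      moreover have "y \<notin> F" using y(2)[of y] \<delta> by auto
      ultimately show False using F(1) by simp
    qed
    have "hausdorff_premeasure ?k (2 * \<delta>) ?S \<le> (\<Sum>x\<in>F. hcost ?k (cball x \<delta>))"
      using F(1) cov \<delta> by (intro hausdorff_premeasure_finite_cover) auto
    also have "\<dots> = (\<Sum>x\<in>F. ennreal (?c * (2 * \<delta>) ^ ?k))"
      using \<delta> by (intro sum.cong) auto
    also have "\<dots> = ennreal (real (card F) * (?c * (2 * \<delta>) ^ ?k))"
      using \<delta> by (simp add: ennreal_of_nat_eq_real_of_nat ennreal_mult')
    also have "real (card F) * (?c * (2 * \<delta>) ^ ?k) = ?c * (2 ^ ?k * (real (card F) * \<delta> ^ ?k))"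
      by (simp add: power_mult_distrib)
    also have "\<dots> \<le> C"
      unfolding C_def using bound[OF F(1)] by (intro mult_left_mono) auto
    finally show ?thesis by (simp add: ennreal_leI)
  qed
  then have "hausdorff_outer ?k ?S \<le> ennreal C"
    unfolding hausdorff_outer_def
  proof (intro SUP_least)
    fix d :: real assume pre: "\<And>\<delta>. 0 < \<delta> \<Longrightarrow> \<delta> \<le> 1 \<Longrightarrow> hausdorff_premeasure ?k (2 * \<delta>) ?S \<le> ennreal C"
      and d: "d \<in> {0<..}"
    have "hausdorff_premeasure ?k d ?S \<le> hausdorff_premeasure ?k (2 * min (d / 2) 1) ?S"
      by (rule hausdorff_premeasure_antimono) auto
    also have "\<dots> \<le> ennreal C" using d by (intro pre) auto
    finally show "hausdorff_premeasure ?k d ?S \<le> ennreal C" .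
  qed
  then show ?thesis by (rule le_less_trans) simp
qed

text \<open>Both sides are rotation invariant, so they agree up to the constant \<open>H(S)\<close>.\<close>

lemma hausdorff_sphere_eq:
  fixes A :: "(real^'n) set"
  assumes card: "CARD('n) \<ge> 2" and A: "A \<in> sets borel"
  shows "hausdorff_outer (CARD('n) - 1) (sphere 0 1 \<inter> A)
    = hausdorff_outer (CARD('n) - 1) (sphere (0 :: real^'n) 1) * emeasure sphere_prob A"
proof -
  let ?k = "CARD('n) - 1" and ?S = "sphere (0 :: real^'n) 1"
  let ?H = "hausdorff_measure (CARD('n) - 1) :: (real^'n) measure"
  have S: "emeasure ?H ?S \<noteq> 0" "emeasure ?H ?S \<noteq> \<infinity>"
    using hausdorff_sphere_pos[OF card] hausdorff_sphere_finite[OF card]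
    by (auto simp: emeasure_hausdorff_measure)
  have um: "emeasure (uniform_measure ?H ?S) B = emeasure ?H (?S \<inter> B) / emeasure ?H ?S" if "B \<in> sets borel" for B
    using that by simp
  have "uniform_measure ?H ?S = sphere_prob"
  proof (rule rotation_invariant_eq_sphere_prob[OF card])
    show "prob_space (uniform_measure ?H ?S)" using S by (intro prob_space_uniform_measure) auto
    show "emeasure (uniform_measure ?H ?S) (- ?S) = 0"
      by (subst um) (auto intro: borel_open)
    fix Q :: "real^'n^'n" and B :: "(real^'n) set"
    assume Q: "rotation_matrix Q" and B: "B \<in> sets borel"
    have T: "orthogonal_transformation ((*v) Q)" by (rule rotation_matrix_orthogonal[OF Q])
    have QB: "(*v) Q -` B \<in> sets borel"
      using measurable_sets_borel[OF linear_borel_measurable B] T orthogonal_transformation_linear by blast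
    have nQ: "norm (Q *v x) = norm x" for x using T by (auto simp: orthogonal_transformation)
    have "(*v) Q ` (?S \<inter> (*v) Q -` B) = ?S \<inter> B"
    proof
      show "?S \<inter> B \<subseteq> (*v) Q ` (?S \<inter> (*v) Q -` B)"
      proof
        fix y assume y: "y \<in> ?S \<inter> B"
        obtain x where "y = Q *v x" using orthogonal_transformation_bij[OF T] by (metis bij_is_surj surjD)
        then show "y \<in> (*v) Q ` (?S \<inter> (*v) Q -` B)" using y nQ[of x] by auto
      qed
    qed (auto simp: nQ)
    moreover have "hausdorff_outer ?k ((*v) Q ` (?S \<inter> (*v) Q -` B)) = hausdorff_outer ?k (?S \<inter> (*v) Q -` B)"
      by (rule emeasure_hausdorff_isometry) (simp add: dist_norm nQ flip: matrix_vector_mult_diff_distrib)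
    ultimately show "emeasure (uniform_measure ?H ?S) ((*v) Q -` B) = emeasure (uniform_measure ?H ?S) B"
      using B QB by (simp only: um emeasure_hausdorff_measure sets.Int borel_closed closed_sphere)
  qed simp
  then have "emeasure sphere_prob A = hausdorff_outer ?k (?S \<inter> A) / hausdorff_outer ?k ?S"
    using um[OF A] A by (simp add: emeasure_hausdorff_measure)
  then show ?thesis
    using S mult_divide_eq_ennreal[of "hausdorff_outer ?k ?S" "hausdorff_outer ?k (?S \<inter> A)"]
    by (simp add: emeasure_hausdorff_measure ennreal_times_divide mult.commute)
qed

section \<open>Moments of the invariant probability on the sphere up to order four\<close>

lemma sphere_prob_integrable:
  fixes f :: "real^'n \<Rightarrow> 'b::euclidean_space"
  assumes "continuous_on UNIV f"
  shows "integrable sphere_prob f"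
proof -
  interpret prob_space "sphere_prob :: (real^'n) measure" by (rule prob_space_sphere_prob)
  have "compact (f ` sphere 0 1)"
    using assms by (intro compact_continuous_image) (auto intro: continuous_on_subset)
  then obtain B where "\<And>x. x \<in> sphere 0 1 \<Longrightarrow> norm (f x) \<le> B"
    using compact_imp_bounded bounded_iff by (metis imageI)
  then show ?thesis
    using AE_sphere_prob borel_measurable_continuous_onI[OF assms]
    by (intro integrable_const_bound[where B = B]) (auto elim!: eventually_mono)
qed

lemma sphere_prob_integral_orthogonal:
  fixes f :: "real^'n \<Rightarrow> real" and T :: "real^'n \<Rightarrow> real^'n"
  assumes T: "orthogonal_transformation T" and f: "f \<in> borel_measurable borel"
  shows "(\<integral>u. f (T u) \<partial>sphere_prob) = (\<integral>u. f u \<partial>sphere_prob)"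
proof -
  have Tm: "T \<in> borel \<rightarrow>\<^sub>M borel"
    by (rule linear_borel_measurable[OF orthogonal_transformation_linear[OF T]])
  have "distr sphere_prob borel T = sphere_prob"
    using Tm by (intro measure_eqI) (auto simp: emeasure_distr sphere_prob_orthogonal[OF T])
  then have "(\<integral>u. f u \<partial>sphere_prob) = (\<integral>u. f u \<partial>distr sphere_prob borel T)" by simp
  also have "\<dots> = (\<integral>u. f (T u) \<partial>sphere_prob)"
    using Tm f by (intro integral_distr) auto
  finally show ?thesis ..
qed

lemma sphere_prob_moment_homogeneous:
  fixes v w :: "real^'n"
  assumes "norm v = norm w"
  shows "(\<integral>u. (u \<bullet> v) ^ k \<partial>sphere_prob) = (\<integral>u. (u \<bullet> w) ^ k \<partial>sphere_prob)"
proof -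
  obtain T :: "real^'n \<Rightarrow> real^'n" where T: "orthogonal_transformation T" "T v = w"
    using orthogonal_transformation_exists[OF assms] .
  have "(\<integral>u. (u \<bullet> w) ^ k \<partial>sphere_prob) = (\<integral>u. (T u \<bullet> w) ^ k \<partial>sphere_prob)"
    by (rule sphere_prob_integral_orthogonal[OF T(1), symmetric]) measurable
  also have "\<dots> = (\<integral>u. (u \<bullet> v) ^ k \<partial>sphere_prob)"
    using T by (simp add: orthogonal_transformation_def flip: T(2))
  finally show ?thesis ..
qed

lemma AE_sphere_prob_integral_cong:
  fixes f g :: "real^'n \<Rightarrow> 'b::euclidean_space"
  assumes "f \<in> borel_measurable borel" "g \<in> borel_measurable borel" "\<And>u. norm u = 1 \<Longrightarrow> f u = g u"
  shows "integral\<^sup>L sphere_prob f = integral\<^sup>L sphere_prob g"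
  using assms AE_sphere_prob[where 'n = 'n]
  by (intro integral_cong_AE) (auto elim!: eventually_mono simp: measurable_cong_sets[OF sets_sphere_prob refl])

lemma measure_sphere_prob_UNIV [simp]: "measure sphere_prob (UNIV :: (real^'n) set) = 1"
  using prob_space.prob_space[OF prob_space_sphere_prob] by simp

lemma sphere_prob_sum_sq:
  fixes f :: "real^'n \<Rightarrow> real"
  assumes "continuous_on UNIV f"
  shows "(\<Sum>b\<in>Basis. \<integral>u. f u * (u \<bullet> b)\<^sup>2 \<partial>sphere_prob) = integral\<^sup>L sphere_prob f"
proof -
  have "(\<Sum>b\<in>Basis. \<integral>u. f u * (u \<bullet> b)\<^sup>2 \<partial>sphere_prob) = (\<integral>u. (\<Sum>b\<in>Basis. f u * (u \<bullet> b)\<^sup>2) \<partial>sphere_prob)"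
    by (intro Bochner_Integration.integral_sum[symmetric] sphere_prob_integrable continuous_intros assms)
  also have "\<dots> = integral\<^sup>L sphere_prob f"
  proof (rule AE_sphere_prob_integral_cong)
    have "(\<Sum>b\<in>Basis. (u \<bullet> b)\<^sup>2) = (norm u)\<^sup>2" for u :: "real^'n"
      unfolding power2_norm_eq_inner by (subst euclidean_inner) (simp add: power2_eq_square)
    then show "norm u = 1 \<Longrightarrow> (\<Sum>b\<in>Basis. f u * (u \<bullet> b)\<^sup>2) = f u" for u
      by (simp add: sum_distrib_left[symmetric])
  qed (intro borel_measurable_continuous_onI continuous_intros assms)+
  finally show ?thesis .
qed

lemma sphere_prob_second_moment:
  fixes v :: "real^'n"
  shows "(\<integral>u. (u \<bullet> v)\<^sup>2 \<partial>sphere_prob) = (norm v)\<^sup>2 / CARD('n)"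
proof -
  obtain e :: "real^'n" where e: "e \<in> Basis" using nonempty_Basis by blast
  have "(\<Sum>b\<in>Basis. \<integral>u. 1 * (u \<bullet> b)\<^sup>2 \<partial>(sphere_prob :: (real^'n) measure)) = 1"
    by (subst sphere_prob_sum_sq) simp_all
  moreover have "(\<integral>u. (u \<bullet> b)\<^sup>2 \<partial>sphere_prob) = (\<integral>u. (u \<bullet> e)\<^sup>2 \<partial>sphere_prob)" if "b \<in> Basis" for b :: "real^'n"
    by (rule sphere_prob_moment_homogeneous) (use that e in simp)
  ultimately have 1: "(\<integral>u. (u \<bullet> e)\<^sup>2 \<partial>sphere_prob) = 1 / CARD('n)"
    by (simp add: field_simps)
  have "(\<integral>u. (u \<bullet> v)\<^sup>2 \<partial>sphere_prob) = (\<integral>u. (u \<bullet> (norm v *\<^sub>R e))\<^sup>2 \<partial>sphere_prob)"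
    by (rule sphere_prob_moment_homogeneous) (use e in simp)
  also have "\<dots> = (norm v)\<^sup>2 * (\<integral>u. (u \<bullet> e)\<^sup>2 \<partial>sphere_prob)"
    by (simp add: power_mult_distrib)
  finally show ?thesis using 1 by simp
qed

text \<open>The mixed moments follow from the rotation invariance of \<open>\<integral>(u \<bullet> v)^4\<close> by polarisation.\<close>

lemma sphere_prob_fourth_moment_sq:
  fixes v w :: "real^'n"
  shows "(\<integral>u. (u \<bullet> v)\<^sup>2 * (u \<bullet> w)\<^sup>2 \<partial>sphere_prob)
    = ((norm v)\<^sup>2 * (norm w)\<^sup>2 + 2 * (v \<bullet> w)\<^sup>2) / (real CARD('n) * (real CARD('n) + 2))"
proof -
  obtain e :: "real^'n" where e: "e \<in> Basis" using nonempty_Basis by blast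
  define a where "a = (\<integral>u. (u \<bullet> e) ^ 4 \<partial>sphere_prob)"
  note int = sphere_prob_integrable[where 'b = real and 'n = 'n]
  have hom: "(\<integral>u. (u \<bullet> v) ^ 4 \<partial>sphere_prob) = a * ((norm v)\<^sup>2)\<^sup>2" for v :: "real^'n"
  proof -
    have "(\<integral>u. (u \<bullet> v) ^ 4 \<partial>sphere_prob) = (\<integral>u. (u \<bullet> (norm v *\<^sub>R e)) ^ 4 \<partial>sphere_prob)"
      by (rule sphere_prob_moment_homogeneous) (use e in simp)
    then show ?thesis by (simp add: power_mult_distrib a_def mult.commute flip: power_mult)
  qed
  have mixed: "(\<integral>u. (u \<bullet> v)\<^sup>2 * (u \<bullet> w)\<^sup>2 \<partial>sphere_prob) = a / 3 * ((norm v)\<^sup>2 * (norm w)\<^sup>2 + 2 * (v \<bullet> w)\<^sup>2)"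
    for v w :: "real^'n"
  proof -
    have "(u \<bullet> (v + w)) ^ 4 + (u \<bullet> (v - w)) ^ 4 = 2 * (u \<bullet> v) ^ 4 + 12 * ((u \<bullet> v)\<^sup>2 * (u \<bullet> w)\<^sup>2) + 2 * (u \<bullet> w) ^ 4" for u
      unfolding inner_add_right inner_diff_right by algebra
    then have "(\<integral>u. (u \<bullet> (v + w)) ^ 4 + (u \<bullet> (v - w)) ^ 4 \<partial>sphere_prob)
      = (\<integral>u. 2 * (u \<bullet> v) ^ 4 + 12 * ((u \<bullet> v)\<^sup>2 * (u \<bullet> w)\<^sup>2) + 2 * (u \<bullet> w) ^ 4 \<partial>sphere_prob)" by simp
    moreover have "(\<integral>u. (u \<bullet> (v + w)) ^ 4 + (u \<bullet> (v - w)) ^ 4 \<partial>sphere_prob)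
      = a * ((norm (v + w))\<^sup>2)\<^sup>2 + a * ((norm (v - w))\<^sup>2)\<^sup>2"
      unfolding hom[symmetric] by (intro Bochner_Integration.integral_add int continuous_intros)
    moreover have "(\<integral>u. 2 * (u \<bullet> v) ^ 4 + 12 * ((u \<bullet> v)\<^sup>2 * (u \<bullet> w)\<^sup>2) + 2 * (u \<bullet> w) ^ 4 \<partial>sphere_prob)
      = 2 * (a * ((norm v)\<^sup>2)\<^sup>2) + 12 * (\<integral>u. (u \<bullet> v)\<^sup>2 * (u \<bullet> w)\<^sup>2 \<partial>sphere_prob) + 2 * (a * ((norm w)\<^sup>2)\<^sup>2)"
      unfolding hom[symmetric] integral_mult_right_zero[symmetric]
      by (subst Bochner_Integration.integral_add, (intro int continuous_intros)+)+ (rule refl)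
    ultimately have "12 * (\<integral>u. (u \<bullet> v)\<^sup>2 * (u \<bullet> w)\<^sup>2 \<partial>sphere_prob)
      = a * ((norm (v + w))\<^sup>2)\<^sup>2 + a * ((norm (v - w))\<^sup>2)\<^sup>2 - 2 * (a * ((norm v)\<^sup>2)\<^sup>2) - 2 * (a * ((norm w)\<^sup>2)\<^sup>2)"
      by linarith
    also have "(norm (v + w))\<^sup>2 = (norm v)\<^sup>2 + (norm w)\<^sup>2 + 2 * (v \<bullet> w)"
      by (simp add: power2_norm_eq_inner inner_simps inner_commute)
    also have "(norm (v - w))\<^sup>2 = (norm v)\<^sup>2 + (norm w)\<^sup>2 - 2 * (v \<bullet> w)"
      by (simp add: power2_norm_eq_inner inner_simps inner_commute)
    also have "a * ((norm v)\<^sup>2 + (norm w)\<^sup>2 + 2 * (v \<bullet> w))\<^sup>2 + a * ((norm v)\<^sup>2 + (norm w)\<^sup>2 - 2 * (v \<bullet> w))\<^sup>2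
        - 2 * (a * ((norm v)\<^sup>2)\<^sup>2) - 2 * (a * ((norm w)\<^sup>2)\<^sup>2) = 4 * (a * ((norm v)\<^sup>2 * (norm w)\<^sup>2 + 2 * (v \<bullet> w)\<^sup>2))"
      by algebra
    finally show ?thesis by simp
  qed
  \<comment> \<open>Summing over b replaces (u . b)^2 by 1 and leaves a second moment; comparison
    with the closed form in \<open>a\<close> determines \<open>a\<close>.\<close>
  have "(\<Sum>b\<in>Basis. \<integral>u. (u \<bullet> e)\<^sup>2 * (u \<bullet> b)\<^sup>2 \<partial>(sphere_prob :: (real^'n) measure)) = 1 / CARD('n)"
    using e by (subst sphere_prob_sum_sq) (auto intro!: continuous_intros simp: sphere_prob_second_moment)
  moreover have "(\<Sum>b\<in>Basis. a / 3 * ((norm e)\<^sup>2 * (norm b)\<^sup>2 + 2 * (e \<bullet> b)\<^sup>2)) = a / 3 * (real CARD('n) + 2)"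
  proof -
    have "(\<Sum>b\<in>Basis. a / 3 * ((norm e)\<^sup>2 * (norm b)\<^sup>2 + 2 * (e \<bullet> b)\<^sup>2))
      = (\<Sum>b\<in>(Basis :: (real^'n) set). a / 3 * (1 + 2 * (if b = e then 1 else 0)))"
      using e by (intro sum.cong) (auto simp: inner_Basis)
    also have "\<dots> = a / 3 * (\<Sum>b\<in>(Basis :: (real^'n) set). (1 + 2 * (if b = e then 1 else 0)))"
      by (simp only: sum_distrib_left)
    also have "(\<Sum>b\<in>(Basis :: (real^'n) set). (1 + 2 * (if b = e then 1 else 0))) = real CARD('n) + 2"
      using e by (simp add: sum.distrib sum_distrib_left[symmetric])
    finally show ?thesis .
  qed
  ultimately have eq: "a / 3 * (real CARD('n) + 2) = 1 / real CARD('n)" unfolding mixed by simp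
  have gen: "p = 1 / (r * q)" if "p * q = 1 / r" "q \<noteq> 0" for p q r :: real
    using that by (simp add: eq_divide_eq flip: divide_divide_eq_left)
  have "a / 3 = 1 / (real CARD('n) * (real CARD('n) + 2))"
    by (rule gen[OF eq]) linarith
  then show ?thesis using mixed[of v w] by simp
qed

text \<open>Polarisation in each of the two pairs of arguments, starting from the case of two
  squares.\<close>

lemma sphere_prob_fourth_moment:
  fixes v w x y :: "real^'n"
  shows "(\<integral>u. (u \<bullet> v) * (u \<bullet> w) * ((u \<bullet> x) * (u \<bullet> y)) \<partial>sphere_prob)
    = ((v \<bullet> w) * (x \<bullet> y) + (v \<bullet> x) * (w \<bullet> y) + (v \<bullet> y) * (w \<bullet> x)) / (real CARD('n) * (real CARD('n) + 2))"
proof -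
  define \<kappa> where "\<kappa> = 1 / (real CARD('n) * (real CARD('n) + 2))"
  note int = sphere_prob_integrable[where 'b = real and 'n = 'n]
  have sq: "(\<integral>u. (u \<bullet> v)\<^sup>2 * (u \<bullet> w)\<^sup>2 \<partial>sphere_prob) = \<kappa> * ((v \<bullet> v) * (w \<bullet> w) + 2 * (v \<bullet> w)\<^sup>2)" for v w :: "real^'n"
    using sphere_prob_fourth_moment_sq[of v w] by (simp add: \<kappa>_def power2_norm_eq_inner)
  have half: "(\<integral>u. (u \<bullet> v) * (u \<bullet> w) * (u \<bullet> x)\<^sup>2 \<partial>sphere_prob) = \<kappa> * ((v \<bullet> w) * (x \<bullet> x) + 2 * (v \<bullet> x) * (w \<bullet> x))"
    for v w x :: "real^'n"
  proof -
    have "(u \<bullet> v) * (u \<bullet> w) * (u \<bullet> x)\<^sup>2 = ((u \<bullet> (v + w))\<^sup>2 * (u \<bullet> x)\<^sup>2 - (u \<bullet> (v - w))\<^sup>2 * (u \<bullet> x)\<^sup>2) / 4" for u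
      unfolding inner_add_right inner_diff_right by (simp add: power2_eq_square algebra_simps)
    then have "(\<integral>u. (u \<bullet> v) * (u \<bullet> w) * (u \<bullet> x)\<^sup>2 \<partial>sphere_prob)
      = ((\<integral>u. (u \<bullet> (v + w))\<^sup>2 * (u \<bullet> x)\<^sup>2 \<partial>sphere_prob) - (\<integral>u. (u \<bullet> (v - w))\<^sup>2 * (u \<bullet> x)\<^sup>2 \<partial>sphere_prob)) / 4"
      by (simp only: integral_divide_zero) (subst Bochner_Integration.integral_diff, (intro int continuous_intros)+, rule refl)
    then show ?thesis
      unfolding sq unfolding inner_add_left inner_add_right inner_diff_left inner_diff_right inner_commute[of w v]
      by (simp add: field_simps power2_eq_square)
  qed
  have "(u \<bullet> v) * (u \<bullet> w) * ((u \<bullet> x) * (u \<bullet> y))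
      = ((u \<bullet> v) * (u \<bullet> w) * (u \<bullet> (x + y))\<^sup>2 - (u \<bullet> v) * (u \<bullet> w) * (u \<bullet> (x - y))\<^sup>2) / 4" for u
    unfolding inner_add_right inner_diff_right by (simp add: power2_eq_square algebra_simps)
  then have "(\<integral>u. (u \<bullet> v) * (u \<bullet> w) * ((u \<bullet> x) * (u \<bullet> y)) \<partial>sphere_prob)
    = ((\<integral>u. (u \<bullet> v) * (u \<bullet> w) * (u \<bullet> (x + y))\<^sup>2 \<partial>sphere_prob) - (\<integral>u. (u \<bullet> v) * (u \<bullet> w) * (u \<bullet> (x - y))\<^sup>2 \<partial>sphere_prob)) / 4"
    by (simp only: integral_divide_zero) (subst Bochner_Integration.integral_diff, (intro int continuous_intros)+, rule refl)
  also have "\<dots> = \<kappa> * ((v \<bullet> w) * (x \<bullet> y) + (v \<bullet> x) * (w \<bullet> y) + (v \<bullet> y) * (w \<bullet> x))"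
    unfolding half unfolding inner_add_left inner_add_right inner_diff_left inner_diff_right inner_commute[of y x]
    by (simp add: field_simps)
  finally show ?thesis by (simp add: \<kappa>_def)
qed

section \<open>Bodies with unique normals\<close>

text \<open>The bodies that matter here have exactly one outer unit normal at each boundary point.\<close>

locale body =
  fixes K :: "(real^'n) set"
  assumes compact_K: "compact K" and convex_K: "convex K" and zero_K: "0 \<in> interior K"
    and unique_normal: "\<And>x m n. \<lbrakk>x \<in> frontier K; norm m = 1; norm n = 1;
      \<forall>y\<in>K. (y - x) \<bullet> m \<le> 0; \<forall>y\<in>K. (y - x) \<bullet> n \<le> 0\<rbrakk> \<Longrightarrow> m = n"
begin

definition "h = support_function K"
definition "\<nu> = outer_normal K"
text \<open>The vector that represents the norming functional at y; it lies on the boundary of the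
  polar body.\<close>

definition "p y = \<nu> y /\<^sub>R h (\<nu> y)"
text \<open>The gauge function of K, written as a supremum of linear functionals: subgradients and a
  Lipschitz bound are then at hand, and \<open>N_ray\<close> identifies it on each ray.\<close>

definition "N x = (SUP y\<in>frontier K. x \<bullet> p y)"

lemma closed_K: "closed K" using compact_K by (rule compact_imp_closed)
lemma bounded_K: "bounded K" using compact_K by (rule compact_imp_bounded)
lemma K_nonempty: "K \<noteq> {}" using zero_K interior_subset by blast
lemma frontier_K: "frontier K \<subseteq> K" using closed_K by (simp add: frontier_subset_eq)
lemma compact_frontier_K: "compact (frontier K)" using compact_K by (rule compact_frontier)
lemma zero_notin_frontier: "0 \<notin> frontier K" using zero_K by (simp add: frontier_def)

lemma bdd_above_inner: "bdd_above ((\<lambda>x. x \<bullet> u) ` K)"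
proof -
  have "compact ((\<lambda>x. x \<bullet> u) ` K)"
    by (intro compact_continuous_image compact_K continuous_intros)
  then show ?thesis by (intro bounded_imp_bdd_above compact_imp_bounded)
qed

lemma inner_le_h: "x \<in> K \<Longrightarrow> x \<bullet> u \<le> h u"
  unfolding h_def support_function_def by (rule cSUP_upper[OF _ bdd_above_inner])

lemma h_le: "(\<And>x. x \<in> K \<Longrightarrow> x \<bullet> u \<le> c) \<Longrightarrow> h u \<le> c"
  unfolding h_def support_function_def by (rule cSUP_least[OF K_nonempty])

lemma inner_radius: obtains r where "0 < r" "cball 0 r \<subseteq> K"
  using zero_K mem_interior_cball by blast

lemma h_lower: "\<exists>r>0. \<forall>u. norm u = 1 \<longrightarrow> r \<le> h u"
proof -
  obtain r where r: "0 < r" "cball 0 r \<subseteq> K" by (rule inner_radius)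
  have "r \<le> h u" if "norm u = 1" for u
  proof -
    have "r *\<^sub>R u \<in> K" using r that by (intro subsetD[OF r(2)]) simp
    then have "(r *\<^sub>R u) \<bullet> u \<le> h u" by (rule inner_le_h)
    then show ?thesis using that by (simp add: dot_square_norm)
  qed
  then show ?thesis using r(1) by blast
qed

lemma h_pos: "norm u = 1 \<Longrightarrow> 0 < h u"
  using h_lower by (meson less_le_trans)

lemma ex_normal:
  assumes x: "x \<in> frontier K"
  shows "\<exists>!n. norm n = 1 \<and> (\<forall>y\<in>K. (y - x) \<bullet> n \<le> 0)"
proof -
  have "interior K \<noteq> {}" using zero_K by auto
  then have "x \<notin> rel_interior K"
    using x by (simp add: rel_interior_nonempty_interior frontier_def)
  moreover have "x \<in> K" using x frontier_K by auto
  ultimately obtain a where a: "a \<noteq> 0" "\<And>y. y \<in> K \<Longrightarrow> a \<bullet> x \<le> a \<bullet> y"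
    using supporting_hyperplane_rel_boundary[OF convex_K] by metis
  have "(y - x) \<bullet> (- (a /\<^sub>R norm a)) \<le> 0" if "y \<in> K" for y
  proof -
    have "(y - x) \<bullet> (- (a /\<^sub>R norm a)) = (a \<bullet> x - a \<bullet> y) / norm a"
      by (simp add: inner_simps inner_commute divide_inverse algebra_simps)
    then show ?thesis using a(2)[OF that] by (simp add: divide_nonpos_nonneg)
  qed
  moreover have "norm (- (a /\<^sub>R norm a)) = 1" using a(1) by simp
  ultimately show ?thesis
    using unique_normal[OF x] by (intro ex1I[of _ "- (a /\<^sub>R norm a)"]) blast+
qed

lemma normal:
  assumes x: "x \<in> frontier K"
  shows "norm (\<nu> x) = 1" "\<And>y. y \<in> K \<Longrightarrow> (y - x) \<bullet> \<nu> x \<le> 0" "x \<bullet> \<nu> x = h (\<nu> x)"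
proof -
  have *: "norm (\<nu> x) = 1 \<and> (\<forall>y\<in>K. (y - x) \<bullet> \<nu> x \<le> 0)"
    unfolding \<nu>_def outer_normal_def by (rule theI'[OF ex_normal[OF x]])
  then show "norm (\<nu> x) = 1" and le: "\<And>y. y \<in> K \<Longrightarrow> (y - x) \<bullet> \<nu> x \<le> 0" by auto
  show "x \<bullet> \<nu> x = h (\<nu> x)"
    using le x frontier_K by (intro antisym inner_le_h h_le) (auto simp: inner_simps)
qed

lemma h_normal_pos: "x \<in> frontier K \<Longrightarrow> 0 < h (\<nu> x)"
  using normal(1) by (rule h_pos)

text \<open>A map into a compact set is continuous if its graph is closed. By uniqueness of normals
  the graph consists of all pairs (x, n) that satisfy the supporting inequalities, which is a closed
  condition.\<close>

lemma continuous_normal: "continuous_on (frontier K) \<nu>"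
proof (rule continuous_from_closed_graph)
  show "compact (sphere (0::real^'n) 1)" by simp
  show "\<nu> \<in> frontier K \<rightarrow> sphere 0 1" using normal(1) by auto
  have "(\<lambda>x. (x, \<nu> x)) ` frontier K
    = (frontier K \<times> sphere 0 1) \<inter> (\<Inter>y\<in>K. {z. (y - fst z) \<bullet> snd z \<le> 0})" (is "_ = ?R")
  proof
    show "(\<lambda>x. (x, \<nu> x)) ` frontier K \<subseteq> ?R" using normal by auto
    show "?R \<subseteq> (\<lambda>x. (x, \<nu> x)) ` frontier K"
    proof
      fix z assume z: "z \<in> ?R"
      then have "snd z = \<nu> (fst z)"
        using normal by (intro unique_normal[of "fst z"]) auto
      then show "z \<in> (\<lambda>x. (x, \<nu> x)) ` frontier K" using z by (auto intro!: image_eqI[of _ _ "fst z"])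
    qed
  qed
  moreover have "closed ?R"
    by (intro closed_Int closed_INT closed_Times closed_Collect_le continuous_intros ballI) auto
  ultimately show "closed ((\<lambda>x. (x, \<nu> x)) ` frontier K)" by simp
qed

lemma continuous_h_normal: "continuous_on (frontier K) (\<lambda>x. h (\<nu> x))"
proof -
  have "continuous_on (frontier K) (\<lambda>x. x \<bullet> \<nu> x)"
    by (intro continuous_intros continuous_normal)
  then show ?thesis by (rule continuous_on_eq) (simp add: normal(3))
qed

lemma continuous_p: "continuous_on (frontier K) p"
  unfolding p_def[abs_def]
  by (intro continuous_intros continuous_normal continuous_h_normal) (use h_normal_pos in force)

lemma p_frontier:
  assumes y: "y \<in> frontier K"
  shows "y \<bullet> p y = 1" "\<And>x. x \<in> K \<Longrightarrow> x \<bullet> p y \<le> 1" "norm (p y) = 1 / h (\<nu> y)"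
  using normal[OF y] h_normal_pos[OF y] inner_le_h[of _ "\<nu> y"]
  by (auto simp: p_def field_simps)

lemma p_bound: "\<exists>M. 0 < M \<and> (\<forall>y\<in>frontier K. norm (p y) \<le> M)"
proof -
  obtain r where r: "0 < r" "\<forall>u. norm u = 1 \<longrightarrow> r \<le> h u" using h_lower by blast
  show ?thesis
  proof (intro exI[of _ "1 / r"] conjI ballI)
    fix y assume y: "y \<in> frontier K"
    have "r \<le> h (\<nu> y)" using r(2) normal(1)[OF y] by blast
    then show "norm (p y) \<le> 1 / r"
      using p_frontier(3)[OF y] r(1) by (simp add: frac_le)
  qed (use r in simp)
qed

lemma ray_frontier:
  assumes "x \<noteq> 0"
  obtains d where "0 < d" "d *\<^sub>R x \<in> frontier K"
  using ray_to_frontier[OF bounded_K zero_K assms] by force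

lemma frontier_nonempty: "frontier K \<noteq> {}"
proof -
  obtain e :: "real^'n" where "e \<in> Basis" using nonempty_Basis by blast
  then have "e \<noteq> 0" by auto
  then show ?thesis by (rule ray_frontier) auto
qed

lemma N_upper: "y \<in> frontier K \<Longrightarrow> x \<bullet> p y \<le> N x"
proof -
  have "compact ((\<lambda>y. x \<bullet> p y) ` frontier K)"
    by (intro compact_continuous_image compact_frontier_K continuous_intros continuous_p)
  then have "bdd_above ((\<lambda>y. x \<bullet> p y) ` frontier K)"
    by (intro bounded_imp_bdd_above compact_imp_bounded)
  then show "y \<in> frontier K \<Longrightarrow> x \<bullet> p y \<le> N x" unfolding N_def by (intro cSUP_upper)
qed

lemma N_least: "(\<And>y. y \<in> frontier K \<Longrightarrow> x \<bullet> p y \<le> c) \<Longrightarrow> N x \<le> c"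
  unfolding N_def by (rule cSUP_least[OF frontier_nonempty])

lemma N_zero [simp]: "N 0 = 0"
  using frontier_nonempty by (auto simp: N_def)

text \<open>The norming functional at the boundary point d x takes the value 1 there, and no norming
  functional exceeds 1 on K.\<close>

lemma N_ray:
  assumes "0 < d" "d *\<^sub>R x \<in> frontier K"
  shows "N x = 1 / d"
proof (rule antisym)
  show "N x \<le> 1 / d"
  proof (rule N_least)
    fix y assume "y \<in> frontier K"
    then have "(d *\<^sub>R x) \<bullet> p y \<le> 1" using assms(2) frontier_K by (intro p_frontier(2)) auto
    then show "x \<bullet> p y \<le> 1 / d" using assms(1) by (simp add: field_simps)
  qed
  have "1 / d = x \<bullet> p (d *\<^sub>R x)"
    using p_frontier(1)[OF assms(2)] assms(1) by (simp add: field_simps)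
  then show "1 / d \<le> N x" using N_upper[OF assms(2)] by simp
qed

lemma N_pos: "x \<noteq> 0 \<Longrightarrow> 0 < N x"
  by (rule ray_frontier[of x]) (auto simp: N_ray)

lemma N_frontier: "x \<noteq> 0 \<Longrightarrow> x /\<^sub>R N x \<in> frontier K"
  by (rule ray_frontier[of x]) (auto simp: N_ray)

lemma N_frontier_eq: "x \<in> frontier K \<Longrightarrow> N x = 1"
  using N_ray[of 1 x] by simp

lemma N_scale: "0 \<le> c \<Longrightarrow> N (c *\<^sub>R x) = c * N x"
proof (cases "c = 0 \<or> x = 0")
  case False
  assume "0 \<le> c"
  obtain d where d: "0 < d" "d *\<^sub>R x \<in> frontier K" using False by (metis ray_frontier)
  have "N (c *\<^sub>R x) = 1 / (d / c)"
    using d False \<open>0 \<le> c\<close> by (intro N_ray) auto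
  then show ?thesis using N_ray[OF d] by simp
qed auto

lemma K_iff_N: "x \<in> K \<longleftrightarrow> N x \<le> 1"
proof (cases "x = 0")
  case True
  then show ?thesis using zero_K interior_subset by auto
next
  case False
  show ?thesis
  proof
    assume "x \<in> K"
    then show "N x \<le> 1" using p_frontier(2) by (intro N_least) auto
  next
    assume N1: "N x \<le> 1"
    have "x = (1 - N x) *\<^sub>R 0 + N x *\<^sub>R (x /\<^sub>R N x)" using N_pos[OF False] by simp
    also have "\<dots> \<in> K"
      using N1 N_pos[OF False] N_frontier[OF False] frontier_K zero_K interior_subset
      by (intro convexD[OF convex_K]) auto
    finally show "x \<in> K" .
  qed
qed

text \<open>A bound for the norming functionals, and thus a Lipschitz constant for
  \<open>N\<close>.\<close>

definition "M = (SOME M. 0 < M \<and> (\<forall>y\<in>frontier K. norm (p y) \<le> M))"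

lemma M: "0 < M" "y \<in> frontier K \<Longrightarrow> norm (p y) \<le> M"
  using someI_ex[OF p_bound] unfolding M_def by blast+

lemma N_self: "x \<noteq> 0 \<Longrightarrow> x \<bullet> p (x /\<^sub>R N x) = N x"
  using p_frontier(1)[OF N_frontier, of x] N_pos[of x] by (simp add: field_simps)

lemma N_subgradient: "x \<noteq> 0 \<Longrightarrow> N x + (y - x) \<bullet> p (x /\<^sub>R N x) \<le> N y"
  using N_upper[OF N_frontier, of x y] N_self[of x] by (simp add: inner_simps)

lemma N_lipschitz: "\<bar>N x - N y\<bar> \<le> M * norm (x - y)"
proof -
  have "N x - N y \<le> M * norm (x - y)" for x y
  proof -
    have "N x \<le> N y + M * norm (x - y)"
    proof (rule N_least)
      fix z assume z: "z \<in> frontier K"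
      have "x \<bullet> p z = y \<bullet> p z + (x - y) \<bullet> p z" by (simp add: inner_simps)
      also have "(x - y) \<bullet> p z \<le> norm (x - y) * norm (p z)" by (rule norm_cauchy_schwarz)
      also have "\<dots> \<le> norm (x - y) * M" using M(2)[OF z] by (intro mult_left_mono) auto
      finally show "x \<bullet> p z \<le> N y + M * norm (x - y)"
        using N_upper[OF z, of y] by (simp add: mult.commute)
    qed
    then show ?thesis by simp
  qed
  from this[of x y] this[of y x] show ?thesis by (simp add: norm_minus_commute abs_le_iff)
qed

lemma continuous_N: "continuous_on A N"
proof -
  have "M-lipschitz_on A N"
    using M(1) N_lipschitz by (intro lipschitz_onI) (auto simp: dist_norm)
  then show ?thesis by (rule lipschitz_on_continuous_on)
qed

lemma borel_measurable_N [measurable]: "N \<in> borel_measurable borel"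
  by (rule borel_measurable_continuous_onI[OF continuous_N])

lemma continuous_hat: "continuous_on (- {0}) (\<lambda>x. x /\<^sub>R N x)"
  by (intro continuous_intros continuous_N) (use N_pos in force)

lemma continuous_p_hat: "continuous_on (- {0}) (\<lambda>x. p (x /\<^sub>R N x))"
  by (rule continuous_on_compose2[OF continuous_p continuous_hat]) (use N_frontier in auto)

lemma hat_scale: "0 < c \<Longrightarrow> (c *\<^sub>R x) /\<^sub>R N (c *\<^sub>R x) = x /\<^sub>R N x"
  by (simp add: N_scale)

lemma hat_frontier: "y \<in> frontier K \<Longrightarrow> 0 < c \<Longrightarrow> (c *\<^sub>R y) /\<^sub>R N (c *\<^sub>R y) = y"
  by (simp add: N_scale N_frontier_eq)

text \<open>The subgradient inequalities at x and at y squeeze the remainder between 0 and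
  \<open>norm (y - x)\<close> times the change of \<open>p\<close> from x / N x to y / N y, and that
  change tends to 0 by continuity.\<close>

lemma N_has_derivative:
  assumes x: "x \<noteq> 0"
  shows "(N has_derivative (\<lambda>v. v \<bullet> p (x /\<^sub>R N x))) (at x)"
  unfolding has_derivative_at_within
proof (intro conjI)
  show "bounded_linear (\<lambda>v. v \<bullet> p (x /\<^sub>R N x))" by (rule bounded_linear_inner_left)
  have lim: "((\<lambda>y. norm (p (y /\<^sub>R N y) - p (x /\<^sub>R N x))) \<longlongrightarrow> 0) (at x)"
  proof -
    have "isCont (\<lambda>x. p (x /\<^sub>R N x)) x"
      using continuous_p_hat x continuous_on_eq_continuous_at[of "- {0}"] by auto
    then have "((\<lambda>y. norm (p (y /\<^sub>R N y) - p (x /\<^sub>R N x))) \<longlongrightarrow> norm (p (x /\<^sub>R N x) - p (x /\<^sub>R N x))) (at x)"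
      unfolding isCont_def by (intro tendsto_intros)
    then show ?thesis by simp
  qed
  show "((\<lambda>y. (N y - N x - (y - x) \<bullet> p (x /\<^sub>R N x)) /\<^sub>R norm (y - x)) \<longlongrightarrow> 0) (at x)"
  proof (rule Lim_null_comparison[OF _ lim])
    have "eventually (\<lambda>y. y \<noteq> 0) (at x)"
      by (rule tendsto_imp_eventually_ne[OF tendsto_ident_at x])
    moreover have "eventually (\<lambda>y. y \<noteq> x) (at x)" by (simp add: eventually_at_filter)
    ultimately show "\<forall>\<^sub>F y in at x. norm ((N y - N x - (y - x) \<bullet> p (x /\<^sub>R N x)) /\<^sub>R norm (y - x))
        \<le> norm (p (y /\<^sub>R N y) - p (x /\<^sub>R N x))"
    proof eventually_elim
      case (elim y)
      have low: "0 \<le> N y - N x - (y - x) \<bullet> p (x /\<^sub>R N x)" using N_subgradient[OF x, of y] by simp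
      have "N y - N x \<le> (y - x) \<bullet> p (y /\<^sub>R N y)"
        using N_subgradient[OF elim(1), of x] by (simp add: inner_simps)
      then have "N y - N x - (y - x) \<bullet> p (x /\<^sub>R N x) \<le> (y - x) \<bullet> (p (y /\<^sub>R N y) - p (x /\<^sub>R N x))"
        by (simp add: inner_simps)
      also have "\<dots> \<le> norm (y - x) * norm (p (y /\<^sub>R N y) - p (x /\<^sub>R N x))" by (rule norm_cauchy_schwarz)
      finally have "N y - N x - (y - x) \<bullet> p (x /\<^sub>R N x) \<le> norm (y - x) * norm (p (y /\<^sub>R N y) - p (x /\<^sub>R N x))" .
      then show ?case using low elim(2) by (simp add: field_simps)
    qed
  qed
qed

end

section \<open>Cones over the boundary\<close>

lemma vimage_scale_homothety:
  assumes "0 < c"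
  shows "vimage_scale (\<lambda>x :: 'a::euclidean_space. c *\<^sub>R x) = 1 / c ^ DIM('a)"
    "linear (\<lambda>x :: 'a. c *\<^sub>R x)" "bij (\<lambda>x :: 'a. c *\<^sub>R x)"
proof -
  have "(\<lambda>x :: 'a. c *\<^sub>R x) -` ball 0 1 = ball 0 (1 / c)"
    using assms by (auto simp: field_simps)
  then show "vimage_scale (\<lambda>x :: 'a. c *\<^sub>R x) = 1 / c ^ DIM('a)"
    using assms by (simp add: vimage_scale_def measure_def emeasure_ball power_divide)
  show "linear (\<lambda>x :: 'a. c *\<^sub>R x)" by simp
  show "bij (\<lambda>x :: 'a. c *\<^sub>R x)"
    using assms by (intro o_bij[where g = "\<lambda>x. (1 / c) *\<^sub>R x"]) (auto simp: fun_eq_iff)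
qed

text \<open>Finitely many small compact pieces cover X, and inner regularity passes from compact to
  Borel subsets of a piece. Compact sets are convenient for the local test because their continuous
  images are again Borel.\<close>

lemma measure_le_locally:
  fixes \<mu> \<nu> :: "'a::euclidean_space measure"
  assumes sets: "sets \<mu> = sets borel" "sets \<nu> = sets borel"
    and X: "compact X" "emeasure \<mu> (- X) = 0" and fin: "finite_measure \<nu>"
    and loc: "\<And>x. x \<in> X \<Longrightarrow> \<exists>r>0. \<forall>C. compact C \<and> C \<subseteq> X \<inter> ball x r \<longrightarrow> emeasure \<mu> C \<le> ennreal D * emeasure \<nu> C"
    and A: "A \<in> sets borel" "A \<subseteq> X"
  shows "emeasure \<mu> A \<le> ennreal D * emeasure \<nu> A"
proof -
  obtain r where r: "\<And>x. x \<in> X \<Longrightarrow> 0 < r x"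
    "\<And>x C. x \<in> X \<Longrightarrow> compact C \<Longrightarrow> C \<subseteq> X \<inter> ball x (r x) \<Longrightarrow> emeasure \<mu> C \<le> ennreal D * emeasure \<nu> C"
    using loc by metis
  define V where "V x = X \<inter> cball x (r x / 2)" for x
  have V: "compact (V x)" "V x \<subseteq> X \<inter> ball x (r x)" if "x \<in> X" for x
    using X(1) r(1)[OF that] by (auto simp: V_def)
  have V_le: "emeasure \<mu> C \<le> ennreal D * emeasure \<nu> C" if "x \<in> X" "compact C" "C \<subseteq> V x" for x C
    by (rule r(2)[OF that(1,2) order_trans[OF that(3) V(2)[OF that(1)]]])
  have "X \<subseteq> (\<Union>x\<in>X. ball x (r x / 2))"
  proof
    fix x assume "x \<in> X"
    then have "x \<in> ball x (r x / 2)" using r(1)[of x] by simp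
    then show "x \<in> (\<Union>x\<in>X. ball x (r x / 2))" using \<open>x \<in> X\<close> by blast
  qed
  then obtain F where F: "F \<subseteq> X" "finite F" "X \<subseteq> (\<Union>x\<in>F. ball x (r x / 2))"
    by (rule compactE_image[OF X(1) open_ball])
  have cov: "X \<subseteq> (\<Union>x\<in>F. V x)"
  proof
    fix x assume x: "x \<in> X"
    then obtain y where "y \<in> F" "x \<in> ball y (r y / 2)" using F(3) by blast
    then have "y \<in> F" "x \<in> V y" using x by (simp_all add: V_def)
    then show "x \<in> (\<Union>x\<in>F. V x)" by blast
  qed
  have Vm: "V x \<in> sets borel" if "x \<in> X" for x
    using compact_imp_closed[OF V(1)[OF that]] by (rule borel_closed)
  have Xc: "- X \<in> sets borel" using compact_imp_closed[OF X(1)] by (intro borel_open) auto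
  have UV: "(\<Union>x\<in>F. V x) \<in> sets borel" using F Vm by (intro sets.finite_UN) auto
  interpret \<nu>: finite_measure \<nu> by fact
  \<comment> \<open>Inner regularity requires \<mu> to be finite; the comparison on the finitely
    many compact pieces shows that it is.\<close>
  have "emeasure \<mu> UNIV \<le> emeasure \<mu> (- X \<union> (\<Union>x\<in>F. V x))"
    using cov Xc UV by (intro emeasure_mono) (auto simp: sets)
  also have "\<dots> \<le> emeasure \<mu> (- X) + emeasure \<mu> (\<Union>x\<in>F. V x)"
    using Xc UV by (intro emeasure_subadditive) (auto simp: sets)
  also have "\<dots> = emeasure \<mu> (\<Union>x\<in>F. V x)" using X(2) by simp
  also have "\<dots> \<le> (\<Sum>x\<in>F. emeasure \<mu> (V x))"
    using F Vm by (intro emeasure_subadditive_finite) (auto simp: sets)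
  also have "\<dots> \<le> (\<Sum>x\<in>F. ennreal D * emeasure \<nu> (V x))"
    using F V by (intro sum_mono V_le) auto
  also have "\<dots> < \<infinity>"
    using F(2) by (induction F) (auto simp: ennreal_mult_eq_top_iff less_top[symmetric] \<nu>.emeasure_finite)
  finally have fin\<mu>: "emeasure \<mu> (space \<mu>) \<noteq> \<infinity>"
    using sets_eq_imp_space_eq[OF sets(1)] by simp
  have one: "emeasure \<mu> B \<le> ennreal D * emeasure \<nu> B" if "x \<in> X" "B \<in> sets borel" "B \<subseteq> V x" for x B
    unfolding inner_regular[OF sets(1) fin\<mu> that(2)]
  proof (rule SUP_least)
    fix C assume C: "C \<in> {C. C \<subseteq> B \<and> compact C}"
    then have "emeasure \<mu> C \<le> ennreal D * emeasure \<nu> C"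
      using that by (intro V_le[OF that(1)]) auto
    also have "\<dots> \<le> ennreal D * emeasure \<nu> B"
      using C that(2) by (intro mult_left_mono emeasure_mono) (auto simp: sets)
    finally show "emeasure \<mu> C \<le> ennreal D * emeasure \<nu> B" .
  qed
  have "\<forall>B\<in>sets borel. B \<subseteq> (\<Union>x\<in>G. V x) \<longrightarrow> emeasure \<mu> B \<le> ennreal D * emeasure \<nu> B"
    if "finite G" "G \<subseteq> X" for G
    using that
  proof (induction G)
    case (insert x G)
    show ?case
    proof (intro ballI impI)
      fix B assume B: "B \<in> sets borel" "B \<subseteq> (\<Union>y\<in>insert x G. V y)"
      have x: "x \<in> X" using insert.prems by simp
      have B1: "B \<inter> V x \<in> sets borel" and B2: "B - V x \<in> sets borel"
        using B(1) Vm[OF x] by auto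
      have "emeasure \<mu> B = emeasure \<mu> (B \<inter> V x) + emeasure \<mu> (B - V x)"
        using B1 B2 by (subst plus_emeasure) (auto simp: sets Int_Diff_Un)
      also have "emeasure \<mu> (B \<inter> V x) \<le> ennreal D * emeasure \<nu> (B \<inter> V x)"
        by (rule one[OF x B1]) simp
      also have "emeasure \<mu> (B - V x) \<le> ennreal D * emeasure \<nu> (B - V x)"
      proof -
        have "G \<subseteq> X" using insert.prems by simp
        from insert.IH[OF this] have "B - V x \<subseteq> (\<Union>y\<in>G. V y) \<longrightarrow> ?thesis" using B2 by (rule bspec)
        then show ?thesis using B(2) by auto
      qed
      also have "ennreal D * emeasure \<nu> (B \<inter> V x) + ennreal D * emeasure \<nu> (B - V x) = ennreal D * emeasure \<nu> B"
        using B1 B2 by (subst distrib_left[symmetric], subst plus_emeasure) (auto simp: sets Int_Diff_Un)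
      finally show "emeasure \<mu> B \<le> ennreal D * emeasure \<nu> B" by (simp add: add_mono)
    qed
  qed auto
  from this[OF F(2,1)] show ?thesis using A cov by blast
qed

text \<open>Near the unit vector n, radial projection is almost isometric along directions almost
  orthogonal to n: the difference of the lengths of a and b is governed by (b - a) . n, which s
  bounds, up to an error of order t |a - b|.\<close>

lemma normalise_near_unit:
  fixes a b n :: "'a::real_inner"
  assumes n: "norm n = 1" and t: "0 < t" "t \<le> 1/2" and ab: "norm (a - n) \<le> t" "norm (b - n) \<le> t"
    and s: "\<bar>(b - a) \<bullet> n\<bar> \<le> s"
  shows "norm (a /\<^sub>R norm a - b /\<^sub>R norm b) * (1 - t) \<le> norm (a - b) + (2 * s + 2 * t * norm (a - b))"
    "norm (a - b) - (2 * s + 2 * t * norm (a - b)) \<le> (1 + t) * norm (a /\<^sub>R norm a - b /\<^sub>R norm b)"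
    "1 - t \<le> norm a" "norm a \<le> 1 + t"
proof -
  show na: "1 - t \<le> norm a" "norm a \<le> 1 + t"
    using ab(1) n norm_triangle_ineq3[of a n] by auto
  have nb: "1 - t \<le> norm b" "norm b \<le> 1 + t"
    using ab(2) n norm_triangle_ineq3[of b n] by auto
  have a0: "a \<noteq> 0" "b \<noteq> 0" using na nb t by auto
  have "\<bar>norm b - norm a\<bar> * (norm b + norm a) = \<bar>(b - a) \<bullet> (b + a)\<bar>"
  proof -
    have "(norm b - norm a) * (norm b + norm a) = (b - a) \<bullet> (b + a)"
      by (simp add: inner_simps inner_commute algebra_simps flip: power2_norm_eq_inner power2_eq_square)
    then show ?thesis by (metis abs_mult abs_of_nonneg add_nonneg_nonneg norm_ge_zero)
  qed
  \<comment> \<open>The difference of squared lengths is expanded around 2 n, the approximate value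
    of a + b.\<close>
  also have "(b - a) \<bullet> (b + a) = 2 * ((b - a) \<bullet> n) + (b - a) \<bullet> ((a - n) + (b - n))"
    by (simp add: inner_simps)
  also have "\<bar>\<dots>\<bar> \<le> 2 * s + norm (b - a) * (t + t)"
  proof -
    have "\<bar>(b - a) \<bullet> ((a - n) + (b - n))\<bar> \<le> norm (b - a) * norm ((a - n) + (b - n))"
      by (rule Cauchy_Schwarz_ineq2)
    also have "\<dots> \<le> norm (b - a) * (t + t)"
      using norm_triangle_le[of "a - n" "b - n" "t + t"] ab by (intro mult_left_mono) auto
    finally show ?thesis using s by linarith
  qed
  finally have "\<bar>norm b - norm a\<bar> * (norm b + norm a) \<le> 2 * s + 2 * t * norm (a - b)"
    by (simp add: norm_minus_commute[of b a] algebra_simps)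
  moreover have "\<bar>norm b - norm a\<bar> * 1 \<le> \<bar>norm b - norm a\<bar> * (norm b + norm a)"
    using na nb t by (intro mult_left_mono) auto
  ultimately have \<tau>: "\<bar>norm b - norm a\<bar> \<le> 2 * s + 2 * t * norm (a - b)" by simp
  let ?\<psi> = "a /\<^sub>R norm a - b /\<^sub>R norm b"
  have id: "a - b = norm a *\<^sub>R ?\<psi> + (norm a - norm b) *\<^sub>R (b /\<^sub>R norm b)"
    using a0 by (simp add: algebra_simps)
  have nn: "norm ((norm a - norm b) *\<^sub>R (b /\<^sub>R norm b)) = \<bar>norm b - norm a\<bar>"
    using a0 by (simp add: abs_mult abs_minus_commute)
  have n\<psi>: "norm (norm a *\<^sub>R ?\<psi>) = norm a * norm ?\<psi>" by simp
  have 1: "norm a * norm ?\<psi> \<le> norm (a - b) + \<bar>norm b - norm a\<bar>"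
    using norm_triangle_ineq4[of "a - b" "(norm a - norm b) *\<^sub>R (b /\<^sub>R norm b)"] id nn n\<psi>
    by (metis add_diff_cancel_right')
  have 2: "norm (a - b) \<le> norm a * norm ?\<psi> + \<bar>norm b - norm a\<bar>"
    using norm_triangle_ineq[of "norm a *\<^sub>R ?\<psi>" "(norm a - norm b) *\<^sub>R (b /\<^sub>R norm b)"] id nn n\<psi> by metis
  have "(1 - t) * norm ?\<psi> \<le> norm a * norm ?\<psi>" by (intro mult_right_mono na) simp
  then show "norm ?\<psi> * (1 - t) \<le> norm (a - b) + (2 * s + 2 * t * norm (a - b))"
    using 1 \<tau> by (simp add: mult.commute)
  have "norm a * norm ?\<psi> \<le> (1 + t) * norm ?\<psi>" by (intro mult_right_mono na) simp
  then show "norm (a - b) - (2 * s + 2 * t * norm (a - b)) \<le> (1 + t) * norm ?\<psi>"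
    using 2 \<tau> by linarith
qed

text \<open>The two long quotients are the distortion factors that
  \<open>tangent_map_near_isometry\<close> meets for a tolerance t; every quantity here tends to 1
  as t tends to 0.\<close>

lemma ex_small_parameter:
  fixes \<eta> W c :: real
  assumes \<eta>: "0 < \<eta>"
  shows "\<exists>t>0. t \<le> 1/2 \<and> 1 + t < 1 + \<eta> \<and> 1 / (1 + \<eta>) < 1 - t \<and>
    ((1 + t * W) * (1 + 2 * t) + 2 * t * c) / (1 - t) < 1 + \<eta> \<and>
    1 / (1 + \<eta>) < ((1 - t * W) * (1 - 2 * t) - 2 * t * c) / (1 + t)"
proof -
  have \<eta>1: "1 / (1 + \<eta>) < 1" using \<eta> by simp
  have "((\<lambda>t. ((1 + t * W) * (1 + 2 * t) + 2 * t * c) / (1 - t)) \<longlongrightarrow> 1) (at_right (0::real))"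
    "((\<lambda>t. ((1 - t * W) * (1 - 2 * t) - 2 * t * c) / (1 + t)) \<longlongrightarrow> 1) (at_right (0::real))"
    "((\<lambda>t. 1 + t) \<longlongrightarrow> 1) (at_right (0::real))" "((\<lambda>t. 1 - t) \<longlongrightarrow> 1) (at_right (0::real))"
    by (auto intro!: tendsto_eq_intros)
  note * = order_tendstoD(2)[OF this(1), of "1 + \<eta>"] order_tendstoD(1)[OF this(2), OF \<eta>1]
    order_tendstoD(2)[OF this(3), of "1 + \<eta>"] order_tendstoD(1)[OF this(4), OF \<eta>1]
  have "\<forall>\<^sub>F t in at_right (0::real). 0 < t" by (simp add: eventually_at_filter)
  moreover have "\<forall>\<^sub>F t in at_right (0::real). t < 1/2"
    by (rule order_tendstoD(2)[OF tendsto_ident_at]) simp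
  moreover have "\<forall>\<^sub>F t in at_right (0::real). ((1 + t * W) * (1 + 2 * t) + 2 * t * c) / (1 - t) < 1 + \<eta>"
    using *(1) \<eta> by simp
  moreover have "\<forall>\<^sub>F t in at_right (0::real). 1 + t < 1 + \<eta>"
    using *(3) \<eta> by simp
  ultimately have "\<forall>\<^sub>F t in at_right (0::real). 0 < t \<and> t \<le> 1/2 \<and> 1 + t < 1 + \<eta> \<and> 1 / (1 + \<eta>) < 1 - t \<and>
    ((1 + t * W) * (1 + 2 * t) + 2 * t * c) / (1 - t) < 1 + \<eta> \<and>
    1 / (1 + \<eta>) < ((1 - t * W) * (1 - 2 * t) - 2 * t * c) / (1 + t)"
    using *(2,4) by eventually_elim simp
  then show ?thesis
    using eventually_happens'[of "at_right (0::real)"] by (auto simp: trivial_limit_at_right_real)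
qed

context body
begin

abbreviation "tangent_map x0 y \<equiv> y + (\<nu> x0 \<bullet> y) *\<^sub>R ((\<nu> x0 - x0) /\<^sub>R h (\<nu> x0))"

text \<open>The linear map \<open>tangent_map x0\<close> fixes the tangent directions at \<open>x0\<close> and sends \<open>x0\<close> to the
  unit normal there, so that followed by radial projection it is a near isometry from the boundary
  near \<open>x0\<close> to the unit sphere, and it maps cones over boundary pieces to cones over sphere pieces.\<close>

lemma tangent_map_near_isometry:
  assumes x0: "x0 \<in> frontier K" and \<eta>: "0 < \<eta>"
  defines "L \<equiv> tangent_map x0"
  shows "\<exists>r>0. \<forall>x\<in>frontier K \<inter> ball x0 r.
    1 / (1 + \<eta>) < norm (L x) \<and> norm (L x) < 1 + \<eta> \<and>
    norm (p x) \<le> (1 + \<eta>) * norm (p x0) \<and> norm (p x0) \<le> (1 + \<eta>) * norm (p x) \<and>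
    (\<forall>y\<in>frontier K \<inter> ball x0 r.
      dist (L x /\<^sub>R norm (L x)) (L y /\<^sub>R norm (L y)) \<le> (1 + \<eta>) * dist x y \<and>
      dist x y \<le> (1 + \<eta>) * dist (L x /\<^sub>R norm (L x)) (L y /\<^sub>R norm (L y)))"
proof -
  define w where "w = (\<nu> x0 - x0) /\<^sub>R h (\<nu> x0)"
  define W where "W = norm w"
  \<comment> \<open>The factor by which \<open>L\<close> multiplies the component along the
    normal.\<close>
  define c where "c = 1 / h (\<nu> x0)"
  let ?n = "\<nu> x0"
  note n = normal[OF x0] and h0 = h_normal_pos[OF x0]
  have c: "0 < c" using h0 by (simp add: c_def)
  have W: "0 \<le> W" by (simp add: W_def)
  have L: "L y = y + (?n \<bullet> y) *\<^sub>R w" for y by (simp add: L_def w_def)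
  have Ldiff: "L x - L y = L (x - y)" for x y by (simp add: L inner_simps algebra_simps)
  have nn: "?n \<bullet> ?n = 1" using n(1) by (simp add: norm_eq_1)
  have nw: "1 + ?n \<bullet> w = c"
    using h0 n(3) nn by (simp add: w_def c_def inner_simps inner_commute field_simps)
  have nL: "?n \<bullet> L y = c * (?n \<bullet> y)" for y
    using nw by (simp add: L inner_simps algebra_simps) (metis distrib_left mult.right_neutral mult.commute)
  have Lx0: "L x0 = ?n"
    using n(3) h0 by (simp add: L w_def inner_commute)
  obtain t where t: "0 < t" "t \<le> 1/2" "1 + t < 1 + \<eta>" "1 / (1 + \<eta>) < 1 - t"
    "((1 + t * W) * (1 + 2 * t) + 2 * t * c) / (1 - t) < 1 + \<eta>"
    "1 / (1 + \<eta>) < ((1 - t * W) * (1 - 2 * t) - 2 * t * c) / (1 + t)"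
    using ex_small_parameter[OF \<eta>, of W c] by blast
  obtain r1 where r1: "0 < r1" "\<And>y. y \<in> frontier K \<Longrightarrow> dist y x0 < r1 \<Longrightarrow> dist (\<nu> y) ?n < t"
    using continuous_normal x0 t(1) unfolding continuous_on_iff by meson
  \<comment> \<open>With this tolerance \<open>norm (p x0) - e\<close> equals
    \<open>norm (p x0) / (1 + \<eta>)\<close>, for the lower comparison, and
    \<open>e \<le> \<eta> * norm (p x0)\<close>, for the upper one.\<close>
  define e where "e = norm (p x0) * \<eta> / (1 + \<eta>)"
  have p0: "0 < norm (p x0)" using p_frontier(3)[OF x0] h0 by simp
  then have e: "0 < e" using \<eta> by (simp add: e_def)
  have "continuous_on (frontier K) (\<lambda>x. norm (p x))" by (intro continuous_intros continuous_p)
  then obtain r2 where r2: "0 < r2" "\<And>y. y \<in> frontier K \<Longrightarrow> dist y x0 < r2 \<Longrightarrow> dist (norm (p y)) (norm (p x0)) < e"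
    using x0 e unfolding continuous_on_iff by meson
  \<comment> \<open>The last bound keeps L x within t of the normal, since \<open>L\<close>
    stretches secants by at most 1 + t W.\<close>
  define r where "r = min (min r1 r2) (t / (1 + t * W))"
  have tW: "0 < 1 + t * W" using t(1) W by (simp add: add_pos_nonneg)
  have r: "0 < r" "r \<le> r1" "r \<le> r2" "r \<le> t / (1 + t * W)"
    using r1(1) r2(1) t(1) tW by (auto simp: r_def)
  let ?B = "frontier K \<inter> ball x0 r"
  have x0B: "x0 \<in> ?B" using x0 r by simp
  \<comment> \<open>Secants are nearly tangent: the supporting inequalities at the two endpoints
    bound the normal component from both sides, and both normals are t-close to the one at
    \<open>x0\<close>.\<close>
  have nd: "\<bar>?n \<bullet> (y - x)\<bar> \<le> t * norm (y - x)" if "x \<in> ?B" "y \<in> ?B" for x y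
  proof -
    have "?n \<bullet> (y - x) \<le> t * norm (y - x)" if "x \<in> ?B" "y \<in> ?B" for x y
    proof -
      have "?n \<bullet> (y - x) = (?n - \<nu> x) \<bullet> (y - x) + (y - x) \<bullet> \<nu> x" by (simp add: inner_simps inner_commute)
      also have "(y - x) \<bullet> \<nu> x \<le> 0" using that frontier_K by (intro normal(2)) auto
      also have "(?n - \<nu> x) \<bullet> (y - x) \<le> norm (?n - \<nu> x) * norm (y - x)" by (rule norm_cauchy_schwarz)
      also have "\<dots> \<le> t * norm (y - x)"
        using r1(2)[of x] that r by (intro mult_right_mono) (auto simp: dist_norm norm_minus_commute)
      finally show ?thesis by simp
    qed
    from this[OF that] this[OF that(2,1)] show ?thesis
      by (simp add: inner_diff_right norm_minus_commute abs_le_iff)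
  qed
  have Ld: "norm (L (y - x)) \<le> (1 + t * W) * norm (y - x)" "(1 - t * W) * norm (y - x) \<le> norm (L (y - x))"
    if "x \<in> ?B" "y \<in> ?B" for x y
  proof -
    have "norm ((?n \<bullet> (y - x)) *\<^sub>R w) \<le> t * norm (y - x) * W"
      using nd[OF that] W by (simp add: W_def mult_right_mono)
    then show "norm (L (y - x)) \<le> (1 + t * W) * norm (y - x)" "(1 - t * W) * norm (y - x) \<le> norm (L (y - x))"
      unfolding L using norm_triangle_ineq[of "y - x" "(?n \<bullet> (y - x)) *\<^sub>R w"]
        norm_diff_ineq[of "y - x" "(?n \<bullet> (y - x)) *\<^sub>R w"] by (auto simp: algebra_simps)
  qed
  have near: "norm (L x - ?n) \<le> t" if x: "x \<in> ?B" for x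
  proof -
    have "norm (L x - ?n) = norm (L (x - x0))" using Lx0 Ldiff[of x x0] by simp
    also have "\<dots> \<le> (1 + t * W) * norm (x - x0)" by (rule Ld(1)[OF x0B x])
    also have "\<dots> \<le> (1 + t * W) * (t / (1 + t * W))"
      using x r(4) tW by (intro mult_left_mono) (auto simp: dist_norm norm_minus_commute)
    finally show ?thesis using tW by simp
  qed
  show ?thesis
  proof (intro exI[of _ r] conjI ballI)
    fix x assume x: "x \<in> ?B"
    note normalise = normalise_near_unit[OF n(1) t(1,2) near[OF x]]
    have self: "\<bar>(L x - L x) \<bullet> ?n\<bar> \<le> 0" by simp
    show "1 / (1 + \<eta>) < norm (L x)" "norm (L x) < 1 + \<eta>"
      using normalise(3)[OF near[OF x] self] normalise(4)[OF near[OF x] self] t by auto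
    have "dist (norm (p x)) (norm (p x0)) < e" using r2(2)[of x] x r by (auto simp: dist_commute)
    then have px: "norm (p x) < norm (p x0) + e" "norm (p x0) - e < norm (p x)" by (auto simp: dist_real_def)
    have "e \<le> norm (p x0) * \<eta>" using p0 \<eta> by (simp add: e_def field_simps)
    then show "norm (p x) \<le> (1 + \<eta>) * norm (p x0)" using px by (simp add: algebra_simps)
    have "norm (p x0) - e = norm (p x0) / (1 + \<eta>)" using \<eta> by (simp add: e_def field_simps)
    then have "norm (p x0) / (1 + \<eta>) < norm (p x)" using px by simp
    then show "norm (p x0) \<le> (1 + \<eta>) * norm (p x)"
      using \<eta> by (simp add: pos_divide_less_eq mult.commute less_imp_le)
    fix y assume y: "y \<in> ?B"
    let ?d = "norm (y - x)" and ?q = "norm (L x - L y)" and ?s = "c * (t * norm (y - x))"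
    have s: "\<bar>(L y - L x) \<bullet> ?n\<bar> \<le> ?s"
    proof -
      have "\<bar>(L y - L x) \<bullet> ?n\<bar> = c * \<bar>?n \<bullet> (y - x)\<bar>"
        using c by (simp add: Ldiff inner_commute[of _ ?n] nL abs_mult)
      then show ?thesis using nd[OF x y] c by (simp add: mult_left_mono)
    qed
    have q: "?q \<le> (1 + t * W) * ?d" "(1 - t * W) * ?d \<le> ?q"
      using Ld[OF x y] by (simp_all add: Ldiff[symmetric] norm_minus_commute)
    let ?\<psi> = "norm (L x /\<^sub>R norm (L x) - L y /\<^sub>R norm (L y))"
    have d0: "0 \<le> ?d" by simp
    have "?\<psi> * (1 - t) \<le> ?q * (1 + 2 * t) + 2 * ?s"
      using normalise(1)[OF near[OF y] s] by (simp add: algebra_simps)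
    also have "?q * (1 + 2 * t) \<le> (1 + t * W) * ?d * (1 + 2 * t)"
      using q(1) t by (intro mult_right_mono) auto
    finally have "?\<psi> * (1 - t) \<le> ((1 + t * W) * (1 + 2 * t) + 2 * t * c) * ?d" by (simp add: algebra_simps)
    then have "?\<psi> \<le> ((1 + t * W) * (1 + 2 * t) + 2 * t * c) / (1 - t) * ?d"
      using t(2) by (simp add: field_simps)
    also have "\<dots> \<le> (1 + \<eta>) * ?d" using t(5) d0 by (intro mult_right_mono) auto
    finally show "dist (L x /\<^sub>R norm (L x)) (L y /\<^sub>R norm (L y)) \<le> (1 + \<eta>) * dist x y"
      by (simp add: dist_norm norm_minus_commute)
    have "(1 - t * W) * ?d * (1 - 2 * t) \<le> ?q * (1 - 2 * t)"
      using q(2) t by (intro mult_right_mono) auto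
    also have "\<dots> - 2 * ?s \<le> (1 + t) * ?\<psi>"
      using normalise(2)[OF near[OF y] s] by (simp add: algebra_simps)
    finally have "((1 - t * W) * (1 - 2 * t) - 2 * t * c) * ?d \<le> (1 + t) * ?\<psi>" by (simp add: algebra_simps)
    then have le: "((1 - t * W) * (1 - 2 * t) - 2 * t * c) / (1 + t) * ?d \<le> ?\<psi>"
      using t(1) by (simp add: field_simps)
    have "1 / (1 + \<eta>) * ?d \<le> ((1 - t * W) * (1 - 2 * t) - 2 * t * c) / (1 + t) * ?d"
      using t(6) d0 by (intro mult_right_mono) auto
    with le have "1 / (1 + \<eta>) * ?d \<le> ?\<psi>" by linarith
    then show "dist x y \<le> (1 + \<eta>) * dist (L x /\<^sub>R norm (L x)) (L y /\<^sub>R norm (L y))"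
      using \<eta> by (simp add: dist_norm norm_minus_commute field_simps)
  qed (rule r(1))
qed

text \<open>The cone over C, cut off by the boundary of K and without the origin, where x / N x has
  no meaning.\<close>

definition "sector C = {x \<in> K. x \<noteq> 0 \<and> x /\<^sub>R N x \<in> C}"

lemma sectorI:
  assumes "y \<in> C" "y \<in> frontier K" "0 < s" "s \<le> 1"
  shows "s *\<^sub>R y \<in> sector C"
proof -
  have "s *\<^sub>R y \<in> K" using assms by (simp add: K_iff_N N_scale N_frontier_eq)
  moreover have "s *\<^sub>R y \<noteq> 0" using assms zero_notin_frontier by auto
  moreover have "(s *\<^sub>R y) /\<^sub>R N (s *\<^sub>R y) \<in> C"
    using assms(1) by (simp only: hat_frontier[OF assms(2,3)])
  ultimately show ?thesis by (simp add: sector_def)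
qed

lemma p_hat_measurable [measurable]:
  "(\<lambda>x. indicator (- {0}) x *\<^sub>R p (x /\<^sub>R N x)) \<in> borel_measurable borel"
  by (rule borel_measurable_continuous_on_indicator[OF _ continuous_p_hat]) (auto intro: borel_open)

lemma sector_borel [measurable]: "C \<in> sets borel \<Longrightarrow> sector C \<in> sets borel"
  using closed_K unfolding sector_def by (measurable, auto intro!: borel_closed)

text \<open>Both maps are rank-one perturbations of the identity, and n . x0 = h turns their
  determinants 1 + n . w into 1 / h and h.\<close>

lemma tangent_map_inverse:
  assumes x0: "x0 \<in> frontier K"
  defines "L \<equiv> tangent_map x0" and "L' \<equiv> \<lambda>y. y + (\<nu> x0 \<bullet> y) *\<^sub>R (x0 - \<nu> x0)"
  shows "L' (L y) = y" "linear L" "bij L" "linear L'" "bij L'"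
    "vimage_scale L = h (\<nu> x0)" "vimage_scale L' = 1 / h (\<nu> x0)"
proof -
  have h0: "0 < h (\<nu> x0)" by (rule h_normal_pos[OF x0])
  have nn: "\<nu> x0 \<bullet> \<nu> x0 = 1" using normal(1)[OF x0] by (simp add: norm_eq_1)
  have L: "1 + \<nu> x0 \<bullet> ((\<nu> x0 - x0) /\<^sub>R h (\<nu> x0)) = 1 / h (\<nu> x0)"
    using h0 nn normal(3)[OF x0] by (simp add: inner_simps inner_commute field_simps)
  have L': "1 + \<nu> x0 \<bullet> (x0 - \<nu> x0) = h (\<nu> x0)"
    using nn normal(3)[OF x0] by (simp add: inner_simps inner_commute)
  have "\<nu> x0 \<bullet> L y = (\<nu> x0 \<bullet> y) * (1 + \<nu> x0 \<bullet> ((\<nu> x0 - x0) /\<^sub>R h (\<nu> x0)))"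
    by (simp add: L_def inner_add_right distrib_left)
  then have nL: "\<nu> x0 \<bullet> L y = (\<nu> x0 \<bullet> y) / h (\<nu> x0)" unfolding L by simp
  have "L' (L y) = y + (\<nu> x0 \<bullet> y) *\<^sub>R ((\<nu> x0 - x0) /\<^sub>R h (\<nu> x0)) + ((\<nu> x0 \<bullet> y) / h (\<nu> x0)) *\<^sub>R (x0 - \<nu> x0)"
    unfolding L'_def nL by (simp add: L_def)
  also have "\<dots> = y"
    by (simp add: divide_inverse scaleR_diff_right)
  finally show "L' (L y) = y" .
  show "linear L" "bij L"
    unfolding L_def using bij_add_rank_one[of "\<nu> x0" "(\<nu> x0 - x0) /\<^sub>R h (\<nu> x0)"] L h0 by auto
  show "linear L'" "bij L'"
    unfolding L'_def using bij_add_rank_one[of "\<nu> x0" "x0 - \<nu> x0"] L' h0 by auto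
  show "vimage_scale L = h (\<nu> x0)"
    unfolding L_def using L h0 by (subst vimage_scale_add_rank_one) auto
  show "vimage_scale L' = 1 / h (\<nu> x0)"
    unfolding L'_def using L' h0 by (subst vimage_scale_add_rank_one) auto
qed

lemma emeasure_homothety_linear_vimage:
  fixes f :: "real^'n \<Rightarrow> real^'n"
  assumes "0 < c" "linear f" "bij f" "A \<in> sets borel"
  shows "emeasure lborel ((\<lambda>x. c *\<^sub>R f x) -` A) = ennreal (vimage_scale f / c ^ CARD('n)) * emeasure lborel A"
proof -
  note hom = vimage_scale_homothety[OF assms(1), where 'a = "real^'n"]
  have "(\<lambda>x. c *\<^sub>R f x) = (\<lambda>x. c *\<^sub>R x) \<circ> f" by auto
  moreover have "linear ((\<lambda>x. c *\<^sub>R x) \<circ> f)" "bij ((\<lambda>x. c *\<^sub>R x) \<circ> f)"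
    using assms hom by (auto intro: linear_compose bij_comp)
  ultimately show ?thesis
    using assms(4) vimage_scale_compose[OF hom(2,3) assms(2,3)] hom(1)
    by (simp add: emeasure_linear_vimage)
qed

text \<open>A linear map takes cones to cones, so only the cut-off differs: on C the length of L x
  lies between 1 / (1 + \<eta>) and 1 + \<eta> instead of being 1. Shrinking by c = 1 / (1 + \<eta>)
  yields an inclusion in each direction and costs (1 + \<eta>)^m.\<close>

lemma sector_comparison:
  assumes x0: "x0 \<in> frontier K" and \<eta>: "0 < \<eta>"
  defines "L \<equiv> tangent_map x0"
  assumes C: "C \<subseteq> frontier K" "C \<in> sets borel" "(\<lambda>x. L x /\<^sub>R norm (L x)) ` C \<in> sets borel"
    and L: "\<And>x. x \<in> C \<Longrightarrow> 1 / (1 + \<eta>) < norm (L x)" "\<And>x. x \<in> C \<Longrightarrow> norm (L x) < 1 + \<eta>"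
  defines "S \<equiv> {x \<in> ball 0 1. x /\<^sub>R norm x \<in> (\<lambda>x. L x /\<^sub>R norm (L x)) ` C}"
  shows "emeasure lborel S \<le> ennreal ((1 + \<eta>) ^ CARD('n) * norm (p x0)) * emeasure lborel (sector C)"
    "emeasure lborel (sector C) \<le> ennreal ((1 + \<eta>) ^ CARD('n) / norm (p x0)) * emeasure lborel S"
proof -
  define L' where "L' = (\<lambda>y. y + (\<nu> x0 \<bullet> y) *\<^sub>R (x0 - \<nu> x0))"
  have inv: "L' (L y) = y" "linear L" "bij L" "linear L'" "bij L'"
    "vimage_scale L = h (\<nu> x0)" "vimage_scale L' = 1 / h (\<nu> x0)" for y
    unfolding L_def L'_def by (rule tangent_map_inverse[OF x0])+
  define c where "c = 1 / (1 + \<eta>)"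
  have c: "0 < c" "1 / c = 1 + \<eta>" using \<eta> by (auto simp: c_def)
  have p0: "norm (p x0) = 1 / h (\<nu> x0)" by (rule p_frontier(3)[OF x0])
  have Lpos: "0 < norm (L x)" if "x \<in> C" for x
    using less_trans[OF c(1), of "norm (L x)"] L(1)[OF that] unfolding c_def .
  have [measurable]: "(\<lambda>x. L x /\<^sub>R norm (L x)) ` C \<in> sets borel" by (rule C(3))
  have Sm: "S \<in> sets borel" unfolding S_def by measurable
  have "S \<subseteq> (\<lambda>x. c *\<^sub>R L' x) -` sector C"
  proof
    fix x assume "x \<in> S"
    then obtain y where y: "y \<in> C" "x /\<^sub>R norm x = L y /\<^sub>R norm (L y)" and x1: "norm x < 1" by (auto simp: S_def)
    have "x \<noteq> 0"
      using y Lpos[OF y(1)] by auto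
    then have "x = norm x *\<^sub>R (x /\<^sub>R norm x)" by simp
    then have x: "x = (norm x / norm (L y)) *\<^sub>R L y" unfolding y(2) by (simp add: divide_inverse)
    let ?s = "c * (norm x / norm (L y))"
    have "L' x = (norm x / norm (L y)) *\<^sub>R y"
      by (subst x) (simp add: linear_scale[OF inv(4)] inv(1))
    then have cx: "c *\<^sub>R L' x = ?s *\<^sub>R y" by simp
    have s0: "0 < ?s" using c \<open>x \<noteq> 0\<close> Lpos[OF y(1)] by simp
    have "c * norm x \<le> c * 1" using x1 c by (intro mult_left_mono) auto
    then have "c * norm x \<le> norm (L y)" using L(1)[OF y(1)] unfolding c_def by linarith
    then have s1: "?s \<le> 1" using Lpos[OF y(1)] by (simp add: field_simps)
    have yf: "y \<in> frontier K" using C(1) y(1) by blast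
    have "?s *\<^sub>R y \<in> sector C" by (rule sectorI[OF y(1) yf s0 s1])
    then show "x \<in> (\<lambda>x. c *\<^sub>R L' x) -` sector C" using cx by simp
  qed
  then have "emeasure lborel S \<le> emeasure lborel ((\<lambda>x. c *\<^sub>R L' x) -` sector C)"
  proof (rule emeasure_mono)
    have "(\<lambda>x. c *\<^sub>R L' x) \<in> borel \<rightarrow>\<^sub>M borel"
      using inv(4) by (intro linear_borel_measurable linear_compose_scale_right)
    then show "(\<lambda>x. c *\<^sub>R L' x) -` sector C \<in> sets lborel"
      using measurable_sets_borel[OF _ sector_borel[OF C(2)]] by simp
  qed
  also have "\<dots> = ennreal (vimage_scale L' / c ^ CARD('n)) * emeasure lborel (sector C)"
    using c(1) inv(4,5) sector_borel[OF C(2)] by (rule emeasure_homothety_linear_vimage)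
  also have "vimage_scale L' / c ^ CARD('n) = (1 + \<eta>) ^ CARD('n) * norm (p x0)"
    using c by (simp add: inv(7) p0 c_def power_divide)
  finally show "emeasure lborel S \<le> ennreal ((1 + \<eta>) ^ CARD('n) * norm (p x0)) * emeasure lborel (sector C)" .
  have "sector C \<subseteq> (\<lambda>x. c *\<^sub>R L x) -` S"
  proof
    fix x assume x: "x \<in> sector C"
    define y where "y = x /\<^sub>R N x"
    have y: "y \<in> C" "x \<noteq> 0" "N x \<le> 1" using x by (auto simp: sector_def y_def K_iff_N)
    have N0: "0 < N x" using y(2) by (rule N_pos)
    let ?s = "c * N x"
    have s0: "0 < ?s" using c N0 by simp
    have "x = N x *\<^sub>R y" using N0 by (simp add: y_def)
    then have cx: "c *\<^sub>R L x = ?s *\<^sub>R L y" by (metis linear_scale[OF inv(2)] scaleR_scaleR)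
    have "norm (?s *\<^sub>R L y) = c * (N x * norm (L y))" using c(1) N0 by (simp add: abs_mult)
    also have "\<dots> \<le> c * (1 * norm (L y))" using c y(3) by (intro mult_left_mono mult_right_mono) auto
    also have "\<dots> < c * (1 + \<eta>)" using c L(2)[OF y(1)] by simp
    also have "\<dots> = 1" using c \<eta> by (simp add: c_def)
    finally have "norm (?s *\<^sub>R L y) < 1" .
    moreover have eq: "(?s *\<^sub>R L y) /\<^sub>R norm (?s *\<^sub>R L y) = L y /\<^sub>R norm (L y)"
      using c(1) N0 by (simp add: abs_mult field_simps)
    moreover have "(?s *\<^sub>R L y) /\<^sub>R norm (?s *\<^sub>R L y) \<in> (\<lambda>x. L x /\<^sub>R norm (L x)) ` C"
      unfolding eq using y(1) by blast
    ultimately have "?s *\<^sub>R L y \<in> S" unfolding S_def by simp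
    then show "x \<in> (\<lambda>x. c *\<^sub>R L x) -` S" using cx by simp
  qed
  then have "emeasure lborel (sector C) \<le> emeasure lborel ((\<lambda>x. c *\<^sub>R L x) -` S)"
  proof (rule emeasure_mono)
    have "(\<lambda>x. c *\<^sub>R L x) \<in> borel \<rightarrow>\<^sub>M borel"
      using inv(2) by (intro linear_borel_measurable linear_compose_scale_right)
    then show "(\<lambda>x. c *\<^sub>R L x) -` S \<in> sets lborel"
      using measurable_sets_borel[OF _ Sm] by simp
  qed
  also have "\<dots> = ennreal (vimage_scale L / c ^ CARD('n)) * emeasure lborel S"
    using c(1) inv(2,3) Sm by (rule emeasure_homothety_linear_vimage)
  also have "vimage_scale L / c ^ CARD('n) = (1 + \<eta>) ^ CARD('n) / norm (p x0)"
    using c by (simp add: inv(6) p0 c_def power_divide)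
  finally show "emeasure lborel (sector C) \<le> ennreal ((1 + \<eta>) ^ CARD('n) / norm (p x0)) * emeasure lborel S" .
qed

end

section \<open>Surface measure as the projection of a weighted volume\<close>

lemma ennreal_le_of_le_powers:
  assumes "\<And>\<eta>. 0 < \<eta> \<Longrightarrow> a \<le> ennreal ((1 + \<eta>) ^ q) * b" "b < \<infinity>"
  shows "a \<le> b"
proof -
  obtain b' where b': "0 \<le> b'" "b = ennreal b'" using assms(2) by (cases b) auto
  let ?f = "\<lambda>n. ennreal ((1 + 1 / real (Suc n)) ^ q * b')"
  have "(\<lambda>n. 1 / real (Suc n)) \<longlonglongrightarrow> 0" by real_asymp
  then have "?f \<longlonglongrightarrow> ennreal ((1 + 0) ^ q * b')"
    by (intro tendsto_ennrealI tendsto_intros)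
  moreover have "a \<le> ?f n" for n
    using assms(1)[of "1 / real (Suc n)"] b' by (simp add: ennreal_mult')
  ultimately have "a \<le> ennreal ((1 + 0) ^ q * b')"
    by (intro LIMSEQ_le_const) blast+
  then show ?thesis using b' by simp
qed

definition ten :: "real^'n \<Rightarrow> real^'n \<Rightarrow> real^'n^'n" where
  "ten x q = (\<chi> i j. x $ i * q $ j)"

lemma tensor_inner: "tensor x (\<lambda>z. z \<bullet> q) = ten x q"
  by (simp add: tensor_def ten_def matrix_def vec_eq_iff inner_axis' mult.commute)

lemma continuous_on_ten [continuous_intros]:
  "continuous_on A f \<Longrightarrow> continuous_on A g \<Longrightarrow> continuous_on A (\<lambda>x. ten (f x) (g x))"
  unfolding ten_def by (intro continuous_on_vec_lambda continuous_intros)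

context body
begin

text \<open>The area of the unit sphere divided by the volume of the unit ball. It multiplies the
  tensor integral and its normalisation alike and cancels in
  \<open>isotropy_tensor_eq\<close>.\<close>

definition "c0 = enn2real (hausdorff_outer (CARD('n) - 1) (sphere (0 :: real^'n) 1)) / unit_ball_vol (real CARD('n))"

text \<open>On K without the origin this is 1 / h at the normal of x / N x. It is expressed through
  \<open>p\<close>, whose composition with x / N x is continuous off the origin, so that it is
  measurable.\<close>

definition "weight x = indicator K x * norm (indicator (- {0}) x *\<^sub>R p (x /\<^sub>R N x))"

definition "cone_measure = distr (density lborel (\<lambda>x. ennreal (c0 * weight x))) borel (\<lambda>x. x /\<^sub>R N x)"

lemma c0_pos: "CARD('n) \<ge> 2 \<Longrightarrow> 0 < c0"
  using hausdorff_sphere_pos[where 'n = 'n] hausdorff_sphere_finite[where 'n = 'n]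
  by (simp add: c0_def enn2real_positive_iff)

lemma hausdorff_sphere_lebesgue:
  fixes A :: "(real^'n) set"
  assumes card: "CARD('n) \<ge> 2" and A: "A \<in> sets borel" "A \<subseteq> sphere 0 1"
  shows "hausdorff_outer (CARD('n) - 1) A = ennreal c0 * emeasure lborel {x \<in> ball 0 1. x /\<^sub>R norm x \<in> A}"
proof -
  let ?H = "hausdorff_outer (CARD('n) - 1) (sphere (0 :: real^'n) 1)" and ?V = "unit_ball_vol (real CARD('n))"
  let ?L = "emeasure lborel {x \<in> ball 0 1. x /\<^sub>R norm x \<in> A}"
  have H: "?H = ennreal (c0 * ?V)"
    using hausdorff_sphere_finite[OF card] by (simp add: c0_def)
  have "hausdorff_outer (CARD('n) - 1) A = ?H * (?L / ennreal ?V)"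
    using hausdorff_sphere_eq[OF card A(1)] A(2)
    by (simp add: Int_absorb1 emeasure_sphere_prob[OF A(1)] emeasure_unit_ball)
  also have "\<dots> = ennreal c0 * (ennreal ?V * ?L / ennreal ?V)"
    unfolding H using c0_pos[OF card] by (simp add: ennreal_mult' ennreal_times_divide mult.assoc)
  also have "ennreal ?V * ?L / ennreal ?V = ?L"
    using mult_divide_eq_ennreal[of "ennreal ?V" ?L] by (simp add: mult.commute)
  finally show ?thesis .
qed

lemma K_borel [measurable]: "K \<in> sets borel"
  using closed_K by (rule borel_closed)

lemma frontier_borel [measurable]: "frontier K \<in> sets borel"
  by (rule borel_closed) simp

lemma weight_measurable [measurable]: "weight \<in> borel_measurable borel"
  unfolding weight_def[abs_def] by measurable

lemma weight_nonneg: "0 \<le> weight x"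
  by (simp add: weight_def)

lemma emeasure_cone_measure:
  assumes [measurable]: "C \<in> sets borel" and card: "CARD('n) \<ge> 2"
  shows "emeasure cone_measure C = (\<integral>\<^sup>+x\<in>sector C. ennreal (c0 * norm (p (x /\<^sub>R N x))) \<partial>lborel)"
proof -
  have "(\<lambda>x. x /\<^sub>R N x) -` C \<in> sets borel"
    using measurable_sets_borel[OF _ assms(1), of "\<lambda>x. x /\<^sub>R N x"] by measurable
  then have "emeasure cone_measure C = (\<integral>\<^sup>+x. ennreal (c0 * weight x) * indicator ((\<lambda>x. x /\<^sub>R N x) -` C) x \<partial>lborel)"
    unfolding cone_measure_def by (subst emeasure_distr) (auto simp: emeasure_density)
  also have "\<dots> = (\<integral>\<^sup>+x\<in>sector C. ennreal (c0 * norm (p (x /\<^sub>R N x))) \<partial>lborel)"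
    by (intro nn_integral_cong) (auto simp: weight_def sector_def indicator_def)
  finally show ?thesis .
qed

lemma cone_measure_bounds:
  assumes C: "C \<in> sets borel" and card: "CARD('n) \<ge> 2" and ab: "0 \<le> a" "\<And>y. y \<in> C \<Longrightarrow> a \<le> norm (p y) \<and> norm (p y) \<le> b"
  shows "ennreal (c0 * a) * emeasure lborel (sector C) \<le> emeasure cone_measure C"
    "emeasure cone_measure C \<le> ennreal (c0 * b) * emeasure lborel (sector C)"
proof -
  note c0 = c0_pos[OF card]
  have S: "sector C \<in> sets lborel" using sector_borel[OF C] by simp
  have *: "emeasure lborel (sector C) * ennreal c = (\<integral>\<^sup>+x\<in>sector C. ennreal c \<partial>lborel)" for c
    using S by (simp add: mult.commute nn_integral_cmult_indicator)
  have hat: "x /\<^sub>R N x \<in> C" if "x \<in> sector C" for x using that by (simp add: sector_def)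
  show "ennreal (c0 * a) * emeasure lborel (sector C) \<le> emeasure cone_measure C"
    unfolding emeasure_cone_measure[OF C card] mult.commute[of "ennreal (c0 * a)"] *
    using hat ab c0 by (intro nn_integral_mono) (auto simp: indicator_def intro!: ennreal_leI)
  show "emeasure cone_measure C \<le> ennreal (c0 * b) * emeasure lborel (sector C)"
    unfolding emeasure_cone_measure[OF C card] mult.commute[of "ennreal (c0 * b)"] *
    using hat ab c0 by (intro nn_integral_mono) (auto simp: indicator_def intro!: ennreal_leI)
qed

lemma sets_cone_measure [simp]: "sets cone_measure = sets borel"
  by (simp add: cone_measure_def)

lemma emeasure_cone_measure_frontier:
  assumes "A \<in> sets borel" "CARD('n) \<ge> 2"
  shows "emeasure cone_measure A = emeasure cone_measure (frontier K \<inter> A)"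
proof -
  have "sector A = sector (frontier K \<inter> A)" using N_frontier by (auto simp: sector_def)
  moreover have "frontier K \<inter> A \<in> sets borel" using assms(1) by (auto intro: borel_closed)
  ultimately show ?thesis using assms by (simp add: emeasure_cone_measure)
qed

lemma finite_measure_cone_measure:
  assumes card: "CARD('n) \<ge> 2"
  shows "finite_measure cone_measure"
proof
  have "emeasure cone_measure (space cone_measure) = emeasure cone_measure (frontier K \<inter> UNIV)"
    using emeasure_cone_measure_frontier[OF _ card, of UNIV] by (simp add: cone_measure_def)
  also have "\<dots> \<le> ennreal (c0 * M) * emeasure lborel (sector (frontier K \<inter> UNIV))"
    using M by (intro cone_measure_bounds(2)[OF _ card, of _ 0]) (auto intro: borel_closed)
  also have "\<dots> < \<infinity>"
    using emeasure_bounded_finite[OF bounded_subset[OF bounded_K, of "sector (frontier K \<inter> UNIV)"]]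
    by (auto simp: ennreal_mult_less_top sector_def)
  finally show "emeasure cone_measure (space cone_measure) \<noteq> \<infinity>" by simp
qed

text \<open>The chain near \<open>x0\<close> runs from the Hausdorff measure of C to that of its
  image on the sphere, the volume of the cone over the image, the volume of the sector over C, and
  the cone measure of C. The losses are (1 + \<eta>)^(m-1) for the Lipschitz step, (1 + \<eta>)^m
  for the sector and 1 + \<eta> for freezing \<open>norm (p x)\<close> at \<open>x0\<close>:
  together the power 2 m.\<close>

lemma local_comparison:
  assumes card: "CARD('n) \<ge> 2" and x0: "x0 \<in> frontier K" and \<eta>: "0 < \<eta>"
  shows "\<exists>r>0. \<forall>C. compact C \<and> C \<subseteq> frontier K \<inter> ball x0 r \<longrightarrow>
    hausdorff_outer (CARD('n) - 1) C \<le> ennreal ((1 + \<eta>) ^ (2 * CARD('n))) * emeasure cone_measure C \<and>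
    emeasure cone_measure C \<le> ennreal ((1 + \<eta>) ^ (2 * CARD('n))) * hausdorff_outer (CARD('n) - 1) C"
proof -
  let ?m = "CARD('n)" and ?k = "CARD('n) - 1"
  define L where "L y = tangent_map x0 y" for y
  define \<psi> where "\<psi> x = L x /\<^sub>R norm (L x)" for x
  obtain r where r: "0 < r" and near: "\<And>x. x \<in> frontier K \<inter> ball x0 r \<Longrightarrow>
      1 / (1 + \<eta>) < norm (L x) \<and> norm (L x) < 1 + \<eta> \<and>
      norm (p x) \<le> (1 + \<eta>) * norm (p x0) \<and> norm (p x0) \<le> (1 + \<eta>) * norm (p x)"
    and lip: "\<And>x y. x \<in> frontier K \<inter> ball x0 r \<Longrightarrow> y \<in> frontier K \<inter> ball x0 r \<Longrightarrow>
      dist (\<psi> x) (\<psi> y) \<le> (1 + \<eta>) * dist x y \<and> dist x y \<le> (1 + \<eta>) * dist (\<psi> x) (\<psi> y)"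
    using tangent_map_near_isometry[OF x0 \<eta>] unfolding L_def[symmetric] \<psi>_def[symmetric] by blast
  have p0: "0 < norm (p x0)" using p_frontier(3)[OF x0] h_normal_pos[OF x0] by simp
  have \<eta>1: "0 < 1 + \<eta>" using \<eta> by simp
  have c0: "0 < c0" by (rule c0_pos[OF card])
  have m: "?m = Suc ?k" using card by simp
  show ?thesis
  proof (intro exI[of _ r] conjI allI impI)
    fix C assume C: "compact C \<and> C \<subseteq> frontier K \<inter> ball x0 r"
    then have Cf: "C \<subseteq> frontier K" and Cb: "C \<in> sets borel" by (auto intro: borel_compact)
    have CB: "x \<in> frontier K \<inter> ball x0 r" if "x \<in> C" for x using C that by blast
    have "(1 + \<eta>)-lipschitz_on C \<psi>"
      using lip CB \<eta>1 by (intro lipschitz_onI) auto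
    then have "compact (\<psi> ` C)"
      using C lipschitz_on_continuous_on compact_continuous_image by blast
    then have \<psi>b: "\<psi> ` C \<in> sets borel" by (rule borel_compact)
    have inj: "inj_on \<psi> C"
    proof (rule inj_onI)
      fix x y assume "x \<in> C" "y \<in> C" "\<psi> x = \<psi> y"
      then show "x = y" using lip[OF CB CB, of x y] by simp
    qed
    define S where "S = {x \<in> ball 0 1. x /\<^sub>R norm x \<in> \<psi> ` C}"
    have Lpos: "0 < norm (L x)" if "x \<in> C" for x
    proof -
      have "0 < 1 / (1 + \<eta>)" using \<eta>1 by simp
      also have "\<dots> < norm (L x)" using near[OF CB[OF that]] by simp
      finally show ?thesis .
    qed
    have sph: "\<psi> ` C \<subseteq> sphere 0 1" using Lpos by (auto simp: \<psi>_def)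
    have H\<psi>: "hausdorff_outer ?k (\<psi> ` C) = ennreal c0 * emeasure lborel S"
      unfolding S_def by (rule hausdorff_sphere_lebesgue[OF card \<psi>b sph])
    have cmp: "emeasure lborel S \<le> ennreal ((1 + \<eta>) ^ ?m * norm (p x0)) * emeasure lborel (sector C)"
      "emeasure lborel (sector C) \<le> ennreal ((1 + \<eta>) ^ ?m / norm (p x0)) * emeasure lborel S"
      using sector_comparison[OF x0 \<eta> Cf Cb] \<psi>b near CB
      unfolding S_def \<psi>_def[abs_def] L_def by blast+
    have b: "norm (p x0) / (1 + \<eta>) \<le> norm (p y) \<and> norm (p y) \<le> (1 + \<eta>) * norm (p x0)" if "y \<in> C" for y
      using near[OF CB[OF that]] \<eta>1 by (simp add: pos_divide_le_eq mult.commute)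
    have cm: "ennreal (c0 * (norm (p x0) / (1 + \<eta>))) * emeasure lborel (sector C) \<le> emeasure cone_measure C"
      "emeasure cone_measure C \<le> ennreal (c0 * ((1 + \<eta>) * norm (p x0))) * emeasure lborel (sector C)"
      using cone_measure_bounds[OF Cb card _ b] \<eta>1 by auto
    have lip1: "hausdorff_outer ?k (\<psi> ` C) \<le> ennreal ((1 + \<eta>) ^ ?k) * hausdorff_outer ?k C"
      using lip CB \<eta>1 by (intro hausdorff_outer_lipschitz) auto
    have "hausdorff_outer ?k (inv_into C \<psi> ` (\<psi> ` C)) \<le> ennreal ((1 + \<eta>) ^ ?k) * hausdorff_outer ?k (\<psi> ` C)"
    proof (rule hausdorff_outer_lipschitz[OF \<eta>1])
      fix a b assume "a \<in> \<psi> ` C" "b \<in> \<psi> ` C"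
      then obtain x y where "x \<in> C" "y \<in> C" "a = \<psi> x" "b = \<psi> y" by blast
      then show "dist (inv_into C \<psi> a) (inv_into C \<psi> b) \<le> (1 + \<eta>) * dist a b"
        using lip[OF CB CB, of x y] inj by simp
    qed
    then have lip2: "hausdorff_outer ?k C \<le> ennreal ((1 + \<eta>) ^ ?k) * hausdorff_outer ?k (\<psi> ` C)"
      by (simp add: inv_into_image_cancel[OF inj order.refl])
    have pw: "(1 + \<eta>) ^ (2 * ?m) = (1 + \<eta>) ^ ?k * ((1 + \<eta>) ^ ?m * (1 + \<eta>))"
    proof -
      have "2 * ?m = ?k + (?m + 1)" using m by linarith
      then show ?thesis by (simp only: power_add power_one_right)
    qed
    have "hausdorff_outer ?k C \<le> ennreal ((1 + \<eta>) ^ ?k) * (ennreal c0 * (ennreal ((1 + \<eta>) ^ ?m * norm (p x0)) * emeasure lborel (sector C)))"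
      using lip2 unfolding H\<psi> by (rule order_trans) (intro mult_left_mono cmp(1); simp)
    also have "\<dots> = ennreal ((1 + \<eta>) ^ (2 * ?m)) * (ennreal (c0 * (norm (p x0) / (1 + \<eta>))) * emeasure lborel (sector C))"
    proof -
      have "(1 + \<eta>) ^ ?k * (c0 * ((1 + \<eta>) ^ ?m * norm (p x0))) = (1 + \<eta>) ^ (2 * ?m) * (c0 * (norm (p x0) / (1 + \<eta>)))"
        unfolding pw using \<eta>1 by simp
      moreover have "ennreal A * (ennreal B * (ennreal D * X)) = ennreal (A * (B * D)) * X"
        "ennreal A * (ennreal B * X) = ennreal (A * B) * X" if "0 \<le> A" "0 \<le> B" for A B D X
        using that by (simp_all add: ennreal_mult' mult.assoc)
      ultimately show ?thesis using c0 p0 \<eta>1 by simp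
    qed
    also have "\<dots> \<le> ennreal ((1 + \<eta>) ^ (2 * ?m)) * emeasure cone_measure C"
      by (intro mult_left_mono cm(1)) simp
    finally show "hausdorff_outer ?k C \<le> ennreal ((1 + \<eta>) ^ (2 * ?m)) * emeasure cone_measure C" .
    have "emeasure cone_measure C \<le> ennreal (c0 * ((1 + \<eta>) * norm (p x0))) * (ennreal ((1 + \<eta>) ^ ?m / norm (p x0)) * emeasure lborel S)"
      using cm(2) by (rule order_trans) (intro mult_left_mono cmp(2); simp)
    also have "\<dots> = ennreal ((1 + \<eta>) ^ ?m * (1 + \<eta>)) * (ennreal c0 * emeasure lborel S)"
      unfolding mult.assoc[symmetric] using c0 p0 \<eta>1
      by (simp flip: ennreal_mult' add: mult_ac)
    also have "\<dots> \<le> ennreal ((1 + \<eta>) ^ ?m * (1 + \<eta>)) * (ennreal ((1 + \<eta>) ^ ?k) * hausdorff_outer ?k C)"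
      using lip1 unfolding H\<psi> by (intro mult_left_mono) simp_all
    also have "\<dots> = ennreal ((1 + \<eta>) ^ (2 * ?m)) * hausdorff_outer ?k C"
    proof -
      have "(1 + \<eta>) ^ (2 * ?m) = ((1 + \<eta>) ^ ?m * (1 + \<eta>)) * (1 + \<eta>) ^ ?k" unfolding pw by simp
      then show ?thesis using \<eta>1 by (simp only: ennreal_mult' mult.assoc zero_le_power zero_le_mult_iff less_imp_le simp_thms)
    qed
    finally show "emeasure cone_measure C \<le> ennreal ((1 + \<eta>) ^ (2 * ?m)) * hausdorff_outer ?k C" .
  qed (rule r)
qed

text \<open>A density on the whole space, so that an equation with \<open>cone_measure\<close> makes
  sense; the space of \<open>surface_measure\<close> is the boundary.\<close>

definition "boundary_hausdorff = density (hausdorff_measure (CARD('n) - 1)) (\<lambda>x. ennreal (indicator (frontier K) x))"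

lemma emeasure_boundary_hausdorff:
  "A \<in> sets borel \<Longrightarrow> emeasure boundary_hausdorff A = hausdorff_outer (CARD('n) - 1) (frontier K \<inter> A)"
proof -
  assume A: "A \<in> sets borel"
  let ?H = "hausdorff_measure (CARD('n) - 1) :: (real^'n) measure"
  have "emeasure boundary_hausdorff A = (\<integral>\<^sup>+x. ennreal (indicator (frontier K) x) * indicator A x \<partial>?H)"
  proof -
    have "(\<lambda>x. ennreal (indicator (frontier K) x)) \<in> borel_measurable ?H" by measurable
    then show ?thesis using A unfolding boundary_hausdorff_def by (intro emeasure_density) simp_all
  qed
  also have "\<dots> = (\<integral>\<^sup>+x. indicator (frontier K \<inter> A) x \<partial>?H)"
    by (intro nn_integral_cong) (simp add: indicator_def)
  also have "\<dots> = hausdorff_outer (CARD('n) - 1) (frontier K \<inter> A)"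
    using A by (simp add: emeasure_hausdorff_measure)
  finally show ?thesis .
qed

text \<open>The local bounds become global for each \<eta>, and then \<eta> tends to 0. The order
  matters: at first only the cone measure is known to be finite, and the inequality against it
  supplies the finiteness of Hausdorff measure on which the reverse inequality relies.\<close>

theorem boundary_hausdorff_eq_cone_measure:
  assumes card: "CARD('n) \<ge> 2"
  shows "boundary_hausdorff = cone_measure"
proof (rule measure_eqI)
  show sets: "sets boundary_hausdorff = sets cone_measure" by (simp add: boundary_hausdorff_def)
  then have sets': "sets boundary_hausdorff = sets borel" by simp
  interpret cm: finite_measure cone_measure by (rule finite_measure_cone_measure[OF card])
  have fb: "frontier K \<in> sets borel" by (auto intro: borel_closed)
  have null: "emeasure boundary_hausdorff (- frontier K) = 0" "emeasure cone_measure (- frontier K) = 0"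
    using fb emeasure_cone_measure_frontier[OF _ card, of "- frontier K"]
    by (auto simp: emeasure_boundary_hausdorff borel_open)
  have loc: "\<exists>r>0. \<forall>C. compact C \<and> C \<subseteq> frontier K \<inter> ball x r \<longrightarrow>
      emeasure boundary_hausdorff C \<le> ennreal ((1 + \<eta>) ^ (2 * CARD('n))) * emeasure cone_measure C"
    "\<exists>r>0. \<forall>C. compact C \<and> C \<subseteq> frontier K \<inter> ball x r \<longrightarrow>
      emeasure cone_measure C \<le> ennreal ((1 + \<eta>) ^ (2 * CARD('n))) * emeasure boundary_hausdorff C"
    if \<eta>: "0 < \<eta>" and x: "x \<in> frontier K" for \<eta> x
  proof -
    obtain r where r: "0 < r" "\<And>C. compact C \<Longrightarrow> C \<subseteq> frontier K \<inter> ball x r \<Longrightarrow>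
      hausdorff_outer (CARD('n) - 1) C \<le> ennreal ((1 + \<eta>) ^ (2 * CARD('n))) * emeasure cone_measure C \<and>
      emeasure cone_measure C \<le> ennreal ((1 + \<eta>) ^ (2 * CARD('n))) * hausdorff_outer (CARD('n) - 1) C"
      using local_comparison[OF card x \<eta>] by blast
    have "emeasure boundary_hausdorff C = hausdorff_outer (CARD('n) - 1) C"
      if "compact C" "C \<subseteq> frontier K \<inter> ball x r" for C
      using that by (subst emeasure_boundary_hausdorff) (auto intro: borel_compact simp: Int_absorb1)
    then show "\<exists>r>0. \<forall>C. compact C \<and> C \<subseteq> frontier K \<inter> ball x r \<longrightarrow>
      emeasure boundary_hausdorff C \<le> ennreal ((1 + \<eta>) ^ (2 * CARD('n))) * emeasure cone_measure C"
    "\<exists>r>0. \<forall>C. compact C \<and> C \<subseteq> frontier K \<inter> ball x r \<longrightarrow>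
      emeasure cone_measure C \<le> ennreal ((1 + \<eta>) ^ (2 * CARD('n))) * emeasure boundary_hausdorff C"
      using r by (metis+)
  qed
  have le1: "emeasure boundary_hausdorff B \<le> ennreal ((1 + \<eta>) ^ (2 * CARD('n))) * emeasure cone_measure B"
    if "B \<in> sets borel" "B \<subseteq> frontier K" "0 < \<eta>" for B \<eta>
    using loc(1)[OF that(3)] that
    by (intro measure_le_locally[OF sets' sets_cone_measure compact_frontier_K null(1) cm.finite_measure_axioms]) auto
  have le1': "emeasure boundary_hausdorff B \<le> emeasure cone_measure B" if "B \<in> sets borel" "B \<subseteq> frontier K" for B
    using le1[OF that] by (rule ennreal_le_of_le_powers) (simp_all add: cm.emeasure_finite less_top[symmetric])
  have whole: "emeasure boundary_hausdorff A = emeasure boundary_hausdorff (frontier K \<inter> A)" if "A \<in> sets borel" for A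
    using that fb by (simp add: emeasure_boundary_hausdorff)
  have fin: "finite_measure boundary_hausdorff"
  proof
    have "emeasure boundary_hausdorff (space boundary_hausdorff) = emeasure boundary_hausdorff (frontier K)"
      using whole[of UNIV] by (simp add: boundary_hausdorff_def)
    also have "\<dots> \<le> emeasure cone_measure (frontier K)" using fb by (intro le1') auto
    finally show "emeasure boundary_hausdorff (space boundary_hausdorff) \<noteq> \<infinity>"
      using cm.emeasure_finite by (metis infinity_ennreal_def neq_top_trans)
  qed
  have le2: "emeasure cone_measure B \<le> ennreal ((1 + \<eta>) ^ (2 * CARD('n))) * emeasure boundary_hausdorff B"
    if "B \<in> sets borel" "B \<subseteq> frontier K" "0 < \<eta>" for B \<eta>
    using loc(2)[OF that(3)] that
    by (intro measure_le_locally[OF sets_cone_measure sets' compact_frontier_K null(2) fin]) auto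
  have le2': "emeasure cone_measure B \<le> emeasure boundary_hausdorff B" if "B \<in> sets borel" "B \<subseteq> frontier K" for B
    using le2[OF that] by (rule ennreal_le_of_le_powers)
      (simp_all add: finite_measure.emeasure_finite[OF fin] less_top[symmetric])
  fix A assume "A \<in> sets boundary_hausdorff"
  then have A: "A \<in> sets borel" using sets' by simp
  then have "frontier K \<inter> A \<in> sets borel" using fb by auto
  then have "emeasure boundary_hausdorff (frontier K \<inter> A) = emeasure cone_measure (frontier K \<inter> A)"
    by (intro antisym le1' le2') auto
  then show "emeasure boundary_hausdorff A = emeasure cone_measure A"
    using whole[OF A] emeasure_cone_measure_frontier[OF A card] by simp
qed

text \<open>The bridge by which integrals over the boundary become Lebesgue integrals over K. The
  origin, which x / N x does not send to the boundary, has weight 0.\<close>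

lemma surface_integral:
  fixes f :: "real^'n \<Rightarrow> 'b::euclidean_space"
  assumes card: "CARD('n) \<ge> 2" and f: "continuous_on (frontier K) f"
  shows "integrable (surface_measure K) f"
    "(\<integral>x. f x \<partial>surface_measure K) = c0 *\<^sub>R (\<integral>x. weight x *\<^sub>R f (x /\<^sub>R N x) \<partial>lborel)"
    "integrable lborel (\<lambda>x. weight x *\<^sub>R f (x /\<^sub>R N x))"
proof -
  let ?H = "hausdorff_measure (CARD('n) - 1) :: (real^'n) measure"
  define g where "g x = indicator (frontier K) x *\<^sub>R f x" for x
  note c0 = c0_pos[OF card]
  have g [measurable]: "g \<in> borel_measurable borel"
    unfolding g_def[abs_def] using f by (intro borel_measurable_continuous_on_indicator) auto
  obtain B where B: "\<And>x. x \<in> frontier K \<Longrightarrow> norm (f x) \<le> B"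
    using compact_continuous_image[OF f compact_frontier_K] compact_imp_bounded bounded_iff by (metis imageI)
  have gB: "norm (g x) \<le> max B 0" for x
    using B[of x] by (auto simp: g_def indicator_def)
  interpret cm: finite_measure cone_measure by (rule finite_measure_cone_measure[OF card])
  have gm: "g \<in> borel_measurable cone_measure" using g by (simp add: measurable_cong_sets[OF sets_cone_measure refl])
  have int: "integrable cone_measure g"
    using gB gm by (intro cm.integrable_const_bound[of _ "max B 0"]) auto
  have m1: "(\<lambda>x. x /\<^sub>R N x) \<in> density lborel (\<lambda>x. ennreal (c0 * weight x)) \<rightarrow>\<^sub>M borel"
    by measurable
  have m2: "(\<lambda>x. g (x /\<^sub>R N x)) \<in> borel_measurable lborel" by measurable
  have AE: "AE x in lborel. 0 \<le> c0 * weight x" using c0 weight_nonneg by simp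
  have wm: "(\<lambda>x. c0 * weight x) \<in> borel_measurable lborel" by measurable
  have wg: "(c0 * weight x) *\<^sub>R g (x /\<^sub>R N x) = c0 *\<^sub>R (weight x *\<^sub>R f (x /\<^sub>R N x))" for x
  proof (cases "x = 0")
    case True
    then show ?thesis by (simp add: weight_def)
  next
    case False
    then show ?thesis using N_frontier[OF False] by (simp add: g_def)
  qed
  have "integrable lborel (\<lambda>x. c0 *\<^sub>R (weight x *\<^sub>R f (x /\<^sub>R N x)))"
    using int unfolding cone_measure_def integrable_distr_eq[OF m1 g] integrable_density[OF m2 wm AE] wg .
  then have "integrable lborel (\<lambda>x. (1 / c0) *\<^sub>R (c0 *\<^sub>R (weight x *\<^sub>R f (x /\<^sub>R N x))))"
    by (rule integrable_scaleR_right)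
  then show "integrable lborel (\<lambda>x. weight x *\<^sub>R f (x /\<^sub>R N x))"
    using c0 by simp
  have cmi: "(\<integral>x. g x \<partial>cone_measure) = c0 *\<^sub>R (\<integral>x. weight x *\<^sub>R f (x /\<^sub>R N x) \<partial>lborel)"
    unfolding cone_measure_def integral_distr[OF m1 g] integral_density[OF m2 wm AE] wg
    by (simp only: integral_scaleR_right)
  have fr: "frontier K \<inter> space ?H \<in> sets ?H" by simp
  have gH: "g \<in> borel_measurable ?H" using g by (simp add: measurable_cong_sets[OF sets_hausdorff_measure refl])
  have iH: "(\<lambda>x. indicator (frontier K) x :: real) \<in> borel_measurable ?H"
    by (simp add: borel_measurable_indicator)
  have AEi: "AE x in ?H. 0 \<le> (indicator (frontier K) x :: real)" by simp
  have ig: "indicator (frontier K) x *\<^sub>R g x = indicator (frontier K) x *\<^sub>R f x" for x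
    by (simp add: g_def indicator_def)
  have "integrable boundary_hausdorff g" using int boundary_hausdorff_eq_cone_measure[OF card] by simp
  then have "integrable ?H (\<lambda>x. indicator (frontier K) x *\<^sub>R f x)"
    unfolding boundary_hausdorff_def integrable_density[OF gH iH AEi] ig .
  then show "integrable (surface_measure K) f"
    unfolding surface_measure_def integrable_restrict_space[OF fr] .
  have "(\<integral>x. f x \<partial>surface_measure K) = (\<integral>x. g x \<partial>boundary_hausdorff)"
    unfolding surface_measure_def integral_restrict_space[OF fr] boundary_hausdorff_def
      integral_density[OF gH iH AEi] ig ..
  then show "(\<integral>x. f x \<partial>surface_measure K) = c0 *\<^sub>R (\<integral>x. weight x *\<^sub>R f (x /\<^sub>R N x) \<partial>lborel)"
    using cmi boundary_hausdorff_eq_cone_measure[OF card] by simp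
qed

lemma surface_measurable:
  fixes f :: "real^'n \<Rightarrow> 'b::euclidean_space"
  assumes "continuous_on (frontier K) f"
  shows "f \<in> borel_measurable (surface_measure K)"
proof -
  have "sets (surface_measure K) = sets (restrict_space borel (frontier K))"
    unfolding surface_measure_def by (rule sets_restrict_space_cong) simp
  then show ?thesis
    using borel_measurable_continuous_on_restrict[OF assms] by (simp cong: measurable_cong_sets)
qed

abbreviation "hn x \<equiv> h (\<nu> (x /\<^sub>R N x))"

text \<open>The weight is 1 / h and absorbs one power of h; this turns the exponent \<alpha> on the
  boundary into \<alpha> - 1 on K.\<close>

lemma weight_mult:
  assumes "\<And>y. y \<in> frontier K \<Longrightarrow> F y = h (\<nu> y) * G y"
  shows "weight x * F (x /\<^sub>R N x) = indicator (K - {0}) x * G (x /\<^sub>R N x)"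
proof (cases "x = 0")
  case False
  note fr = N_frontier[OF False]
  then show ?thesis
    using False assms[OF fr] h_normal_pos[OF fr] by (simp add: weight_def p_frontier(3)[OF fr] indicator_def)
qed (simp add: weight_def)

text \<open>The normalising integral of h^\<alpha> over the boundary, divided by
  \<open>c0\<close>.\<close>

definition "Z \<alpha> = (\<integral>x. indicator (K - {0}) x * hn x powr (\<alpha> - 1) \<partial>lborel)"

lemma continuous_h_powr: "continuous_on (frontier K) (\<lambda>y. h (\<nu> y) powr \<alpha>)"
  using h_normal_pos by (intro continuous_intros continuous_h_normal) force

lemma powr_split: "y \<in> frontier K \<Longrightarrow> h (\<nu> y) powr \<alpha> = h (\<nu> y) * h (\<nu> y) powr (\<alpha> - 1)"
  using h_normal_pos[of y] by (simp add: powr_diff)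

lemma K_integrable:
  fixes f :: "real^'n \<Rightarrow> 'b::euclidean_space"
  assumes card: "CARD('n) \<ge> 2" and f: "continuous_on (frontier K) f"
  shows "integrable lborel (\<lambda>x. indicator (K - {0}) x *\<^sub>R f (x /\<^sub>R N x))"
proof -
  have "continuous_on (frontier K) (\<lambda>y. h (\<nu> y) *\<^sub>R f y)"
    by (intro continuous_intros continuous_h_normal f)
  from surface_integral(3)[OF card this]
  have "integrable lborel (\<lambda>x. (weight x * h (\<nu> (x /\<^sub>R N x))) *\<^sub>R f (x /\<^sub>R N x))" by simp
  also have "(\<lambda>x. (weight x * h (\<nu> (x /\<^sub>R N x))) *\<^sub>R f (x /\<^sub>R N x)) = (\<lambda>x. indicator (K - {0}) x *\<^sub>R f (x /\<^sub>R N x))"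
    using weight_mult[of "\<lambda>y. h (\<nu> y)" "\<lambda>_. 1"] by simp
  finally show ?thesis .
qed

lemma Z_pos:
  assumes card: "CARD('n) \<ge> 2"
  shows "0 < Z \<alpha>"
proof -
  let ?f = "\<lambda>x. indicator (K - {0}) x * hn x powr (\<alpha> - 1)"
  have int: "integrable lborel ?f"
    using K_integrable[OF card continuous_h_powr[of "\<alpha> - 1"]] by simp
  have nn: "AE x in lborel. 0 \<le> ?f x" by simp
  have "Z \<alpha> \<noteq> 0"
  proof
    assume "Z \<alpha> = 0"
    then have f0: "AE x in lborel. ?f x = 0"
      using integral_nonneg_eq_0_iff_AE[OF int nn] by (simp add: Z_def)
    have "?f x \<noteq> 0" if "x \<in> K - {0}" for x
      using h_normal_pos[OF N_frontier, of x] that by (simp add: indicator_def)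
    then have "AE x in lborel. x \<notin> K - {0}" by (intro eventually_mono[OF f0]) blast
    then have "AE x in lborel. x \<notin> interior K - {0}"
      using interior_subset by (auto elim!: eventually_mono)
    moreover have "open (interior K - {0})" by (intro open_Diff) auto
    ultimately have "emeasure lborel (interior K - {0}) = 0"
      by (subst (asm) AE_iff_measurable[of "interior K - {0}"]) (auto simp: borel_open)
    then have "emeasure lborel (interior K) = 0"
      using emeasure_Diff_null_set[of "{0}" lborel "interior K"] by (auto simp: null_sets_def)
    moreover obtain r where r: "0 < r" "ball 0 r \<subseteq> interior K"
      using zero_K open_interior openE by metis
    then have "emeasure lborel (ball (0 :: real^'n) r) \<le> emeasure lborel (interior K)"
      by (intro emeasure_mono) auto
    ultimately show False using r(1) unit_ball_vol_pos[of "CARD('n)"] by (simp add: emeasure_ball)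
  qed
  moreover have "0 \<le> Z \<alpha>" unfolding Z_def by (rule integral_nonneg_AE[OF nn])
  ultimately show ?thesis by simp
qed

theorem isotropy_tensor_eq:
  assumes card: "CARD('n) \<ge> 2"
  shows "isotropy_tensor \<alpha> K = (real CARD('n) / Z \<alpha>) *\<^sub>R
    (\<integral>x. (indicator (K - {0}) x * hn x powr (\<alpha> - 1)) *\<^sub>R ten (x /\<^sub>R N x) (p (x /\<^sub>R N x)) \<partial>lborel)"
proof -
  note c0 = c0_pos[OF card] and Z = Z_pos[OF card, of \<alpha>]
  have surf: "support_function K (outer_normal K y) = h (\<nu> y)" for y by (simp add: h_def \<nu>_def)
  have tens: "tensor y (norming_functional K y) = ten y (p y)" for y
    unfolding tensor_inner[symmetric]
    by (simp add: norming_functional_def[abs_def] p_def h_def \<nu>_def divide_inverse mult.commute)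
  have ZZ: "(\<integral>y. h (\<nu> y) powr \<alpha> \<partial>surface_measure K) = c0 * Z \<alpha>"
    unfolding surface_integral(2)[OF card continuous_h_powr] Z_def
    using weight_mult[OF powr_split[where \<alpha> = \<alpha>]] by simp
  have cont: "continuous_on (frontier K) (\<lambda>y. ten y (p y))"
    by (intro continuous_intros continuous_p)
  let ?d = "\<lambda>y. h (\<nu> y) powr \<alpha> / (c0 * Z \<alpha>)"
  have cd: "continuous_on (frontier K) ?d"
    using c0 Z by (intro continuous_intros continuous_h_powr) auto
  have "(\<integral>y. tensor y (norming_functional K y) \<partial>boundary_measure \<alpha> K)
    = (\<integral>y. ten y (p y) \<partial>density (surface_measure K) (\<lambda>y. ennreal (?d y)))"
    unfolding boundary_measure_def surf tens ZZ ..
  also have "\<dots> = (\<integral>y. ?d y *\<^sub>R ten y (p y) \<partial>surface_measure K)"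
    using c0 Z by (intro integral_density surface_measurable cont cd) auto
  also have "\<dots> = c0 *\<^sub>R (\<integral>x. weight x *\<^sub>R (?d (x /\<^sub>R N x) *\<^sub>R ten (x /\<^sub>R N x) (p (x /\<^sub>R N x))) \<partial>lborel)"
    by (intro surface_integral(2)[OF card] continuous_on_scaleR cd cont)
  also have "\<dots> = c0 *\<^sub>R (\<integral>x. (1 / (c0 * Z \<alpha>)) *\<^sub>R ((indicator (K - {0}) x * hn x powr (\<alpha> - 1)) *\<^sub>R ten (x /\<^sub>R N x) (p (x /\<^sub>R N x))) \<partial>lborel)"
  proof -
    have eq: "weight x * ?d (x /\<^sub>R N x) = (1 / (c0 * Z \<alpha>)) * (indicator (K - {0}) x * hn x powr (\<alpha> - 1))" for x
      using weight_mult[OF powr_split[where \<alpha> = \<alpha>], of x] by (simp add: field_simps)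
    show ?thesis by (simp only: scaleR_scaleR eq)
  qed
  also have "\<dots> = (1 / Z \<alpha>) *\<^sub>R (\<integral>x. (indicator (K - {0}) x * hn x powr (\<alpha> - 1)) *\<^sub>R ten (x /\<^sub>R N x) (p (x /\<^sub>R N x)) \<partial>lborel)"
    using c0 by (subst integral_scaleR_right) simp
  finally show ?thesis by (simp add: isotropy_tensor_def)
qed

end

section \<open>The tensor for exponent one, by differentiation under rank-one maps\<close>

lemma integral_linear_vimage:
  fixes f :: "'a::euclidean_space \<Rightarrow> 'a" and F :: "'a \<Rightarrow> real"
  assumes f: "linear f" "bij f" and F: "F \<in> borel_measurable borel"
  shows "(\<integral>x. F (f x) \<partial>lborel) = vimage_scale f * (\<integral>x. F x \<partial>lborel)"
proof -
  note [measurable] = linear_borel_measurable[OF f(1)] F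
  have eq: "distr lborel borel f = density lborel (\<lambda>_. ennreal (vimage_scale f))"
    by (rule measure_eqI) (auto simp: emeasure_distr emeasure_density emeasure_linear_vimage[OF f] nn_integral_cmult_indicator)
  have "(\<integral>x. F (f x) \<partial>lborel) = (\<integral>x. F x \<partial>distr lborel borel f)"
    by (rule integral_distr[symmetric]) measurable
  also have "\<dots> = (\<integral>x. vimage_scale f *\<^sub>R F x \<partial>lborel)"
    unfolding eq using vimage_scale_pos[OF f] by (intro integral_density) auto
  finally show ?thesis by simp
qed

text \<open>The profile is chosen for its derivative, -1 / s on (1/2, 1) and 0 outside [1/2, 1]:
  differentiating \<open>clip_ln (N x)\<close> in the direction (a . x) w produces (a . x) / N x, so
  that only x / N x enters. Clipping at 1/2 keeps the function Lipschitz, and clipping at 1 makes it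
  vanish outside K.\<close>

definition clip_ln :: "real \<Rightarrow> real" where
  "clip_ln s = - ln (max (1/2) (min s 1))"

text \<open>The logarithm has slope at most 2 on [1/2, 1], and clipping the argument does not
  increase distances.\<close>

lemma clip_ln_lipschitz: "\<bar>clip_ln s - clip_ln t\<bar> \<le> 2 * \<bar>s - t\<bar>"
proof -
  have *: "ln a - ln b \<le> 2 * \<bar>a - b\<bar>" if "1/2 \<le> a" "1/2 \<le> b" for a b :: real
  proof -
    have "ln a - ln b = ln (a / b)" using that by (simp add: ln_div)
    also have "\<dots> \<le> a / b - 1" using that by (intro ln_le_minus_one) simp
    also have "\<dots> = (a - b) / b" using that by (simp add: field_simps)
    also have "\<dots> \<le> \<bar>a - b\<bar> / b" using that by (intro divide_right_mono) auto
    also have "\<dots> \<le> \<bar>a - b\<bar> / (1/2)" using that by (intro divide_left_mono) auto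
    finally show ?thesis by simp
  qed
  define a where "a = max (1/2) (min s 1)"
  define b where "b = max (1/2) (min t 1)"
  have ab: "1/2 \<le> a" "1/2 \<le> b" by (simp_all add: a_def b_def)
  have "\<bar>max (1/2) u - max (1/2) v\<bar> \<le> \<bar>u - v\<bar>" for u v :: real by linarith
  moreover have "\<bar>min s 1 - min t 1\<bar> \<le> \<bar>s - t\<bar>" by linarith
  ultimately have "\<bar>a - b\<bar> \<le> \<bar>s - t\<bar>" unfolding a_def b_def by (rule order_trans)
  then have 1: "2 * \<bar>a - b\<bar> \<le> 2 * \<bar>s - t\<bar>" by simp
  have 2: "\<bar>- ln a - - ln b\<bar> \<le> 2 * \<bar>a - b\<bar>"
    using *[OF ab] *[OF ab(2,1)] by (simp add: abs_le_iff abs_minus_commute)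
  show ?thesis unfolding clip_ln_def a_def[symmetric] b_def[symmetric] using 2 1 by (rule order_trans)
qed

lemma clip_ln_eq_0: "1 \<le> s \<Longrightarrow> clip_ln s = 0"
  by (simp add: clip_ln_def)

lemma clip_ln_deriv:
  assumes "s \<noteq> 1/2" "s \<noteq> 1"
  shows "(clip_ln has_real_derivative (if 1/2 < s \<and> s < 1 then - 1 / s else 0)) (at s)"
proof -
  consider "s < 1/2" | "1/2 < s" "s < 1" | "1 < s" using assms by linarith
  then show ?thesis
  proof cases
    case 1
    have "((\<lambda>_. - ln (1/2)) has_real_derivative 0) (at s)" by (rule DERIV_const)
    then have "(clip_ln has_real_derivative 0) (at s)"
      by (rule has_field_derivative_transform_within_open[of _ _ _ "{..<1/2}"]) (use 1 in \<open>auto simp: clip_ln_def\<close>)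
    then show ?thesis using 1 by simp
  next
    case 2
    have "((\<lambda>s. - ln s) has_real_derivative - (1 / s)) (at s)"
      using 2 by (intro DERIV_minus DERIV_ln_divide) simp
    then have "(clip_ln has_real_derivative - (1 / s)) (at s)"
      by (rule has_field_derivative_transform_within_open[of _ _ _ "{1/2<..<1}"]) (use 2 in \<open>auto simp: clip_ln_def\<close>)
    then show ?thesis using 2 by simp
  next
    case 3
    have "((\<lambda>_. 0) has_real_derivative 0) (at s)" by (rule DERIV_const)
    then have "(clip_ln has_real_derivative 0) (at s)"
      by (rule has_field_derivative_transform_within_open[of _ _ _ "{1<..}"]) (use 3 in \<open>auto simp: clip_ln_def\<close>)
    then show ?thesis using 3 by simp
  qed
qed

lemma clip_ln_measurable [measurable]: "clip_ln \<in> borel_measurable borel"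
  unfolding clip_ln_def[abs_def] by measurable

context body
begin

text \<open>The level sets of the gauge are dilates of the boundary of a convex set, hence
  null.\<close>

lemma AE_N_neq:
  assumes "0 < s"
  shows "AE x in lborel. N x \<noteq> s"
proof -
  have "negligible (frontier K)" by (rule negligible_convex_frontier[OF convex_K])
  then have f0: "emeasure lborel (frontier K) = 0"
    by (simp add: negligible_iff_emeasure0 emeasure_completion)
  have sub: "{x. N x = s} \<subseteq> (\<lambda>x. (1 / s) *\<^sub>R id x) -` frontier K"
  proof
    fix x assume "x \<in> {x. N x = s}"
    then have x: "N x = s" by simp
    then have "x \<noteq> 0" using assms by auto
    from N_frontier[OF this] show "x \<in> (\<lambda>x. (1 / s) *\<^sub>R id x) -` frontier K"
      using x by (simp add: divide_inverse)
  qed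
  have "emeasure lborel ((\<lambda>x. (1 / s) *\<^sub>R id x) -` frontier K) = ennreal (vimage_scale (id :: real^'n \<Rightarrow> real^'n) / (1 / s) ^ CARD('n)) * emeasure lborel (frontier K)"
    by (rule emeasure_homothety_linear_vimage[OF _ linear_id bij_id frontier_borel]) (use assms in simp)
  then have z: "emeasure lborel ((\<lambda>x. (1 / s) *\<^sub>R id x) -` frontier K) = 0" using f0 by simp
  have "(\<lambda>x :: real^'n. (1 / s) *\<^sub>R id x) \<in> borel \<rightarrow>\<^sub>M borel" by measurable
  then have "(\<lambda>x. (1 / s) *\<^sub>R id x) -` frontier K \<in> sets borel"
    by (rule measurable_sets_borel) measurable
  then show ?thesis
    using sub z by (intro AE_I[where N = "(\<lambda>x. (1 / s) *\<^sub>R id x) -` frontier K"]) auto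
qed

definition "stretch a w t x = x + (a \<bullet> x) *\<^sub>R (t *\<^sub>R w)"

lemma stretch_deriv:
  assumes x: "x \<noteq> 0" and N: "N x \<noteq> 1/2" "N x \<noteq> 1"
  shows "((\<lambda>t. clip_ln (N (stretch a w t x))) has_real_derivative
    (if 1/2 < N x \<and> N x < 1 then - 1 / N x else 0) * ((a \<bullet> x) * (w \<bullet> p (x /\<^sub>R N x)))) (at 0)"
proof -
  have s0: "stretch a w 0 x = x" by (simp add: stretch_def)
  have 1: "((\<lambda>t. stretch a w t x) has_derivative (\<lambda>t. (a \<bullet> x) *\<^sub>R (t *\<^sub>R w))) (at 0)"
    unfolding stretch_def by (auto intro!: derivative_eq_intros)
  have "(N has_derivative (\<lambda>v. v \<bullet> p (x /\<^sub>R N x))) (at (stretch a w 0 x))"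
    unfolding s0 by (rule N_has_derivative[OF x])
  from has_derivative_compose[OF 1 this]
  have "((\<lambda>t. N (stretch a w t x)) has_derivative (\<lambda>t. ((a \<bullet> x) *\<^sub>R (t *\<^sub>R w)) \<bullet> p (x /\<^sub>R N x))) (at 0)" .
  then have 2: "((\<lambda>t. N (stretch a w t x)) has_real_derivative (a \<bullet> x) * (w \<bullet> p (x /\<^sub>R N x))) (at 0)"
    unfolding has_field_derivative_def by (rule back_subst[where P = "\<lambda>D. (_ has_derivative D) _"]) (simp add: fun_eq_iff)
  have 3: "(clip_ln has_real_derivative (if 1/2 < N x \<and> N x < 1 then - 1 / N x else 0)) (at (N (stretch a w 0 x)))"
    unfolding s0 by (rule clip_ln_deriv[OF N])
  from DERIV_chain2[OF 3 2] show ?thesis .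
qed

lemma stretch_integral:
  assumes t: "1 + a \<bullet> (t *\<^sub>R w) > 0"
  shows "(\<integral>x. clip_ln (N (stretch a w t x)) \<partial>lborel) = (\<integral>x. clip_ln (N x) \<partial>lborel) / (1 + t * (a \<bullet> w))"
proof -
  have "(\<lambda>x. clip_ln (N x)) \<in> borel_measurable borel" by measurable
  from integral_linear_vimage[OF bij_add_rank_one(2,1) this, of a "t *\<^sub>R w"]
  show ?thesis
    using t unfolding stretch_def vimage_scale_add_rank_one[OF less_imp_neq[OF t, symmetric]] by simp
qed

definition "shell x = (if 1/2 < N x \<and> N x < 1 then 1 else 0 :: real)"

text \<open>By \<open>stretch_integral\<close> the integral of
  \<open>clip_ln (N (stretch a w t x))\<close> is I / (1 + t (a . w)). The two sides are
  differentiated at t = 0, the left one by dominated convergence along the sequence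
  \<open>t n\<close>.\<close>

lemma shell_integral:
  "(\<integral>x. shell x * ((a \<bullet> (x /\<^sub>R N x)) * (w \<bullet> p (x /\<^sub>R N x))) \<partial>lborel) = (a \<bullet> w) * (\<integral>x. clip_ln (N x) \<partial>lborel)"
proof -
  define I where "I = (\<integral>x. clip_ln (N x) \<partial>lborel)"
  obtain R where R: "\<And>x. x \<in> K \<Longrightarrow> norm x \<le> R" using bounded_K bounded_iff by blast
  have R0: "0 \<le> R" using R[of 0] K_iff_N[of 0] by simp
  \<comment> \<open>For 0 < t \<le> s no point is moved by more than half its norm, and 1 + t (a .
    w) stays positive.\<close>
  define s where "s = 1 / (2 * (norm a * norm w + 1))"
  have nn: "0 \<le> norm a * norm w" by simp
  have "0 < 1 / (2 * (X + 1)) \<and> 1 / (2 * (X + 1)) * X \<le> 1/2" if "0 \<le> X" for X :: real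
    using that by (simp add: field_simps)
  from this[OF nn] have s: "0 < s" "s * (norm a * norm w) \<le> 1/2" by (simp_all only: s_def)
  define t where "t n = s / real (Suc n)" for n
  have t: "0 < t n" "t n * (norm a * norm w) \<le> 1/2" for n
  proof -
    show "0 < t n" using s by (simp add: t_def)
    have "t n \<le> s" using s by (simp add: t_def field_simps)
    then show "t n * (norm a * norm w) \<le> 1/2" using s(2) nn by (meson mult_right_mono order_trans)
  qed
  have t_lim: "t \<longlonglongrightarrow> 0" unfolding t_def by real_asymp
  have taw: "\<bar>t n * (a \<bullet> w)\<bar> \<le> 1/2" for n
  proof -
    have "\<bar>t n * (a \<bullet> w)\<bar> \<le> t n * (norm a * norm w)"
      using t(1)[of n] Cauchy_Schwarz_ineq2[of a w] by (simp add: abs_mult)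
    then show ?thesis using t(2)[of n] by linarith
  qed
  define q where "q n x = (clip_ln (N (stretch a w (t n) x)) - clip_ln (N x)) / t n" for n x
  define g where "g x = - (shell x * ((a \<bullet> (x /\<^sub>R N x)) * (w \<bullet> p (x /\<^sub>R N x))))" for x
  \<comment> \<open>Within radius 2 R the Lipschitz constants 2 of \<open>clip_ln\<close> and
    \<open>M\<close> of \<open>N\<close> bound the quotient. Beyond it, x and its stretched image
    both lie outside K, where \<open>clip_ln (N x)\<close> vanishes.\<close>
  define B where "B x = 2 * M * norm a * norm w * (2 * R) * indicator (cball 0 (2 * R)) x" for x :: "real^'n"
  have sm [measurable]: "stretch a w (t n) \<in> borel_measurable borel" for n
    unfolding stretch_def[abs_def] by measurable
  have q_meas: "q n \<in> borel_measurable lborel" for n unfolding q_def[abs_def] by measurable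
  have bound: "norm (q n x) \<le> B x" for n x
  proof (cases "norm x \<le> 2 * R")
    case True
    have "\<bar>clip_ln (N (stretch a w (t n) x)) - clip_ln (N x)\<bar> \<le> 2 * \<bar>N (stretch a w (t n) x) - N x\<bar>"
      by (rule clip_ln_lipschitz)
    also have "\<bar>N (stretch a w (t n) x) - N x\<bar> \<le> M * norm (stretch a w (t n) x - x)" by (rule N_lipschitz)
    also have "norm (stretch a w (t n) x - x) = t n * (\<bar>a \<bullet> x\<bar> * norm w)"
      using t(1)[of n] by (simp add: stretch_def abs_mult)
    also have "t n * (\<bar>a \<bullet> x\<bar> * norm w) \<le> t n * ((norm a * (2 * R)) * norm w)"
    proof -
      have "\<bar>a \<bullet> x\<bar> \<le> norm a * norm x" by (rule Cauchy_Schwarz_ineq2)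
      also have "\<dots> \<le> norm a * (2 * R)" using True by (intro mult_left_mono) auto
      finally show ?thesis using t(1)[of n] by (intro mult_left_mono mult_right_mono) auto
    qed
    finally have "\<bar>clip_ln (N (stretch a w (t n) x)) - clip_ln (N x)\<bar> \<le> (2 * M * norm a * norm w * (2 * R)) * t n"
      using M(1) by (simp add: mult_ac)
    then show ?thesis using True t(1)[of n] by (simp add: q_def B_def pos_divide_le_eq)
  next
    case False
    have "x \<notin> K" using R[of x] False R0 by auto
    have "norm x - norm ((a \<bullet> x) *\<^sub>R (t n *\<^sub>R w)) \<le> norm (stretch a w (t n) x)"
      unfolding stretch_def by (rule norm_diff_ineq)
    moreover have "norm ((a \<bullet> x) *\<^sub>R (t n *\<^sub>R w)) \<le> (1/2) * norm x"
    proof -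
      have "norm ((a \<bullet> x) *\<^sub>R (t n *\<^sub>R w)) = \<bar>a \<bullet> x\<bar> * (t n * norm w)" using t(1)[of n] by (simp add: abs_mult)
      also have "\<dots> \<le> (norm a * norm x) * (t n * norm w)"
        using t(1)[of n] Cauchy_Schwarz_ineq2 by (intro mult_right_mono) auto
      also have "\<dots> = (t n * (norm a * norm w)) * norm x" by (simp add: mult_ac)
      also have "\<dots> \<le> (1/2) * norm x" using t(2)[of n] by (intro mult_right_mono) auto
      finally show ?thesis .
    qed
    ultimately have "R < norm (stretch a w (t n) x)" using False by linarith
    then have "stretch a w (t n) x \<notin> K" using R[of "stretch a w (t n) x"] by auto
    then have "clip_ln (N (stretch a w (t n) x)) = 0" "clip_ln (N x) = 0"
      using \<open>x \<notin> K\<close> by (auto simp: K_iff_N intro!: clip_ln_eq_0)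
    then show ?thesis using False by (simp add: q_def B_def)
  qed
  have "AE x in lborel. x \<noteq> (0 :: real^'n)" by (rule AE_lborel_singleton)
  moreover have "AE x in lborel. N x \<noteq> 1/2" "AE x in lborel. N x \<noteq> 1" by (rule AE_N_neq, simp)+
  ultimately have lim: "AE x in lborel. (\<lambda>n. q n x) \<longlonglongrightarrow> g x"
  proof eventually_elim
    case (elim x)
    have "((\<lambda>h. (clip_ln (N (stretch a w (0 + h) x)) - clip_ln (N (stretch a w 0 x))) / h) \<longlongrightarrow>
      (if 1/2 < N x \<and> N x < 1 then - 1 / N x else 0) * ((a \<bullet> x) * (w \<bullet> p (x /\<^sub>R N x)))) (at 0)"
      using stretch_deriv[OF elim] unfolding DERIV_def .
    moreover have "filterlim t (at 0) sequentially"
      by (rule filterlim_atI[OF t_lim]) (simp add: less_imp_neq[OF t(1), symmetric])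
    ultimately have "(\<lambda>n. (clip_ln (N (stretch a w (0 + t n) x)) - clip_ln (N (stretch a w 0 x))) / t n) \<longlonglongrightarrow>
      (if 1/2 < N x \<and> N x < 1 then - 1 / N x else 0) * ((a \<bullet> x) * (w \<bullet> p (x /\<^sub>R N x)))"
      by (rule filterlim_compose)
    moreover have "(if 1/2 < N x \<and> N x < 1 then - 1 / N x else 0) * ((a \<bullet> x) * (w \<bullet> p (x /\<^sub>R N x))) = g x"
    proof -
      have "a \<bullet> (x /\<^sub>R N x) = (a \<bullet> x) / N x" by (simp add: divide_inverse mult.commute)
      then show ?thesis
        unfolding g_def shell_def by (cases "1/2 < N x \<and> N x < 1") (simp_all only: if_True if_False, simp_all)
    qed
    moreover have "stretch a w 0 x = x" by (simp add: stretch_def)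
    ultimately show "(\<lambda>n. q n x) \<longlonglongrightarrow> g x" by (simp only: q_def add_0_left)
  qed
  have Bint: "integrable lborel B" unfolding B_def[abs_def]
    using emeasure_bounded_finite[OF bounded_cball[of "0 :: real^'n" "2 * R"]]
    by (intro integrable_mult_right integrable_real_indicator) auto
  have gm: "g \<in> borel_measurable lborel"
  proof -
    have eq: "g = (\<lambda>x. - (shell x * ((a \<bullet> (x /\<^sub>R N x)) * (w \<bullet> (indicator (- {0}) x *\<^sub>R p (x /\<^sub>R N x))))))"
      by (auto simp: fun_eq_iff g_def shell_def indicator_def)
    show ?thesis unfolding eq unfolding shell_def[abs_def] by measurable
  qed
  have "(\<lambda>n. \<integral>x. q n x \<partial>lborel) \<longlonglongrightarrow> (\<integral>x. g x \<partial>lborel)"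
    by (rule integral_dominated_convergence[where w = B]) (use gm q_meas Bint lim bound in auto)
  moreover have "(\<integral>x. q n x \<partial>lborel) = I * (- (a \<bullet> w) / (1 + t n * (a \<bullet> w)))" for n
  proof -
    have pos: "0 < 1 + t n * (a \<bullet> w)" using taw[of n] by linarith
    have int0: "integrable lborel (\<lambda>x. clip_ln (N x))"
    proof (rule Bochner_Integration.integrable_bound[of _ "\<lambda>x. ln 2 * indicator K x"])
      show "integrable lborel (\<lambda>x. ln 2 * indicator K x :: real)"
        using emeasure_bounded_finite[OF bounded_K] by (intro integrable_mult_right integrable_real_indicator) auto
      show "AE x in lborel. norm (clip_ln (N x)) \<le> norm (ln 2 * indicator K x :: real)"
      proof (intro always_eventually allI)
        fix x
        show "norm (clip_ln (N x)) \<le> norm (ln 2 * indicator K x :: real)"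
        proof (cases "N x \<le> 1")
          case True
          then have "clip_ln (N x) = - ln (max (1/2) (N x))" by (simp add: clip_ln_def)
          moreover have "ln (1/2) \<le> ln (max (1/2) (N x))" "ln (max (1/2) (N x)) \<le> 0"
            using True by (auto simp: ln_le_cancel_iff)
          ultimately show ?thesis using True by (simp add: K_iff_N ln_div)
        qed (simp add: clip_ln_eq_0)
      qed
    qed measurable
    have "integrable lborel (\<lambda>x. t n * q n x + clip_ln (N x))"
      using int0 Bochner_Integration.integrable_bound[OF Bint q_meas[of n]] bound[of n]
      by (intro Bochner_Integration.integrable_add integrable_mult_right) (auto intro: order_trans[OF _ abs_ge_self])
    then have "integrable lborel (\<lambda>x. clip_ln (N (stretch a w (t n) x)))"
      using t(1)[of n] by (simp add: q_def)
    then have "(\<integral>x. q n x \<partial>lborel) = (I / (1 + t n * (a \<bullet> w)) - I) / t n"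
      using int0 stretch_integral[of a "t n" w] pos by (simp add: q_def I_def)
    also have "\<dots> = I * (- (a \<bullet> w) / (1 + t n * (a \<bullet> w)))"
    proof -
      have "(J / (1 + s * b) - J) / s = J * (- b / (1 + s * b))" if "s \<noteq> 0" "1 + s * b \<noteq> 0" for J s b :: real
      proof -
        have "J / (1 + s * b) - J = (J - J * (1 + s * b)) / (1 + s * b)"
          using that by (simp add: diff_divide_distrib)
        also have "J - J * (1 + s * b) = s * (J * - b)" by (simp add: algebra_simps)
        finally show ?thesis using that by simp
      qed
      then show ?thesis using pos t(1)[of n] by simp
    qed
    finally show ?thesis .
  qed
  moreover have "(\<lambda>n. I * (- (a \<bullet> w) / (1 + t n * (a \<bullet> w)))) \<longlonglongrightarrow> I * (- (a \<bullet> w) / (1 + 0 * (a \<bullet> w)))"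
    by (intro tendsto_intros t_lim) simp
  ultimately have "(\<integral>x. g x \<partial>lborel) = I * (- (a \<bullet> w) / (1 + 0 * (a \<bullet> w)))"
    using LIMSEQ_unique by fastforce
  then show ?thesis by (simp add: g_def I_def mult.commute)
qed

text \<open>Up to a null set the shell is K without its half-size copy, and F (x / N x) is constant
  along rays, so that copy carries the fraction 1 / 2^m of the integral.\<close>

lemma shell_eq:
  fixes F :: "real^'n \<Rightarrow> real"
  assumes card: "CARD('n) \<ge> 2" and F: "continuous_on (frontier K) F"
  shows "(\<integral>x. shell x * F (x /\<^sub>R N x) \<partial>lborel)
    = (1 - 1 / 2 ^ CARD('n)) * (\<integral>x. indicator (K - {0}) x * F (x /\<^sub>R N x) \<partial>lborel)"
proof -
  define f where "f x = indicator (K - {0}) x * F (x /\<^sub>R N x)" for x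
  have int: "integrable lborel f" unfolding f_def using K_integrable[OF card F] by simp
  then have fm: "f \<in> borel_measurable borel" by simp
  have h2: "vimage_scale (\<lambda>x :: real^'n. 2 *\<^sub>R x) = 1 / 2 ^ CARD('n)"
    "linear (\<lambda>x :: real^'n. 2 *\<^sub>R x)" "bij (\<lambda>x :: real^'n. 2 *\<^sub>R x)"
    using vimage_scale_homothety[of 2, where 'a = "real^'n"] by auto
  have f2: "(\<integral>x. f (2 *\<^sub>R x) \<partial>lborel) = 1 / 2 ^ CARD('n) * (\<integral>x. f x \<partial>lborel)"
    using integral_linear_vimage[OF h2(2,3) fm] h2(1) by simp
  have int2: "integrable lborel (\<lambda>x. f (2 *\<^sub>R x))"
  proof -
    have "integrable (distr lborel borel (\<lambda>x :: real^'n. 2 *\<^sub>R x)) f"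
    proof -
      have "distr lborel borel (\<lambda>x :: real^'n. 2 *\<^sub>R x) = density lborel (\<lambda>_. ennreal (1 / 2 ^ CARD('n)))"
        using emeasure_linear_vimage[OF h2(2,3)]
        by (intro measure_eqI) (auto simp: emeasure_distr emeasure_density h2(1) nn_integral_cmult_indicator)
      then show ?thesis using int fm by (simp add: integrable_density)
    qed
    then show ?thesis using fm by (simp add: integrable_distr_eq)
  qed
  have "AE x in lborel. x \<noteq> (0 :: real^'n)" by (rule AE_lborel_singleton)
  then have "AE x in lborel. shell x * F (x /\<^sub>R N x) = f x - f (2 *\<^sub>R x)"
    using AE_N_neq[of 1, OF zero_less_one]
  proof eventually_elim
    case (elim x)
    have "F ((2 *\<^sub>R x) /\<^sub>R N (2 *\<^sub>R x)) = F (x /\<^sub>R N x)" by (simp only: hat_scale zero_less_numeral)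
    then have "f (2 *\<^sub>R x) = (if N x \<le> 1/2 then F (x /\<^sub>R N x) else 0)"
      using elim(1) by (simp add: f_def indicator_def K_iff_N N_scale)
    moreover have "f x = (if N x < 1 then F (x /\<^sub>R N x) else 0)"
      using elim by (simp add: f_def indicator_def K_iff_N)
    ultimately show ?case by (simp add: shell_def)
  qed
  then have "(\<integral>x. shell x * F (x /\<^sub>R N x) \<partial>lborel) = (\<integral>x. f x - f (2 *\<^sub>R x) \<partial>lborel)"
  proof (rule integral_cong_AE[rotated 2])
    show "(\<lambda>x. f x - f (2 *\<^sub>R x)) \<in> borel_measurable lborel" using int int2 by auto
    have eq: "(\<lambda>x. shell x * F (x /\<^sub>R N x)) = (\<lambda>x. shell x * f x)"
      by (auto simp: fun_eq_iff shell_def f_def indicator_def K_iff_N)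
    note [measurable] = fm
    show "(\<lambda>x. shell x * F (x /\<^sub>R N x)) \<in> borel_measurable lborel"
      unfolding eq unfolding shell_def[abs_def] by measurable
  qed
  also have "\<dots> = (1 - 1 / 2 ^ CARD('n)) * (\<integral>x. f x \<partial>lborel)"
    using int int2 f2 by (simp add: algebra_simps)
  finally show ?thesis by (simp add: f_def)
qed

text \<open>In classical terms, the divergence theorem for linear vector fields.
  \<open>shell_eq\<close> and \<open>shell_integral\<close> leave one unknown constant I; taking a =
  w = b and summing over the basis evaluates it, because y . p y = 1 on the boundary.\<close>

theorem divergence_identity:
  assumes card: "CARD('n) \<ge> 2"
  shows "(\<integral>x. indicator (K - {0}) x * ((a \<bullet> (x /\<^sub>R N x)) * (w \<bullet> p (x /\<^sub>R N x))) \<partial>lborel)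
    = (a \<bullet> w) / CARD('n) * (\<integral>x. indicator (K - {0}) x \<partial>lborel)"
proof -
  define c where "c = (1 - 1 / 2 ^ CARD('n) :: real)"
  define I where "I = (\<integral>x. clip_ln (N x) \<partial>lborel)"
  have c: "0 < c" using card by (simp add: c_def)
  have cont: "continuous_on (frontier K) (\<lambda>y. (a \<bullet> y) * (w \<bullet> p y))" for a w
    by (intro continuous_intros continuous_p)
  have *: "c * (\<integral>x. indicator (K - {0}) x * ((a \<bullet> (x /\<^sub>R N x)) * (w \<bullet> p (x /\<^sub>R N x))) \<partial>lborel) = (a \<bullet> w) * I" for a w
    using shell_eq[OF card cont[of a w]] shell_integral[of a w] by (simp add: c_def I_def)
  have int: "integrable lborel (\<lambda>x. indicator (K - {0}) x * ((a \<bullet> (x /\<^sub>R N x)) * (w \<bullet> p (x /\<^sub>R N x))))" for a w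
    using K_integrable[OF card cont[of a w]] by simp
  have "(\<Sum>b\<in>Basis. c * (\<integral>x. indicator (K - {0}) x * ((b \<bullet> (x /\<^sub>R N x)) * (b \<bullet> p (x /\<^sub>R N x))) \<partial>lborel))
    = c * (\<integral>x. (\<Sum>b\<in>Basis. indicator (K - {0}) x * ((b \<bullet> (x /\<^sub>R N x)) * (b \<bullet> p (x /\<^sub>R N x)))) \<partial>lborel)"
    by (subst Bochner_Integration.integral_sum[OF int]) (simp add: sum_distrib_left)
  also have "(\<lambda>x. \<Sum>b\<in>Basis. indicator (K - {0}) x * ((b \<bullet> (x /\<^sub>R N x)) * (b \<bullet> p (x /\<^sub>R N x))))
    = (\<lambda>x. indicator (K - {0}) x :: real)"
  proof
    fix x
    have "(\<Sum>b\<in>Basis. indicator (K - {0}) x * ((b \<bullet> (x /\<^sub>R N x)) * (b \<bullet> p (x /\<^sub>R N x))))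
      = indicator (K - {0}) x * ((x /\<^sub>R N x) \<bullet> p (x /\<^sub>R N x))"
      unfolding sum_distrib_left[symmetric] by (subst (3) euclidean_inner) (simp add: inner_commute)
    also have "\<dots> = indicator (K - {0}) x"
      using p_frontier(1)[OF N_frontier, of x] by (auto simp: indicator_def)
    finally show "(\<Sum>b\<in>Basis. indicator (K - {0}) x * ((b \<bullet> (x /\<^sub>R N x)) * (b \<bullet> p (x /\<^sub>R N x)))) = (indicator (K - {0}) x :: real)" .
  qed
  also have "(\<Sum>b\<in>Basis. c * (\<integral>x. indicator (K - {0}) x * ((b \<bullet> (x /\<^sub>R N x)) * (b \<bullet> p (x /\<^sub>R N x))) \<partial>lborel))
    = CARD('n) * I"
    unfolding * by simp
  finally have I: "I = c * (\<integral>x. indicator (K - {0}) x \<partial>lborel) / CARD('n)" by (simp add: field_simps)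
  have "c * (\<integral>x. indicator (K - {0}) x * ((a \<bullet> (x /\<^sub>R N x)) * (w \<bullet> p (x /\<^sub>R N x))) \<partial>lborel)
    = c * ((a \<bullet> w) / CARD('n) * (\<integral>x. indicator (K - {0}) x \<partial>lborel))"
    unfolding * I by simp
  then show ?thesis by (rule mult_left_cancel[THEN iffD1, OF less_imp_neq[OF c, symmetric]])
qed

end

section \<open>Calculus of smooth functions\<close>

lemma has_derivative_frechet_derivative: "f differentiable (at x) \<Longrightarrow> (f has_derivative frechet_derivative f (at x)) (at x)"
  by (simp add: frechet_derivative_works)

lemma has_derivative_cong_open:
  assumes "open S" "x \<in> S" "\<And>y. y \<in> S \<Longrightarrow> f y = g y"
  shows "(f has_derivative D) (at x) \<longleftrightarrow> (g has_derivative D) (at x)"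
  using has_derivative_transform_within_open[of f D x UNIV S g] has_derivative_transform_within_open[of g D x UNIV S f] assms
  by auto

lemma C_k_on_cong:
  assumes "open S" "\<And>x. x \<in> S \<Longrightarrow> f x = g x"
  shows "C_k_on k S f \<longleftrightarrow> C_k_on k S g"
  using assms(2)
proof (induction k arbitrary: f g)
  case 0
  then show ?case by (simp cong: continuous_on_cong)
next
  case (Suc k)
  have eq: "(f has_derivative D) (at x) \<longleftrightarrow> (g has_derivative D) (at x)" if "x \<in> S" for x D
    using has_derivative_cong_open[OF assms(1) that, of f g] Suc.prems by blast
  have "frechet_derivative f (at x) = frechet_derivative g (at x)" if "x \<in> S" for x
    unfolding frechet_derivative_def by (simp only: eq[OF that])
  then have "C_k_on k S (\<lambda>x. frechet_derivative f (at x) v) \<longleftrightarrow> C_k_on k S (\<lambda>x. frechet_derivative g (at x) v)" for v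
    by (intro Suc.IH) simp
  then show ?case using eq by (auto simp: differentiable_def)
qed

text \<open>Lets an explicit derivative stand in for \<open>frechet_derivative\<close>, which is a
  choice term; most closure rules below go through it.\<close>

lemma C_k_on_SucI:
  assumes "open S" "\<And>x. x \<in> S \<Longrightarrow> (f has_derivative f' x) (at x)" "\<And>v. C_k_on k S (\<lambda>x. f' x v)"
  shows "C_k_on (Suc k) S f"
proof -
  have "C_k_on k S (\<lambda>x. frechet_derivative f (at x) v)" for v
    using assms(3)[of v] frechet_derivative_at[OF assms(2)]
    by (subst C_k_on_cong[OF assms(1), of _ "\<lambda>x. f' x v"]) metis+
  then show ?thesis using assms(2) by (auto simp: differentiable_def)
qed

lemma C_k_on_SucD:
  assumes "C_k_on (Suc k) S f"
  shows "x \<in> S \<Longrightarrow> (f has_derivative frechet_derivative f (at x)) (at x)"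
    "C_k_on k S (\<lambda>x. frechet_derivative f (at x) v)"
  using assms by (auto intro: has_derivative_frechet_derivative)

lemma C_k_on_Suc_imp: "C_k_on (Suc k) S f \<Longrightarrow> C_k_on k S f"
proof (induction k arbitrary: f)
  case 0
  then show ?case
    by (auto intro!: continuous_at_imp_continuous_on differentiable_imp_continuous_within)
next
  case (Suc k)
  have "\<forall>x\<in>S. f differentiable (at x)" using Suc.prems by simp
  moreover have "C_k_on k S (\<lambda>x. frechet_derivative f (at x) v)" for v
    using Suc.prems by (intro Suc.IH) simp
  ultimately show ?case by simp
qed

lemma C_k_on_continuous: "C_k_on k S f \<Longrightarrow> continuous_on S f"
  by (induction k) (simp, metis C_k_on_Suc_imp)

lemma C_k_on_const: "open S \<Longrightarrow> C_k_on k S (\<lambda>_. c)"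
proof (induction k arbitrary: c)
  case (Suc k)
  show ?case by (rule C_k_on_SucI[OF Suc.prems, where f' = "\<lambda>_ _. 0"]) (auto intro: Suc)
qed simp

lemma C_k_on_linear:
  assumes "bounded_linear L" "open S"
  shows "C_k_on k S f \<Longrightarrow> C_k_on k S (\<lambda>x. L (f x))"
proof (induction k arbitrary: f)
  case 0
  then show ?case using assms(1) by (simp add: bounded_linear.continuous_on)
next
  case (Suc k)
  note D = C_k_on_SucD[OF Suc.prems]
  show ?case
    by (rule C_k_on_SucI[OF assms(2) bounded_linear.has_derivative[OF assms(1) D(1)]]) (auto intro: Suc.IH D(2))
qed

lemma C_k_on_id: "open S \<Longrightarrow> C_k_on k S (\<lambda>x. x)"
proof (cases k)
  case (Suc j)
  assume S: "open S"
  show ?thesis unfolding Suc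
    by (rule C_k_on_SucI[OF S, where f' = "\<lambda>_ v. v"]) (auto intro: C_k_on_const S)
qed auto

lemma C_k_on_add:
  assumes "open S"
  shows "C_k_on k S f \<Longrightarrow> C_k_on k S g \<Longrightarrow> C_k_on k S (\<lambda>x. f x + g x)"
proof (induction k arbitrary: f g)
  case 0
  then show ?case by (simp add: continuous_on_add)
next
  case (Suc k)
  note D = C_k_on_SucD[OF Suc.prems(1)] C_k_on_SucD[OF Suc.prems(2)]
  show ?case
    by (rule C_k_on_SucI[OF assms has_derivative_add[OF D(1,3)]]) (auto intro: Suc.IH D)
qed

lemma C_k_on_sum:
  assumes "open S" "\<And>i. i \<in> I \<Longrightarrow> C_k_on k S (f i)"
  shows "C_k_on k S (\<lambda>x. \<Sum>i\<in>I. f i x)"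
  using assms(2)
proof (induction I rule: infinite_finite_induct)
  case (insert i I)
  have "C_k_on k S (\<lambda>x. f i x + (\<Sum>i\<in>I. f i x))"
    by (intro C_k_on_add[OF assms(1)] insert.IH insert.prems) auto
  then show ?case using insert.hyps by simp
qed (auto intro: C_k_on_const assms(1))

lemma C_k_on_bilinear:
  assumes bil: "bounded_bilinear pr" and S: "open S"
  shows "C_k_on k S f \<Longrightarrow> C_k_on k S g \<Longrightarrow> C_k_on k S (\<lambda>x. pr (f x) (g x))"
proof (induction k arbitrary: f g)
  case 0
  then show ?case by (simp add: bounded_bilinear.continuous_on[OF bil])
next
  case (Suc k)
  note D = C_k_on_SucD[OF Suc.prems(1)] C_k_on_SucD[OF Suc.prems(2)]
  show ?case
    by (rule C_k_on_SucI[OF S bounded_bilinear.FDERIV[OF bil D(1,3)]])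
      (auto intro!: C_k_on_add S Suc.IH D C_k_on_Suc_imp[OF Suc.prems(1)] C_k_on_Suc_imp[OF Suc.prems(2)])
qed

lemmas C_k_on_mult = C_k_on_bilinear[OF bounded_bilinear_mult]
lemmas C_k_on_scaleR = C_k_on_bilinear[OF bounded_bilinear_scaleR]
lemmas C_k_on_inner = C_k_on_bilinear[OF bounded_bilinear_inner]

lemma C_k_on_prod:
  fixes f :: "'i \<Rightarrow> 'a::real_normed_vector \<Rightarrow> real"
  assumes "open S" "\<And>i. i \<in> I \<Longrightarrow> C_k_on k S (f i)"
  shows "C_k_on k S (\<lambda>x. \<Prod>i\<in>I. f i x)"
  using assms(2)
proof (induction I rule: infinite_finite_induct)
  case (insert i I)
  have "C_k_on k S (\<lambda>x. f i x * (\<Prod>i\<in>I. f i x))"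
    by (intro C_k_on_mult assms(1) insert.IH insert.prems) auto
  then show ?case using insert.hyps by simp
qed (auto intro: C_k_on_const assms(1))

text \<open>The chain rule is expanded in the basis of the middle space: the recursion in
  \<open>C_k_on\<close> differentiates in a fixed direction, whereas the direction in which g is
  differentiated varies with x.\<close>

lemma C_k_on_compose:
  fixes f :: "'a::real_normed_vector \<Rightarrow> 'b::euclidean_space"
  assumes S: "open S" and T: "open T" and im: "\<And>x. x \<in> S \<Longrightarrow> f x \<in> T"
  shows "C_k_on k S f \<Longrightarrow> C_k_on k T g \<Longrightarrow> C_k_on k S (\<lambda>x. g (f x))"
proof (induction k arbitrary: g)
  case 0
  then show ?case using im by (auto intro: continuous_on_compose2)
next
  case (Suc k)
  note Df = C_k_on_SucD[OF Suc.prems(1)] and Dg = C_k_on_SucD[OF Suc.prems(2)]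
  let ?f' = "\<lambda>x. frechet_derivative f (at x)" and ?g' = "\<lambda>x. frechet_derivative g (at x)"
  have "((\<lambda>x. g (f x)) has_derivative (\<lambda>v. \<Sum>b\<in>Basis. (?f' x v \<bullet> b) *\<^sub>R ?g' (f x) b)) (at x)" if x: "x \<in> S" for x
  proof -
    have lin: "linear (?g' (f x))" using Dg(1)[OF im[OF x]] by (rule has_derivative_linear)
    have "?g' (f x) (?f' x v) = (\<Sum>b\<in>Basis. (?f' x v \<bullet> b) *\<^sub>R ?g' (f x) b)" for v
      by (subst euclidean_representation[of "?f' x v", symmetric]) (simp add: linear_sum[OF lin] linear_scale[OF lin])
    then show ?thesis using has_derivative_compose[OF Df(1)[OF x] Dg(1)[OF im[OF x]]] by simp
  qed
  then show ?case
  proof (rule C_k_on_SucI[OF S])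
    fix v
    have "C_k_on k S (\<lambda>x. ?f' x v \<bullet> b)" for b
      by (rule C_k_on_linear[OF bounded_linear_inner_left S Df(2)])
    moreover have "C_k_on k S (\<lambda>x. ?g' (f x) b)" for b
      by (rule Suc.IH[OF C_k_on_Suc_imp[OF Suc.prems(1)] Dg(2)])
    ultimately show "C_k_on k S (\<lambda>x. \<Sum>b\<in>Basis. (?f' x v \<bullet> b) *\<^sub>R ?g' (f x) b)"
      by (intro C_k_on_sum S C_k_on_scaleR)
  qed
qed

text \<open>The derivative is a product of copies of \<open>inverse\<close> itself, so the induction
  hypothesis applies to it; \<open>C_k_on_norm\<close> follows the same pattern.\<close>

lemma C_k_on_inverse: "C_k_on k (- {0 :: real}) inverse"
proof (induction k)
  case (Suc k)
  have S: "open (- {0 :: real})" by (simp add: open_Compl)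
  show ?case
  proof (rule C_k_on_SucI[OF S, where f' = "\<lambda>x v. - (inverse x * v * inverse x)"])
    show "(inverse has_derivative (\<lambda>v. - (inverse x * v * inverse x))) (at x)" if "x \<in> - {0}" for x :: real
      using that by (auto intro!: derivative_eq_intros)
    show "C_k_on k (- {0}) (\<lambda>x. - (inverse x * v * inverse x))" for v :: real
      by (intro C_k_on_linear[OF bounded_linear_minus[OF bounded_linear_ident] S] C_k_on_mult S Suc C_k_on_const)
  qed
qed (auto intro!: continuous_intros)

lemma C_k_on_inverse_compose:
  fixes f :: "'a::real_normed_vector \<Rightarrow> real"
  assumes "open S" "C_k_on k S f" "\<And>x. x \<in> S \<Longrightarrow> f x \<noteq> 0"
  shows "C_k_on k S (\<lambda>x. inverse (f x))"
  by (rule C_k_on_compose[OF assms(1) _ _ assms(2) C_k_on_inverse]) (use assms(3) in \<open>auto simp: open_Compl\<close>)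

lemma C_k_on_norm: "C_k_on k (- {0 :: 'a::euclidean_space}) norm"
proof (induction k)
  case (Suc k)
  have S: "open (- {0 :: 'a})" by (simp add: open_Compl)
  show ?case
  proof (rule C_k_on_SucI[OF S, where f' = "\<lambda>x v. (v \<bullet> x) * inverse (norm x)"])
    show "(norm has_derivative (\<lambda>v. (v \<bullet> x) * inverse (norm x))) (at x)" if "x \<in> - {0}" for x :: 'a
      using has_derivative_norm[of x] that by (simp add: sgn_div_norm inner_commute mult.commute)
    show "C_k_on k (- {0}) (\<lambda>x. (v \<bullet> x) * inverse (norm x))" for v :: 'a
      by (intro C_k_on_mult S C_k_on_inverse_compose Suc C_k_on_linear[OF bounded_linear_inner_right S] C_k_on_id) auto
  qed
qed (auto intro!: continuous_intros)

lemma C_k_on_vec_lambda: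
  assumes S: "open S" and "\<And>i. C_k_on k S (\<lambda>x. f x i)"
  shows "C_k_on k S (\<lambda>x. (\<chi> i. f x i) :: real^'n)"
proof -
  have "C_k_on k S (\<lambda>x. \<Sum>i\<in>UNIV. f x i *\<^sub>R axis i (1::real))"
    by (intro C_k_on_sum S C_k_on_scaleR assms C_k_on_const)
  moreover have "(\<Sum>i\<in>UNIV. f x i *\<^sub>R axis i (1::real)) = (\<chi> i. f x i)" for x
    by (simp add: vec_eq_iff axis_def if_distrib[of "\<lambda>z. _ * z"] cong: if_cong)
  ultimately show ?thesis by simp
qed

lemma C_k_on_det:
  fixes A :: "'a::real_normed_vector \<Rightarrow> real^'n^'n"
  assumes S: "open S" and "\<And>i j. C_k_on k S (\<lambda>x. A x $ i $ j)"
  shows "C_k_on k S (\<lambda>x. det (A x))"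
  unfolding det_def by (intro C_k_on_sum S C_k_on_mult C_k_on_const C_k_on_prod assms)

text \<open>Bootstrapping: by Cramer's rule the inverse Jacobian, and with it the derivative of
  \<Psi> at y, is a smooth function of \<Psi> y, so C^k for \<Psi> gives C^(k+1). Continuity starts
  the induction.\<close>

lemma C_k_on_inverse_map:
  fixes \<Phi> \<Psi> :: "real^'n \<Rightarrow> real^'n"
  assumes W: "open W" and V: "open V" and \<Phi>: "smooth_on W \<Phi>"
    and cont: "continuous_on V \<Psi>" and im: "\<And>y. y \<in> V \<Longrightarrow> \<Psi> y \<in> W" and inv: "\<And>y. y \<in> V \<Longrightarrow> \<Phi> (\<Psi> y) = y"
    and det: "\<And>x. x \<in> W \<Longrightarrow> det (matrix (frechet_derivative \<Phi> (at x))) \<noteq> 0"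
  shows "C_k_on k V \<Psi>"
proof (induction k)
  case 0
  then show ?case using cont by simp
next
  case (Suc k)
  define A where "A x = matrix (frechet_derivative \<Phi> (at x))" for x
  define R where "R x v = (\<chi> k. det (\<chi> i j. if j = k then v $ i else A x $ i $ j) / det (A x))" for x and v :: "real^'n"
  have d\<Phi>: "(\<Phi> has_derivative frechet_derivative \<Phi> (at x)) (at x)" if "x \<in> W" for x
    using \<Phi> that by (intro C_k_on_SucD(1)[of 0]) (auto simp: smooth_on_def simp del: C_k_on.simps)
  have \<Phi>A: "frechet_derivative \<Phi> (at x) v = A x *v v" if "x \<in> W" for x v
    unfolding A_def using has_derivative_linear[OF d\<Phi>[OF that]] by (simp add: matrix_works)
  have R: "A x *v z = v \<longleftrightarrow> z = R x v" if "x \<in> W" for x z v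
    unfolding R_def by (rule cramer) (use det[OF that] in \<open>simp add: A_def\<close>)
  have Rinv: "\<exists>B. R x = (*v) B" if "x \<in> W" for x
  proof -
    have "invertible (A x)" using det[OF that] by (simp add: invertible_det_nz A_def)
    then obtain B where "A x ** B = mat 1" unfolding invertible_def by blast
    then have "A x *v (B *v v) = v" for v by (simp add: matrix_vector_mul_assoc)
    then have "R x v = B *v v" for v using R[OF that] by metis
    then show ?thesis by blast
  qed
  show ?case
  proof (rule C_k_on_SucI[OF V, where f' = "\<lambda>y v. R (\<Psi> y) v"])
    fix y assume y: "y \<in> V"
    show "(\<Psi> has_derivative R (\<Psi> y)) (at y)"
    proof (rule has_derivative_inverse_basic[where f = \<Phi> and g = \<Psi> and y = y and T = V])
      show "(\<Phi> has_derivative frechet_derivative \<Phi> (at (\<Psi> y))) (at (\<Psi> y))" by (rule d\<Phi>[OF im[OF y]])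
      show "bounded_linear (R (\<Psi> y))"
        using Rinv[OF im[OF y]] by (auto simp: linear_conv_bounded_linear[symmetric])
      show "R (\<Psi> y) \<circ> frechet_derivative \<Phi> (at (\<Psi> y)) = id"
      proof
        fix x
        show "(R (\<Psi> y) \<circ> frechet_derivative \<Phi> (at (\<Psi> y))) x = id x"
          unfolding o_apply \<Phi>A[OF im[OF y]] id_apply
          by (rule sym, rule iffD1[OF R[OF im[OF y]] refl])
      qed
      show "continuous (at y) \<Psi>" using cont V y continuous_on_eq_continuous_at by blast
    qed (fact V y inv)+
  next
    fix v
    have entry: "C_k_on k W (\<lambda>x. A x $ i $ j)" for i j
    proof -
      have "C_k_on k W (\<lambda>x. frechet_derivative \<Phi> (at x) (axis j 1) \<bullet> axis i 1)"
        using \<Phi> by (intro C_k_on_linear[OF bounded_linear_inner_left W] C_k_on_SucD(2)) (auto simp: smooth_on_def simp del: C_k_on.simps)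
      then show ?thesis by (simp add: A_def matrix_def inner_axis)
    qed
    have "C_k_on k W (\<lambda>x. det (\<chi> i j. if j = l then v $ i else A x $ i $ j) * inverse (det (A x)))" for l
    proof (intro C_k_on_mult W C_k_on_inverse_compose C_k_on_det entry)
      show "C_k_on k W (\<lambda>x. (\<chi> i j. if j = l then v $ i else A x $ i $ j) $ i $ j)" for i j
        by (cases "j = l") (auto intro: entry C_k_on_const W)
    qed (use det in \<open>simp add: A_def\<close>)
    then have "C_k_on k W (\<lambda>x. R x v)"
      unfolding R_def divide_inverse by (rule C_k_on_vec_lambda[OF W])
    then show "C_k_on k V (\<lambda>y. R (\<Psi> y) v)"
      by (intro C_k_on_compose[where f = \<Psi> and g = "\<lambda>x. R x v" and S = V and T = W] V W im Suc.IH)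
  qed
qed

text \<open>A is not assumed convex; in the application it is an annulus. Points at distance at most
  e are joined by a segment in the e-neighbourhood of A, where the derivative is bounded by
  \<open>M1\<close>; for other pairs the difference is at most 2 C \<le> (2 C / e) |x - y|.\<close>

lemma C_1_lipschitz_compact:
  fixes f :: "'a::euclidean_space \<Rightarrow> 'b::real_normed_vector"
  assumes O: "open O'" and f: "C_k_on (Suc 0) O' f" and A: "compact A" "A \<subseteq> O'"
  shows "\<exists>M\<ge>0. (\<forall>x\<in>A. \<forall>y\<in>A. norm (f x - f y) \<le> M * norm (x - y)) \<and>
    (\<forall>x\<in>A. \<forall>v. norm (frechet_derivative f (at x) v) \<le> M * norm v)"
proof (cases "A = {}")
  case False
  obtain e where e: "0 < e" "{x. infdist x A \<le> e} \<subseteq> O'"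
    using compact_in_open_separated[OF False A(1) O A(2)] by blast
  let ?B = "{x. infdist x A \<le> e}"
  have cB: "compact ?B" using compact_infdist_le[OF False A(1) e(1)] .
  note D = C_k_on_SucD[OF f]
  have "\<exists>c. \<forall>x\<in>?B. norm (frechet_derivative f (at x) b) \<le> c" for b
  proof -
    have "continuous_on ?B (\<lambda>x. frechet_derivative f (at x) b)"
      using D(2)[of b] e(2) by (auto intro: continuous_on_subset)
    from compact_imp_bounded[OF compact_continuous_image[OF this cB]]
    show ?thesis unfolding bounded_iff by blast
  qed
  then obtain c where c: "\<And>b x. x \<in> ?B \<Longrightarrow> norm (frechet_derivative f (at x) b) \<le> c b" by metis
  define M1 where "M1 = (\<Sum>b\<in>Basis. \<bar>c b\<bar>)"
  have on: "onorm (frechet_derivative f (at x)) \<le> M1" if x: "x \<in> ?B" for x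
  proof (rule onorm_le)
    fix v
    have lin: "linear (frechet_derivative f (at x))" using D(1)[of x] e(2) x by (intro has_derivative_linear) auto
    have "frechet_derivative f (at x) v = (\<Sum>b\<in>Basis. (v \<bullet> b) *\<^sub>R frechet_derivative f (at x) b)"
      by (subst euclidean_representation[of v, symmetric]) (simp only: linear_sum[OF lin] linear_scale[OF lin])
    also have "norm \<dots> \<le> (\<Sum>b\<in>Basis. norm v * \<bar>c b\<bar>)"
    proof (rule sum_norm_le)
      fix b :: 'a assume b: "b \<in> Basis"
      have "\<bar>v \<bullet> b\<bar> * norm (frechet_derivative f (at x) b) \<le> norm v * \<bar>c b\<bar>"
        using c[OF x, of b] Basis_le_norm[OF b, of v] by (intro mult_mono) auto
      then show "norm ((v \<bullet> b) *\<^sub>R frechet_derivative f (at x) b) \<le> norm v * \<bar>c b\<bar>" by simp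
    qed
    finally show "norm (frechet_derivative f (at x) v) \<le> M1 * norm v"
      by (simp add: M1_def sum_distrib_left[symmetric] mult.commute)
  qed
  have "continuous_on A f" using C_k_on_continuous[OF f] A(2) by (rule continuous_on_subset)
  then have "bounded (f ` A)" by (intro compact_imp_bounded compact_continuous_image A(1))
  then obtain C where C: "\<And>x. x \<in> A \<Longrightarrow> norm (f x) \<le> C" unfolding bounded_iff by blast
  have C0: "0 \<le> C" using False C norm_ge_zero order_trans by blast
  have M10: "0 \<le> M1" by (simp add: M1_def sum_nonneg)
  show ?thesis
  proof (intro exI[of _ "M1 + 2 * C / e"] conjI ballI allI)
    show "0 \<le> M1 + 2 * C / e" using C0 e M10 by simp
    fix x assume x: "x \<in> A"
    fix v
    have xB: "x \<in> ?B" using x e(1) infdist_zero[OF x] by simp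
    have "bounded_linear (frechet_derivative f (at x))"
      using D(1)[OF subsetD[OF e(2) xB]] by (rule has_derivative_bounded_linear)
    then have "norm (frechet_derivative f (at x) v) \<le> onorm (frechet_derivative f (at x)) * norm v"
      by (rule onorm)
    also have "\<dots> \<le> (M1 + 2 * C / e) * norm v"
    proof (rule mult_right_mono)
      have "0 \<le> 2 * C / e" using C0 e(1) by simp
      then show "onorm (frechet_derivative f (at x)) \<le> M1 + 2 * C / e" using on[OF xB] by linarith
    qed simp
    finally show "norm (frechet_derivative f (at x) v) \<le> (M1 + 2 * C / e) * norm v" .
  next
    fix x y assume x: "x \<in> A" and y: "y \<in> A"
    show "norm (f x - f y) \<le> (M1 + 2 * C / e) * norm (x - y)"
    proof (cases "norm (x - y) \<le> e")
      case True
      have sub: "cball x e \<subseteq> ?B"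
      proof
        fix z assume "z \<in> cball x e"
        then have "dist z x \<le> e" by (simp add: dist_commute)
        with infdist_le[OF x] have "infdist z A \<le> e" by (rule order_trans)
        then show "z \<in> ?B" by (rule CollectI)
      qed
      have "norm (f x - f y) \<le> M1 * norm (x - y)"
      proof (rule differentiable_bound[of "cball x e" f "\<lambda>z. frechet_derivative f (at z)" M1 x y])
        show "(f has_derivative frechet_derivative f (at z)) (at z within cball x e)" if "z \<in> cball x e" for z
          by (rule has_derivative_at_withinI[OF D(1)[OF subsetD[OF e(2) subsetD[OF sub that]]]])
        show "onorm (frechet_derivative f (at z)) \<le> M1" if "z \<in> cball x e" for z
          by (rule on[OF subsetD[OF sub that]])
      qed (use True e in \<open>simp_all add: dist_norm\<close>)
      also have "\<dots> \<le> (M1 + 2 * C / e) * norm (x - y)" using C0 e by (intro mult_right_mono) auto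
      finally show ?thesis .
    next
      case far: False
      have "norm (f x - f y) \<le> 2 * C" using norm_triangle_ineq4[of "f x" "f y"] C[OF x] C[OF y] by linarith
      also have "\<dots> = 2 * C / e * e" using e(1) by simp
      also have "\<dots> \<le> 2 * C / e * norm (x - y)" using far C0 e(1) by (intro mult_left_mono) auto
      also have "\<dots> \<le> (M1 + 2 * C / e) * norm (x - y)" using M10 by (intro mult_right_mono) auto
      finally show ?thesis .
    qed
  qed
qed auto

section \<open>Deviation of the isotropy tensor from the identity\<close>

lemma ten_nth: "ten x q $ i $ j = (axis i 1 \<bullet> x) * (axis j 1 \<bullet> q)"
  by (simp add: ten_def inner_axis')

lemma integral_matrix_nth:
  fixes f :: "'a \<Rightarrow> real^'n^'m"
  assumes "integrable M f"
  shows "integral\<^sup>L M f $ i $ j = (\<integral>x. f x $ i $ j \<partial>M)"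
proof -
  have "bounded_linear (\<lambda>A :: real^'n^'m. A $ i $ j)"
    by (rule bounded_linear_compose[OF bounded_linear_vec_nth bounded_linear_vec_nth])
  from integral_bounded_linear[OF this assms] show ?thesis ..
qed

lemma integral_combine:
  fixes f g :: "'a \<Rightarrow> 'b::euclidean_space" and k l :: "'a \<Rightarrow> real"
  assumes "integrable M f" "integrable M g" "integrable M k" "integrable M l"
  shows "(\<integral>x. (r *\<^sub>R f x - r *\<^sub>R g x) - (k x *\<^sub>R c - l x *\<^sub>R c) \<partial>M)
    = (r *\<^sub>R integral\<^sup>L M f - r *\<^sub>R integral\<^sup>L M g) - (integral\<^sup>L M k *\<^sub>R c - integral\<^sup>L M l *\<^sub>R c)"
  using assms by simp

context body
begin

lemma continuous_ten_p: "continuous_on (frontier K) (\<lambda>y. ten y (p y))"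
  by (intro continuous_intros continuous_p)

lemma integral_ten:
  assumes card: "CARD('n) \<ge> 2"
  shows "(\<integral>x. indicator (K - {0}) x *\<^sub>R ten (x /\<^sub>R N x) (p (x /\<^sub>R N x)) \<partial>lborel)
    = ((\<integral>x. indicator (K - {0}) x \<partial>lborel) / CARD('n)) *\<^sub>R mat 1"
proof -
  note int = K_integrable[OF card continuous_ten_p]
  show ?thesis
    using divergence_identity[OF card, of "axis i 1" "axis j 1" for i j]
    by (simp add: vec_eq_iff integral_matrix_nth[OF int] ten_nth mat_def inner_axis_axis)
qed

text \<open>By \<open>integral_ten\<close>, m x \<otimes> p - I integrates to 0 over K. Subtracting
  this from the integral is what makes the scalar factor vanish where h = 1.\<close>

theorem isotropy_tensor_deviation:
  assumes card: "CARD('n) \<ge> 2"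
  shows "isotropy_tensor \<alpha> K = mat 1 + (1 / Z \<alpha>) *\<^sub>R
    (\<integral>x. (indicator (K - {0}) x * (hn x powr (\<alpha> - 1) - 1)) *\<^sub>R
      (real CARD('n) *\<^sub>R ten (x /\<^sub>R N x) (p (x /\<^sub>R N x)) - mat 1) \<partial>lborel)"
proof -
  let ?m = "real CARD('n)"
  let ?i = "\<lambda>x. indicator (K - {0}) x :: real"
  let ?t = "\<lambda>x. ten (x /\<^sub>R N x) (p (x /\<^sub>R N x))"
  let ?h = "\<lambda>x. hn x powr (\<alpha> - 1)"
  let ?V = "\<integral>x. ?i x \<partial>lborel"
  have Z: "0 < Z \<alpha>" by (rule Z_pos[OF card])
  have i1: "integrable lborel (\<lambda>x. (?i x * ?h x) *\<^sub>R ?t x)"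
    using K_integrable[OF card continuous_on_scaleR[OF continuous_h_powr[of "\<alpha> - 1"] continuous_ten_p]] by simp
  have i2: "integrable lborel (\<lambda>x. ?i x *\<^sub>R ?t x)" by (rule K_integrable[OF card continuous_ten_p])
  have i3: "integrable lborel (\<lambda>x. ?i x * ?h x)" using K_integrable[OF card continuous_h_powr[of "\<alpha> - 1"]] by simp
  have i4: "integrable lborel ?i" using K_integrable[OF card continuous_on_const[of _ "1::real"]] by simp
  have "(\<lambda>x. (?i x * (?h x - 1)) *\<^sub>R (?m *\<^sub>R ?t x - mat 1))
    = (\<lambda>x. (?m *\<^sub>R ((?i x * ?h x) *\<^sub>R ?t x) - ?m *\<^sub>R (?i x *\<^sub>R ?t x)) - ((?i x * ?h x) *\<^sub>R mat 1 - ?i x *\<^sub>R mat 1))"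
    by (simp add: fun_eq_iff algebra_simps)
  then have "(\<integral>x. (?i x * (?h x - 1)) *\<^sub>R (?m *\<^sub>R ?t x - mat 1) \<partial>lborel)
    = (?m *\<^sub>R (\<integral>x. (?i x * ?h x) *\<^sub>R ?t x \<partial>lborel) - ?m *\<^sub>R (\<integral>x. ?i x *\<^sub>R ?t x \<partial>lborel))
      - ((\<integral>x. ?i x * ?h x \<partial>lborel) *\<^sub>R mat 1 - ?V *\<^sub>R mat 1)"
    using integral_combine[OF i1 i2 i3 i4, of ?m "mat 1"] by (simp only:)
  also have "\<dots> = ?m *\<^sub>R (\<integral>x. (?i x * ?h x) *\<^sub>R ?t x \<partial>lborel) - Z \<alpha> *\<^sub>R mat 1"
    unfolding integral_ten[OF card] by (simp add: Z_def)
  finally have D: "(\<integral>x. (?i x * (?h x - 1)) *\<^sub>R (?m *\<^sub>R ?t x - mat 1) \<partial>lborel)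
    = ?m *\<^sub>R (\<integral>x. (?i x * ?h x) *\<^sub>R ?t x \<partial>lborel) - Z \<alpha> *\<^sub>R mat 1" .
  have gen: "(r / z) *\<^sub>R P = I + (1 / z) *\<^sub>R (r *\<^sub>R P - z *\<^sub>R I)" if "z \<noteq> 0" for r z and P I :: "real^'n^'n"
    using that by (simp add: scaleR_diff_right)
  show ?thesis
    unfolding isotropy_tensor_eq[OF card] D by (rule gen) (use Z in simp)
qed

corollary isotropy_tensor_1: "CARD('n) \<ge> 2 \<Longrightarrow> isotropy_tensor 1 K = mat 1"
proof -
  assume card: "CARD('n) \<ge> 2"
  have eq: "(\<lambda>x. (indicator (K - {0}) x * (hn x powr (1 - 1) - 1)) *\<^sub>R
      (real CARD('n) *\<^sub>R ten (x /\<^sub>R N x) (p (x /\<^sub>R N x)) - mat 1)) = (\<lambda>_. 0)"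
  proof
    fix x
    show "(indicator (K - {0}) x * (hn x powr (1 - 1) - 1)) *\<^sub>R
      (real CARD('n) *\<^sub>R ten (x /\<^sub>R N x) (p (x /\<^sub>R N x)) - mat 1) = 0"
      \<comment> \<open>As \<open>0 powr 0 = 0\<close>, positivity of h is what makes the power
        equal to 1; at x = 0 the indicator vanishes.\<close>
      using h_normal_pos[OF N_frontier, of x] by (cases "x = 0") auto
  qed
  show ?thesis unfolding isotropy_tensor_deviation[OF card] eq by simp
qed

end

section \<open>Uniqueness of outer normals at smooth boundary points\<close>

lemma gradient_exists:
  fixes F :: "'a::euclidean_space \<Rightarrow> real"
  assumes "(F has_derivative D) (at x)"
  shows "D v = (\<Sum>b\<in>Basis. D b *\<^sub>R b) \<bullet> v"
proof -
  have lin: "linear D" using assms by (rule has_derivative_linear)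
  have "D v = D (\<Sum>b\<in>Basis. (v \<bullet> b) *\<^sub>R b)" by (simp add: euclidean_representation)
  also have "\<dots> = (\<Sum>b\<in>Basis. (v \<bullet> b) * D b)" by (simp add: linear_sum[OF lin] linear_scale[OF lin])
  also have "\<dots> = (\<Sum>b\<in>Basis. D b *\<^sub>R b) \<bullet> v" by (simp add: inner_sum_left inner_commute[of v] mult.commute)
  finally show ?thesis .
qed

text \<open>A supporting hyperplane at a regular boundary point contains the tangent directions: otherwise
  the intermediate value theorem yields a zero of \<open>F\<close> beyond the hyperplane.\<close>

lemma supporting_normal_orthogonal_tangent:
  fixes F :: "'a::euclidean_space \<Rightarrow> real"
  assumes U: "open U" "x \<in> U" and cF: "continuous_on U F" and DF: "(F has_derivative (\<lambda>v. a \<bullet> v)) (at x)"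
    and a: "a \<noteq> 0" and Fx: "F x = 0"
    and sup: "\<And>y. y \<in> U \<Longrightarrow> F y = 0 \<Longrightarrow> (y - x) \<bullet> m \<le> 0" and v: "a \<bullet> v = 0"
  shows "m \<bullet> v \<le> 0"
proof (rule ccontr)
  assume "\<not> m \<bullet> v \<le> 0"
  then have mv: "0 < m \<bullet> v" by simp
  \<comment> \<open>Small enough that v + s a still points strictly beyond the hyperplane whenever
    |s| \<le> \<eta>.\<close>
  define \<eta> where "\<eta> = (m \<bullet> v) / (2 * (\<bar>m \<bullet> a\<bar> + 1))"
  have \<eta>: "0 < \<eta>" using mv by (simp add: \<eta>_def)
  have "\<eta> * (\<bar>m \<bullet> a\<bar> + 1) = (m \<bullet> v) / 2" unfolding \<eta>_def by (simp add: field_simps)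
  then have \<eta>m: "\<eta> * \<bar>m \<bullet> a\<bar> < m \<bullet> v" using \<eta> mv by (simp add: distrib_left)
  have aa: "0 < a \<bullet> a" using a by simp
  have line: "((\<lambda>t. F (x + t *\<^sub>R (v + s *\<^sub>R a))) has_real_derivative s * (a \<bullet> a)) (at 0)" for s
  proof -
    have 1: "((\<lambda>t. x + t *\<^sub>R (v + s *\<^sub>R a)) has_derivative (\<lambda>t. t *\<^sub>R (v + s *\<^sub>R a))) (at 0)"
      by (auto intro!: derivative_eq_intros)
    have "(F has_derivative (\<lambda>v. a \<bullet> v)) (at (x + 0 *\<^sub>R (v + s *\<^sub>R a)))" using DF by simp
    from has_derivative_compose[OF 1 this] show ?thesis
      unfolding has_field_derivative_def
      by (rule back_subst[where P = "\<lambda>D. (_ has_derivative D) _"]) (simp add: fun_eq_iff inner_simps v)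
  qed
  have "\<exists>d>0. \<forall>t>0. t < d \<longrightarrow> F (x + 0 *\<^sub>R (v + \<eta> *\<^sub>R a)) < F (x + (0 + t) *\<^sub>R (v + \<eta> *\<^sub>R a))"
    by (rule DERIV_pos_inc_right[OF line]) (use \<eta> aa in simp)
  then obtain d1 where d1: "d1 > 0" "\<And>t. 0 < t \<Longrightarrow> t < d1 \<Longrightarrow> 0 < F (x + t *\<^sub>R (v + \<eta> *\<^sub>R a))"
    using Fx by auto
  have "\<exists>d>0. \<forall>t>0. t < d \<longrightarrow> F (x + 0 *\<^sub>R (v + (- \<eta>) *\<^sub>R a)) > F (x + (0 + t) *\<^sub>R (v + (- \<eta>) *\<^sub>R a))"
    by (rule DERIV_neg_dec_right[OF line]) (use \<eta> aa in simp)
  then obtain d2 where d2: "d2 > 0" "\<And>t. 0 < t \<Longrightarrow> t < d2 \<Longrightarrow> F (x + t *\<^sub>R (v + (- \<eta>) *\<^sub>R a)) < 0"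
    using Fx by auto
  obtain e where e: "e > 0" "ball x e \<subseteq> U" using U openE by blast
  define B where "B = norm v + \<eta> * norm a + 1"
  have B: "0 < B" using \<eta> by (simp add: B_def add_nonneg_pos)
  define q where "q = min (min d1 d2) (e / B)"
  have q: "0 < q" "q \<le> d1" "q \<le> d2" "q \<le> e / B" using d1(1) d2(1) e(1) B by (simp_all add: q_def)
  define t where "t = q / 2"
  have t: "0 < t" "t < d1" "t < d2" "t < e / B" using q unfolding t_def by linarith+
  have inU: "x + t *\<^sub>R (v + s *\<^sub>R a) \<in> U" if "s \<in> {- \<eta>..\<eta>}" for s
  proof -
    have "norm (v + s *\<^sub>R a) \<le> norm v + \<bar>s\<bar> * norm a" using norm_triangle_ineq[of v "s *\<^sub>R a"] by simp
    also have "\<dots> \<le> norm v + \<eta> * norm a" using that by (intro add_left_mono mult_right_mono) auto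
    finally have "norm (v + s *\<^sub>R a) \<le> B" by (simp add: B_def)
    then have "t * norm (v + s *\<^sub>R a) \<le> t * B" using t by (intro mult_left_mono) auto
    also have "\<dots> < e" using t(4) B by (simp add: pos_less_divide_eq)
    finally have "x + t *\<^sub>R (v + s *\<^sub>R a) \<in> ball x e" using t(1) by (simp add: dist_norm)
    then show ?thesis using e(2) by blast
  qed
  have "continuous_on {- \<eta>..\<eta>} (\<lambda>s. F (x + t *\<^sub>R (v + s *\<^sub>R a)))"
    by (rule continuous_on_compose2[OF cF]) (use inU in \<open>auto intro!: continuous_intros\<close>)
  then obtain s where s: "- \<eta> \<le> s" "s \<le> \<eta>" "F (x + t *\<^sub>R (v + s *\<^sub>R a)) = 0"
    using IVT'[of "\<lambda>s. F (x + t *\<^sub>R (v + s *\<^sub>R a))" "- \<eta>" 0 \<eta>] d1(2)[OF t(1,2)] d2(2)[OF t(1,3)] \<eta> by (auto simp: less_imp_le)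
  have "(x + t *\<^sub>R (v + s *\<^sub>R a) - x) \<bullet> m \<le> 0" using inU[of s] s by (intro sup) auto
  then have "t * (m \<bullet> v + s * (m \<bullet> a)) \<le> 0" by (simp add: inner_simps inner_commute)
  then have "m \<bullet> v + s * (m \<bullet> a) \<le> 0" using t(1) by (simp add: mult_le_0_iff)
  moreover have "\<bar>s * (m \<bullet> a)\<bar> \<le> \<eta> * \<bar>m \<bullet> a\<bar>"
    unfolding abs_mult using s by (intro mult_right_mono) auto
  ultimately show False using \<eta>m by linarith
qed

text \<open>A supporting normal is orthogonal to the tangent hyperplane, hence a multiple of the
  gradient of the defining function. Two unit multiples agree up to sign, and opposite normals would
  confine K to a hyperplane.\<close>

theorem smooth_strictly_convex_body_imp_body:
  fixes K :: "(real^'n) set"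
  assumes K: "smooth_strictly_convex_body K"
  shows "body K"
proof
  show "compact K" "convex K" "0 \<in> interior K"
    using K by (auto simp: smooth_strictly_convex_body_def convex_body_def)
  fix x m n
  assume x: "x \<in> frontier K" and m1: "norm m = 1" "norm n = 1"
    and mK: "\<forall>y\<in>K. (y - x) \<bullet> m \<le> 0" and nK: "\<forall>y\<in>K. (y - x) \<bullet> n \<le> 0"
  have fK: "frontier K \<subseteq> K" using \<open>compact K\<close> compact_imp_closed frontier_subset_eq by blast
  have "smooth_boundary K" using K by (simp add: smooth_strictly_convex_body_def)
  then have "\<exists>U (F :: real^'n \<Rightarrow> real). open U \<and> x \<in> U \<and> smooth_on U F \<and>
      (\<forall>y\<in>U. frechet_derivative F (at y) \<noteq> (\<lambda>v. 0)) \<and> frontier K \<inter> U = {y\<in>U. F y = 0}"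
    using x unfolding smooth_boundary_def by (rule bspec)
  then obtain U and F :: "real^'n \<Rightarrow> real" where *: "open U \<and> x \<in> U \<and> smooth_on U F \<and>
      (\<forall>y\<in>U. frechet_derivative F (at y) \<noteq> (\<lambda>v. 0)) \<and> frontier K \<inter> U = {y\<in>U. F y = 0}"
    by (elim exE)
  then have U: "open U" "x \<in> U" "smooth_on U F" "frontier K \<inter> U = {y\<in>U. F y = 0}"
    and regular: "frechet_derivative F (at x) \<noteq> (\<lambda>v. 0)" by simp_all
  have C1: "C_k_on (Suc 0) U F" using U(3) unfolding smooth_on_def by blast
  note DF = C_k_on_SucD(1)[OF C1 U(2)]
  define a where "a = (\<Sum>b\<in>Basis. frechet_derivative F (at x) b *\<^sub>R b)"
  have Da: "frechet_derivative F (at x) = (\<lambda>v. a \<bullet> v)"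
    unfolding a_def using gradient_exists[OF DF] by blast
  have a0: "a \<noteq> 0" using regular Da by auto
  have Fx: "F x = 0" using x U(2,4) by blast
  \<comment> \<open>With v the tangential part of m', the product m' . v is |v|^2 and at the same
    time at most 0.\<close>
  have par: "m' = ((m' \<bullet> a) / (a \<bullet> a)) *\<^sub>R a" if m': "\<forall>y\<in>K. (y - x) \<bullet> m' \<le> 0" for m'
  proof -
    define v where "v = m' - ((m' \<bullet> a) / (a \<bullet> a)) *\<^sub>R a"
    have av: "a \<bullet> v = 0" using a0 by (simp add: v_def inner_simps inner_commute)
    have "(y - x) \<bullet> m' \<le> 0" if "y \<in> U" "F y = 0" for y
    proof -
      have "y \<in> frontier K" using that U(4) by blast
      then show ?thesis using m' fK by blast
    qed
    then have "m' \<bullet> v \<le> 0"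
      by (intro supporting_normal_orthogonal_tangent[OF U(1,2) C_k_on_continuous[OF C1] DF[unfolded Da] a0 Fx _ av])
    moreover have "m' \<bullet> v = v \<bullet> v" using av by (simp add: v_def inner_simps inner_commute)
    ultimately have "v \<bullet> v = 0" using inner_ge_zero[of v] by linarith
    then show ?thesis by (simp add: v_def)
  qed
  define c d where "c = (m \<bullet> a) / (a \<bullet> a)" and "d = (n \<bullet> a) / (a \<bullet> a)"
  have mc: "m = c *\<^sub>R a" and nd: "n = d *\<^sub>R a" unfolding c_def d_def using par mK nK by blast+
  have "\<bar>c\<bar> * norm a = \<bar>d\<bar> * norm a" using m1 by (metis mc nd norm_scaleR)
  then have "\<bar>c\<bar> = \<bar>d\<bar>" using a0 by simp
  then have "c = d \<or> c = - d" by linarith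
  then show "m = n"
  proof
    assume "c = d" then show ?thesis using mc nd by simp
  next
    assume "c = - d"
    then have mn: "n = - m" using mc nd by simp
    obtain r where r: "0 < r" "cball 0 r \<subseteq> K" using \<open>0 \<in> interior K\<close> mem_interior_cball by blast
    have "r *\<^sub>R m \<in> K" "- (r *\<^sub>R m) \<in> K" using m1 r(1) by (auto intro!: subsetD[OF r(2)])
    then have "(r *\<^sub>R m - x) \<bullet> m \<le> 0" "(- (r *\<^sub>R m) - x) \<bullet> n \<le> 0" using mK nK by blast+
    then have "2 * r * (m \<bullet> m) \<le> 0" by (simp add: mn inner_simps)
    then show ?thesis using r(1) m1(1) by (simp add: dot_square_norm)
  qed
qed

section \<open>Bodies with perturbed support function\<close>

text \<open>A point outside K is cut off by a hyperplane, and its unit normal pointing away from K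
  violates the corresponding inequality. This is why a support function determines its body.\<close>

lemma convex_body_eq_halfspaces:
  assumes K: "convex_body K"
  shows "K = {x. \<forall>u\<in>sphere 0 1. x \<bullet> u \<le> support_function K u}"
proof
  have comp: "compact K" and conv: "convex K" and ne: "K \<noteq> {}"
    using K interior_subset by (auto simp: convex_body_def)
  have bdd: "bdd_above ((\<lambda>x. x \<bullet> u) ` K)" for u
    by (intro bounded_imp_bdd_above compact_imp_bounded compact_continuous_image comp continuous_intros)
  show "K \<subseteq> {x. \<forall>u\<in>sphere 0 1. x \<bullet> u \<le> support_function K u}"
    using bdd by (auto simp: support_function_def intro!: cSUP_upper)
  show "{x. \<forall>u\<in>sphere 0 1. x \<bullet> u \<le> support_function K u} \<subseteq> K"
  proof (rule subsetI, rule ccontr)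
    fix x assume x: "x \<in> {x. \<forall>u\<in>sphere 0 1. x \<bullet> u \<le> support_function K u}" and "x \<notin> K"
    then obtain a b where ab: "a \<bullet> x < b" "\<And>y. y \<in> K \<Longrightarrow> b < a \<bullet> y"
      using separating_hyperplane_closed_point[OF conv compact_imp_closed[OF comp]] by metis
    obtain y0 where "y0 \<in> K" using ne by blast
    then have a0: "a \<noteq> 0" using ab(1) ab(2)[of y0] by auto
    define u where "u = - (a /\<^sub>R norm a)"
    have u: "u \<in> sphere 0 1" using a0 by (simp add: u_def)
    have zu: "z \<bullet> u = - (a \<bullet> z) / norm a" for z by (simp add: u_def inner_commute divide_inverse)
    have "support_function K u \<le> - b / norm a"
      unfolding support_function_def
    proof (rule cSUP_least[OF ne])
      fix y assume "y \<in> K"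
      then have "- (a \<bullet> y) \<le> - b" using ab(2)[of y] by simp
      then show "y \<bullet> u \<le> - b / norm a" unfolding zu by (rule divide_right_mono) simp
    qed
    also have "\<dots> < x \<bullet> u" unfolding zu using ab(1) a0 by (simp add: divide_strict_right_mono)
    finally have "support_function K u < x \<bullet> u" .
    moreover have "x \<bullet> u \<le> support_function K u" using x u by blast
    ultimately show False by linarith
  qed
qed

lemma has_support_function_unique:
  assumes "has_support_function K f" "has_support_function K' f"
  shows "K = K'"
proof -
  have "L = {x. \<forall>u\<in>sphere 0 1. x \<bullet> u \<le> f u}" if "has_support_function L f" for L
  proof -
    have "L = {x. \<forall>u\<in>sphere 0 1. x \<bullet> u \<le> support_function L u}"
      using that by (intro convex_body_eq_halfspaces) (simp add: has_support_function_def)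
    also have "\<dots> = {x. \<forall>u\<in>sphere 0 1. x \<bullet> u \<le> f u}"
      using that by (simp add: has_support_function_def)
    finally show ?thesis .
  qed
  from this[OF assms(1)] this[OF assms(2)] show ?thesis by simp
qed

lemma C_k_on_subset: "C_k_on k S f \<Longrightarrow> T \<subseteq> S \<Longrightarrow> C_k_on k T f"
  by (induction k arbitrary: f) (auto intro: continuous_on_subset)

text \<open>G is homogeneous of degree one, as support functions are, so its gradient V leads to the
  boundary points u + \<epsilon> V u of the perturbed body; V u . u = g u is Euler's
  identity.\<close>

lemma smooth_homogeneous_extension:
  fixes g :: "real^'n \<Rightarrow> real"
  assumes "smooth_on_sphere g"
  obtains G :: "real^'n \<Rightarrow> real" and V :: "real^'n \<Rightarrow> real^'n" where
    "\<And>x. x \<noteq> 0 \<Longrightarrow> (G has_derivative (\<lambda>v. V x \<bullet> v)) (at x)"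
    "\<And>x. x \<noteq> 0 \<Longrightarrow> G x = norm x * g (x /\<^sub>R norm x)"
    "\<And>u. norm u = 1 \<Longrightarrow> V u \<bullet> u = g u" "smooth_on (- {0}) V"
proof -
  obtain U F where U: "open U" "sphere 0 1 \<subseteq> U" "smooth_on U F" "\<forall>u\<in>sphere 0 1. F u = g u"
    using assms unfolding smooth_on_sphere_def by blast
  define G where "G x = norm x * F (inverse (norm x) *\<^sub>R x)" for x
  define V where "V x = (\<Sum>b\<in>Basis. frechet_derivative G (at x) b *\<^sub>R b)" for x
  have S: "open (- {0 :: real^'n})" by (simp add: open_Compl)
  have G: "C_k_on k (- {0}) G" for k
    unfolding G_def
  proof (intro C_k_on_mult S C_k_on_norm)
    show "C_k_on k (- {0}) (\<lambda>x. F (inverse (norm x) *\<^sub>R x))"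
    proof (rule C_k_on_compose[OF S U(1)])
      show "C_k_on k (- {0}) (\<lambda>x :: real^'n. inverse (norm x) *\<^sub>R x)"
        by (intro C_k_on_scaleR S C_k_on_inverse_compose C_k_on_norm C_k_on_id) simp
      show "C_k_on k U F" using U(3) by (simp add: smooth_on_def)
      show "inverse (norm x) *\<^sub>R x \<in> U" if "x \<in> - {0}" for x using that U(2) by (auto intro!: subsetD[OF U(2)])
    qed
  qed
  have D: "(G has_derivative (\<lambda>v. V x \<bullet> v)) (at x)" if "x \<noteq> 0" for x
  proof -
    have DG: "(G has_derivative frechet_derivative G (at x)) (at x)"
      by (rule C_k_on_SucD(1)[OF G[of "Suc 0"]]) (use that in simp)
    moreover have "frechet_derivative G (at x) = (\<lambda>v. V x \<bullet> v)"
      unfolding V_def using gradient_exists[OF DG] by blast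
    ultimately show ?thesis by simp
  qed
  have Gx: "G x = norm x * g (x /\<^sub>R norm x)" if "x \<noteq> 0" for x
    using that U(4) by (simp add: G_def)
  have hom: "G (c *\<^sub>R x) = c * G x" if "0 < c" for c x
  proof -
    have "inverse (norm (c *\<^sub>R x)) *\<^sub>R (c *\<^sub>R x) = inverse (norm x) *\<^sub>R x"
      using that by (auto simp: field_simps)
    then show ?thesis unfolding G_def by (simp only:) (use that in simp)
  qed
  have Vu: "V u \<bullet> u = g u" if u: "norm u = 1" for u
  proof -
    have u0: "u \<noteq> 0" using u by auto
    have 1: "((\<lambda>t. u + t *\<^sub>R u) has_derivative (\<lambda>t. t *\<^sub>R u)) (at 0)"
      by (auto intro!: derivative_eq_intros)
    have "(G has_derivative (\<lambda>v. V u \<bullet> v)) (at (u + 0 *\<^sub>R u))" using D[OF u0] by simp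
    from has_derivative_compose[OF 1 this]
    have d1: "((\<lambda>t. G (u + t *\<^sub>R u)) has_derivative (\<lambda>t. V u \<bullet> (t *\<^sub>R u))) (at 0)" .
    have e1: "((\<lambda>t. (1 + t) * G u) has_derivative (\<lambda>t. t * G u)) (at 0)"
      by (auto intro!: derivative_eq_intros)
    have e2: "(1 + t) * G u = G (u + t *\<^sub>R u)" if "t \<in> {-1<..}" for t
      using hom[of "1 + t" u] that by (simp add: scaleR_left_distrib)
    have d2: "((\<lambda>t. G (u + t *\<^sub>R u)) has_derivative (\<lambda>t. t * G u)) (at 0)"
      by (rule has_derivative_transform_within_open[OF e1 open_greaterThan[of "-1"] _ e2]) simp_all
    have "V u \<bullet> (1 *\<^sub>R u) = 1 * G u"
      using has_derivative_unique[OF d1 d2] by meson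
    then show ?thesis using Gx[OF u0] u by simp
  qed
  have "C_k_on k (- {0}) V" for k
    unfolding V_def
    by (intro C_k_on_sum S C_k_on_scaleR C_k_on_const C_k_on_SucD(2)[OF G])
  then have "smooth_on (- {0}) V" by (simp add: smooth_on_def)
  show ?thesis by (rule that[of G V]) (fact D Gx Vu \<open>smooth_on (- {0}) V\<close>)+
qed

text \<open>C is a second-order Taylor constant on the sphere and M a Lipschitz constant of V on the
  annulus 1/2 \<le> |x| \<le> 2. Of the smallness conditions, the first makes \<open>X u\<close> a
  support point in direction u, the second makes \<open>X\<close> injective with invertible
  derivative near the sphere, and the third keeps the support function within [1/2, 3/2].\<close>

locale support_perturbation =
  fixes g G :: "real^'n \<Rightarrow> real" and V :: "real^'n \<Rightarrow> real^'n" and C M \<epsilon> :: real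
  assumes D: "\<And>x. x \<noteq> 0 \<Longrightarrow> (G has_derivative (\<lambda>v. V x \<bullet> v)) (at x)"
    and G: "\<And>x. x \<noteq> 0 \<Longrightarrow> G x = norm x * g (x /\<^sub>R norm x)"
    and Vu: "\<And>u. norm u = 1 \<Longrightarrow> V u \<bullet> u = g u" and V: "smooth_on (- {0}) V"
    and taylor: "\<And>u v. norm u = 1 \<Longrightarrow> norm v = 1 \<Longrightarrow> \<bar>g v - V u \<bullet> v\<bar> \<le> C * (norm (u - v))\<^sup>2"
    and M: "\<And>x y. x \<in> cball 0 2 - ball 0 (1/2) \<Longrightarrow> y \<in> cball 0 2 - ball 0 (1/2) \<Longrightarrow> norm (V x - V y) \<le> M * norm (x - y)"
      "\<And>x v. x \<in> cball 0 2 - ball 0 (1/2) \<Longrightarrow> norm (frechet_derivative V (at x) v) \<le> M * norm v"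
    and small: "\<bar>\<epsilon>\<bar> * C < 1/2" "\<bar>\<epsilon>\<bar> * M < 1" "\<And>u. norm u = 1 \<Longrightarrow> \<bar>\<epsilon> * g u\<bar> \<le> 1/2"
begin

definition "hh u = 1 + \<epsilon> * g u"
text \<open>On the sphere this is the gradient of \<open>norm x + \<epsilon> * G x\<close>, the
  boundary point with outer normal u. Off the sphere the first summand is u itself and not its
  direction, which makes \<open>X\<close> a perturbation of the identity.\<close>

definition "X u = u + \<epsilon> *\<^sub>R V u"
text \<open>The Wulff shape of \<open>hh\<close>; the points \<open>X u\<close> show that each of
  the half-spaces is touched.\<close>

definition "K = {x. \<forall>u\<in>sphere 0 1. x \<bullet> u \<le> hh u}"

lemma hh_bounds: "norm u = 1 \<Longrightarrow> 1/2 \<le> hh u \<and> hh u \<le> 3/2"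
  using small(3)[of u] by (auto simp: hh_def abs_le_iff)

lemma X_inner: "norm u = 1 \<Longrightarrow> X u \<bullet> u = hh u"
  using Vu[of u] by (simp add: X_def hh_def inner_simps dot_square_norm)

text \<open>For the unit ball the gap is |u - v|^2 / 2, and the perturbation changes it by at most
  |\<epsilon>| times the Taylor error.\<close>

lemma X_gap:
  assumes "norm u = 1" "norm v = 1"
  shows "X u \<bullet> v \<le> hh v - (1/2 - \<bar>\<epsilon>\<bar> * C) * (norm (u - v))\<^sup>2"
proof -
  have "u \<bullet> u = 1" "v \<bullet> v = 1" using assms by (simp_all add: norm_eq_1)
  then have "(norm (u - v))\<^sup>2 = 2 - 2 * (u \<bullet> v)"
    by (simp add: power2_norm_eq_inner inner_simps inner_commute)
  then have "hh v - X u \<bullet> v = (norm (u - v))\<^sup>2 / 2 + \<epsilon> * (g v - V u \<bullet> v)"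
    by (simp add: hh_def X_def inner_simps algebra_simps)
  moreover have "\<bar>\<epsilon> * (g v - V u \<bullet> v)\<bar> \<le> \<bar>\<epsilon>\<bar> * (C * (norm (u - v))\<^sup>2)"
    unfolding abs_mult using taylor[OF assms] by (intro mult_left_mono) auto
  ultimately show ?thesis by (simp add: algebra_simps abs_le_iff)
qed

lemma X_le: "norm u = 1 \<Longrightarrow> norm v = 1 \<Longrightarrow> X u \<bullet> v \<le> hh v"
proof -
  assume "norm u = 1" "norm v = 1"
  then have "X u \<bullet> v \<le> hh v - (1/2 - \<bar>\<epsilon>\<bar> * C) * (norm (u - v))\<^sup>2" by (rule X_gap)
  moreover have "0 \<le> (1/2 - \<bar>\<epsilon>\<bar> * C) * (norm (u - v))\<^sup>2"
    using small(1) by (intro mult_nonneg_nonneg) auto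
  ultimately show ?thesis by linarith
qed

lemma X_in_K: "norm u = 1 \<Longrightarrow> X u \<in> K"
  using X_le by (auto simp: K_def)

lemma support_K: "norm u = 1 \<Longrightarrow> support_function K u = hh u"
proof -
  assume u: "norm u = 1"
  have le: "x \<bullet> u \<le> hh u" if "x \<in> K" for x using that u by (simp add: K_def)
  have "bdd_above ((\<lambda>x. x \<bullet> u) ` K)" using le by (intro bdd_aboveI2[of _ _ "hh u"])
  then have "X u \<bullet> u \<le> support_function K u"
    unfolding support_function_def using X_in_K[OF u] by (rule cSUP_upper[rotated])
  moreover have "support_function K u \<le> hh u"
    unfolding support_function_def using X_in_K[OF u] le by (intro cSUP_least) auto
  ultimately show ?thesis using X_inner[OF u] by simp
qed

lemma K_geometry: "compact K" "convex K" "ball 0 (1/2) \<subseteq> K"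
proof -
  have K: "K = (\<Inter>u\<in>sphere 0 1. {x. x \<bullet> u \<le> hh u})" by (auto simp: K_def)
  have "closed K" unfolding K by (intro closed_INT ballI closed_Collect_le continuous_intros)
  moreover have "bounded K"
    unfolding bounded_iff
  proof (intro exI[of _ "3/2"] ballI)
    fix x assume x: "x \<in> K"
    show "norm x \<le> 3/2"
    proof (cases "x = 0")
      case False
      then have n: "norm (x /\<^sub>R norm x) = 1" by simp
      have "norm x = x \<bullet> (x /\<^sub>R norm x)" using False by (simp add: dot_square_norm power2_eq_square)
      also have "\<dots> \<le> hh (x /\<^sub>R norm x)" using x n unfolding K_def by (simp only: mem_Collect_eq Ball_def mem_sphere dist_0_norm)
      also have "\<dots> \<le> 3/2" using hh_bounds[OF n] by blast
      finally show ?thesis .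
    qed simp
  qed
  ultimately show "compact K" by (simp add: compact_eq_bounded_closed)
  show "convex K" unfolding K
  proof (rule convex_INT)
    fix u :: "real^'n"
    show "convex {x. x \<bullet> u \<le> hh u}" using convex_halfspace_le[of u "hh u"] by (simp add: inner_commute)
  qed
  show "ball 0 (1/2) \<subseteq> K"
  proof
    fix x :: "real^'n" assume x: "x \<in> ball 0 (1/2)"
    have "x \<bullet> u \<le> hh u" if u: "norm u = 1" for u
    proof -
      have "x \<bullet> u \<le> norm x * norm u" by (rule norm_cauchy_schwarz)
      then show ?thesis using x u hh_bounds[OF u] by simp
    qed
    then show "x \<in> K" by (simp add: K_def)
  qed
qed

lemma continuous_hh: "continuous_on (sphere 0 1) hh"
proof -
  have "isCont G u" if "u \<in> sphere 0 1" for u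
  proof -
    have "u \<noteq> 0" using that by auto
    from has_derivative_continuous[OF D[OF this]] show ?thesis .
  qed
  then have cG: "continuous_on (sphere 0 1) G" by (intro continuous_at_imp_continuous_on) auto
  have "G u = g u" if "u \<in> sphere 0 1" for u
    using G[of u] that by (cases "u = 0") auto
  with cG have "continuous_on (sphere 0 1) g" by (rule continuous_on_eq)
  then show ?thesis unfolding hh_def[abs_def] by (intro continuous_intros)
qed

text \<open>The homogeneous support function minus x . v is nonnegative off the origin and vanishes
  at u, so its gradient X u - x at this minimum is 0.\<close>

lemma contact_point:
  assumes x: "x \<in> K" and u: "norm u = 1" and eq: "x \<bullet> u = hh u"
  shows "x = X u"
proof -
  define f where "f v = norm v + \<epsilon> * G v - x \<bullet> v" for v
  have u0: "u \<noteq> 0" using u by auto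
  have df: "(f has_derivative (\<lambda>v. (X u - x) \<bullet> v)) (at u)"
  proof -
    have "(f has_derivative (\<lambda>v. u \<bullet> v / norm u + \<epsilon> * (V u \<bullet> v) - x \<bullet> v)) (at u)"
      unfolding f_def[abs_def] using D[OF u0] has_derivative_norm[OF u0] u
      by (auto intro!: derivative_eq_intros simp: sgn_div_norm inner_commute)
    then show ?thesis using u by (simp add: X_def inner_simps)
  qed
  have f0: "0 \<le> f v" if "v \<in> - {0}" for v
  proof -
    have v: "v \<noteq> 0" "norm (v /\<^sub>R norm v) = 1" using that by auto
    have "x \<bullet> (v /\<^sub>R norm v) \<le> hh (v /\<^sub>R norm v)"
      using x v(2) unfolding K_def by (simp only: mem_Collect_eq Ball_def mem_sphere dist_0_norm)
    then have le: "norm v * (x \<bullet> (v /\<^sub>R norm v)) \<le> norm v * hh (v /\<^sub>R norm v)" by (rule mult_left_mono) simp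
    have e1: "norm v * (x \<bullet> (v /\<^sub>R norm v)) = x \<bullet> v" using v by simp
    have e2: "norm v * hh (v /\<^sub>R norm v) = norm v + \<epsilon> * G v" unfolding hh_def G[OF v(1)] by (simp add: algebra_simps)
    show ?thesis using le unfolding e1 e2 f_def by linarith
  qed
  have fu: "f u = 0" using eq u G[OF u0] by (simp add: f_def hh_def)
  have "(\<lambda>v. (X u - x) \<bullet> v) = (\<lambda>v. 0)"
    by (rule differential_zero_maxmin[OF _ _ df, of "- {0}"]) (use u0 f0 fu in \<open>auto simp: open_Compl\<close>)
  from fun_cong[OF this, of "X u - x"] have "(X u - x) \<bullet> (X u - x) = 0" .
  then show ?thesis by simp
qed

text \<open>The slack hh u - x . u attains its minimum on the sphere. If positive, it is the radius
  of a ball around x inside K; if 0, then x is a contact point. Conversely, X u + e u leaves K for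
  every e > 0.\<close>

lemma frontier_K: "frontier K = X ` sphere 0 1"
proof
  have cl: "closed K" using K_geometry(1) by (rule compact_imp_closed)
  show "frontier K \<subseteq> X ` sphere 0 1"
  proof
    fix x assume x: "x \<in> frontier K"
    have xK: "x \<in> K" using x cl frontier_subset_eq by blast
    have ne: "sphere (0 :: real^'n) 1 \<noteq> {}" by simp
    have "continuous_on (sphere 0 1) (\<lambda>u. hh u - x \<bullet> u)" by (intro continuous_intros continuous_hh)
    from continuous_attains_inf[OF compact_sphere ne this]
    obtain u where u: "norm u = 1" "\<And>v. norm v = 1 \<Longrightarrow> hh u - x \<bullet> u \<le> hh v - x \<bullet> v" by auto
    have "x \<bullet> u \<le> hh u" using xK u(1) by (simp add: K_def)
    moreover have "\<not> x \<bullet> u < hh u"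
    proof
      assume lt: "x \<bullet> u < hh u"
      have "ball x (hh u - x \<bullet> u) \<subseteq> K"
      proof
        fix y assume y: "y \<in> ball x (hh u - x \<bullet> u)"
        have "y \<bullet> v \<le> hh v" if v: "norm v = 1" for v
        proof -
          have "y \<bullet> v = x \<bullet> v + (y - x) \<bullet> v" by (simp add: inner_simps)
          also have "(y - x) \<bullet> v \<le> norm (y - x) * norm v" by (rule norm_cauchy_schwarz)
          finally show ?thesis using y u(2)[OF v] v by (simp add: dist_norm norm_minus_commute)
        qed
        then show "y \<in> K" by (simp add: K_def)
      qed
      then have "x \<in> interior K"
        unfolding mem_interior using lt by (intro exI[of _ "hh u - x \<bullet> u"]) simp
      then show False using x by (simp add: frontier_def)
    qed
    ultimately have "x = X u" using contact_point[OF xK u(1)] by simp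
    then show "x \<in> X ` sphere 0 1" using u(1) by simp
  qed
  show "X ` sphere 0 1 \<subseteq> frontier K"
  proof (rule image_subsetI)
    fix u :: "real^'n" assume "u \<in> sphere 0 1"
    then have u: "norm u = 1" by simp
    have "X u \<notin> interior K"
    proof
      assume "X u \<in> interior K"
      then obtain e where e: "0 < e" "cball (X u) e \<subseteq> K" using mem_interior_cball by blast
      have "X u + e *\<^sub>R u \<in> K" using e(1) u by (intro subsetD[OF e(2)]) (simp add: dist_norm)
      then have "(X u + e *\<^sub>R u) \<bullet> u \<le> hh u" using u by (simp add: K_def)
      then show False using X_inner[OF u] u e(1) by (simp add: inner_simps dot_square_norm)
    qed
    then show "X u \<in> frontier K" using X_in_K[OF u] closure_subset by (auto simp: frontier_def)
  qed
qed

text \<open>If an inner point of the segment were on the boundary, both ends would lie on its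
  supporting hyperplane, which meets K in a single point by \<open>contact_point\<close>.\<close>

lemma strictly_convex_K:
  assumes "x \<in> K" "y \<in> K" "x \<noteq> y"
  shows "open_segment x y \<subseteq> interior K"
proof
  fix z assume z: "z \<in> open_segment x y"
  then obtain t where t: "0 < t" "t < 1" "z = (1 - t) *\<^sub>R x + t *\<^sub>R y"
    by (auto simp: in_segment)
  have zK: "z \<in> K" unfolding t(3) using t assms by (intro convexD[OF K_geometry(2)]) auto
  show "z \<in> interior K"
  proof (rule ccontr)
    assume "z \<notin> interior K"
    then have "z \<in> frontier K" using zK closure_subset by (auto simp: frontier_def)
    then obtain u where u: "norm u = 1" "z = X u" unfolding frontier_K by auto
    have "z \<bullet> u = hh u" using X_inner[OF u(1)] u(2) by simp
    then have zu: "(1 - t) * (x \<bullet> u) + t * (y \<bullet> u) = hh u"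
      unfolding t(3) inner_add_left inner_scaleR_left .
    have xu: "x \<bullet> u \<le> hh u" and yu: "y \<bullet> u \<le> hh u" using assms u(1) by (auto simp: K_def)
    have "(1 - t) * (x \<bullet> u) \<le> (1 - t) * hh u" "t * (y \<bullet> u) \<le> t * hh u"
      using xu yu t by (auto intro: mult_left_mono)
    moreover have "(1 - t) * hh u + t * hh u = hh u" by (simp add: algebra_simps)
    ultimately have "(1 - t) * (x \<bullet> u) = (1 - t) * hh u" "t * (y \<bullet> u) = t * hh u" using zu by linarith+
    then have "x \<bullet> u = hh u" "y \<bullet> u = hh u" using t by auto
    then have "x = y" using contact_point[OF assms(1) u(1)] contact_point[OF assms(2) u(1)] by simp
    then show False using assms(3) by simp
  qed
qed

text \<open>One defining function serves the whole boundary: |\<Psi> y|^2 - 1, with \<Psi> the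
  smooth inverse of \<open>X\<close> on an open annulus around the sphere.\<close>

lemma smooth_boundary_K: "smooth_boundary K"
proof -
  define W where "W = ball 0 2 - cball (0 :: real^'n) (1/2)"
  define \<delta> where "\<delta> = 1 - \<bar>\<epsilon>\<bar> * M"
  have \<delta>: "0 < \<delta>" using small(2) by (simp add: \<delta>_def)
  have W: "open W" by (simp add: W_def open_Diff)
  have WA: "x \<in> cball 0 2 - ball 0 (1/2)" if "x \<in> W" for x using that by (auto simp: W_def)
  have W0: "x \<noteq> 0" if "x \<in> W" for x using that by (auto simp: W_def)
  have SW: "u \<in> W" if "norm u = 1" for u using that by (simp add: W_def)
  have expand: "\<delta> * norm (y - z) \<le> norm (X y - X z)" if "y \<in> W" "z \<in> W" for y z
  proof -
    have "X y - X z = (y - z) + \<epsilon> *\<^sub>R (V y - V z)" by (simp add: X_def algebra_simps)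
    then have "norm (y - z) - norm (\<epsilon> *\<^sub>R (V y - V z)) \<le> norm (X y - X z)" by (metis norm_diff_ineq)
    moreover have "norm (\<epsilon> *\<^sub>R (V y - V z)) \<le> \<bar>\<epsilon>\<bar> * (M * norm (y - z))"
      using M(1)[OF WA[OF that(1)] WA[OF that(2)]] by (simp add: mult_left_mono)
    ultimately show ?thesis by (simp add: \<delta>_def algebra_simps)
  qed
  have CX: "C_k_on k W X" for k
  proof -
    have "C_k_on k (- {0}) X"
      unfolding X_def using V
      by (intro C_k_on_add C_k_on_id C_k_on_linear[OF bounded_linear_scaleR_right]) (auto simp: open_Compl smooth_on_def)
    then show ?thesis by (rule C_k_on_subset) (use W0 in auto)
  qed
  have inj: "inj_on X W"
  proof (rule inj_onI)
    fix y z assume "y \<in> W" "z \<in> W" "X y = X z"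
    then have "\<delta> * norm (y - z) \<le> 0" using expand[of y z] by simp
    then show "y = z" using \<delta> by (simp add: mult_le_0_iff)
  qed
  \<comment> \<open>Injectivity and continuity already make the image open;
    \<open>C_k_on_inverse_map\<close> asks for an open domain of \<Psi>.\<close>
  have oXW: "open (X ` W)"
    by (rule invariance_of_domain[OF C_k_on_continuous[OF CX[of 0]] W inj])
  define \<Psi> where "\<Psi> = inv_into W X"
  have \<Psi>W: "\<Psi> y \<in> W" and X\<Psi>: "X (\<Psi> y) = y" if "y \<in> X ` W" for y
    using that by (auto simp: \<Psi>_def inv_into_into f_inv_into_f)
  have \<Psi>X: "\<Psi> (X z) = z" if "z \<in> W" for z using that inj by (simp add: \<Psi>_def)
  have "(1 / \<delta>)-lipschitz_on (X ` W) \<Psi>"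
  proof (rule lipschitz_onI)
    fix a b assume "a \<in> X ` W" "b \<in> X ` W"
    then show "dist (\<Psi> a) (\<Psi> b) \<le> 1 / \<delta> * dist a b"
      using expand[OF \<Psi>W \<Psi>W, of a b] X\<Psi> \<delta> by (simp add: dist_norm field_simps)
  qed (use \<delta> in simp)
  then have cont: "continuous_on (X ` W) \<Psi>" by (rule lipschitz_on_continuous_on)
  have DX: "(X has_derivative (\<lambda>v. v + \<epsilon> *\<^sub>R frechet_derivative V (at x) v)) (at x)" if "x \<in> W" for x
  proof -
    have "C_k_on (Suc 0) (- {0}) V" using V unfolding smooth_on_def by blast
    from C_k_on_SucD(1)[OF this, of x] show ?thesis
      unfolding X_def[abs_def] using W0[OF that] by (auto intro!: derivative_eq_intros)
  qed
  have det: "det (matrix (frechet_derivative X (at x))) \<noteq> 0" if x: "x \<in> W" for x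
  proof -
    let ?D = "\<lambda>v. v + \<epsilon> *\<^sub>R frechet_derivative V (at x) v"
    have lin: "linear ?D" using DX[OF x] by (rule has_derivative_linear)
    have "inj ?D"
      unfolding linear_injective_0[OF lin]
    proof (intro allI impI)
      fix v assume "?D v = 0"
      then have "v = - (\<epsilon> *\<^sub>R frechet_derivative V (at x) v)" by (simp add: add_eq_0_iff)
      then have "norm v = \<bar>\<epsilon>\<bar> * norm (frechet_derivative V (at x) v)" by (metis norm_minus_cancel norm_scaleR)
      also have "\<dots> \<le> \<bar>\<epsilon>\<bar> * (M * norm v)" using M(2)[OF WA[OF x]] by (intro mult_left_mono) auto
      finally have "\<delta> * norm v \<le> 0" by (simp add: \<delta>_def algebra_simps)
      then show "v = 0" using \<delta> by (simp add: mult_le_0_iff)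
    qed
    then have "det (matrix ?D) \<noteq> 0" using det_nz_iff_inj[OF lin] by simp
    then show ?thesis using frechet_derivative_at[OF DX[OF x]] by simp
  qed
  define f where "f y = \<Psi> y \<bullet> \<Psi> y - 1" for y
  have C\<Psi>: "C_k_on k (X ` W) \<Psi>" for k
    by (rule C_k_on_inverse_map[OF W oXW _ cont \<Psi>W X\<Psi> det]) (use CX in \<open>simp_all add: smooth_on_def\<close>)
  have Cf: "smooth_on (X ` W) f"
  proof -
    have "C_k_on k (X ` W) (\<lambda>y. \<Psi> y \<bullet> \<Psi> y + (- 1))" for k
      by (intro C_k_on_add oXW C_k_on_inner C\<Psi> C_k_on_const)
    then show ?thesis by (simp add: smooth_on_def f_def[abs_def])
  qed
  \<comment> \<open>Composed with X, f becomes |z|^2 - 1, whose derivative does not vanish on W; so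
    neither does that of f.\<close>
  have regular: "frechet_derivative f (at y) \<noteq> (\<lambda>v. 0)" if y: "y \<in> X ` W" for y
  proof
    assume 0: "frechet_derivative f (at y) = (\<lambda>v. 0)"
    have "C_k_on (Suc 0) (X ` W) f" using Cf unfolding smooth_on_def by blast
    from C_k_on_SucD(1)[OF this y] have "(f has_derivative (\<lambda>v. 0)) (at (X (\<Psi> y)))"
      using 0 X\<Psi>[OF y] by simp
    from has_derivative_compose[OF DX[OF \<Psi>W[OF y]] this]
    have "((\<lambda>z. f (X z)) has_derivative (\<lambda>v. 0)) (at (\<Psi> y))" .
    then have d1: "((\<lambda>z. z \<bullet> z - 1) has_derivative (\<lambda>v. 0)) (at (\<Psi> y))"
      by (rule has_derivative_transform_within_open[OF _ W \<Psi>W[OF y]]) (simp add: f_def \<Psi>X)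
    have d2: "((\<lambda>z. z \<bullet> z - 1) has_derivative (\<lambda>v. \<Psi> y \<bullet> v + v \<bullet> \<Psi> y)) (at (\<Psi> y))"
      by (auto intro!: derivative_eq_intros)
    have "\<Psi> y \<bullet> \<Psi> y + \<Psi> y \<bullet> \<Psi> y = 0" 
      using fun_cong[OF has_derivative_unique[OF d1 d2], of "\<Psi> y"] by simp
    then show False using W0[OF \<Psi>W[OF y]] by simp
  qed
  have level: "frontier K \<inter> X ` W = {y \<in> X ` W. f y = 0}"
  proof -
    have "X z \<in> frontier K \<longleftrightarrow> norm z = 1" if z: "z \<in> W" for z
    proof
      assume "X z \<in> frontier K"
      then obtain u where "norm u = 1" "X z = X u" unfolding frontier_K by auto
      then show "norm z = 1" using inj_onD[OF inj _ z SW, of u] by simp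
    qed (auto simp: frontier_K)
    moreover have "f (X z) = 0 \<longleftrightarrow> norm z = 1" if z: "z \<in> W" for z
      using \<Psi>X[OF z] by (simp add: f_def dot_square_norm power2_eq_1_iff) (smt (verit) norm_ge_zero)
    ultimately show ?thesis by auto
  qed
  show ?thesis
    unfolding smooth_boundary_def
  proof
    fix x assume "x \<in> frontier K"
    then have "x \<in> X ` W" using SW by (auto simp: frontier_K)
    then show "\<exists>U (F :: real^'n \<Rightarrow> real). open U \<and> x \<in> U \<and> smooth_on U F \<and>
        (\<forall>y\<in>U. frechet_derivative F (at y) \<noteq> (\<lambda>v. 0)) \<and> frontier K \<inter> U = {y \<in> U. F y = 0}"
      using oXW Cf regular level by (intro exI[of _ "X ` W"] exI[of _ f]) simp
  qed
qed

lemma has_support: "has_support_function K (\<lambda>u. 1 + \<epsilon> * g u)"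
  using K_geometry support_K interior_maximal[OF K_geometry(3)]
  by (auto simp: has_support_function_def convex_body_def hh_def)

lemma smooth_strictly_convex_K: "smooth_strictly_convex_body K"
proof -
  have "0 \<in> interior K" using interior_maximal[OF K_geometry(3)] by auto
  then show ?thesis
    using has_support smooth_boundary_K strictly_convex_K
    by (simp add: smooth_strictly_convex_body_def has_support_function_def)
qed

end

text \<open>All constants are chosen before \<epsilon>, so that a single bound serves a whole
  sequence of parameters under dominated convergence.\<close>

lemma ex_support_perturbation:
  fixes g :: "real^'n \<Rightarrow> real"
  assumes "smooth_on_sphere g"
  shows "\<exists>G V C M b \<epsilon>0. 0 < \<epsilon>0 \<and> 0 \<le> b \<and> \<epsilon>0 * b \<le> 1/2 \<and> (\<forall>u. norm u = 1 \<longrightarrow> \<bar>g u\<bar> \<le> b) \<and>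
    (\<forall>\<epsilon>. \<bar>\<epsilon>\<bar> < \<epsilon>0 \<longrightarrow> support_perturbation g G V C M \<epsilon>)"
proof (rule smooth_homogeneous_extension[OF assms])
  fix G V assume D: "\<And>x :: real^'n. x \<noteq> 0 \<Longrightarrow> (G has_derivative (\<lambda>v. V x \<bullet> v)) (at x)"
    and G: "\<And>x. x \<noteq> 0 \<Longrightarrow> G x = norm x * g (x /\<^sub>R norm x)"
    and Vu: "\<And>u. norm u = 1 \<Longrightarrow> V u \<bullet> u = g u" and V: "smooth_on (- {0}) V"
  let ?A = "cball (0 :: real^'n) 2 - ball 0 (1/2)"
  have CV: "C_k_on (Suc 0) (- {0}) V" using V unfolding smooth_on_def by blast
  have "compact ?A" by (intro compact_diff) auto
  moreover have "?A \<subseteq> - {0}" by auto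
  moreover have "open (- {0 :: real^'n})" by (simp add: open_Compl)
  ultimately obtain M where M: "0 \<le> M" "\<And>x y. x \<in> ?A \<Longrightarrow> y \<in> ?A \<Longrightarrow> norm (V x - V y) \<le> M * norm (x - y)"
    "\<And>x v. x \<in> ?A \<Longrightarrow> norm (frechet_derivative V (at x) v) \<le> M * norm v"
    using C_1_lipschitz_compact[OF _ CV] by meson
  have "continuous_on (sphere 0 1) V"
    using C_k_on_continuous[OF CV] by (rule continuous_on_subset) auto
  from compact_imp_bounded[OF compact_continuous_image[OF this compact_sphere]]
  obtain b where "\<forall>w\<in>V ` sphere 0 1. norm w \<le> b" unfolding bounded_iff by blast
  then have b: "norm (V u) \<le> b" if "norm u = 1" for u using that by auto
  obtain e :: "real^'n" where "e \<in> Basis" using nonempty_Basis by blast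
  then have b0: "0 \<le> b" using order_trans[OF norm_ge_zero b[of e]] by simp
  have gb: "\<bar>g u\<bar> \<le> b" if u: "norm u = 1" for u
  proof -
    have "\<bar>V u \<bullet> u\<bar> \<le> norm (V u) * norm u" by (rule Cauchy_Schwarz_ineq2)
    then show ?thesis using b[OF u] Vu[OF u] u by simp
  qed
  \<comment> \<open>M takes care of pairs at distance at most 1/2, whose segment stays in the
    annulus. For other pairs the error is at most 2 b = 8 b (1/2)^2.\<close>
  define C where "C = M + 8 * b"
  have taylor: "\<bar>g v - V u \<bullet> v\<bar> \<le> C * (norm (u - v))\<^sup>2" if u: "norm u = 1" and v: "norm v = 1" for u v
  proof (cases "norm (u - v) \<le> 1/2")
    case True
    have Gg: "G w = g w" if "norm w = 1" for w using G[of w] that by (cases "w = 0") auto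
    define \<phi> where "\<phi> z = G z - V u \<bullet> z" for z
    have seg: "z \<in> ?A" "z \<noteq> 0" "norm (z - u) \<le> norm (v - u)" if "z \<in> closed_segment u v" for z
    proof -
      show zu: "norm (z - u) \<le> norm (v - u)" using segment_bound(1)[OF that] .
      have "norm u - norm (z - u) \<le> norm z" using norm_triangle_ineq2[of u "u - z"] by (simp add: norm_minus_commute)
      moreover have "norm z \<le> norm u + norm (z - u)" using norm_triangle_ineq[of u "z - u"] by simp
      ultimately show "z \<in> ?A" "z \<noteq> 0" using u zu True by (auto simp: norm_minus_commute)
    qed
    have uA: "u \<in> ?A" using u by simp
    have "norm (\<phi> v - \<phi> u) \<le> (M * norm (v - u)) * norm (v - u)"
    proof (rule differentiable_bound[of "closed_segment u v" \<phi> "\<lambda>z w. (V z - V u) \<bullet> w"])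
      fix z assume z: "z \<in> closed_segment u v"
      have "(\<phi> has_derivative (\<lambda>w. (V z - V u) \<bullet> w)) (at z)"
        unfolding \<phi>_def[abs_def] inner_diff_left
        by (intro has_derivative_diff D seg(2)[OF z] bounded_linear_imp_has_derivative bounded_linear_inner_right)
      then show "(\<phi> has_derivative (\<lambda>w. (V z - V u) \<bullet> w)) (at z within closed_segment u v)"
        by (rule has_derivative_at_withinI)
      show "onorm (\<lambda>w. (V z - V u) \<bullet> w) \<le> M * norm (v - u)"
      proof (rule onorm_le)
        fix w
        have "norm ((V z - V u) \<bullet> w) \<le> norm (V z - V u) * norm w" using Cauchy_Schwarz_ineq2[of "V z - V u" w] by simp
        also have "\<dots> \<le> (M * norm (v - u)) * norm w"
        proof (rule mult_right_mono)
          have "norm (V z - V u) \<le> M * norm (z - u)" by (rule M(2)[OF seg(1)[OF z] uA])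
          also have "\<dots> \<le> M * norm (v - u)" using seg(3)[OF z] M(1) by (rule mult_left_mono)
          finally show "norm (V z - V u) \<le> M * norm (v - u)" .
        qed simp
        finally show "norm ((V z - V u) \<bullet> w) \<le> (M * norm (v - u)) * norm w" .
      qed
    qed auto
    moreover have "\<phi> v - \<phi> u = g v - V u \<bullet> v" using Gg[OF u] Gg[OF v] Vu[OF u] by (simp add: \<phi>_def)
    ultimately have "\<bar>g v - V u \<bullet> v\<bar> \<le> M * (norm (u - v))\<^sup>2"
      by (simp add: power2_eq_square norm_minus_commute mult.assoc)
    also have "\<dots> \<le> C * (norm (u - v))\<^sup>2" using b0 by (intro mult_right_mono) (auto simp: C_def)
    finally show ?thesis .
  next
    case False
    have "\<bar>V u \<bullet> v\<bar> \<le> norm (V u) * norm v" by (rule Cauchy_Schwarz_ineq2)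
    then have "\<bar>g v - V u \<bullet> v\<bar> \<le> 2 * b" using gb[OF v] b[OF u] v by simp
    also have "\<dots> = 8 * b * (1/2)\<^sup>2" by (simp add: power2_eq_square)
    also have "\<dots> \<le> 8 * b * (norm (u - v))\<^sup>2" using False b0 by (intro mult_left_mono power_mono) auto
    also have "\<dots> \<le> C * (norm (u - v))\<^sup>2" using M(1) by (intro mult_right_mono) (auto simp: C_def)
    finally show ?thesis .
  qed
  define S where "S = C + M + b + 1"
  have C0: "0 \<le> C" using M(1) b0 by (simp add: C_def)
  have S: "0 < S" "C \<le> S" "M \<le> S" "b \<le> S" using M(1) b0 C0 by (auto simp: S_def)
  define \<epsilon>0 where "\<epsilon>0 = 1 / (2 * S)"
  have \<epsilon>0: "0 < \<epsilon>0" "\<epsilon>0 * S = 1/2" using S by (auto simp: \<epsilon>0_def)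
  have pert: "support_perturbation g G V C M \<epsilon>" if \<epsilon>: "\<bar>\<epsilon>\<bar> < \<epsilon>0" for \<epsilon>
  proof
    have lt: "\<bar>\<epsilon>\<bar> * S < 1/2" using mult_strict_right_mono[OF \<epsilon> S(1)] \<epsilon>0(2) by simp
    have le: "\<bar>\<epsilon>\<bar> * s \<le> \<bar>\<epsilon>\<bar> * S" if "s \<le> S" for s using that by (intro mult_left_mono) auto
    show "\<bar>\<epsilon>\<bar> * C < 1/2" "\<bar>\<epsilon>\<bar> * M < 1" using le[OF S(2)] le[OF S(3)] lt by linarith+
    fix u :: "real^'n" assume u: "norm u = 1"
    have "\<bar>\<epsilon> * g u\<bar> \<le> \<bar>\<epsilon>\<bar> * b" unfolding abs_mult using gb[OF u] by (intro mult_left_mono) auto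
    then show "\<bar>\<epsilon> * g u\<bar> \<le> 1/2" using le[OF S(4)] lt by linarith
  qed (fact D G Vu V taylor M(2) M(3))+
  have "\<epsilon>0 * b \<le> \<epsilon>0 * S" using S(4) \<epsilon>0(1) by (intro mult_left_mono) auto
  then show ?thesis using \<epsilon>0 b0 gb pert by (intro exI[of _ G] exI[of _ V] exI[of _ C] exI[of _ M] exI[of _ b] exI[of _ \<epsilon>0]) auto
qed

context support_perturbation
begin

sublocale B: body K
  by (rule smooth_strictly_convex_body_imp_body[OF smooth_strictly_convex_K])

text \<open>The support function is within t = |\<epsilon>| b of 1, and this alone confines the
  boundary point over a direction to order t and its normal to order sqrt t; no derivative of g is
  involved.\<close>

lemma normal_estimates:
  assumes b: "\<And>u. norm u = 1 \<Longrightarrow> \<bar>g u\<bar> \<le> b" and \<epsilon>: "\<bar>\<epsilon>\<bar> * b \<le> 1/2" and x: "x \<noteq> 0"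
  defines "y \<equiv> x /\<^sub>R B.N x"
  shows "norm (B.\<nu> y) = 1" "B.h (B.\<nu> y) = 1 + \<epsilon> * g (B.\<nu> y)"
    "1 - \<bar>\<epsilon>\<bar> * b \<le> norm y" "norm y \<le> 1 + \<bar>\<epsilon>\<bar> * b" "norm x = B.N x * norm y"
    "(norm (B.\<nu> y - x /\<^sub>R norm x))\<^sup>2 \<le> 4 * (\<bar>\<epsilon>\<bar> * b)"
    "y = norm y *\<^sub>R (x /\<^sub>R norm x)"
proof -
  define t where "t = \<bar>\<epsilon>\<bar> * b"
  have eg: "\<bar>\<epsilon> * g u\<bar> \<le> t" if "norm u = 1" for u
    unfolding t_def abs_mult using b[OF that] by (intro mult_left_mono) auto
  have yf: "y \<in> frontier K" unfolding y_def by (rule B.N_frontier[OF x])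
  have Npos: "0 < B.N x" by (rule B.N_pos[OF x])
  show n: "norm (B.\<nu> y) = 1" by (rule B.normal(1)[OF yf])
  have h: "B.h u = 1 + \<epsilon> * g u" if "norm u = 1" for u
    unfolding B.h_def using support_K[OF that] by (simp add: hh_def)
  show "B.h (B.\<nu> y) = 1 + \<epsilon> * g (B.\<nu> y)" by (rule h[OF n])
  show "norm x = B.N x * norm y" using Npos by (simp add: y_def)
  define u where "u = x /\<^sub>R norm x"
  have u: "norm u = 1" using x by (simp add: u_def)
  have y: "y = norm y *\<^sub>R u" using Npos x by (simp add: y_def u_def)
  then show "y = norm y *\<^sub>R (x /\<^sub>R norm x)" by (simp add: u_def)
  have "y \<bullet> u \<le> B.h u" using yf B.frontier_K by (intro B.inner_le_h) auto
  moreover have "y \<bullet> u = norm y" using u by (subst y) (simp add: dot_square_norm)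
  ultimately show up: "norm y \<le> 1 + \<bar>\<epsilon>\<bar> * b" using h[OF u] eg[OF u] by (simp add: t_def[symmetric] abs_le_iff)
  have yn: "y \<bullet> B.\<nu> y = 1 + \<epsilon> * g (B.\<nu> y)" using B.normal(3)[OF yf] h[OF n] by simp
  have low': "1 - t \<le> y \<bullet> B.\<nu> y" using yn eg[OF n] by (simp add: abs_le_iff)
  have "y \<bullet> B.\<nu> y \<le> norm y * norm (B.\<nu> y)" by (rule norm_cauchy_schwarz)
  then show low: "1 - \<bar>\<epsilon>\<bar> * b \<le> norm y" using low' n by (simp add: t_def)
  have t: "0 \<le> t" "t \<le> 1/2" using eg[OF u] \<epsilon> by (auto simp: t_def[symmetric])
  have un: "1 - t \<le> norm y * (u \<bullet> B.\<nu> y)" using low' by (subst (asm) y) simp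
  \<comment> \<open>A smaller inner product would turn 1 - t \<le> |y| (u . n), with |y| \<le> 1 +
    t, into 1 - t \<le> (1 + t) (1 - 2 t) = 1 - t - 2 t^2. This forces t = 0, and then |y| \<le> 1
    gives the contradiction.\<close>
  have "1 - 2 * t \<le> u \<bullet> B.\<nu> y"
  proof (rule ccontr)
    assume neg: "\<not> 1 - 2 * t \<le> u \<bullet> B.\<nu> y"
    then have "norm y * (u \<bullet> B.\<nu> y) \<le> norm y * (1 - 2 * t)" by (intro mult_left_mono) auto
    also have "\<dots> \<le> (1 + t) * (1 - 2 * t)" using up t by (intro mult_right_mono) (auto simp: t_def)
    finally have "1 - t \<le> (1 + t) * (1 - 2 * t)" using un by simp
    then have "2 * t\<^sup>2 \<le> 0" by (simp add: algebra_simps power2_eq_square)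
    then have "t = 0" by simp
    moreover have "norm y * (u \<bullet> B.\<nu> y) \<le> u \<bullet> B.\<nu> y" if "0 \<le> u \<bullet> B.\<nu> y" "norm y \<le> 1"
      using that by (simp add: mult_left_le_one_le)
    ultimately show False
      using neg un up mult_nonneg_nonpos[of "norm y" "u \<bullet> B.\<nu> y"]
      by (cases "0 \<le> u \<bullet> B.\<nu> y") (auto simp: t_def[symmetric])
  qed
  moreover have "(norm (B.\<nu> y - u))\<^sup>2 = 2 - 2 * (u \<bullet> B.\<nu> y)"
  proof -
    have "u \<bullet> u = 1" "B.\<nu> y \<bullet> B.\<nu> y = 1" using u n by (simp_all add: norm_eq_1)
    then show ?thesis by (simp add: power2_norm_eq_inner inner_simps inner_commute)
  qed
  ultimately show "(norm (B.\<nu> y - x /\<^sub>R norm x))\<^sup>2 \<le> 4 * (\<bar>\<epsilon>\<bar> * b)" by (simp add: u_def t_def)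
qed

end

text \<open>The difference quotient of (1 + s)^\<beta> at 0, completed by its limit \<beta>.
  Continuity on a compact interval provides the uniform bound below, continuity at 0 the
  limit.\<close>

lemma powr_quotient:
  fixes \<beta> :: real
  defines "\<phi> \<equiv> \<lambda>s. if s = 0 then \<beta> else ((1 + s) powr \<beta> - 1) / s"
  shows "continuous_on {-1/2..1/2} \<phi>"
proof -
  have "isCont \<phi> s" if s: "s \<in> {-1/2..1/2}" for s
  proof (cases "s = 0")
    case True
    have "((\<lambda>s. (1 + s) powr \<beta>) has_real_derivative \<beta>) (at 0)"
      by (auto intro!: derivative_eq_intros)
    then have "(\<lambda>s. ((1 + s) powr \<beta> - 1) / s) \<midarrow>0\<rightarrow> \<beta>" by (simp add: DERIV_def)
    then have "\<phi> \<midarrow>0\<rightarrow> \<beta>" by (rule Lim_transform_eventually) (simp add: \<phi>_def eventually_at_filter)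
    then show ?thesis using True by (simp add: isCont_def \<phi>_def)
  next
    case False
    have "isCont (\<lambda>s. ((1 + s) powr \<beta> - 1) / s) s" using False s by (auto intro!: continuous_intros)
    moreover have "\<forall>\<^sub>F z in nhds s. z \<in> - {0}"
      by (rule eventually_nhds_in_open) (use False in \<open>auto simp: open_Compl\<close>)
    then have "\<forall>\<^sub>F z in nhds s. \<phi> z = ((1 + z) powr \<beta> - 1) / z"
      by eventually_elim (simp add: \<phi>_def)
    ultimately show ?thesis by (subst isCont_cong) auto
  qed
  then show ?thesis by (intro continuous_at_imp_continuous_on) auto
qed

lemma powr_quotient_bound:
  fixes \<beta> :: real
  obtains L where "0 \<le> L"
    "\<And>\<epsilon> c. \<epsilon> \<noteq> 0 \<Longrightarrow> \<bar>\<epsilon> * c\<bar> \<le> 1/2 \<Longrightarrow> \<bar>((1 + \<epsilon> * c) powr \<beta> - 1) / \<epsilon>\<bar> \<le> L * \<bar>c\<bar>"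
proof -
  define \<phi> where "\<phi> = (\<lambda>s. if s = 0 then \<beta> else ((1 + s) powr \<beta> - 1) / s)"
  have "compact (\<phi> ` {-1/2..1/2})"
    unfolding \<phi>_def by (rule compact_continuous_image[OF powr_quotient compact_Icc])
  from compact_imp_bounded[OF this] obtain L where bd: "\<forall>w\<in>\<phi> ` {-1/2..1/2}. norm w \<le> L"
    unfolding bounded_iff ..
  have L: "\<bar>\<phi> s\<bar> \<le> L" if "\<bar>s\<bar> \<le> 1/2" for s
  proof -
    have "s \<in> {-1/2..1/2}" using that unfolding atLeastAtMost_iff by (intro conjI) linarith+
    from bspec[OF bd imageI[OF this]] show ?thesis by simp
  qed
  show ?thesis
  proof (rule that)
    show "0 \<le> L" using L[of 0] by simp
    fix \<epsilon> c :: real assume e: "\<epsilon> \<noteq> 0" "\<bar>\<epsilon> * c\<bar> \<le> 1/2"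
    have "((1 + \<epsilon> * c) powr \<beta> - 1) / \<epsilon> = \<phi> (\<epsilon> * c) * c"
      using e(1) by (cases "c = 0") (auto simp: \<phi>_def)
    then show "\<bar>((1 + \<epsilon> * c) powr \<beta> - 1) / \<epsilon>\<bar> \<le> L * \<bar>c\<bar>"
      using L[OF e(2)] by (simp only: abs_mult) (rule mult_right_mono, auto)
  qed
qed

lemma powr_quotient_tendsto:
  fixes \<beta> \<gamma> :: real
  assumes "\<epsilon> \<longlonglongrightarrow> 0" "\<And>n. \<epsilon> n \<noteq> 0" "c \<longlonglongrightarrow> \<gamma>"
  shows "(\<lambda>n. ((1 + \<epsilon> n * c n) powr \<beta> - 1) / \<epsilon> n) \<longlonglongrightarrow> \<beta> * \<gamma>"
proof -
  define \<phi> where "\<phi> = (\<lambda>s. if s = 0 then \<beta> else ((1 + s) powr \<beta> - 1) / s)"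
  have "continuous_on {-1/2<..<1/2} \<phi>"
    using powr_quotient[of \<beta>] unfolding \<phi>_def by (rule continuous_on_subset) auto
  then have "isCont \<phi> 0" by (subst (asm) continuous_on_eq_continuous_at) auto
  moreover have "(\<lambda>n. \<epsilon> n * c n) \<longlonglongrightarrow> 0" using tendsto_mult[OF assms(1,3)] by simp
  ultimately have "(\<lambda>n. \<phi> (\<epsilon> n * c n)) \<longlonglongrightarrow> \<phi> 0" by (rule isCont_tendsto_compose)
  from tendsto_mult[OF this assms(3)] have "(\<lambda>n. \<phi> (\<epsilon> n * c n) * c n) \<longlonglongrightarrow> \<beta> * \<gamma>" by (simp add: \<phi>_def)
  moreover have "\<phi> (\<epsilon> n * c n) * c n = ((1 + \<epsilon> n * c n) powr \<beta> - 1) / \<epsilon> n" for n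
    using assms(2)[of n] by (cases "c n = 0") (auto simp: \<phi>_def)
  ultimately show ?thesis by simp
qed

section \<open>The limit of the difference quotients\<close>

lemma AE_norm_neq_1: "AE x :: 'a::euclidean_space in lborel. norm x \<noteq> 1"
proof -
  have "negligible (sphere (0 :: 'a) 1)" by (rule negligible_sphere)
  then have "sphere (0 :: 'a) 1 \<in> null_sets lborel"
    by (simp add: negligible_iff_null_sets null_sets_completion_iff)
  from AE_not_in[OF this] show ?thesis by simp
qed

lemma ten_bound:
  obtains W :: real where "0 \<le> W"
    "\<And>x q :: real^'n. norm x \<le> 2 \<Longrightarrow> norm q \<le> 2 \<Longrightarrow> norm (c *\<^sub>R ten x q - mat 1) \<le> W"
proof -
  define f :: "(real^'n) \<times> (real^'n) \<Rightarrow> real^'n^'n" where "f z = c *\<^sub>R ten (fst z) (snd z) - mat 1" for z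
  have "continuous_on (cball 0 2 \<times> cball 0 2) f"
    unfolding f_def[abs_def] by (intro continuous_intros)
  then have "compact (f ` (cball 0 2 \<times> cball 0 2))"
    by (rule compact_continuous_image) (intro compact_Times compact_cball)
  from compact_imp_bounded[OF this] obtain W where bd: "\<forall>w\<in>f ` (cball 0 2 \<times> cball 0 2). norm w \<le> W"
    unfolding bounded_iff ..
  have W: "norm (f (x, q)) \<le> W" if "norm x \<le> 2" "norm q \<le> 2" for x q
    by (rule bspec[OF bd imageI]) (use that in simp)
  show ?thesis
  proof (rule that)
    show "0 \<le> W" using order_trans[OF norm_ge_zero W[of 0 0]] by simp
  next
    fix x q :: "real^'n" assume "norm x \<le> 2" "norm q \<le> 2"
    then show "norm (c *\<^sub>R ten x q - mat 1) \<le> W" using W[of x q] by (simp add: f_def)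
  qed
qed

text \<open>Dominated convergence concerns sequences, so the derivative is computed along an
  arbitrary null sequence of nonzero parameters.\<close>

locale perturbation_sequence =
  fixes g G :: "real^'n \<Rightarrow> real" and V :: "real^'n \<Rightarrow> real^'n" and C M b :: real and \<epsilon> :: "nat \<Rightarrow> real"
  assumes card: "CARD('n) \<ge> 2" and P: "\<And>n. support_perturbation g G V C M (\<epsilon> n)"
    and gb: "\<And>u. norm u = 1 \<Longrightarrow> \<bar>g u\<bar> \<le> b" and \<epsilon>b: "\<And>n. \<bar>\<epsilon> n\<bar> * b \<le> 1/2"
    and \<epsilon>0: "\<And>n. \<epsilon> n \<noteq> 0" and lim: "\<epsilon> \<longlonglongrightarrow> 0"
begin

definition "Kn n = support_perturbation.K g (\<epsilon> n)"
definition "N n = body.N (Kn n)"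
definition "y n x = x /\<^sub>R N n x"
definition "v n x = body.\<nu> (Kn n) (y n x)"
definition "q n x = v n x /\<^sub>R (1 + \<epsilon> n * g (v n x))"

lemma body_Kn: "body (Kn n)"
  unfolding Kn_def by (rule smooth_strictly_convex_body_imp_body[OF support_perturbation.smooth_strictly_convex_K[OF P]])

lemma estimates:
  assumes "x \<noteq> 0"
  shows "norm (v n x) = 1" "body.h (Kn n) (v n x) = 1 + \<epsilon> n * g (v n x)"
    "1 - \<bar>\<epsilon> n\<bar> * b \<le> norm (y n x)" "norm (y n x) \<le> 1 + \<bar>\<epsilon> n\<bar> * b" "norm x = N n x * norm (y n x)"
    "(norm (v n x - x /\<^sub>R norm x))\<^sup>2 \<le> 4 * (\<bar>\<epsilon> n\<bar> * b)"
    "y n x = norm (y n x) *\<^sub>R (x /\<^sub>R norm x)"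
  using support_perturbation.normal_estimates[OF P[of n] gb \<epsilon>b[of n] assms]
  unfolding v_def y_def N_def Kn_def by blast+

lemma p_eq: "x \<noteq> 0 \<Longrightarrow> body.p (Kn n) (y n x) = q n x"
  using estimates(2)[of x n] by (simp add: body.p_def[OF body_Kn] q_def v_def)

text \<open>g is recovered from the continuous support function of a single body, since \<epsilon> 0
  is nonzero.\<close>

lemma continuous_g: "continuous_on (sphere 0 1) g"
proof -
  have "continuous_on (sphere 0 1) (\<lambda>u. (support_perturbation.hh g (\<epsilon> 0) u - 1) / \<epsilon> 0)"
    by (intro continuous_intros support_perturbation.continuous_hh[OF P]) (use \<epsilon>0[of 0] in auto)
  then show ?thesis using \<epsilon>0[of 0] by (simp add: support_perturbation.hh_def[OF P])
qed

lemma \<epsilon>g: "norm u = 1 \<Longrightarrow> \<bar>\<epsilon> n * g u\<bar> \<le> 1/2"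
  using mult_left_mono[OF gb[of u], of "\<bar>\<epsilon> n\<bar>"] \<epsilon>b[of n] by (simp add: abs_mult)

lemma limits:
  assumes x: "x \<noteq> 0"
  shows "(\<lambda>n. v n x) \<longlonglongrightarrow> x /\<^sub>R norm x" "(\<lambda>n. y n x) \<longlonglongrightarrow> x /\<^sub>R norm x"
    "(\<lambda>n. g (v n x)) \<longlonglongrightarrow> g (x /\<^sub>R norm x)" "(\<lambda>n. q n x) \<longlonglongrightarrow> x /\<^sub>R norm x" "(\<lambda>n. N n x) \<longlonglongrightarrow> norm x"
proof -
  define u where "u = x /\<^sub>R norm x"
  have u: "norm u = 1" using x by (simp add: u_def)
  have eb: "(\<lambda>n. \<bar>\<epsilon> n\<bar> * b) \<longlonglongrightarrow> 0" using tendsto_mult_right[OF tendsto_rabs[OF lim], of b] by simp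
  have "(\<lambda>n. sqrt (4 * (\<bar>\<epsilon> n\<bar> * b))) \<longlonglongrightarrow> sqrt (4 * 0)" by (intro tendsto_intros eb)
  then have s: "(\<lambda>n. sqrt (4 * (\<bar>\<epsilon> n\<bar> * b))) \<longlonglongrightarrow> 0" by simp
  have "(\<lambda>n. v n x - u) \<longlonglongrightarrow> 0"
    using s
  proof (rule Lim_null_comparison[rotated])
    show "\<forall>\<^sub>F n in sequentially. norm (v n x - u) \<le> sqrt (4 * (\<bar>\<epsilon> n\<bar> * b))"
      using estimates(6)[OF x] by (intro always_eventually allI real_le_rsqrt) (simp add: u_def)
  qed
  then show v: "(\<lambda>n. v n x) \<longlonglongrightarrow> x /\<^sub>R norm x" by (simp add: LIM_zero_iff u_def)
  have r: "(\<lambda>n. norm (y n x)) \<longlonglongrightarrow> 1"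
  proof (rule tendsto_sandwich)
    show "(\<lambda>n. 1 - \<bar>\<epsilon> n\<bar> * b) \<longlonglongrightarrow> 1" using tendsto_diff[OF tendsto_const[of 1] eb] by simp
    show "(\<lambda>n. 1 + \<bar>\<epsilon> n\<bar> * b) \<longlonglongrightarrow> 1" using tendsto_add[OF tendsto_const[of 1] eb] by simp
  qed (use estimates(3,4)[OF x] in \<open>auto intro!: always_eventually\<close>)
  have "(\<lambda>n. norm (y n x) *\<^sub>R u) \<longlonglongrightarrow> 1 *\<^sub>R u" by (intro tendsto_intros r)
  then show "(\<lambda>n. y n x) \<longlonglongrightarrow> x /\<^sub>R norm x"
    using estimates(7)[OF x] unfolding u_def by (simp only: scaleR_one)
  have "(\<lambda>n. norm x / norm (y n x)) \<longlonglongrightarrow> norm x / 1" by (intro tendsto_intros r) simp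
  moreover have "norm x / norm (y n x) = N n x" for n
  proof -
    have "norm (y n x) \<noteq> 0" using estimates(3)[OF x, of n] \<epsilon>b[of n] by linarith
    then show ?thesis using estimates(5)[OF x, of n] by (simp add: field_simps)
  qed
  ultimately show "(\<lambda>n. N n x) \<longlonglongrightarrow> norm x" by simp
  show gl: "(\<lambda>n. g (v n x)) \<longlonglongrightarrow> g (x /\<^sub>R norm x)"
    by (rule continuous_on_tendsto_compose[OF continuous_g v])
      (use u estimates(1)[OF x] in \<open>auto simp: u_def\<close>)
  have "(\<lambda>n. v n x /\<^sub>R (1 + \<epsilon> n * g (v n x))) \<longlonglongrightarrow> (x /\<^sub>R norm x) /\<^sub>R (1 + 0 * g (x /\<^sub>R norm x))"
    by (intro tendsto_intros v gl lim) simp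
  then show "(\<lambda>n. q n x) \<longlonglongrightarrow> x /\<^sub>R norm x" by (simp add: q_def[abs_def])
qed

lemma indicator_tendsto:
  assumes "x \<noteq> 0" "norm x \<noteq> 1"
  shows "(\<lambda>n. indicator (Kn n - {0}) x :: real) \<longlonglongrightarrow> indicator (ball 0 1) x"
proof (rule tendsto_eventually, cases "norm x < 1")
  case True
  show "\<forall>\<^sub>F n in sequentially. indicator (Kn n - {0}) x = (indicator (ball 0 1) x :: real)"
    using order_tendstoD(2)[OF limits(5)[OF assms(1)] True]
    by eventually_elim (use True assms in \<open>auto simp: body.K_iff_N[OF body_Kn] N_def indicator_def\<close>)
next
  case False
  then have "1 < norm x" using assms by simp
  from order_tendstoD(1)[OF limits(5)[OF assms(1)] this]
  show "\<forall>\<^sub>F n in sequentially. indicator (Kn n - {0}) x = (indicator (ball 0 1) x :: real)"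
    by eventually_elim (use False in \<open>auto simp: body.K_iff_N[OF body_Kn] N_def indicator_def\<close>)
qed

lemma q_y_bound:
  assumes "x \<noteq> 0"
  shows "norm (y n x) \<le> 2" "norm (q n x) \<le> 2"
proof -
  show "norm (y n x) \<le> 2" using estimates(4)[OF assms, of n] \<epsilon>b[of n] by linarith
  have "1/2 \<le> 1 + \<epsilon> n * g (v n x)" using \<epsilon>g[OF estimates(1)[OF assms, of n], of n] by (simp add: abs_le_iff)
  then show "norm (q n x) \<le> 2" using estimates(1)[OF assms, of n] by (simp add: q_def field_simps)
qed

lemma Kn_subset: "indicator (Kn n - {0}) x \<le> (indicator (cball 0 2) x :: real)"
proof (cases "x \<in> Kn n - {0}")
  case True
  then have x: "x \<noteq> 0" "N n x \<le> 1" by (auto simp: body.K_iff_N[OF body_Kn] N_def)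
  have "norm x \<le> 1 * norm (y n x)" unfolding estimates(5)[OF x(1), of n] by (intro mult_right_mono x) simp
  then have "norm x \<le> 2" using q_y_bound(1)[OF x(1), of n] by simp
  then show ?thesis by (simp add: indicator_def)
qed simp

lemma AE_generic: "AE x in lborel. x \<noteq> (0 :: real^'n) \<and> norm x \<noteq> 1"
  using AE_lborel_singleton[of 0] AE_norm_neq_1 by eventually_elim simp

lemma hn_eq: "x \<noteq> 0 \<Longrightarrow> body.h (Kn n) (body.\<nu> (Kn n) (x /\<^sub>R body.N (Kn n) x)) = 1 + \<epsilon> n * g (v n x)"
  using estimates(2)[of x n] by (simp add: v_def y_def N_def)

lemma integrable_const_cball: "integrable lborel (\<lambda>x :: real^'n. (c :: real) * indicator (cball 0 2) x)"
  by (intro integrable_mult_right integrable_real_indicator emeasure_lborel_cball_finite) simp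

lemma Z_tendsto: "(\<lambda>n. body.Z (Kn n) \<alpha>) \<longlonglongrightarrow> unit_ball_vol (real CARD('n))"
proof -
  obtain L where L: "0 \<le> L" "\<And>\<epsilon> c. \<epsilon> \<noteq> 0 \<Longrightarrow> \<bar>\<epsilon> * c\<bar> \<le> 1/2 \<Longrightarrow> \<bar>((1 + \<epsilon> * c) powr (\<alpha> - 1) - 1) / \<epsilon>\<bar> \<le> L * \<bar>c\<bar>"
    using powr_quotient_bound by blast
  have "(\<lambda>n. \<integral>x. indicator (Kn n - {0}) x * body.h (Kn n) (body.\<nu> (Kn n) (x /\<^sub>R body.N (Kn n) x)) powr (\<alpha> - 1) \<partial>lborel)
      \<longlonglongrightarrow> (\<integral>x. indicator (ball (0 :: real^'n) 1) x \<partial>lborel)"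
  proof (rule integral_dominated_convergence[where w = "\<lambda>x. (1 + L) * indicator (cball 0 2) x"])
    show "(\<lambda>x. indicator (Kn n - {0}) x * body.h (Kn n) (body.\<nu> (Kn n) (x /\<^sub>R body.N (Kn n) x)) powr (\<alpha> - 1)) \<in> borel_measurable lborel" for n
      using body.K_integrable[OF body_Kn card body.continuous_h_powr[OF body_Kn, of _ "\<alpha> - 1"]] by simp
    show "AE x in lborel. (\<lambda>n. indicator (Kn n - {0}) x * body.h (Kn n) (body.\<nu> (Kn n) (x /\<^sub>R body.N (Kn n) x)) powr (\<alpha> - 1))
        \<longlonglongrightarrow> indicator (ball 0 1) x"
      using AE_generic
    proof eventually_elim
      case (elim x)
      then have x: "x \<noteq> 0" "norm x \<noteq> 1" by auto
      have "(\<lambda>n. indicator (Kn n - {0}) x * (1 + \<epsilon> n * g (v n x)) powr (\<alpha> - 1))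
        \<longlonglongrightarrow> indicator (ball 0 1) x * (1 + 0 * g (x /\<^sub>R norm x)) powr (\<alpha> - 1)"
        by (intro tendsto_intros limits(3) indicator_tendsto x lim) simp
      then show ?case by (simp add: hn_eq[OF x(1)])
    qed
    show "AE x in lborel. norm (indicator (Kn n - {0}) x * body.h (Kn n) (body.\<nu> (Kn n) (x /\<^sub>R body.N (Kn n) x)) powr (\<alpha> - 1))
        \<le> (1 + L) * indicator (cball 0 2) x" for n
      using AE_generic
    proof eventually_elim
      case (elim x)
      then have x: "x \<noteq> 0" by simp
      let ?c = "g (v n x)" let ?e = "\<epsilon> n"
      let ?q = "((1 + ?e * ?c) powr (\<alpha> - 1) - 1) / ?e"
      have ec: "\<bar>?e * ?c\<bar> \<le> 1/2" by (rule \<epsilon>g[OF estimates(1)[OF x]])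
      \<comment> \<open>The bound for the difference quotient also dominates the power itself,
        uniformly in n.\<close>
      have "(1 + ?e * ?c) powr (\<alpha> - 1) = 1 + ?e * ?q" using \<epsilon>0[of n] by simp
      also have "\<dots> \<le> 1 + \<bar>?e\<bar> * \<bar>?q\<bar>" by (simp only: abs_mult[symmetric] abs_ge_self add_left_mono)
      also have "\<dots> \<le> 1 + \<bar>?e\<bar> * (L * \<bar>?c\<bar>)" by (intro add_left_mono mult_left_mono L(2) \<epsilon>0 ec) simp
      also have "\<dots> = 1 + L * \<bar>?e * ?c\<bar>" by (simp add: abs_mult)
      also have "\<dots> \<le> 1 + L * 1" using ec by (intro add_left_mono mult_left_mono L(1)) linarith
      finally have "(1 + ?e * ?c) powr (\<alpha> - 1) \<le> 1 + L" by simp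
      then have "indicator (Kn n - {0}) x * (1 + ?e * ?c) powr (\<alpha> - 1) \<le> indicator (cball 0 2) x * (1 + L)"
        by (intro mult_mono Kn_subset) auto
      then show ?case by (simp add: hn_eq[OF x] mult.commute)
    qed
    show "integrable lborel (\<lambda>x :: real^'n. (1 + L) * indicator (cball 0 2) x)" by (rule integrable_const_cball)
    show "indicator (ball (0 :: real^'n) 1) \<in> borel_measurable lborel" by (intro borel_measurable_indicator) auto
  qed
  then show ?thesis by (simp add: body.Z_def[OF body_Kn] emeasure_unit_ball measure_def)
qed

lemma deviation_tendsto:
  "(\<lambda>n. (isotropy_tensor \<alpha> (Kn n) - mat 1) /\<^sub>R \<epsilon> n) \<longlonglongrightarrow>
    (1 / unit_ball_vol (real CARD('n))) *\<^sub>R (\<integral>x. indicator (ball 0 1) x *\<^sub>R (((\<alpha> - 1) * g (x /\<^sub>R norm x)) *\<^sub>R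
      (real CARD('n) *\<^sub>R ten (x /\<^sub>R norm x) (x /\<^sub>R norm x) - mat 1)) \<partial>lborel)"
proof -
  let ?m = "real CARD('n)"
  obtain L where L: "0 \<le> L" "\<And>\<epsilon> c. \<epsilon> \<noteq> 0 \<Longrightarrow> \<bar>\<epsilon> * c\<bar> \<le> 1/2 \<Longrightarrow> \<bar>((1 + \<epsilon> * c) powr (\<alpha> - 1) - 1) / \<epsilon>\<bar> \<le> L * \<bar>c\<bar>"
    using powr_quotient_bound by blast
  obtain W where W: "0 \<le> W" "\<And>x q :: real^'n. norm x \<le> 2 \<Longrightarrow> norm q \<le> 2 \<Longrightarrow> norm (?m *\<^sub>R ten x q - mat 1) \<le> W"
    using ten_bound[of ?m] by blast
  define f where "f n y = ((body.h (Kn n) (body.\<nu> (Kn n) y) powr (\<alpha> - 1) - 1) / \<epsilon> n) *\<^sub>R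
    (?m *\<^sub>R ten y (body.p (Kn n) y) - mat 1)" for n y
  define F where "F n x = indicator (Kn n - {0}) x *\<^sub>R f n (x /\<^sub>R body.N (Kn n) x)" for n x
  define F' where "F' x = indicator (ball 0 1) x *\<^sub>R (((\<alpha> - 1) * g (x /\<^sub>R norm x)) *\<^sub>R
      (?m *\<^sub>R ten (x /\<^sub>R norm x) (x /\<^sub>R norm x) - mat 1))" for x
  have F_eq: "F n x = indicator (Kn n - {0}) x *\<^sub>R ((((1 + \<epsilon> n * g (v n x)) powr (\<alpha> - 1) - 1) / \<epsilon> n) *\<^sub>R
      (?m *\<^sub>R ten (y n x) (q n x) - mat 1))" if "x \<noteq> 0" for n x
    using hn_eq[OF that, of n] p_eq[OF that, of n] unfolding F_def f_def y_def N_def by simp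
  have mF: "F n \<in> borel_measurable lborel" for n
  proof -
    have "continuous_on (frontier (Kn n)) (\<lambda>y. ten y (body.p (Kn n) y))"
      by (rule continuous_on_ten[OF continuous_on_id body.continuous_p[OF body_Kn]])
    have nz: "\<forall>x\<in>frontier (Kn n). \<epsilon> n \<noteq> 0" using \<epsilon>0[of n] by simp
    note c = \<open>continuous_on (frontier (Kn n)) (\<lambda>y. ten y (body.p (Kn n) y))\<close> body.continuous_h_powr[OF body_Kn, of n "\<alpha> - 1"]
    have "continuous_on (frontier (Kn n)) (f n)"
      unfolding f_def[abs_def]
      by (rule continuous_on_scaleR continuous_on_divide continuous_on_diff c nz continuous_on_const)+
    from body.K_integrable[OF body_Kn card this] show ?thesis
      unfolding F_def[abs_def] by simp
  qed
  have ptw: "AE x in lborel. (\<lambda>n. F n x) \<longlonglongrightarrow> F' x"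
    using AE_generic
  proof eventually_elim
    case (elim x)
    then have x: "x \<noteq> 0" "norm x \<noteq> 1" by auto
    have "(\<lambda>n. ten (y n x) (q n x)) \<longlonglongrightarrow> ten (x /\<^sub>R norm x) (x /\<^sub>R norm x)"
      unfolding ten_def by (intro tendsto_intros limits x)
    then show ?case
      unfolding F_eq[OF x(1)] F'_def
      by (intro tendsto_intros indicator_tendsto powr_quotient_tendsto lim \<epsilon>0 limits x)
  qed
  have dom: "AE x in lborel. norm (F n x) \<le> ((L * b) * W) * indicator (cball 0 2) x" for n
    using AE_generic
  proof eventually_elim
    case (elim x)
    then have x: "x \<noteq> 0" by simp
    have v: "norm (v n x) = 1" by (rule estimates(1)[OF x])
    have b0: "0 \<le> b" using gb[OF v] by simp
    have "\<bar>((1 + \<epsilon> n * g (v n x)) powr (\<alpha> - 1) - 1) / \<epsilon> n\<bar> \<le> L * \<bar>g (v n x)\<bar>"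
      by (rule L(2)[OF \<epsilon>0 \<epsilon>g[OF v]])
    also have "\<dots> \<le> L * b" by (intro mult_left_mono gb v L(1))
    finally have le: "\<bar>((1 + \<epsilon> n * g (v n x)) powr (\<alpha> - 1) - 1) / \<epsilon> n\<bar> \<le> L * b" .
    have fin: "\<bar>((1 + \<epsilon> n * g (v n x)) powr (\<alpha> - 1) - 1) / \<epsilon> n\<bar> * norm (?m *\<^sub>R ten (y n x) (q n x) - mat 1) \<le> (L * b) * W"
      by (rule mult_mono[OF le W(2)[OF q_y_bound[OF x]]]) (use L(1) b0 in auto)
    have "indicator (Kn n - {0}) x * (\<bar>((1 + \<epsilon> n * g (v n x)) powr (\<alpha> - 1) - 1) / \<epsilon> n\<bar> * norm (?m *\<^sub>R ten (y n x) (q n x) - mat 1))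
      \<le> indicator (cball 0 2) x * ((L * b) * W)"
      by (rule mult_mono[OF Kn_subset fin]) (use L(1) b0 W(1) in auto)
    then show ?case unfolding F_eq[OF x] norm_scaleR by (simp only: mult.commute abs_of_nonneg indicator_pos_le)
  qed
  \<comment> \<open>Nothing is assumed about g off the sphere, so it is cut off by an indicator
    before being composed with x / |x|. This affects F' at most at the origin, where its value is
    added back.\<close>
  have meas: "F' \<in> borel_measurable lborel"
  proof -
    have gm: "(\<lambda>x. indicator (sphere 0 1) x * g x) \<in> borel_measurable borel"
      using borel_measurable_continuous_on_indicator[OF _ continuous_g] by (simp add: borel_closed)
    have "(\<lambda>x :: real^'n. (\<lambda>x. indicator (sphere 0 1) x * g x) (x /\<^sub>R norm x)) \<in> borel_measurable borel"
      by (rule measurable_compose[OF _ gm]) measurable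
    then have gm': "(\<lambda>x :: real^'n. indicator (sphere 0 1) (x /\<^sub>R norm x) * g (x /\<^sub>R norm x)) \<in> borel_measurable borel" .
    have "continuous_on UNIV (\<lambda>x :: real^'n. ten x x)" by (intro continuous_intros)
    then have tm: "(\<lambda>x :: real^'n. ten x x) \<in> borel_measurable borel" by (rule borel_measurable_continuous_onI)
    have tm': "(\<lambda>x :: real^'n. ten (x /\<^sub>R norm x) (x /\<^sub>R norm x)) \<in> borel_measurable borel"
      by (rule measurable_compose[OF _ tm]) measurable
    have bs: "ball (0 :: real^'n) 1 - {0} \<in> sets borel" by (intro borel_open open_Diff) auto
    have "(\<lambda>x. (indicator (ball 0 1 - {0}) x * (indicator (sphere 0 1) (x /\<^sub>R norm x) * g (x /\<^sub>R norm x)) * (\<alpha> - 1)) *\<^sub>R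
      (?m *\<^sub>R ten (x /\<^sub>R norm x) (x /\<^sub>R norm x) - mat 1) + (indicator {0} x) *\<^sub>R F' 0) \<in> borel_measurable borel"
      by (rule borel_measurable_add[OF borel_measurable_scaleR[OF borel_measurable_times[OF
          borel_measurable_times[OF borel_measurable_indicator[OF bs] gm'] borel_measurable_const]
          borel_measurable_diff[OF borel_measurable_scaleR[OF borel_measurable_const tm'] borel_measurable_const]]
          borel_measurable_scaleR[OF borel_measurable_indicator[OF borel_singleton[OF sets.empty_sets]] borel_measurable_const]])
    moreover have "(\<lambda>x. (indicator (ball 0 1 - {0}) x * (indicator (sphere 0 1) (x /\<^sub>R norm x) * g (x /\<^sub>R norm x)) * (\<alpha> - 1)) *\<^sub>R
      (?m *\<^sub>R ten (x /\<^sub>R norm x) (x /\<^sub>R norm x) - mat 1) + (indicator {0} x) *\<^sub>R F' 0) = F'"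
    proof
      fix x
      show "(indicator (ball 0 1 - {0}) x * (indicator (sphere 0 1) (x /\<^sub>R norm x) * g (x /\<^sub>R norm x)) * (\<alpha> - 1)) *\<^sub>R
      (?m *\<^sub>R ten (x /\<^sub>R norm x) (x /\<^sub>R norm x) - mat 1) + (indicator {0} x) *\<^sub>R F' 0 = F' x"
        by (cases "x = 0") (auto simp: F'_def indicator_def mult.commute)
    qed
    ultimately show ?thesis by simp
  qed
  have "(\<lambda>n. \<integral>x. F n x \<partial>lborel) \<longlonglongrightarrow> (\<integral>x. F' x \<partial>lborel)"
    by (rule integral_dominated_convergence[OF meas mF integrable_const_cball ptw dom])
  then have "(\<lambda>n. (1 / body.Z (Kn n) \<alpha>) *\<^sub>R (\<integral>x. F n x \<partial>lborel)) \<longlonglongrightarrow>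
      (1 / unit_ball_vol (real CARD('n))) *\<^sub>R (\<integral>x. F' x \<partial>lborel)"
    by (intro tendsto_intros Z_tendsto) simp_all
  moreover have "(isotropy_tensor \<alpha> (Kn n) - mat 1) /\<^sub>R \<epsilon> n = (1 / body.Z (Kn n) \<alpha>) *\<^sub>R (\<integral>x. F n x \<partial>lborel)" for n
  proof -
    have "(\<integral>x. (indicator (Kn n - {0}) x * (body.h (Kn n) (body.\<nu> (Kn n) (x /\<^sub>R body.N (Kn n) x)) powr (\<alpha> - 1) - 1)) *\<^sub>R
      (?m *\<^sub>R ten (x /\<^sub>R body.N (Kn n) x) (body.p (Kn n) (x /\<^sub>R body.N (Kn n) x)) - mat 1) \<partial>lborel) = (\<integral>x. \<epsilon> n *\<^sub>R F n x \<partial>lborel)"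
      using \<epsilon>0[of n] by (simp add: F_def f_def)
    also have "\<dots> = \<epsilon> n *\<^sub>R (\<integral>x. F n x \<partial>lborel)" by (rule integral_scaleR_right)
    finally have "isotropy_tensor \<alpha> (Kn n) - mat 1 = (1 / body.Z (Kn n) \<alpha>) *\<^sub>R (\<epsilon> n *\<^sub>R (\<integral>x. F n x \<partial>lborel))"
      unfolding body.isotropy_tensor_deviation[OF body_Kn card] by simp
    then show ?thesis using \<epsilon>0[of n] by simp
  qed
  ultimately show ?thesis unfolding F'_def by simp
qed

end

section \<open>Spherical harmonics of degree two\<close>

lemma basis_real_vec: "(Basis :: (real^'n) set) = range (\<lambda>i. axis i 1)"
  by (auto simp: Basis_vec_def)

lemma sum_Basis_vec: "(\<Sum>b\<in>Basis. f (b :: real^'n)) = (\<Sum>i\<in>UNIV. f (axis i 1))"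
proof -
  have "inj (\<lambda>i :: 'n. axis i (1::real))" by (auto simp: inj_on_def axis_eq_axis)
  then show ?thesis by (simp add: basis_real_vec sum.reindex)
qed

lemma linear_axis_expansion:
  fixes f :: "real^'n \<Rightarrow> real"
  assumes "linear f"
  shows "f x = (\<Sum>i\<in>UNIV. x $ i * f (axis i 1))"
proof -
  have "f x = f (\<Sum>i\<in>UNIV. x $ i *\<^sub>R axis i 1)"
    using basis_expansion[of x] by (simp add: scalar_mult_eq_scaleR)
  then show ?thesis by (simp add: linear_sum[OF assms] linear_scale[OF assms])
qed

lemma quadratic_form_expansion:
  fixes x :: "real^'n"
  shows "x \<bullet> (S *v x) = (\<Sum>i\<in>UNIV. \<Sum>j\<in>UNIV. S $ i $ j * (x $ i * x $ j))"
  by (simp add: inner_vec_def matrix_vector_mult_def sum_distrib_left mult_ac)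

lemma real_polynomial_quadratic_form: "real_polynomial_function (\<lambda>x :: real^'n. x \<bullet> (S *v x))"
  unfolding quadratic_form_expansion
  by (intro real_polynomial_function_sum real_polynomial_function.intros bounded_linear_vec_nth) simp_all

lemma laplacian_quadratic_form:
  fixes S :: "real^'n^'n"
  assumes "transpose S = S"
  shows "laplacian (\<lambda>x. x \<bullet> (S *v x)) x = 2 * trace S"
proof -
  have sym: "a \<bullet> (S *v b) = b \<bullet> (S *v a)" for a b
    using dot_lmul_matrix[of a S b] assms by (metis inner_commute transpose_matrix_vector)
  have d1: "((\<lambda>x. x \<bullet> (S *v x)) has_derivative (\<lambda>v. 2 * (v \<bullet> (S *v x)))) (at x)" for x
  proof -
    have "((\<lambda>x. x \<bullet> (S *v x)) has_derivative (\<lambda>v. x \<bullet> (S *v v) + v \<bullet> (S *v x))) (at x)"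
      by (intro has_derivative_inner has_derivative_ident bounded_linear_imp_has_derivative
          matrix_vector_mul_bounded_linear)
    then show ?thesis using sym[of x] by simp
  qed
  have d2: "((\<lambda>y. 2 * (b \<bullet> (S *v y))) has_derivative (\<lambda>v. 2 * (b \<bullet> (S *v v)))) (at x)" for b
    by (intro has_derivative_mult_right has_derivative_inner_right bounded_linear_imp_has_derivative
        matrix_vector_mul_bounded_linear)
  have "laplacian (\<lambda>x. x \<bullet> (S *v x)) x = (\<Sum>b\<in>Basis. 2 * (b \<bullet> (S *v b)))"
    unfolding laplacian_def frechet_derivative_at[OF d1, symmetric] frechet_derivative_at[OF d2, symmetric] ..
  also have "\<dots> = 2 * trace S"
    unfolding sum_Basis_vec by (simp add: trace_def inner_axis' matrix_vector_mul_component inner_axis sum_distrib_left)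
  finally show ?thesis .
qed

lemma real_polynomial_C_k_on: "real_polynomial_function (p :: 'a::euclidean_space \<Rightarrow> real) \<Longrightarrow> C_k_on k UNIV p"
proof (induction rule: real_polynomial_function.induct)
  case (linear f)
  then show ?case by (rule C_k_on_linear) (auto intro: C_k_on_id)
qed (auto intro: C_k_on_const C_k_on_add C_k_on_mult)

text \<open>
  The partial derivatives of a homogeneous polynomial of degree two are homogeneous of degree one
  and differentiable at the origin, hence linear; Euler's identity then gives the quadratic form.
\<close>

lemma homogeneous_polynomial_2:
  fixes p :: "real^'n \<Rightarrow> real"
  assumes p: "real_polynomial_function p" and hom: "\<And>t x. p (t *\<^sub>R x) = t ^ 2 * p x"
  shows "\<exists>S :: real^'n^'n. transpose S = S \<and> p = (\<lambda>x. x \<bullet> (S *v x))"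
proof -
  define D where "D x = frechet_derivative p (at x)" for x
  define E where "E v = frechet_derivative (\<lambda>x. D x v) (at 0)" for v
  have C: "C_k_on (Suc (Suc 0)) UNIV p" by (rule real_polynomial_C_k_on[OF p])
  have dp: "(p has_derivative D x) (at x)" for x unfolding D_def by (rule C_k_on_SucD(1)[OF C]) simp
  have dD: "((\<lambda>x. D x v) has_derivative E v) (at 0)" for v
    unfolding E_def D_def by (rule C_k_on_SucD(1)[OF C_k_on_SucD(2)[OF C]]) simp
  have lin: "linear (D x)" "linear (E v)" for x v using has_derivative_linear dp dD by blast+
  have line: "((\<lambda>t. t *\<^sub>R x) has_derivative (\<lambda>t. t *\<^sub>R x)) (at t)" for x :: "real^'n" and t
    by (auto intro!: derivative_eq_intros)
  have euler: "D x x = 2 * p x" for x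
  proof -
    have "(p has_derivative D x) (at (1 *\<^sub>R x))" using dp[of x] by simp
    from has_derivative_compose[OF line this] have d1: "((\<lambda>t. p (t *\<^sub>R x)) has_derivative (\<lambda>s. D x (s *\<^sub>R x))) (at 1)" .
    have d2: "((\<lambda>t. t ^ 2 * p x) has_derivative (\<lambda>s. 2 * s * p x)) (at 1)"
      by (auto intro!: derivative_eq_intros)
    have "D x (1 *\<^sub>R x) = 2 * 1 * p x"
      using fun_cong[OF has_derivative_unique[OF d1[unfolded hom] d2], of 1] .
    then show ?thesis by simp
  qed
  have homD1: "D (t *\<^sub>R x) v = t * D x v" if "t \<noteq> 0" for t x v
  proof -
    have "((\<lambda>y. t *\<^sub>R y) has_derivative (\<lambda>v. t *\<^sub>R v)) (at x)" by (auto intro!: derivative_eq_intros)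
    from has_derivative_compose[OF this dp]
    have d1: "((\<lambda>y. p (t *\<^sub>R y)) has_derivative (\<lambda>v. D (t *\<^sub>R x) (t *\<^sub>R v))) (at x)" .
    have d2: "((\<lambda>y. t ^ 2 * p y) has_derivative (\<lambda>v. t ^ 2 * D x v)) (at x)"
      by (rule has_derivative_mult_right[OF dp])
    have "D (t *\<^sub>R x) (t *\<^sub>R v) = t ^ 2 * D x v"
      using fun_cong[OF has_derivative_unique[OF d1[unfolded hom] d2], of v] .
    then show ?thesis using that by (simp add: linear_scale[OF lin(1)] power2_eq_square)
  qed
  \<comment> \<open>For t = 0 the derivative at the origin must vanish; scaling the origin by 2
    gives D 0 v = 2 D 0 v.\<close>
  have homD: "D (t *\<^sub>R x) v = t * D x v" for t x v
    using homD1[of t x v] homD1[of 2 0 v] by (cases "t = 0") auto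
  have DE: "D x v = E v x" for x v
  proof -
    have "((\<lambda>x. D x v) has_derivative E v) (at (0 *\<^sub>R x))" using dD by simp
    from has_derivative_compose[OF line this] have d1: "((\<lambda>t. D (t *\<^sub>R x) v) has_derivative (\<lambda>s. E v (s *\<^sub>R x))) (at 0)" .
    have d2: "((\<lambda>t. t * D x v) has_derivative (\<lambda>s. s * D x v)) (at 0)"
      by (auto intro!: derivative_eq_intros)
    have "E v (1 *\<^sub>R x) = 1 * D x v"
      using fun_cong[OF has_derivative_unique[OF d1[unfolded homD] d2], of 1] .
    then show ?thesis by simp
  qed
  define A :: "real^'n^'n" where "A = (\<chi> i j. E (axis i 1) (axis j 1) / 2)"
  \<comment> \<open>A is half the Hessian at the origin; symmetrising takes the place of an argument
    that mixed partial derivatives agree.\<close>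
  define S where "S = (1/2) *\<^sub>R (A + transpose A)"
  have pA: "p x = x \<bullet> (A *v x)" for x
  proof -
    have "D x (axis i 1) = (\<Sum>j\<in>UNIV. x $ j * E (axis i 1) (axis j 1))" for i
      unfolding DE by (rule linear_axis_expansion[OF lin(2)])
    then have "D x x = (\<Sum>i\<in>UNIV. x $ i * (\<Sum>j\<in>UNIV. x $ j * E (axis i 1) (axis j 1)))"
      using linear_axis_expansion[OF lin(1)[of x], of x] by simp
    then show ?thesis
      using euler[of x] by (simp add: quadratic_form_expansion A_def sum_divide_distrib[symmetric] sum_distrib_left mult_ac)
  qed
  have "x \<bullet> (transpose A *v x) = x \<bullet> (A *v x)" for x
    using dot_lmul_matrix[of x A x] by (simp add: inner_commute)
  then have "p = (\<lambda>x. x \<bullet> (S *v x))"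
    by (simp add: fun_eq_iff pA S_def scaleR_matrix_vector_assoc[symmetric] matrix_vector_mult_add_rdistrib inner_simps)
  moreover have "transpose S = S" by (simp add: S_def transpose_def vec_eq_iff add.commute)
  ultimately show ?thesis by blast
qed

lemma spherical_harmonics_2:
  "(spherical_harmonics 2 :: (real^'n \<Rightarrow> real) set) =
    {restrict (\<lambda>x. x \<bullet> (S *v x)) (sphere 0 1) | S. transpose S = S \<and> trace S = 0}"
proof (intro equalityI subsetI)
  fix v :: "real^'n \<Rightarrow> real" assume "v \<in> spherical_harmonics 2"
  then obtain p where p: "v = restrict p (sphere 0 1)" "real_polynomial_function p"
    "\<And>t x. p (t *\<^sub>R x) = t ^ 2 * p x" "\<And>x. laplacian p x = 0"
    unfolding spherical_harmonics_def by auto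
  obtain S where S: "transpose S = S" "p = (\<lambda>x. x \<bullet> (S *v x))"
    using homogeneous_polynomial_2[OF p(2,3)] by blast
  have "trace S = 0" using p(4)[of 0] laplacian_quadratic_form[OF S(1), of 0] S(2) by simp
  then show "v \<in> {restrict (\<lambda>x. x \<bullet> (S *v x)) (sphere 0 1) | S. transpose S = S \<and> trace S = 0}"
    using S p(1) by blast
next
  fix v :: "real^'n \<Rightarrow> real"
  assume "v \<in> {restrict (\<lambda>x. x \<bullet> (S *v x)) (sphere 0 1) | S. transpose S = S \<and> trace S = 0}"
  then obtain S where S: "v = restrict (\<lambda>x. x \<bullet> (S *v x)) (sphere 0 1)" "transpose S = S" "trace S = 0" by blast
  have "(t *\<^sub>R x) \<bullet> (S *v (t *\<^sub>R x)) = t ^ 2 * (x \<bullet> (S *v x))" for t x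
    by (simp add: matrix_vector_mult_scaleR power2_eq_square)
  then show "v \<in> spherical_harmonics 2"
    unfolding spherical_harmonics_def using S laplacian_quadratic_form[OF S(2)] real_polynomial_quadratic_form[of S]
    by (intro CollectI exI[of _ "\<lambda>x. x \<bullet> (S *v x)"]) simp
qed

locale rotation_invariant =
  fixes \<omega> :: "(real^'n) measure"
  assumes card: "CARD('n) \<ge> 2" and \<omega>: "rotation_invariant_prob \<omega>"
begin

lemma space_\<omega>: "space \<omega> = sphere 0 1"
proof -
  have "sets \<omega> = sets (restrict_space borel (sphere 0 1))" using \<omega> by (simp add: rotation_invariant_prob_def)
  from sets_eq_imp_space_eq[OF this] show ?thesis by (simp add: space_restrict_space)
qed

lemma id_measurable: "(\<lambda>x. x) \<in> \<omega> \<rightarrow>\<^sub>M borel"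
proof -
  have "sets \<omega> = sets (restrict_space borel (sphere 0 1))" using \<omega> by (simp add: rotation_invariant_prob_def)
  from measurable_cong_sets[OF this refl, of borel] show ?thesis
    using measurable_restrict_space1[OF measurable_ident_sets[OF refl, of borel], of "sphere (0 :: real^'n) 1"]
    by (rule subst[OF sym])
qed

text \<open>f may be arbitrary off the sphere, so it is cut off by an indicator on the way from
  \<omega> to \<open>sphere_prob\<close>, which lives on the whole space.\<close>

lemma sphere_integral:
  fixes f :: "real^'n \<Rightarrow> 'b::euclidean_space"
  assumes "continuous_on (sphere 0 1) f"
  shows "(\<lambda>u. indicator (sphere 0 1) u *\<^sub>R f u) \<in> borel_measurable borel" "integrable \<omega> f"
    "(\<integral>u. f u \<partial>\<omega>) = (\<integral>u. indicator (sphere 0 1) u *\<^sub>R f u \<partial>sphere_prob)"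
proof -
  let ?f = "\<lambda>u. indicator (sphere 0 1) u *\<^sub>R f u"
  show m: "?f \<in> borel_measurable borel"
    by (rule borel_measurable_continuous_on_indicator[OF _ assms]) (simp add: borel_closed)
  interpret prob_space \<omega> using \<omega> by (simp add: rotation_invariant_prob_def)
  from compact_imp_bounded[OF compact_continuous_image[OF assms compact_sphere]]
  obtain B where B: "\<forall>w\<in>f ` sphere 0 1. norm w \<le> B" unfolding bounded_iff ..
  have mf: "?f \<in> borel_measurable \<omega>" by (rule measurable_compose[OF id_measurable m])
  have cong: "?f u = f u" if "u \<in> space \<omega>" for u using that by (simp add: space_\<omega>)
  have "integrable \<omega> ?f"
    by (rule integrable_const_bound[where B = B]) (use mf B space_\<omega> in auto)
  then show "integrable \<omega> f" by (rule iffD1[OF Bochner_Integration.integrable_cong[OF refl cong], rotated])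
  have "(\<integral>u. ?f u \<partial>sphere_prob) = (\<integral>u. ?f u \<partial>distr \<omega> borel (\<lambda>x. x))"
    by (simp add: rotation_invariant_prob_eq[OF card \<omega>])
  also have "\<dots> = (\<integral>u. ?f u \<partial>\<omega>)" by (rule integral_distr[OF id_measurable m])
  also have "\<dots> = (\<integral>u. f u \<partial>\<omega>)" by (rule Bochner_Integration.integral_cong[OF refl cong])
  finally show "(\<integral>u. f u \<partial>\<omega>) = (\<integral>u. ?f u \<partial>sphere_prob)" ..
qed

lemma sphere_integral_continuous:
  fixes f :: "real^'n \<Rightarrow> 'b::euclidean_space"
  assumes "continuous_on UNIV f"
  shows "(\<integral>u. f u \<partial>\<omega>) = integral\<^sup>L sphere_prob f"
proof -
  have c: "continuous_on (sphere 0 1) f" using assms by (rule continuous_on_subset) simp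
  show ?thesis unfolding sphere_integral(3)[OF c]
    by (rule AE_sphere_prob_integral_cong[OF sphere_integral(1)[OF c] borel_measurable_continuous_onI[OF assms]]) simp
qed

lemma ball_integral:
  fixes f :: "real^'n \<Rightarrow> 'b::euclidean_space"
  assumes "continuous_on (sphere 0 1) f"
  shows "(1 / unit_ball_vol (real CARD('n))) *\<^sub>R (\<integral>x. indicator (ball 0 1) x *\<^sub>R f (x /\<^sub>R norm x) \<partial>lborel) = (\<integral>u. f u \<partial>\<omega>)"
proof -
  let ?f = "\<lambda>u. indicator (sphere 0 1) u *\<^sub>R f u" and ?V = "unit_ball_vol (real CARD('n))"
  note m = sphere_integral(1)[OF assms]
  have n: "(\<lambda>x :: real^'n. x /\<^sub>R norm x) \<in> borel \<rightarrow>\<^sub>M borel" by measurable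
  have mn: "(\<lambda>x. ?f (x /\<^sub>R norm x)) \<in> borel_measurable borel" by (rule measurable_compose[OF n m])
  have V: "0 < ?V" by simp
  have "uniform_measure lborel (ball (0 :: real^'n) 1) = density lborel (\<lambda>x. ennreal (indicator (ball 0 1) x / ?V))"
    unfolding uniform_measure_def
    by (intro density_cong) (auto simp: emeasure_unit_ball indicator_def divide_ennreal[OF _ V, symmetric] split: if_splits)
  then have "(\<integral>u. ?f u \<partial>sphere_prob) = (\<integral>x. ?f (x /\<^sub>R norm x) \<partial>density lborel (\<lambda>x. ennreal (indicator (ball 0 1) x / ?V)))"
    unfolding sphere_prob_def using n m by (subst integral_distr) auto
  also have "\<dots> = (\<integral>x. (indicator (ball 0 1) x / ?V) *\<^sub>R ?f (x /\<^sub>R norm x) \<partial>lborel)"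
    using mn by (intro integral_density) (auto intro!: borel_measurable_divide borel_measurable_indicator)
  also have "\<dots> = (\<integral>x. (1 / ?V) *\<^sub>R (indicator (ball 0 1) x *\<^sub>R ?f (x /\<^sub>R norm x)) \<partial>lborel)" by simp
  also have "\<dots> = (1 / ?V) *\<^sub>R (\<integral>x. indicator (ball 0 1) x *\<^sub>R ?f (x /\<^sub>R norm x) \<partial>lborel)"
    by (rule integral_scaleR_right)
  \<comment> \<open>The integrands differ at most at x = 0, where x / |x| is 0 and not on the
    sphere.\<close>
  also have "(\<integral>x. indicator (ball 0 1) x *\<^sub>R ?f (x /\<^sub>R norm x) \<partial>lborel) = (\<integral>x. indicator (ball 0 1) x *\<^sub>R f (x /\<^sub>R norm x) \<partial>lborel)"
  proof -
    have mb: "(\<lambda>x. indicator (ball 0 1) x *\<^sub>R ?f (x /\<^sub>R norm x)) \<in> borel_measurable borel"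
      by (rule borel_measurable_scaleR[OF borel_measurable_indicator mn]) simp
    have "(\<lambda>x. indicator (ball 0 1) x *\<^sub>R ?f (x /\<^sub>R norm x) + indicator {0} x *\<^sub>R f 0) \<in> borel_measurable borel"
      by (rule borel_measurable_add[OF mb borel_measurable_scaleR[OF
          borel_measurable_indicator[OF borel_singleton[OF sets.empty_sets]] borel_measurable_const]])
    moreover have "(\<lambda>x. indicator (ball 0 1) x *\<^sub>R ?f (x /\<^sub>R norm x) + indicator {0} x *\<^sub>R f 0) = (\<lambda>x. indicator (ball 0 1) x *\<^sub>R f (x /\<^sub>R norm x))"
    proof
      fix x show "indicator (ball 0 1) x *\<^sub>R ?f (x /\<^sub>R norm x) + indicator {0} x *\<^sub>R f 0 = indicator (ball 0 1) x *\<^sub>R f (x /\<^sub>R norm x)"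
        by (cases "x = 0") (auto simp: indicator_def)
    qed
    ultimately have mf: "(\<lambda>x. indicator (ball 0 1) x *\<^sub>R f (x /\<^sub>R norm x)) \<in> borel_measurable borel" by simp
    have "AE x in lborel. indicator (ball 0 1) x *\<^sub>R ?f (x /\<^sub>R norm x) = indicator (ball 0 1) x *\<^sub>R f (x /\<^sub>R norm x)"
      using AE_lborel_singleton[of 0] by eventually_elim simp
    then show ?thesis using mb mf by (intro integral_cong_AE) auto
  qed
  finally show ?thesis unfolding sphere_integral(3)[OF assms] ..
qed

text \<open>The trace-free second moment; the derivative formula is m (\<alpha> - 1) times that of
  g.\<close>

definition "moment f = (\<integral>u. f u *\<^sub>R (ten u u - (1 / real CARD('n)) *\<^sub>R mat 1) \<partial>\<omega>)"

lemma continuous_entry: "continuous_on A (\<lambda>u :: real^'n. u $ i * u $ j - mat 1 $ i $ j / real CARD('n))"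
  by (intro continuous_intros) auto

lemma moment_nth:
  assumes f: "continuous_on (sphere 0 1) f"
  shows "moment f $ i $ j = (\<integral>u. f u * (u $ i * u $ j - mat 1 $ i $ j / real CARD('n)) \<partial>\<omega>)"
    "integrable \<omega> (\<lambda>u. f u * (u $ i * u $ j - mat 1 $ i $ j / real CARD('n)))"
proof -
  have "integrable \<omega> (\<lambda>u. f u *\<^sub>R (ten u u - (1 / real CARD('n)) *\<^sub>R mat 1))"
    by (intro sphere_integral(2) continuous_on_scaleR continuous_on_diff f continuous_on_ten continuous_on_id continuous_on_const)
  from integral_matrix_nth[OF this]
  show "moment f $ i $ j = (\<integral>u. f u * (u $ i * u $ j - mat 1 $ i $ j / real CARD('n)) \<partial>\<omega>)"
    by (simp add: moment_def ten_nth inner_axis')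
  show "integrable \<omega> (\<lambda>u. f u * (u $ i * u $ j - mat 1 $ i $ j / real CARD('n)))"
    by (intro sphere_integral(2) continuous_on_mult f continuous_entry)
qed

text \<open>The multiple of the identity in \<open>moment\<close> contributes a multiple of the
  trace of T, which is 0. Thus integrals against quadratic harmonics see f through its moment
  only.\<close>

lemma moment_pairing:
  assumes f: "continuous_on (sphere 0 1) f" and T: "trace T = 0"
  shows "(\<integral>u. f u * (u \<bullet> (T *v u)) \<partial>\<omega>) = (\<Sum>i\<in>UNIV. \<Sum>j\<in>UNIV. T $ i $ j * moment f $ i $ j)"
proof -
  have "f u * (u \<bullet> (T *v u)) = (\<Sum>i\<in>UNIV. \<Sum>j\<in>UNIV. T $ i $ j * (f u * (u $ i * u $ j - mat 1 $ i $ j / real CARD('n))))" for u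
  proof -
    have "(\<Sum>i\<in>UNIV. \<Sum>j\<in>UNIV. T $ i $ j * (f u * (u $ i * u $ j - mat 1 $ i $ j / real CARD('n))))
      = f u * ((\<Sum>i\<in>UNIV. \<Sum>j\<in>UNIV. T $ i $ j * (u $ i * u $ j)) - (\<Sum>i\<in>UNIV. \<Sum>j\<in>UNIV. T $ i $ j * mat 1 $ i $ j) / real CARD('n))"
      by (simp add: algebra_simps sum_subtractf sum_distrib_left sum_divide_distrib)
    also have "(\<Sum>i\<in>UNIV. \<Sum>j\<in>UNIV. T $ i $ j * mat 1 $ i $ j) = trace T"
      by (simp add: trace_def mat_def if_distrib cong: if_cong)
    finally show ?thesis using T by (simp add: quadratic_form_expansion)
  qed
  then show ?thesis
    by (simp add: Bochner_Integration.integral_sum Bochner_Integration.integrable_sum moment_nth[OF f])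
qed

text \<open>Of the three pairings in the fourth moment one gives the trace of S, which is 0, and the
  others give S and its transpose; hence the factor 2 / (m (m + 2)).\<close>

lemma moment_quadratic_form:
  assumes S: "transpose S = S" "trace S = 0"
  shows "moment (\<lambda>u. u \<bullet> (S *v u)) = (2 / (real CARD('n) * (real CARD('n) + 2))) *\<^sub>R S"
proof -
  let ?m = "real CARD('n)"
  have qf: "u \<bullet> (S *v u) = (\<Sum>k\<in>UNIV. (u \<bullet> axis k 1) * (u \<bullet> S $ k))" for u
    by (simp add: inner_vec_def[of u "S *v u"] matrix_vector_mul_component inner_axis inner_commute)
  have second: "(\<integral>u. (u \<bullet> v) * (u \<bullet> w) \<partial>sphere_prob) = (v \<bullet> w) / ?m" for v w :: "real^'n"
  proof -
    have I: "integrable sphere_prob (\<lambda>u. (u \<bullet> z)\<^sup>2)" for z :: "real^'n"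
      by (intro sphere_prob_integrable continuous_intros)
    have "(\<integral>u. (u \<bullet> v) * (u \<bullet> w) \<partial>sphere_prob) = (\<integral>u. ((u \<bullet> (v + w))\<^sup>2 - (u \<bullet> v)\<^sup>2 - (u \<bullet> w)\<^sup>2) / 2 \<partial>sphere_prob)"
      by (simp add: inner_add_right power2_eq_square algebra_simps)
    also have "\<dots> = ((norm (v + w))\<^sup>2 / ?m - (norm v)\<^sup>2 / ?m - (norm w)\<^sup>2 / ?m) / 2"
      using I by (simp add: sphere_prob_second_moment)
    also have "\<dots> = (v \<bullet> w) / ?m"
      by (simp only: power2_norm_eq_inner inner_add_left inner_add_right inner_commute[of w v]) (simp add: field_simps)
    finally show ?thesis .
  qed
  have sv: "S $ j $ i = S $ i $ j" for i j using S(1) by (metis transpose_def vec_lambda_beta)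
  have c: "continuous_on A (\<lambda>u. u \<bullet> (S *v u))" for A
    unfolding qf by (intro continuous_intros)
  have "moment (\<lambda>u. u \<bullet> (S *v u)) $ i $ j = (2 / (?m * (?m + 2))) * S $ i $ j" for i j
  proof -
    have "moment (\<lambda>u. u \<bullet> (S *v u)) $ i $ j = (\<integral>u. (u \<bullet> (S *v u)) * (u $ i * u $ j - mat 1 $ i $ j / ?m) \<partial>sphere_prob)"
      unfolding moment_nth(1)[OF c] by (intro sphere_integral_continuous continuous_on_mult c continuous_entry)
    also have "\<dots> = (\<integral>u. (\<Sum>k\<in>UNIV. (u \<bullet> axis k 1) * (u \<bullet> S $ k) * ((u \<bullet> axis i 1) * (u \<bullet> axis j 1)) - mat 1 $ i $ j / ?m * ((u \<bullet> axis k 1) * (u \<bullet> S $ k))) \<partial>sphere_prob)"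
      unfolding qf sum_distrib_right by (simp add: inner_axis algebra_simps)
    also have "\<dots> = (\<Sum>k\<in>UNIV. (\<integral>u. (u \<bullet> axis k 1) * (u \<bullet> S $ k) * ((u \<bullet> axis i 1) * (u \<bullet> axis j 1)) \<partial>sphere_prob) - mat 1 $ i $ j / ?m * (\<integral>u. (u \<bullet> axis k 1) * (u \<bullet> S $ k) \<partial>sphere_prob))"
    proof -
      have I1: "integrable sphere_prob (\<lambda>u. (u \<bullet> axis k 1) * (u \<bullet> S $ k) * ((u \<bullet> axis i 1) * (u \<bullet> axis j 1)))" for k
        by (intro sphere_prob_integrable continuous_intros)
      have I2: "integrable sphere_prob (\<lambda>u. mat 1 $ i $ j / ?m * ((u \<bullet> axis k 1) * (u \<bullet> S $ k)))" for k
        by (intro sphere_prob_integrable continuous_on_mult continuous_on_const continuous_on_inner continuous_on_id)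
      show ?thesis
        by (subst Bochner_Integration.integral_sum[OF Bochner_Integration.integrable_diff[OF I1 I2]])
          (simp only: Bochner_Integration.integral_diff[OF I1 I2] integral_mult_right_zero)
    qed
    also have "\<dots> = (\<Sum>k\<in>UNIV. (S $ k $ k * mat 1 $ i $ j + (if k = i then S $ k $ j else 0) + (if k = j then S $ k $ i else 0)) / (?m * (?m + 2)) - mat 1 $ i $ j / ?m * (S $ k $ k / ?m))"
    proof (rule sum.cong[OF refl])
      fix k
      have "axis k 1 \<bullet> S $ k = S $ k $ k" "S $ k \<bullet> axis i 1 = S $ k $ i" "S $ k \<bullet> axis j 1 = S $ k $ j"
        by (simp_all add: inner_axis inner_axis')
      moreover have "axis i 1 \<bullet> (axis j 1 :: real^'n) = mat 1 $ i $ j" "axis k 1 \<bullet> (axis i 1 :: real^'n) = (if k = i then 1 else 0)"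
        "axis k 1 \<bullet> (axis j 1 :: real^'n) = (if k = j then 1 else 0)"
        by (simp_all add: inner_axis_axis mat_def)
      ultimately show "(\<integral>u. (u \<bullet> axis k 1) * (u \<bullet> S $ k) * ((u \<bullet> axis i 1) * (u \<bullet> axis j 1)) \<partial>sphere_prob) - mat 1 $ i $ j / ?m * (\<integral>u. (u \<bullet> axis k 1) * (u \<bullet> S $ k) \<partial>sphere_prob)
        = (S $ k $ k * mat 1 $ i $ j + (if k = i then S $ k $ j else 0) + (if k = j then S $ k $ i else 0)) / (?m * (?m + 2)) - mat 1 $ i $ j / ?m * (S $ k $ k / ?m)"
        unfolding sphere_prob_fourth_moment second by simp
    qed
    also have "\<dots> = (trace S * mat 1 $ i $ j + S $ i $ j + S $ j $ i) / (?m * (?m + 2)) - mat 1 $ i $ j / ?m * (trace S / ?m)"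
      by (simp add: trace_def sum_subtractf sum.distrib sum_divide_distrib[symmetric] sum_distrib_left[symmetric] sum_distrib_right[symmetric])
    finally show ?thesis using S(2) sv[of i j] by simp
  qed
  then show ?thesis by (simp add: vec_eq_iff)
qed

lemma moment_symmetric:
  assumes f: "continuous_on (sphere 0 1) f"
  shows "transpose (moment f) = moment f" "trace (moment f) = 0"
proof -
  let ?m = "real CARD('n)"
  show "transpose (moment f) = moment f"
    by (simp add: vec_eq_iff transpose_def moment_nth[OF f] mat_def mult.commute eq_commute)
  have "trace (moment f) = (\<integral>u. (\<Sum>i\<in>UNIV. f u * (u $ i * u $ i - mat 1 $ i $ i / ?m)) \<partial>\<omega>)"
    by (simp add: trace_def moment_nth(1)[OF f] Bochner_Integration.integral_sum[OF moment_nth(2)[OF f]])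
  also have "\<dots> = (\<integral>u. 0 \<partial>\<omega>)"
  proof (rule Bochner_Integration.integral_cong[OF refl])
    fix u assume "u \<in> space \<omega>"
    then have "(\<Sum>i\<in>UNIV. u $ i * u $ i) = 1" by (simp add: space_\<omega> norm_eq_1 inner_vec_def)
    then have "(\<Sum>i\<in>UNIV. u $ i * u $ i - mat 1 $ i $ i / ?m) = 0" by (simp add: sum_subtractf mat_def)
    then show "(\<Sum>i\<in>UNIV. f u * (u $ i * u $ i - mat 1 $ i $ i / ?m)) = 0"
      by (simp only: sum_distrib_left[symmetric] mult_zero_right)
  qed
  finally show "trace (moment f) = 0" by simp
qed

lemma moment_cong: "(\<And>u. u \<in> sphere 0 1 \<Longrightarrow> f u = f' u) \<Longrightarrow> moment f = moment f'"
  unfolding moment_def by (rule Bochner_Integration.integral_cong) (simp_all add: space_\<omega>)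

text \<open>The projection is the quadratic form of \<open>moment g\<close> divided by c, the factor
  from \<open>moment_quadratic_form\<close>; orthogonality is \<open>moment_pairing\<close>. For
  uniqueness, the residual T = moment g - c S is itself an admissible test form, and pairing with it
  gives the squared Frobenius norm of T.\<close>

lemma moment_harmonic_projection:
  assumes g: "continuous_on (sphere 0 1) g"
  shows "moment (harmonic_projection \<omega> 2 g) = moment g"
proof -
  let ?m = "real CARD('n)"
  define c where "c = 2 / (?m * (?m + 2))"
  have c0: "c \<noteq> 0" by (simp add: c_def)
  define S0 where "S0 = (1 / c) *\<^sub>R moment g"
  have S0: "transpose S0 = S0" "trace S0 = 0"
    using moment_symmetric[OF g] by (simp_all add: S0_def transpose_scalar vec_eq_iff transpose_def trace_def sum_divide_distrib[symmetric])
  define Q where "Q S = restrict (\<lambda>x :: real^'n. x \<bullet> (S *v x)) (sphere 0 1)" for S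
  have cq: "continuous_on A (\<lambda>u. u \<bullet> (S *v u))" for A and S :: "real^'n^'n"
    unfolding quadratic_form_expansion by (intro continuous_intros)
  have SH: "spherical_harmonics 2 = {Q S | S. transpose S = S \<and> trace S = 0}"
    unfolding spherical_harmonics_2 Q_def ..
  have pair: "(\<integral>u. (g u - Q S u) * Q T u \<partial>\<omega>) = (\<Sum>i\<in>UNIV. \<Sum>j\<in>UNIV. T $ i $ j * (moment g - c *\<^sub>R S) $ i $ j)"
    if S: "transpose S = S" "trace S = 0" and T: "trace T = 0" for S T
  proof -
    have "(\<integral>u. (g u - Q S u) * Q T u \<partial>\<omega>) = (\<integral>u. g u * (u \<bullet> (T *v u)) - (u \<bullet> (S *v u)) * (u \<bullet> (T *v u)) \<partial>\<omega>)"
      by (rule Bochner_Integration.integral_cong[OF refl]) (simp add: space_\<omega> Q_def algebra_simps)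
    also have "\<dots> = (\<integral>u. g u * (u \<bullet> (T *v u)) \<partial>\<omega>) - (\<integral>u. (u \<bullet> (S *v u)) * (u \<bullet> (T *v u)) \<partial>\<omega>)"
      by (intro Bochner_Integration.integral_diff sphere_integral(2) continuous_on_mult g cq)
    finally show ?thesis
      unfolding moment_pairing[OF g T] moment_pairing[OF cq T] moment_quadratic_form[OF S]
      by (simp add: c_def sum_subtractf[symmetric] right_diff_distrib)
  qed
  have "harmonic_projection \<omega> 2 g = Q S0"
    unfolding harmonic_projection_def SH
  proof (rule the_equality)
    show "Q S0 \<in> {Q S | S. transpose S = S \<and> trace S = 0} \<and>
      (\<forall>v\<in>{Q S | S. transpose S = S \<and> trace S = 0}. (\<integral>u. (g u - Q S0 u) * v u \<partial>\<omega>) = 0)"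
    proof (intro conjI ballI)
      show "Q S0 \<in> {Q S | S. transpose S = S \<and> trace S = 0}" using S0 by blast
      fix v assume "v \<in> {Q S | S. transpose S = S \<and> trace S = 0}"
      then obtain T where T: "v = Q T" "trace T = 0" by blast
      show "(\<integral>u. (g u - Q S0 u) * v u \<partial>\<omega>) = 0"
        unfolding T(1) pair[OF S0 T(2)] using c0 by (simp add: S0_def)
    qed
  next
    fix q assume q: "q \<in> {Q S | S. transpose S = S \<and> trace S = 0} \<and>
      (\<forall>v\<in>{Q S | S. transpose S = S \<and> trace S = 0}. (\<integral>u. (g u - q u) * v u \<partial>\<omega>) = 0)"
    then obtain S where S: "q = Q S" "transpose S = S" "trace S = 0" by blast
    define T where "T = moment g - c *\<^sub>R S"
    have "transpose T = T"
      using moment_symmetric(1)[OF g] S(2) unfolding T_def by (simp add: vec_eq_iff transpose_def)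
    moreover have T0: "trace T = 0"
      using moment_symmetric(2)[OF g] S(3) unfolding T_def by (simp add: trace_def sum_subtractf sum_distrib_left[symmetric])
    ultimately have "Q T \<in> {Q S | S. transpose S = S \<and> trace S = 0}" by blast
    from bspec[OF conjunct2[OF q] this] have "(\<integral>u. (g u - Q S u) * Q T u \<partial>\<omega>) = 0" unfolding S(1) .
    then have sq: "(\<Sum>i\<in>UNIV. \<Sum>j\<in>UNIV. T $ i $ j * T $ i $ j) = 0"
      using pair[OF S(2,3) T0] unfolding T_def[symmetric] by simp
    have "T \<bullet> T = 0" unfolding inner_vec_def using sq by simp
    then have "moment g = c *\<^sub>R S" by (simp add: T_def)
    then have "S = S0" using c0 by (simp add: S0_def)
    then show "q = Q S0" using S(1) by simp
  qed
  then have "moment (harmonic_projection \<omega> 2 g) = moment (\<lambda>u. u \<bullet> (S0 *v u))"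
    by (intro moment_cong) (simp add: Q_def)
  also have "\<dots> = moment g"
    unfolding moment_quadratic_form[OF S0] using c0 by (simp add: S0_def c_def)
  finally show ?thesis .
qed

end

section \<open>The derivative of the tensor and the uniqueness of the exponent\<close>

lemma smooth_on_sphere_continuous: "smooth_on_sphere g \<Longrightarrow> continuous_on (sphere 0 1) g"
proof -
  assume "smooth_on_sphere g"
  then obtain U F where U: "sphere 0 1 \<subseteq> U" "smooth_on U F" "\<forall>u\<in>sphere 0 1. F u = g u"
    unfolding smooth_on_sphere_def by blast
  have "C_k_on 0 U F" using U(2) by (simp only: smooth_on_def)
  then have "continuous_on (sphere 0 1) F" using U(1) by (auto intro: continuous_on_subset)
  then show ?thesis by (rule continuous_on_eq) (use U(3) in blast)
qed

context support_perturbation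
begin

lemma body_with_support_function_eq: "body_with_support_function (\<lambda>u. 1 + \<epsilon> * g u) = K"
  unfolding body_with_support_function_def
  by (rule the_equality, rule has_support, rule has_support_function_unique[OF _ has_support])

lemma isotropy_tensor_ball:
  assumes card: "CARD('n) \<ge> 2" and \<epsilon>: "\<epsilon> = 0"
  shows "isotropy_tensor \<alpha> K = mat 1"
proof -
  have "(\<lambda>x. (indicator (K - {0}) x * (B.h (B.\<nu> (x /\<^sub>R B.N x)) powr (\<alpha> - 1) - 1)) *\<^sub>R
      (real CARD('n) *\<^sub>R ten (x /\<^sub>R B.N x) (B.p (x /\<^sub>R B.N x)) - mat 1)) = (\<lambda>x. 0 :: real^'n^'n)"
  proof
    fix x
    have "B.h (B.\<nu> (x /\<^sub>R B.N x)) = 1" if x: "x \<noteq> 0"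
    proof -
      have "norm (B.\<nu> (x /\<^sub>R B.N x)) = 1" by (rule B.normal(1)[OF B.N_frontier[OF x]])
      from support_K[OF this] have "B.h (B.\<nu> (x /\<^sub>R B.N x)) = hh (B.\<nu> (x /\<^sub>R B.N x))" unfolding B.h_def .
      also have "\<dots> = 1" unfolding hh_def by (simp add: \<epsilon>)
      finally show ?thesis .
    qed
    then show "(indicator (K - {0}) x * (B.h (B.\<nu> (x /\<^sub>R B.N x)) powr (\<alpha> - 1) - 1)) *\<^sub>R
      (real CARD('n) *\<^sub>R ten (x /\<^sub>R B.N x) (B.p (x /\<^sub>R B.N x)) - mat 1) = 0"
      by (cases "x = 0") auto
  qed
  then show ?thesis unfolding B.isotropy_tensor_deviation[OF card] by simp
qed

end

context rotation_invariant
begin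

lemma eventually_smooth_strictly_convex:
  assumes "smooth_on_sphere g"
  shows "\<forall>\<^sub>F \<epsilon> in nhds (0::real). (\<exists>!K. has_support_function K (\<lambda>u :: real^'n. 1 + \<epsilon> * g u)) \<and>
    smooth_strictly_convex_body (body_with_support_function (\<lambda>u. 1 + \<epsilon> * g u))"
proof -
  obtain G V C M b \<epsilon>0 where e0: "0 < \<epsilon>0" and P: "\<And>\<epsilon>. \<bar>\<epsilon>\<bar> < \<epsilon>0 \<Longrightarrow> support_perturbation g G V C M \<epsilon>"
    using ex_support_perturbation[OF assms] by blast
  have "\<forall>\<^sub>F \<epsilon> in nhds (0::real). \<epsilon> \<in> ball 0 \<epsilon>0"
    using e0 by (intro eventually_nhds_in_open) auto
  then show ?thesis
  proof eventually_elim
    case (elim \<epsilon>)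
    then have pert: "support_perturbation g G V C M \<epsilon>" by (intro P) simp
    show ?case
      unfolding support_perturbation.body_with_support_function_eq[OF pert]
      using support_perturbation.has_support[OF pert] has_support_function_unique
        support_perturbation.smooth_strictly_convex_K[OF pert] by blast
  qed
qed

theorem isotropy_tensor_derivative:
  assumes g: "smooth_on_sphere g"
  shows "((\<lambda>\<epsilon>. isotropy_tensor \<alpha> (body_with_support_function (\<lambda>u. 1 + \<epsilon> * g u)))
    has_vector_derivative (real CARD('n) * (\<alpha> - 1)) *\<^sub>R moment g) (at 0)"
proof -
  let ?T = "\<lambda>\<epsilon>. isotropy_tensor \<alpha> (body_with_support_function (\<lambda>u. 1 + \<epsilon> * g u))"
  let ?m = "real CARD('n)" and ?D = "(real CARD('n) * (\<alpha> - 1)) *\<^sub>R moment g"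
  obtain G V C M b \<epsilon>0 where e0: "0 < \<epsilon>0" "0 \<le> b" "\<epsilon>0 * b \<le> 1/2" and b: "\<forall>u. norm u = 1 \<longrightarrow> \<bar>g u\<bar> \<le> b"
    and P: "\<forall>\<epsilon>. \<bar>\<epsilon>\<bar> < \<epsilon>0 \<longrightarrow> support_perturbation g G V C M \<epsilon>"
    using ex_support_perturbation[OF g] by blast
  have gc: "continuous_on (sphere 0 1) g" by (rule smooth_on_sphere_continuous[OF g])
  have T: "?T \<epsilon> = isotropy_tensor \<alpha> (support_perturbation.K g \<epsilon>)" if "\<bar>\<epsilon>\<bar> < \<epsilon>0" for \<epsilon>
    by (simp only: support_perturbation.body_with_support_function_eq[OF P[rule_format, OF that]])
  have pert0: "support_perturbation g G V C M 0" using P e0(1) by simp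
  have T0: "?T 0 = mat 1"
    using T[of 0] support_perturbation.isotropy_tensor_ball[OF pert0 card refl] e0(1) by simp
  have c: "continuous_on (sphere 0 1) (\<lambda>u. ((\<alpha> - 1) * g u) *\<^sub>R (?m *\<^sub>R ten u u - mat 1))"
    by (intro continuous_on_scaleR continuous_on_mult continuous_on_diff continuous_on_ten continuous_on_const continuous_on_id gc)
  have "(\<integral>u. ((\<alpha> - 1) * g u) *\<^sub>R (?m *\<^sub>R ten u u - mat 1) \<partial>\<omega>)
    = (\<integral>u. (?m * (\<alpha> - 1)) *\<^sub>R (g u *\<^sub>R (ten u u - (1 / ?m) *\<^sub>R mat 1)) \<partial>\<omega>)"
    by (intro Bochner_Integration.integral_cong refl) (simp add: scaleR_right_diff_distrib mult_ac)
  also have "\<dots> = ?D" unfolding moment_def by (rule integral_scaleR_right)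
  finally have D: "(\<integral>u. ((\<alpha> - 1) * g u) *\<^sub>R (?m *\<^sub>R ten u u - mat 1) \<partial>\<omega>) = ?D" .
  have "((\<lambda>\<epsilon>. norm (?T \<epsilon> - ?T 0 - \<epsilon> *\<^sub>R ?D) / norm \<epsilon>) \<longlongrightarrow> 0) (at 0)"
    unfolding tendsto_at_iff_sequentially
  proof (intro allI impI)
    fix X :: "nat \<Rightarrow> real" assume X: "\<forall>i. X i \<in> UNIV - {0}" "X \<longlonglongrightarrow> 0"
    have "\<forall>\<^sub>F n in sequentially. \<bar>X n\<bar> < \<epsilon>0"
      using tendstoD[OF X(2) e0(1)] by (simp add: dist_norm)
    \<comment> \<open>The locale demands its bounds at every index, so the first k terms are
      dropped; \<open>LIMSEQ_offset\<close> undoes the shift.\<close>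
    then obtain k where k: "\<And>n. n \<ge> k \<Longrightarrow> \<bar>X n\<bar> < \<epsilon>0" unfolding eventually_sequentially by blast
    let ?X = "\<lambda>n. X (n + k)"
    have small: "\<bar>?X n\<bar> < \<epsilon>0" for n by (rule k) simp
    have seq: "perturbation_sequence g G V C M b ?X"
    proof (rule perturbation_sequence.intro)
      show "\<bar>?X n\<bar> * b \<le> 1/2" for n
        using mult_right_mono[OF less_imp_le[OF small[of n]] e0(2)] e0(3) by linarith
      show "?X \<longlonglongrightarrow> 0" using LIMSEQ_ignore_initial_segment[OF X(2)] .
      show "?X n \<noteq> 0" for n using X(1) by simp
      show "support_perturbation g G V C M (?X n)" for n using P small by blast
      show "\<bar>g u\<bar> \<le> b" if "norm u = 1" for u using b that by blast
    qed (rule card)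
    from perturbation_sequence.deviation_tendsto[OF this, of \<alpha>]
    have "(\<lambda>n. (?T (?X n) - mat 1) /\<^sub>R ?X n) \<longlonglongrightarrow> ?D"
      unfolding perturbation_sequence.Kn_def[OF seq] T[OF small, symmetric] ball_integral[OF c] D .
    from tendsto_norm[OF tendsto_diff[OF this tendsto_const[of ?D]]]
    have "(\<lambda>n. norm ((?T (?X n) - mat 1) /\<^sub>R ?X n - ?D)) \<longlonglongrightarrow> 0" by simp
    moreover have "norm ((?T (?X n) - mat 1) /\<^sub>R ?X n - ?D) = norm (?T (?X n) - ?T 0 - ?X n *\<^sub>R ?D) / norm (?X n)" for n
    proof -
      have "(A - mat 1) /\<^sub>R s - B = (A - mat 1 - s *\<^sub>R B) /\<^sub>R s" if "s \<noteq> 0" for A B :: "real^'n^'n" and s :: real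
        using that by (simp add: scaleR_right_diff_distrib)
      from this[of "?X n"] have "(?T (?X n) - mat 1) /\<^sub>R ?X n - ?D = (?T (?X n) - mat 1 - ?X n *\<^sub>R ?D) /\<^sub>R ?X n"
        using X(1) by blast
      then show ?thesis unfolding T0 by (simp only: norm_scaleR abs_inverse real_norm_def) (simp only: divide_inverse mult.commute)
    qed
    ultimately have "(\<lambda>n. norm (?T (?X n) - ?T 0 - ?X n *\<^sub>R ?D) / norm (?X n)) \<longlonglongrightarrow> 0" by simp
    then show "((\<lambda>\<epsilon>. norm (?T \<epsilon> - ?T 0 - \<epsilon> *\<^sub>R ?D) / norm \<epsilon>) \<circ> X) \<longlonglongrightarrow> 0"
      unfolding o_def by (rule LIMSEQ_offset)
  qed
  then show ?thesis
    unfolding has_vector_derivative_def has_derivative_at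
    by (intro conjI bounded_linear_scaleR_left) simp
qed

text \<open>If \<beta> made all these bodies isotropic, the tensor would be constant along the
  perturbation by the even function g and its derivative would be 0, whereas \<open>moment g\<close>
  is a nonzero multiple of S.\<close>

lemma even_perturbation_not_isotropic:
  assumes \<beta>: "\<beta> \<noteq> 1"
  shows "\<exists>K :: (real^'n) set. smooth_strictly_convex_body K \<and> uminus ` K = K \<and> isotropy_tensor \<beta> K \<noteq> mat 1"
proof (rule ccontr)
  assume neg: "\<not> ?thesis"
  have "\<not> is_singleton (UNIV :: 'n set)" using card by (auto simp: is_singleton_altdef)
  then obtain a b :: 'n where ab: "a \<noteq> b" by (metis UNIV_I is_singletonI' UNIV_not_empty)
  define S :: "real^'n^'n" where "S = (\<chi> i j. if i = j then (if i = a then 1 else if i = b then -1 else 0) else 0)"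
  have St: "transpose S = S" by (simp add: S_def transpose_def vec_eq_iff)
  have "trace S = (\<Sum>i\<in>UNIV. (if i = a then 1 else 0) - (if i = b then 1 else 0))"
    unfolding trace_def by (rule sum.cong) (use ab in \<open>auto simp: S_def\<close>)
  then have Str: "trace S = 0" by (simp add: sum_subtractf)
  have "S $ a $ a = 1" by (simp add: S_def)
  then have S0: "S \<noteq> 0" by auto
  define g where "g u = u \<bullet> (S *v u)" for u
  have "C_k_on k UNIV g" for k
    unfolding g_def[abs_def] by (rule real_polynomial_C_k_on[OF real_polynomial_quadratic_form])
  then have g: "smooth_on_sphere g"
    unfolding smooth_on_sphere_def smooth_on_def by (intro exI[of _ UNIV] exI[of _ g]) simp
  let ?T = "\<lambda>\<epsilon>. isotropy_tensor \<beta> (body_with_support_function (\<lambda>u. 1 + \<epsilon> * g u))"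
  obtain G V C M b \<epsilon>0 where e0: "0 < \<epsilon>0" and P: "\<forall>\<epsilon>. \<bar>\<epsilon>\<bar> < \<epsilon>0 \<longrightarrow> support_perturbation g G V C M \<epsilon>"
    using ex_support_perturbation[OF g] by blast
  have T: "?T \<epsilon> = mat 1" if \<epsilon>: "\<bar>\<epsilon>\<bar> < \<epsilon>0" for \<epsilon>
  proof -
    have pert: "support_perturbation g G V C M \<epsilon>" using P \<epsilon> by blast
    let ?K = "support_perturbation.K g \<epsilon>"
    have sym: "- x \<in> ?K" if x: "x \<in> ?K" for x
      unfolding support_perturbation.K_def[OF pert]
    proof (intro CollectI ballI)
      fix u :: "real^'n" assume u: "u \<in> sphere 0 1"
      have "- u \<in> sphere 0 1" using u by simp
      then have "x \<bullet> (- u) \<le> support_perturbation.hh g \<epsilon> (- u)"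
        using x unfolding support_perturbation.K_def[OF pert] by blast
      moreover have "g (- u) = g u" by (simp add: g_def quadratic_form_expansion)
      ultimately show "(- x) \<bullet> u \<le> support_perturbation.hh g \<epsilon> u"
        by (simp add: support_perturbation.hh_def[OF pert])
    qed
    have "uminus ` ?K = ?K"
    proof (intro equalityI subsetI)
      fix x assume "x \<in> ?K"
      from imageI[OF sym[OF this], of uminus] show "x \<in> uminus ` ?K" by simp
    qed (use sym in auto)
    then have "isotropy_tensor \<beta> ?K = mat 1"
      using neg support_perturbation.smooth_strictly_convex_K[OF pert] by blast
    then show ?thesis unfolding support_perturbation.body_with_support_function_eq[OF pert] .
  qed
  have "(?T has_vector_derivative 0) (at 0)"
  proof (rule has_vector_derivative_transform_within_open)
    show "((\<lambda>_. mat 1 :: real^'n^'n) has_vector_derivative 0) (at 0)" by (rule has_vector_derivative_const)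
    show "open (ball (0::real) \<epsilon>0)" "0 \<in> ball (0::real) \<epsilon>0" using e0 by auto
    show "mat 1 = ?T \<epsilon>" if "\<epsilon> \<in> ball 0 \<epsilon>0" for \<epsilon> using T[of \<epsilon>] that by simp
  qed
  from vector_derivative_unique_at[OF isotropy_tensor_derivative[OF g, of \<beta>] this]
  have "moment g = 0" using \<beta> card by simp
  then show False using moment_quadratic_form[OF St Str] S0 card by (simp add: g_def[abs_def])
qed

end

theorem theorem4:
  fixes g :: "real^'n \<Rightarrow> real" and \<omega> :: "(real^'n) measure" and \<alpha> :: real
  assumes "CARD('n) \<ge> 2"
    and "smooth_on_sphere g"
    and "rotation_invariant_prob \<omega>"
  shows
    "(\<forall>\<^sub>F \<epsilon> in nhds (0::real).
        (\<exists>!K. has_support_function K (\<lambda>u. 1 + \<epsilon> * g u)) \<and>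
        smooth_strictly_convex_body (body_with_support_function (\<lambda>u. 1 + \<epsilon> * g u))) \<and>
     ((\<lambda>\<epsilon>. isotropy_tensor \<alpha> (body_with_support_function (\<lambda>u. 1 + \<epsilon> * g u)))
        has_vector_derivative
          (real CARD('n) * (\<alpha> - 1)) *\<^sub>R
            (\<integral>u. g u *\<^sub>R (tensor u (\<lambda>z. z \<bullet> u) - (1 / real CARD('n)) *\<^sub>R mat 1) \<partial>\<omega>)) (at 0) \<and>
     (real CARD('n) * (\<alpha> - 1)) *\<^sub>R
        (\<integral>u. g u *\<^sub>R (tensor u (\<lambda>z. z \<bullet> u) - (1 / real CARD('n)) *\<^sub>R mat 1) \<partial>\<omega>) =
     (real CARD('n) * (\<alpha> - 1)) *\<^sub>R
        (\<integral>u. harmonic_projection \<omega> 2 g u *\<^sub>R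
              (tensor u (\<lambda>z. z \<bullet> u) - (1 / real CARD('n)) *\<^sub>R mat 1) \<partial>\<omega>) \<and>
     (\<forall>S :: real^'n^'n.
        transpose S = S \<and> trace S = 0 \<and>
        (\<forall>u\<in>sphere 0 1. harmonic_projection \<omega> 2 g u = u \<bullet> (S *v u)) \<longrightarrow>
        ((\<lambda>\<epsilon>. isotropy_tensor \<alpha> (body_with_support_function (\<lambda>u. 1 + \<epsilon> * g u)))
           has_vector_derivative (2 * (\<alpha> - 1) / (real CARD('n) + 2)) *\<^sub>R S) (at 0)) \<and>
     (\<forall>\<beta>::real.
        (\<forall>K :: (real^'n) set. smooth_strictly_convex_body K \<and> uminus ` K = K \<longrightarrow>
            isotropy_tensor \<beta> K = mat 1) \<longleftrightarrow> \<beta> = 1)"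
proof -
  interpret rotation_invariant \<omega> using assms by unfold_locales
  note card = assms(1) and g = assms(2)
  have gc: "continuous_on (sphere 0 1) g" by (rule smooth_on_sphere_continuous[OF g])
  note hp = moment_harmonic_projection[OF gc]
  note deriv = isotropy_tensor_derivative[OF g, of \<alpha>]
  have form: "((\<lambda>\<epsilon>. isotropy_tensor \<alpha> (body_with_support_function (\<lambda>u. 1 + \<epsilon> * g u)))
      has_vector_derivative (2 * (\<alpha> - 1) / (real CARD('n) + 2)) *\<^sub>R S) (at 0)"
    if S: "transpose S = S" "trace S = 0" "\<forall>u\<in>sphere 0 1. harmonic_projection \<omega> 2 g u = u \<bullet> (S *v u)" for S
  proof -
    have "moment g = moment (\<lambda>u. u \<bullet> (S *v u))"
      unfolding hp[symmetric] by (rule moment_cong) (use S(3) in blast)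
    also have "\<dots> = (2 / (real CARD('n) * (real CARD('n) + 2))) *\<^sub>R S" by (rule moment_quadratic_form[OF S(1,2)])
    finally have "(real CARD('n) * (\<alpha> - 1)) *\<^sub>R moment g = (2 * (\<alpha> - 1) / (real CARD('n) + 2)) *\<^sub>R S"
      by (simp add: mult_ac)
    then show ?thesis using deriv by simp
  qed
  have iso: "(\<forall>K :: (real^'n) set. smooth_strictly_convex_body K \<and> uminus ` K = K \<longrightarrow> isotropy_tensor \<beta> K = mat 1) \<longleftrightarrow> \<beta> = 1" for \<beta>
  proof
    assume *: "\<forall>K :: (real^'n) set. smooth_strictly_convex_body K \<and> uminus ` K = K \<longrightarrow> isotropy_tensor \<beta> K = mat 1"
    show "\<beta> = 1"
    proof (rule ccontr)
      assume "\<beta> \<noteq> 1"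
      from even_perturbation_not_isotropic[OF this] show False using * by blast
    qed
  next
    assume "\<beta> = 1"
    then show "\<forall>K :: (real^'n) set. smooth_strictly_convex_body K \<and> uminus ` K = K \<longrightarrow> isotropy_tensor \<beta> K = mat 1"
      using body.isotropy_tensor_1[OF smooth_strictly_convex_body_imp_body card] by blast
  qed
  show ?thesis
    unfolding tensor_inner moment_def[symmetric] hp
    by (intro conjI allI impI eventually_smooth_strictly_convex[OF g] deriv refl iso) (rule form, simp_all)
qed

end
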